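(* Let $H$ be a real Hilbert space, let $\varphi:H\to(-\infty,\infty]$ be a proper lower-semicontinuous convex functional, let $k\in L^1_{\rm loc}([0,\infty))$ be a kernel satisfying condition (K), with conjugate kernel $\ell$ (see context), and let $B:H\to H$ be Lipschitz continuous, i.e., there is a constant $L_B\ge0$ such that $\|B(w_1)-B(w_2)\|_H\le L_B\|w_1-w_2\|_H$ for all $w_1,w_2\in H$. Let $T\in(0,\infty]$ and consider the Cauchy problem $$(\ast)\qquad\frac{\mathrm{d}}{\mathrm{d}t}[k*(u-u_0)](t)+\partial\varphi(u(t))+B(u(t))\ni f(t)\ \text{ in } H,\quad0<t<T.$$ In case $T\in(0,\infty)$, for every $u_0\in D(\varphi)$ and $f\in L^2(0,T;H)$ satisfying $\ell*\|f(\cdot)\|_H^2\in L^\infty(0,T)$, the problem $(\ast)$ admits a unique strong solution $u$ on $[0,T]$ such that $$u\in C([0,T];H),\quad u(0)=u_0\quad\text{and}\quad\varphi(u(\cdot))\in L^\infty(0,T).$$ In case $T=\infty$, for every $u_0\in D(\varphi)$ and $f\in L^2_{\rm loc}([0,\infty);H)$ satisfying $\ell*\|f(\cdot)\|_H^2\in L^\infty_{\rm loc}([0,\infty))$, the problem $(\ast)$ with $T=\infty$ admits a unique strong solution $u$ on $[0,\infty)$ satisfying, for every $T'>0$, $u\in C([0,T'];H)$, $u(0)=u_0$ and $\varphi(u(\cdot))\in L^\infty(0,T')$.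
   Context: Effective domain: $D(\varphi)=\{w\in H:\varphi(w)<\infty\}$; proper means $\varphi\not\equiv\infty$. Subdifferential: for $z\in D(\varphi)$, $\partial\varphi(z)=\{\xi\in H:\varphi(v)-\varphi(z)\ge(\xi,v-z)_H\ \text{for all } v\in D(\varphi)\}$, with domain $D(\partial\varphi)=\{w\in D(\varphi):\partial\varphi(w)\ne\emptyset\}$. Convolution: $(k*w)(t)=\int_0^tk(t-s)w(s)\,\mathrm{d}s$. Condition (K): $k\in L^1_{\rm loc}([0,\infty))$ is nonnegative and nonincreasing (on $(0,\infty)$), and there exists a nonnegative and nonincreasing kernel $\ell\in L^1_{\rm loc}([0,\infty))$ (the conjugate kernel) such that $(k*\ell)(t)=\int_0^tk(t-s)\ell(s)\,\mathrm{d}s=1$ for $t>0$. Strong solution to $(\ast)$ on $[0,T]$, $T<\infty$: a function $u\in L^2(0,T;H)$ such that $k*(u-u_0)\in W^{1,2}(0,T;H)$, $[k*(u-u_0)](0)=0$, $u(t)\in D(\partial\varphi)$ for a.e. $t\in(0,T)$, and there exists $\xi\in L^2(0,T;H)$ with $\xi(t)\in\partial\varphi(u(t))$ and $\frac{\mathrm{d}}{\mathrm{d}t}[k*(u-u_0)](t)+\xi(t)+B(u(t))=f(t)$ for a.e. $t\in(0,T)$. Strong solution on $[0,\infty)$: the same with $L^2(0,T;H)$, $W^{1,2}(0,T;H)$ replaced by $L^2_{\rm loc}([0,\infty);H)$, $W^{1,2}_{\rm loc}([0,\infty);H)$ and the relations holding for a.e. $t\in(0,\infty)$. *)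

theory Defs
  imports "HOL-Analysis.Analysis"
begin

section \<open>Vector-valued integration without separability\<close>

text \<open>The library's \<open>has_bochner_integral\<close> and \<open>integral\<^sup>L\<close> require a second countable
  target type. These are the same definitions without that restriction, so that the Hilbert
  space need not be separable; on second countable types they agree with the library
  (lemmas \<open>has_bochner_int_eq\<close> and \<open>bochner_int_eq\<close> below).\<close>

definition has_bochner_int :: "'a measure \<Rightarrow> ('a \<Rightarrow> 'b::real_normed_vector) \<Rightarrow> 'b \<Rightarrow> bool" where
  "has_bochner_int M f x \<longleftrightarrow>
     f \<in> borel_measurable M \<and>
     (\<exists>s. (\<forall>i. Bochner_Integration.simple_bochner_integrable M (s i)) \<and>
          (\<lambda>i. \<integral>\<^sup>+y. norm (f y - s i y) \<partial>M) \<longlonglongrightarrow> 0 \<and>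
          (\<lambda>i. Bochner_Integration.simple_bochner_integral M (s i)) \<longlonglongrightarrow> x)"

definition bochner_int :: "'a measure \<Rightarrow> ('a \<Rightarrow> 'b::real_normed_vector) \<Rightarrow> 'b" where
  "bochner_int M f = (if \<exists>x. has_bochner_int M f x then THE x. has_bochner_int M f x else 0)"

lemma has_bochner_int_eq:
  fixes f :: "'a \<Rightarrow> 'b::{real_normed_vector, second_countable_topology}"
  shows "has_bochner_int M f x \<longleftrightarrow> has_bochner_integral M f x"
  unfolding has_bochner_int_def has_bochner_integral.simps by blast

lemma bochner_int_eq:
  fixes f :: "'a \<Rightarrow> 'b::{real_normed_vector, second_countable_topology}"
  shows "bochner_int M f = integral\<^sup>L M f"
  unfolding bochner_int_def lebesgue_integral_def has_bochner_int_eq ..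

definition strongly_measurable :: "'a measure \<Rightarrow> ('a \<Rightarrow> 'b::real_normed_vector) \<Rightarrow> bool" where
  "strongly_measurable M f \<longleftrightarrow>
     (\<exists>s. (\<forall>i. simple_function M (s i)) \<and> (AE x in M. (\<lambda>i. s i x) \<longlonglongrightarrow> f x))"

text \<open>Elements of the spaces over \<open>(0,T)\<close> are represented by functions on all of \<open>\<real>\<close>, whose
  values outside \<open>(0,T)\<close> are irrelevant.\<close>

definition L2_on :: "real \<Rightarrow> (real \<Rightarrow> 'b::real_normed_vector) \<Rightarrow> bool" where
  "L2_on T f \<longleftrightarrow> strongly_measurable (lebesgue_on {0<..<T}) f \<and>
     integrable (lebesgue_on {0<..<T}) (\<lambda>t. (norm (f t))\<^sup>2)"

definition L2_loc :: "(real \<Rightarrow> 'b::real_normed_vector) \<Rightarrow> bool" where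
  "L2_loc f \<longleftrightarrow> (\<forall>T>0. L2_on T f)"

definition L1_loc :: "(real \<Rightarrow> real) \<Rightarrow> bool" where
  "L1_loc f \<longleftrightarrow> (\<forall>T>0. integrable (lebesgue_on {0<..<T}) f)"

definition Linf_on :: "real \<Rightarrow> (real \<Rightarrow> ereal) \<Rightarrow> bool" where
  "Linf_on T h \<longleftrightarrow> h \<in> borel_measurable (lebesgue_on {0<..<T}) \<and>
     (\<exists>C::real. AE t in lebesgue_on {0<..<T}. \<bar>h t\<bar> \<le> ereal C)"

definition Linf_loc :: "(real \<Rightarrow> ereal) \<Rightarrow> bool" where
  "Linf_loc h \<longleftrightarrow> (\<forall>T>0. Linf_on T h)"


section \<open>Sobolev functions of time\<close>

definition test_function :: "real \<Rightarrow> (real \<Rightarrow> real) \<Rightarrow> bool" where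
  "test_function T \<psi> \<longleftrightarrow>
     (\<forall>n t. ((deriv ^^ n) \<psi>) field_differentiable (at t)) \<and>
     (\<exists>K. compact K \<and> K \<subseteq> {0<..<T} \<and> (\<forall>t. t \<notin> K \<longrightarrow> \<psi> t = 0))"

text \<open>\<open>W12_on T g g'\<close>: \<open>g\<close> belongs to \<open>W\<^sup>1\<^sup>,\<^sup>2(0,T;H)\<close> and its distributional derivative is \<open>g'\<close>.\<close>

definition W12_on ::
    "real \<Rightarrow> (real \<Rightarrow> 'b::real_normed_vector) \<Rightarrow> (real \<Rightarrow> 'b) \<Rightarrow> bool" where
  "W12_on T g g' \<longleftrightarrow> L2_on T g \<and> L2_on T g' \<and>
     (\<forall>\<psi>. test_function T \<psi> \<longrightarrow>
        bochner_int (lebesgue_on {0<..<T}) (\<lambda>t. deriv \<psi> t *\<^sub>R g t) =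
        - bochner_int (lebesgue_on {0<..<T}) (\<lambda>t. \<psi> t *\<^sub>R g' t))"

definition W12_loc :: "(real \<Rightarrow> 'b::real_normed_vector) \<Rightarrow> (real \<Rightarrow> 'b) \<Rightarrow> bool" where
  "W12_loc g g' \<longleftrightarrow> (\<forall>T>0. W12_on T g g')"


section \<open>Kernels and convolution\<close>

text \<open>For real-valued \<open>w\<close>, \<open>*\<^sub>R\<close> is multiplication and \<open>bochner_int\<close> is the Lebesgue integral.\<close>

definition conv :: "(real \<Rightarrow> real) \<Rightarrow> (real \<Rightarrow> 'b::real_normed_vector) \<Rightarrow> real \<Rightarrow> 'b" where
  "conv k w t = bochner_int (lebesgue_on {0<..<t}) (\<lambda>s. k (t - s) *\<^sub>R w s)"

definition nonneg_nonincreasing_kernel :: "(real \<Rightarrow> real) \<Rightarrow> bool" where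
  "nonneg_nonincreasing_kernel k \<longleftrightarrow>
     L1_loc k \<and> (\<forall>t>0. 0 \<le> k t) \<and> antimono_on {0<..} k"

text \<open>\<open>condition_K k l\<close>: \<open>k\<close> satisfies condition (K) and \<open>l\<close> is a conjugate kernel of \<open>k\<close>.\<close>

definition condition_K :: "(real \<Rightarrow> real) \<Rightarrow> (real \<Rightarrow> real) \<Rightarrow> bool" where
  "condition_K k l \<longleftrightarrow>
     nonneg_nonincreasing_kernel k \<and> nonneg_nonincreasing_kernel l \<and>
     (\<forall>t>0. conv k l t = 1)"


section \<open>Convex functionals and subdifferentials\<close>

definition eff_dom :: "('h \<Rightarrow> ereal) \<Rightarrow> 'h set" where
  "eff_dom \<phi> = {w. \<phi> w < \<infinity>}"

text \<open>Membership in the codomain \<open>(-\<infinity>,\<infinity>]\<close> is the first conjunct.\<close>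

definition proper_functional :: "('h \<Rightarrow> ereal) \<Rightarrow> bool" where
  "proper_functional \<phi> \<longleftrightarrow> (\<forall>w. \<phi> w \<noteq> -\<infinity>) \<and> eff_dom \<phi> \<noteq> {}"

definition convex_functional :: "('h::real_vector \<Rightarrow> ereal) \<Rightarrow> bool" where
  "convex_functional \<phi> \<longleftrightarrow>
     (\<forall>x y a. 0 < a \<and> a < 1 \<longrightarrow>
        \<phi> ((1 - a) *\<^sub>R x + a *\<^sub>R y) \<le> ereal (1 - a) * \<phi> x + ereal a * \<phi> y)"

definition lsc_functional :: "('h::topological_space \<Rightarrow> ereal) \<Rightarrow> bool" where
  "lsc_functional \<phi> \<longleftrightarrow> (\<forall>x. \<forall>c<\<phi> x. \<forall>\<^sub>F y in nhds x. c < \<phi> y)"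

definition subdiff :: "('h::real_inner \<Rightarrow> ereal) \<Rightarrow> 'h \<Rightarrow> 'h set" where
  "subdiff \<phi> z =
     {\<xi>. z \<in> eff_dom \<phi> \<and> (\<forall>v\<in>eff_dom \<phi>. \<phi> v - \<phi> z \<ge> ereal (\<xi> \<bullet> (v - z)))}"

definition dom_subdiff :: "('h::real_inner \<Rightarrow> ereal) \<Rightarrow> 'h set" where
  "dom_subdiff \<phi> = {w \<in> eff_dom \<phi>. subdiff \<phi> w \<noteq> {}}"


section \<open>Strong solutions\<close>

text \<open>In the next two definitions \<open>g\<close> is the continuous representative of \<open>k * (u - u\<^sub>0)\<close> and \<open>g'\<close> is
  its weak derivative. The initial condition \<open>[k * (u - u\<^sub>0)](0) = 0\<close> concerns this representative;
  the pointwise formula \<open>conv\<close> vanishes trivially at \<open>0\<close>.\<close>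

definition strong_solution ::
    "('h::real_inner \<Rightarrow> ereal) \<Rightarrow> (real \<Rightarrow> real) \<Rightarrow> ('h \<Rightarrow> 'h) \<Rightarrow> (real \<Rightarrow> 'h) \<Rightarrow> 'h \<Rightarrow>
     real \<Rightarrow> (real \<Rightarrow> 'h) \<Rightarrow> bool" where
  "strong_solution \<phi> k B f u0 T u \<longleftrightarrow>
     L2_on T u \<and>
     (\<exists>g g'.
        (AE t in lebesgue_on {0<..<T}. g t = conv k (\<lambda>s. u s - u0) t) \<and>
        continuous_on {0..T} g \<and> W12_on T g g' \<and> g 0 = 0 \<and>
        (AE t in lebesgue_on {0<..<T}. u t \<in> dom_subdiff \<phi>) \<and>
        (\<exists>\<xi>. L2_on T \<xi> \<and>
           (AE t in lebesgue_on {0<..<T}.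
              \<xi> t \<in> subdiff \<phi> (u t) \<and> g' t + \<xi> t + B (u t) = f t)))"

definition strong_solution_global ::
    "('h::real_inner \<Rightarrow> ereal) \<Rightarrow> (real \<Rightarrow> real) \<Rightarrow> ('h \<Rightarrow> 'h) \<Rightarrow> (real \<Rightarrow> 'h) \<Rightarrow> 'h \<Rightarrow>
     (real \<Rightarrow> 'h) \<Rightarrow> bool" where
  "strong_solution_global \<phi> k B f u0 u \<longleftrightarrow>
     L2_loc u \<and>
     (\<exists>g g'.
        (AE t in lebesgue_on {0<..}. g t = conv k (\<lambda>s. u s - u0) t) \<and>
        continuous_on {0..} g \<and> W12_loc g g' \<and> g 0 = 0 \<and>
        (AE t in lebesgue_on {0<..}. u t \<in> dom_subdiff \<phi>) \<and>
        (\<exists>\<xi>. L2_loc \<xi> \<and>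
           (AE t in lebesgue_on {0<..}.
              \<xi> t \<in> subdiff \<phi> (u t) \<and> g' t + \<xi> t + B (u t) = f t)))"

end

theory Submission
  imports Defs
begin

text \<open>
  Since \<open>k * l = 1\<close>, the equation is equivalent to the Volterra equation
  \<open>u - u0 = l * (f - \<xi> - B u)\<close> with \<open>\<xi> \<in> \<partial>\<phi>(u)\<close>. Everything rests on the inequality
  \<open>\<psi>(l * h) \<le> l * (h, \<nabla>\<psi>(l * h))\<close> for convex \<open>\<psi>\<close> with Lipschitz gradient and \<open>\<psi>(0) = 0\<close>, a
  consequence of the monotonicity of the kernels.

  For existence \<open>\<partial>\<phi>\<close> is replaced by its Yosida approximation \<open>\<phi>\<^sub>\<theta>'\<close>, and the Volterra equation
  is solved by Picard iteration. With \<open>\<psi>\<close> the Moreau envelope of \<open>\<phi>\<close>, the inequality bounds \<open>\<phi>\<close>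
  along the approximate solutions and \<open>l * |\<phi>\<^sub>\<theta>'(u\<^sub>\<theta>)|\<^sup>2\<close>; with \<open>\<psi> = |\<cdot>|\<^sup>2 / 2\<close> and Gronwall's
  lemma it gives \<open>|u\<^sub>\<theta> - u\<^sub>\<mu>|\<^sup>2 \<le> C (\<theta> + \<mu>)\<close>, hence locally uniform convergence to some \<open>u\<close>.
  Instead of weak compactness, convex combinations of \<open>\<phi>\<^sub>\<theta>'(u\<^sub>\<theta>)\<close> are used which converge
  strongly in \<open>L\<^sup>2\<close> and almost everywhere; the limit lies in \<open>\<partial>\<phi>(u)\<close> because the subgradient
  inequality survives convex combinations.

  For uniqueness, the du Bois-Reymond lemma turns any strong solution into a solution of the
  Volterra equation, and the inequality with \<open>\<psi> = |\<cdot>|\<^sup>2 / 2\<close> applies to the difference of two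
  solutions.
\<close>

section \<open>Strongly measurable functions\<close>

text \<open>The kernels may be singular at 0 and \<open>k\<close> is not assumed differentiable, so
  no chain rule is at hand for the time derivative of a convolution with \<open>k\<close>. The
  inequality is proved by finite increments instead. On the past the weight \<open>k\<close> only
  decreases, and the tangent of \<psi> bounds \<psi> from below. On the last \<open>d\<close> units
  of time the weight is new, but there \<open>u\<close> moves by at most a multiple of the integral
  of \<open>l\<close> over (0,d), so the quadratic remainder costs this integral squared times the
  integral of \<open>k\<close>. The product of the two integrals is O(d), hence the error is o(d).
  The Hilbert space may be nonseparable. Vector identities are therefore tested against fixed
  vectors, and Fubini's theorem is applied to real functions only. The bound on the convolution of
  \<open>l\<close> with |f|^2 enters twice: values |f| > n cost at most |f|^2 / n, which makes the
  convolution of \<open>l\<close> with \<open>f\<close> continuous, and it controls the source term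
  of the energy estimate at every time. The limit is taken in the equation convolved with
  \<open>k\<close>, which is linear in \<xi> and therefore compatible with convex
  combinations.\<close>

lemma strongly_measurable_compose2:
  assumes "strongly_measurable M f" "strongly_measurable M g"
    and c: "continuous_on UNIV (\<lambda>z. c (fst z) (snd z))"
  shows "strongly_measurable M (\<lambda>x. c (f x) (g x))"
proof -
  obtain s t where s: "\<And>i. simple_function M (s i)" "AE x in M. (\<lambda>i. s i x) \<longlonglongrightarrow> f x"
    and t: "\<And>i. simple_function M (t i)" "AE x in M. (\<lambda>i. t i x) \<longlonglongrightarrow> g x"
    using assms(1,2) unfolding strongly_measurable_def by blast
  have "AE x in M. (\<lambda>i. c (s i x) (t i x)) \<longlonglongrightarrow> c (f x) (g x)"
    using s(2) t(2)
  proof eventually_elim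
    case (elim x)
    have "(\<lambda>i. (s i x, t i x)) \<longlonglongrightarrow> (f x, g x)" using elim by (intro tendsto_Pair)
    with c have "(\<lambda>i. (\<lambda>z. c (fst z) (snd z)) (s i x, t i x)) \<longlonglongrightarrow> (\<lambda>z. c (fst z) (snd z)) (f x, g x)"
      by (intro continuous_on_tendsto_compose[OF c]) auto
    then show ?case by simp
  qed
  moreover have "simple_function M (\<lambda>x. c (s i x) (t i x))" for i
    by (rule simple_function_compose2[OF s(1) t(1)])
  ultimately show ?thesis unfolding strongly_measurable_def by (intro exI[of _ "\<lambda>i x. c (s i x) (t i x)"]) auto
qed

lemma strongly_measurable_compose:
  assumes "strongly_measurable M f" and c: "continuous_on UNIV c"
  shows "strongly_measurable M (\<lambda>x. c (f x))"
proof -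
  have "continuous_on UNIV (\<lambda>z. c (fst (z::'b \<times> 'b)))"
    by (intro continuous_on_compose2[OF c]) (auto intro: continuous_intros)
  then show ?thesis by (rule strongly_measurable_compose2[OF assms(1) assms(1), of "\<lambda>a b. c a"])
qed

lemma strongly_measurable_add:
  assumes "strongly_measurable M f" "strongly_measurable M g"
  shows "strongly_measurable M (\<lambda>x. f x + g x)"
  by (rule strongly_measurable_compose2[OF assms, of "(+)"]) (intro continuous_intros)

lemma strongly_measurable_diff:
  assumes "strongly_measurable M f" "strongly_measurable M g"
  shows "strongly_measurable M (\<lambda>x. f x - g x)"
  by (rule strongly_measurable_compose2[OF assms, of "(-)"]) (intro continuous_intros)

lemma strongly_measurable_real:
  fixes f :: "'a \<Rightarrow> real"
  assumes "f \<in> borel_measurable M" shows "strongly_measurable M f"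
proof -
  from borel_measurable_implies_sequence_metric[OF assms, of 0] obtain s where
    "\<And>i. simple_function M (s i)" "\<And>x. x \<in> space M \<Longrightarrow> (\<lambda>i. s i x) \<longlonglongrightarrow> f x" by metis
  then show ?thesis unfolding strongly_measurable_def by (intro exI[of _ s]) auto
qed

lemma strongly_measurable_scaleR:
  assumes "a \<in> borel_measurable M" "strongly_measurable M g"
  shows "strongly_measurable M (\<lambda>x. a x *\<^sub>R g x)"
  by (rule strongly_measurable_compose2[OF strongly_measurable_real[OF assms(1)] assms(2), of scaleR])
    (intro continuous_intros)

lemma strongly_measurable_const: "strongly_measurable M (\<lambda>x. c)"
  unfolding strongly_measurable_def by (intro exI[of _ "\<lambda>i x. c"]) auto

text \<open>Completeness of Lebesgue measure is what admits an exceptional null set: the part of a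
  preimage inside it is measurable whatever it is, and off it the usual pointwise limit theorem
  applies.\<close>

lemma borel_measurable_AE_lim:
  fixes f :: "'a::euclidean_space \<Rightarrow> 'b::real_normed_vector"
  assumes m: "\<And>i. s i \<in> borel_measurable lebesgue"
    and l: "AE x in lebesgue. (\<lambda>i. s i x) \<longlonglongrightarrow> f x"
  shows "f \<in> borel_measurable lebesgue"
proof -
  obtain N where N: "N \<in> null_sets lebesgue" "\<And>x. x \<notin> N \<Longrightarrow> (\<lambda>i. s i x) \<longlonglongrightarrow> f x"
    using l by (auto simp: eventually_ae_filter)
  have Ns [measurable]: "N \<in> sets lebesgue" using N by auto
  note m[measurable]
  define f' where "f' x = (if x \<in> N then 0 else f x)" for x
  have f': "f' \<in> borel_measurable lebesgue"
  proof (rule borel_measurable_LIMSEQ_metric)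
    show "(\<lambda>x. if x \<in> N then 0 else s i x) \<in> borel_measurable lebesgue" for i by measurable
    show "(\<lambda>i. if x \<in> N then 0 else s i x) \<longlonglongrightarrow> f' x" for x
      using N(2)[of x] by (auto simp: f'_def)
  qed
  show ?thesis
  proof (rule measurableI)
    fix A :: "'b set" assume A: "A \<in> sets borel"
    have "f -` A \<inter> space lebesgue = (f' -` A \<inter> space lebesgue - N) \<union> (f -` A \<inter> N)"
      by (auto simp: f'_def)
    moreover have "f' -` A \<inter> space lebesgue \<in> sets lebesgue" using f' A by (rule measurable_sets)
    moreover have "f -` A \<inter> N \<in> sets lebesgue"
      using N(1) null_sets_completion_subset[of "f -` A \<inter> N" N lborel] by auto
    ultimately show "f -` A \<inter> space lebesgue \<in> sets lebesgue" using Ns by (metis sets.Diff sets.Un)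
  qed auto
qed

lemma strongly_measurable_imp_borel:
  fixes f :: "'a::euclidean_space \<Rightarrow> 'b::real_normed_vector"
  assumes "strongly_measurable lebesgue f" shows "f \<in> borel_measurable lebesgue"
  using assms unfolding strongly_measurable_def
  by (auto intro: borel_measurable_AE_lim borel_measurable_simple_function)

lemma strongly_measurable_norm:
  fixes f :: "'a::euclidean_space \<Rightarrow> 'b::real_normed_vector"
  assumes "strongly_measurable lebesgue f" shows "(\<lambda>x. norm (f x)) \<in> borel_measurable lebesgue"
  by (intro strongly_measurable_imp_borel strongly_measurable_compose[OF assms] continuous_intros)

lemma strongly_measurable_inner:
  fixes f :: "'a::euclidean_space \<Rightarrow> 'b::real_inner"
  assumes "strongly_measurable lebesgue f" "strongly_measurable lebesgue g"
  shows "(\<lambda>x. f x \<bullet> g x) \<in> borel_measurable lebesgue"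
  by (rule strongly_measurable_imp_borel, rule strongly_measurable_compose2[OF assms, of "(\<bullet>)"])
    (intro continuous_intros)

section \<open>Essentially separable values\<close>

lemma strongly_measurable_separable:
  assumes "strongly_measurable M f"
  shows "\<exists>C. countable C \<and> (AE x in M. f x \<in> closure C)"
proof -
  obtain s where s: "\<And>i::nat. simple_function M (s i)" "AE x in M. (\<lambda>i. s i x) \<longlonglongrightarrow> f x"
    using assms unfolding strongly_measurable_def by blast
  let ?C = "\<Union>i. s i ` space M"
  have "finite (s i ` space M)" for i using s(1) by (rule simple_functionD(1))
  then have "countable ?C" by (intro countable_UN[OF countableI_type] countable_finite) auto
  moreover have "AE x in M. f x \<in> closure ?C"
    using s(2) AE_space
  proof eventually_elim
    case (elim x)
    then have "\<forall>i. s i x \<in> ?C" by auto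
    with elim(1) show ?case unfolding closure_sequential by (intro exI[of _ "\<lambda>i. s i x"] conjI)
  qed
  ultimately show ?thesis by blast
qed

lemma borel_measurable_compose_continuous:
  assumes "f \<in> borel_measurable M" "continuous_on UNIV c"
  shows "(\<lambda>x. c (f x)) \<in> borel_measurable M"
  using measurable_comp[OF assms(1) borel_measurable_continuous_onI[OF assms(2)]] by (simp add: comp_def)

text \<open>Converse half of Pettis' theorem. The n-th approximant replaces \<open>f x\<close> by
  the nearest among the first n + 1 points of an enumeration of the dense set; taking the least such
  index makes the choice measurable and finitely valued.\<close>

lemma strongly_measurable_from_separable:
  assumes f: "f \<in> borel_measurable M" and C: "countable C" and fC: "AE x in M. f x \<in> closure C"
  shows "strongly_measurable M f"
proof -
  \<comment> \<open>The point 0 is added so that there is something to enumerate even if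
    \<open>C\<close> is empty.\<close>
  define c where "c = from_nat_into (insert 0 C)"
  have rc: "range c = insert 0 C" unfolding c_def using C by (intro range_from_nat_into) auto
  define P where "P n x i \<longleftrightarrow> i \<le> n \<and> (\<forall>j\<le>n. dist (f x) (c i) \<le> dist (f x) (c j))" for n :: nat and x i
  define idx where "idx n x = (LEAST i. P n x i)" for n x
  have ex: "\<exists>i. P n x i" for n x
  proof -
    let ?g = "\<lambda>i. dist (f x) (c i)"
    obtain i where i: "i \<in> {..n}" "Min (?g ` {..n}) = ?g i"
      by (rule obtains_MIN[of "{..n}" ?g]) auto
    have "?g i \<le> ?g j" if "j \<le> n" for j
      unfolding i(2)[symmetric] using that by (intro Min_le) auto
    then have "P n x i" unfolding P_def using i(1) by auto
    then show ?thesis ..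
  qed
  have Pidx: "P n x (idx n x)" for n x unfolding idx_def using ex by (rule LeastI_ex)
  have m1: "(\<lambda>x. dist (f x) a) \<in> borel_measurable M" for a
    by (rule borel_measurable_compose_continuous[OF f]) (intro continuous_intros)
  note m1[measurable]
  have "Measurable.pred M (\<lambda>x. P n x i)" for n i unfolding P_def by measurable
  then have [measurable]: "idx n \<in> measurable M (count_space UNIV)" for n
    unfolding idx_def by (intro measurable_Least) auto
  have sidx: "simple_function M (idx n)" for n
  proof -
    have "idx n ` space M \<subseteq> {..n}" using Pidx[of n] by (auto simp: P_def)
    then have "finite (idx n ` space M)" by (rule finite_subset) auto
    then show ?thesis unfolding simple_function_def by auto
  qed
  have "AE x in M. (\<lambda>n. c (idx n x)) \<longlonglongrightarrow> f x" using fC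
  proof eventually_elim
    case (elim x)
    show ?case
    proof (rule LIMSEQ_I)
      fix e :: real assume "e > 0"
      then obtain a where a: "a \<in> C" "dist a (f x) < e" using elim by (auto simp: closure_approachable)
      then obtain j where j: "c j = a" using rc by (metis UNIV_I image_iff insertCI)
      show "\<exists>no. \<forall>n\<ge>no. norm (c (idx n x) - f x) < e"
      proof (intro exI[of _ j] allI impI)
        fix n assume "j \<le> n"
        then have "dist (f x) (c (idx n x)) \<le> dist (f x) (c j)" using Pidx[of n x] by (auto simp: P_def)
        then show "norm (c (idx n x) - f x) < e" using a j by (simp add: dist_norm norm_minus_commute)
      qed
    qed
  qed
  then show ?thesis unfolding strongly_measurable_def
    using simple_function_compose1[OF sidx, of c] by (intro exI[of _ "\<lambda>n x. c (idx n x)"]) auto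
qed

text \<open>No diagonal sequence of simple functions is formed. The limit is Borel measurable, and
  almost all its values lie in the closure of the union of the countable sets belonging to the
  approximants.\<close>

lemma strongly_measurable_AE_lim:
  fixes f :: "'a::euclidean_space \<Rightarrow> 'b::real_normed_vector"
  assumes m: "\<And>i::nat. strongly_measurable lebesgue (s i)"
    and l: "AE x in lebesgue. (\<lambda>i. s i x) \<longlonglongrightarrow> f x"
  shows "strongly_measurable lebesgue f"
proof -
  obtain C where C: "\<And>i. countable (C i)" "\<And>i. AE x in lebesgue. s i x \<in> closure (C i)"
    using strongly_measurable_separable[OF m] by metis
  have "AE x in lebesgue. \<forall>i. s i x \<in> closure (C i)" using C(2) by (simp add: AE_all_countable)
  then have "AE x in lebesgue. f x \<in> closure (\<Union>i. C i)" using l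
  proof eventually_elim
    case (elim x)
    have "\<And>i. s i x \<in> closure (\<Union>i. C i)" using elim(1) closure_mono[of "C _" "\<Union>i. C i"] by blast
    then show ?case using elim(2) by (meson closed_closure closed_sequentially)
  qed
  moreover have "f \<in> borel_measurable lebesgue"
    using borel_measurable_AE_lim[OF strongly_measurable_imp_borel[OF m] l] .
  ultimately show ?thesis using C(1) by (intro strongly_measurable_from_separable[of _ _ "\<Union>i. C i"]) auto
qed

text \<open>Separability comes from the time axis: a continuous \<open>u\<close> maps the rationals
  onto a dense subset of its range.\<close>

lemma strongly_measurable_continuous:
  fixes u :: "real \<Rightarrow> 'b::real_normed_vector"
  assumes "continuous_on UNIV u" shows "strongly_measurable lebesgue u"
proof (rule strongly_measurable_from_separable)
  show "u \<in> borel_measurable lebesgue"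
    using borel_measurable_continuous_onI[OF assms] by (simp add: measurable_completion)
  show "countable (u ` \<rat>)" by (simp add: countable_rat)
  have "u x \<in> closure (u ` \<rat>)" for x
  proof -
    have "u ` closure \<rat> \<subseteq> closure (u ` \<rat>)"
      by (rule image_closure_subset[OF continuous_on_subset[OF assms]]) (use closure_subset[of "u ` \<rat>"] in auto)
    then show ?thesis using Rats_closure_real by auto
  qed
  then show "AE x in lebesgue. u x \<in> closure (u ` \<rat>)" by auto
qed

lemma strongly_measurable_restrict_iff:
  fixes f :: "'a::euclidean_space \<Rightarrow> 'b::real_normed_vector"
  assumes S: "S \<in> sets lebesgue"
  shows "strongly_measurable (lebesgue_on S) f \<longleftrightarrow> strongly_measurable lebesgue (\<lambda>x. if x \<in> S then f x else 0)"
proof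
  assume "strongly_measurable (lebesgue_on S) f"
  then obtain s where s: "\<And>i::nat. simple_function (lebesgue_on S) (s i)" "AE x in lebesgue_on S. (\<lambda>i. s i x)
      \<longlonglongrightarrow> f x"
    unfolding strongly_measurable_def by blast
  have "simple_function lebesgue (\<lambda>x. if x \<in> S then s i x else 0)" for i
    unfolding simple_function_def
  proof (intro conjI ballI)
    have "(\<lambda>x. if x \<in> S then s i x else 0) ` space lebesgue \<subseteq> insert 0 (s i ` S)" by auto
    moreover have "finite (s i ` S)" using simple_functionD(1)[OF s(1)[of i]] by simp
    ultimately show "finite ((\<lambda>x. if x \<in> S then s i x else 0) ` space lebesgue)" by (meson finite_insert finite_subset)
    fix y
    have "s i -` {y} \<inter> S \<in> sets lebesgue"
      using simple_functionD(2)[OF s(1)[of i], of "{y}"] S by (auto simp: sets_restrict_space_iff)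
    moreover have "(\<lambda>x. if x \<in> S then s i x else 0) -` {y} \<inter> space lebesgue
        = (s i -` {y} \<inter> S) \<union> (if y = 0 then - S else {})" by (auto split: if_splits)
    moreover have "- S \<in> sets lebesgue" using sets.compl_sets[OF S] by (simp add: Compl_eq_Diff_UNIV)
    ultimately show "(\<lambda>x. if x \<in> S then s i x else 0) -` {y} \<inter> space lebesgue \<in> sets lebesgue" by auto
  qed
  moreover have "AE x in lebesgue. (\<lambda>i. if x \<in> S then s i x else 0) \<longlonglongrightarrow> (if x \<in> S then f x else 0)"
    using s(2) S by (simp add: AE_restrict_space_iff)
  ultimately show "strongly_measurable lebesgue (\<lambda>x. if x \<in> S then f x else 0)"
    unfolding strongly_measurable_def by (intro exI[of _ "\<lambda>i x. if x \<in> S then s i x else 0"]) auto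
next
  assume "strongly_measurable lebesgue (\<lambda>x. if x \<in> S then f x else 0)"
  then obtain s where s: "\<And>i::nat. simple_function lebesgue (s i)" "AE x in lebesgue. (\<lambda>i. s i x) \<longlonglongrightarrow>
      (if x \<in> S then f x else 0)"
    unfolding strongly_measurable_def by blast
  have "simple_function (lebesgue_on S) (s i)" for i
    using simple_functionD[OF s(1)[of i]] S unfolding simple_function_def
    by (auto simp: sets_restrict_space_iff space_restrict_space intro: finite_subset[OF image_mono[of S UNIV]])
  moreover have "AE x in lebesgue_on S. (\<lambda>i. s i x) \<longlonglongrightarrow> f x"
    using s(2) S by (simp add: AE_restrict_space_iff) (erule eventually_mono, auto)
  ultimately show "strongly_measurable (lebesgue_on S) f" unfolding strongly_measurable_def by blast
qed

section \<open>The Bochner integral in a Hilbert space\<close>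

text \<open>Pairing the approximating simple functions with \<open>e\<close> preserves the
  approximation by Cauchy-Schwarz. Through this lemma every vector integral is accessed by ordinary
  real integrals.\<close>

lemma has_bochner_int_inner:
  fixes F :: "'a \<Rightarrow> 'h::real_inner"
  assumes "has_bochner_int M F x"
  shows "has_bochner_integral M (\<lambda>y. F y \<bullet> e) (x \<bullet> e)"
proof -
  obtain s where F: "F \<in> borel_measurable M" and s: "\<And>i::nat. Bochner_Integration.simple_bochner_integrable M (s i)"
    and l: "(\<lambda>i. \<integral>\<^sup>+y. norm (F y - s i y) \<partial>M) \<longlonglongrightarrow> 0" and x: "(\<lambda>i.
        Bochner_Integration.simple_bochner_integral M (s i)) \<longlonglongrightarrow> x"
    using assms unfolding has_bochner_int_def by blast
  have ms: "simple_function M (s i)" for i using s[of i] by (cases rule: simple_bochner_integrable.cases)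
  have bl: "bounded_linear (\<lambda>v. v \<bullet> e)" by (rule bounded_linear_inner_left)
  show ?thesis
  proof (rule has_bochner_integral.intros[where s = "\<lambda>i y. s i y \<bullet> e"])
    show "(\<lambda>y. F y \<bullet> e) \<in> borel_measurable M"
      by (rule borel_measurable_compose_continuous[OF F]) (intro continuous_intros)
    show "Bochner_Integration.simple_bochner_integrable M (\<lambda>y. s i y \<bullet> e)" for i
      using simple_bochner_integrable_compose2[OF _ s s, of "\<lambda>a b. a \<bullet> e"] by simp
    have "(\<lambda>i. Bochner_Integration.simple_bochner_integral M (s i) \<bullet> e) \<longlonglongrightarrow> x \<bullet> e" using x by
        (intro tendsto_intros)
    moreover have "Bochner_Integration.simple_bochner_integral M (\<lambda>y. s i y \<bullet> e) =
        Bochner_Integration.simple_bochner_integral M (s i) \<bullet> e" for i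
      using simple_bochner_integral_linear[OF bl[THEN bounded_linear.linear] s] by auto
    ultimately show "(\<lambda>i. Bochner_Integration.simple_bochner_integral M (\<lambda>y. s i y \<bullet> e)) \<longlonglongrightarrow>
        x \<bullet> e" by simp
    show "(\<lambda>i. \<integral>\<^sup>+y. norm (F y \<bullet> e - s i y \<bullet> e) \<partial>M) \<longlonglongrightarrow> 0"
    proof (rule tendsto_sandwich[OF _ _ tendsto_const])
      show "\<forall>\<^sub>F i in sequentially. (\<integral>\<^sup>+y. norm (F y \<bullet> e - s i y \<bullet> e) \<partial>M) \<le>
          ennreal (norm e) * (\<integral>\<^sup>+y. norm (F y - s i y) \<partial>M)"
      proof (intro always_eventually allI)
        fix i
        have "s i \<in> borel_measurable M" using ms by (rule borel_measurable_simple_function)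
        have "(\<integral>\<^sup>+y. norm (F y \<bullet> e - s i y \<bullet> e) \<partial>M) \<le> (\<integral>\<^sup>+y. ennreal (norm e)
            * norm (F y - s i y) \<partial>M)"
          by (intro nn_integral_mono)
            (auto simp: ennreal_mult[symmetric] inner_diff_left[symmetric] mult.commute[of "norm e"] Cauchy_Schwarz_ineq2)
        also have "\<dots> \<le> ennreal (norm e) * (\<integral>\<^sup>+y. norm (F y - s i y) \<partial>M)"
        proof (cases "e = 0")
          case False
          then have "(\<integral>\<^sup>+y. ennreal (norm e) * norm (F y - s i y) \<partial>M) = ennreal (norm e) * (\<integral>\<^sup>+y.
              norm (F y - s i y) \<partial>M)"
          proof (intro nn_integral_cmult)
            \<comment> \<open>Subtraction need not be Borel measurable on a nonseparable space, even
              for measurable arguments. Since \<open>s i\<close> has finitely many values, the norm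
              of the difference is a finite sum of distances to fixed points, each restricted to a
              measurable set.\<close>
            obtain A where A: "finite A" "s i ` space M \<subseteq> A" using simple_functionD(1)[OF ms[of i]] by blast
            have "(\<lambda>y. dist (F y) a) \<in> borel_measurable M" for a
              by (rule borel_measurable_compose_continuous[OF F]) (intro continuous_intros)
            note this[measurable]
            have ind: "(indicator (s i -` {a} \<inter> space M) :: _ \<Rightarrow> real) \<in> borel_measurable M" for a
              using simple_functionD(2)[OF ms[of i]] by simp
            have "(\<lambda>y. \<Sum>a\<in>A. indicator (s i -` {a} \<inter> space M) y * dist (F y) a) \<in> borel_measurable M"
              using ind by measurable
            moreover have "norm (F y - s i y) = (\<Sum>a\<in>A. indicator (s i -` {a} \<inter> space M) y * dist (F y) a)" if "y \<in> space M" for y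
            proof -
              have "(\<Sum>a\<in>A. indicator (s i -` {a} \<inter> space M) y * dist (F y) a) = (\<Sum>a\<in>A. if a = s i y then dist (F
                  y) a else 0)"
                using that by (intro sum.cong) (auto simp: indicator_def)
              also have "\<dots> = dist (F y) (s i y)" using A that by (auto simp: sum.delta)
              finally show ?thesis by (simp add: dist_norm)
            qed
            ultimately have "(\<lambda>y. norm (F y - s i y)) \<in> borel_measurable M"
              by (simp cong: measurable_cong)
            then show "(\<lambda>y. ennreal (norm (F y - s i y))) \<in> borel_measurable M" by measurable
          qed
          then show ?thesis by simp
        qed simp
        finally show "(\<integral>\<^sup>+y. norm (F y \<bullet> e - s i y \<bullet> e) \<partial>M) \<le> ennreal (norm e) *
            (\<integral>\<^sup>+y. norm (F y - s i y) \<partial>M)" .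
      qed
      show "(\<lambda>i. ennreal (norm e) * (\<integral>\<^sup>+y. norm (F y - s i y) \<partial>M)) \<longlonglongrightarrow> 0"
        using tendsto_mult_ennreal[OF tendsto_const[of "ennreal (norm e)"] l] by simp
    qed auto
  qed
qed

text \<open>Cutting the simple approximants off by a multiple of |F| gives a dominated sequence, so
  they converge to \<open>F\<close> in mean; their integrals are then Cauchy, and completeness of
  the space supplies the value.\<close>

lemma has_bochner_int_exists:
  fixes F :: "'a \<Rightarrow> 'h::banach"
  assumes F: "strongly_measurable M F" "F \<in> borel_measurable M" and int: "integrable M (\<lambda>x. norm (F x))"
  shows "\<exists>x. has_bochner_int M F x"
proof -
  obtain s where s: "\<And>i::nat. simple_function M (s i)" "AE x in M. (\<lambda>i. s i x) \<longlonglongrightarrow> F x"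
    using F(1) unfolding strongly_measurable_def by blast
  \<comment> \<open>The factor 2 leaves room: where \<open>F x\<close> is nonzero the bound holds
    for all large \<open>i\<close>, so the cut-off eventually does nothing; where
    \<open>F x = 0\<close> the cut-off function is 0 at once.\<close>
  define A where "A i = {x\<in>space M. norm (s i x) \<le> 2 * norm (F x)}" for i
  define t where "t i x = (if x \<in> A i then s i x else 0)" for i x
  have nF: "(\<lambda>x. norm (F x)) \<in> borel_measurable M"
    by (rule borel_measurable_compose_continuous[OF F(2)]) (intro continuous_intros)
  have ns: "(\<lambda>x. norm (s i x)) \<in> borel_measurable M" for i
    using borel_measurable_simple_function[OF simple_function_compose1[OF s(1)[of i], of norm]] .
  have A: "A i \<in> sets M" for i unfolding A_def using nF ns by measurable
  have st: "simple_function M (t i)" for i unfolding t_def using s(1) A by (intro simple_function_If_set) auto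
  have bt: "norm (t i x) \<le> 2 * norm (F x)" if "x \<in> space M" for i x using that by (auto simp: t_def A_def)
  have mt: "(\<lambda>x. norm (F x - t i x)) \<in> borel_measurable M" for i
  proof -
    have fin: "finite (t i ` space M)" using st by (rule simple_functionD(1))
    have "(\<lambda>y. dist (F y) a) \<in> borel_measurable M" for a
      by (rule borel_measurable_compose_continuous[OF F(2)]) (intro continuous_intros)
    note this[measurable]
    have ind: "(indicator (t i -` {a} \<inter> space M) :: _ \<Rightarrow> real) \<in> borel_measurable M" for a
      using simple_functionD(2)[OF st[of i]] by simp
    have "(\<lambda>y. \<Sum>a\<in>t i ` space M. indicator (t i -` {a} \<inter> space M) y * dist (F y) a) \<in> borel_measurable M"
      using ind by measurable
    moreover have "norm (F y - t i y) = (\<Sum>a\<in>t i ` space M. indicator (t i -` {a} \<inter> space M) y * dist (F y) a)" if "y \<in>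
        space M" for y
    proof -
      have "(\<Sum>a\<in>t i ` space M. indicator (t i -` {a} \<inter> space M) y * dist (F y) a) = (\<Sum>a\<in>t i ` space M. if a = t i
          y then dist (F y) a else 0)"
        using that by (intro sum.cong) (auto simp: indicator_def)
      also have "\<dots> = dist (F y) (t i y)" using fin that by (subst sum.delta) auto
      finally show ?thesis by (simp add: dist_norm)
    qed
    ultimately show ?thesis by (simp cong: measurable_cong)
  qed
  have lt: "AE x in M. (\<lambda>i. norm (F x - t i x)) \<longlonglongrightarrow> 0" using s(2) AE_space
  proof eventually_elim
    case (elim x)
    have "(\<lambda>i. t i x) \<longlonglongrightarrow> F x"
    proof (cases "F x = 0")
      case True
      then show ?thesis using bt[of x] elim by simp
    next
      case False
      then have "\<forall>\<^sub>F i in sequentially. norm (s i x) < 2 * norm (F x)"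
        using order_tendstoD(2)[OF tendsto_norm[OF elim(1)], of "2 * norm (F x)"] by simp
      then have "\<forall>\<^sub>F i in sequentially. s i x = t i x"
        by eventually_elim (use elim in \<open>auto simp: t_def A_def\<close>)
      with elim(1) show ?thesis by (rule Lim_transform_eventually)
    qed
    then have "(\<lambda>i. norm (F x - t i x)) \<longlonglongrightarrow> norm (F x - F x)" by (intro tendsto_intros)
    then show ?case by simp
  qed
  have iI: "(\<lambda>i. \<integral>x. norm (F x - t i x) \<partial>M) \<longlonglongrightarrow> (\<integral>x. 0 \<partial>M)" and ii:
      "\<And>i. integrable M (\<lambda>x. norm (F x - t i x))"
  proof -
    have i3: "integrable M (\<lambda>x. 3 * norm (F x))" using int by simp
    have bb: "norm (norm (F x - t i x)) \<le> 3 * norm (F x)" if "x \<in> space M" for i x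
      using bt[OF that, of i] norm_triangle_ineq4[of "F x" "t i x"] by simp
    show "(\<lambda>i. \<integral>x. norm (F x - t i x) \<partial>M) \<longlonglongrightarrow> (\<integral>x. 0 \<partial>M)"
      by (rule integral_dominated_convergence[OF _ mt i3 lt]) (use bb in auto)
    show "integrable M (\<lambda>x. norm (F x - t i x))" for i
      by (rule Bochner_Integration.integrable_bound[OF i3 mt]) (use bb in auto)
  qed
  have l0: "(\<lambda>i. \<integral>\<^sup>+x. norm (F x - t i x) \<partial>M) \<longlonglongrightarrow> 0"
  proof -
    have "(\<integral>\<^sup>+x. norm (F x - t i x) \<partial>M) = ennreal (\<integral>x. norm (F x - t i x) \<partial>M)" for i
      by (intro nn_integral_eq_integral ii) auto
    moreover have "(\<lambda>i. ennreal (\<integral>x. norm (F x - t i x) \<partial>M)) \<longlonglongrightarrow> ennreal 0"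
      using iI by (intro tendsto_ennrealI) simp
    ultimately show ?thesis by simp
  qed
  have sbt: "Bochner_Integration.simple_bochner_integrable M (t i)" for i
  proof (rule simple_bochner_integrableI_bounded[OF st])
    have "integrable M (\<lambda>x. 2 * norm (F x))" using int by simp
    then have "(\<integral>\<^sup>+x. ennreal (2 * norm (F x)) \<partial>M) < \<infinity>" by (subst nn_integral_eq_integral) auto
    moreover have "(\<integral>\<^sup>+x. norm (t i x) \<partial>M) \<le> (\<integral>\<^sup>+x. ennreal (2 * norm (F x)) \<partial>M)"
      using bt by (intro nn_integral_mono) auto
    ultimately show "(\<integral>\<^sup>+x. norm (t i x) \<partial>M) < \<infinity>" by (rule order.strict_trans1[rotated])
  qed
  let ?S = "\<lambda>i. Bochner_Integration.simple_bochner_integral M (t i)"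
  let ?d = "\<lambda>i. \<integral>x. norm (F x - t i x) \<partial>M"
  have bd: "norm (?S i - ?S j) \<le> ?d i + ?d j" for i j
  proof -
    have "ennreal (norm (?S i - ?S j)) = norm (Bochner_Integration.simple_bochner_integral M (\<lambda>x. t i x - t j x))"
      using sbt by (subst simple_bochner_integral_diff) auto
    also have "\<dots> \<le> Bochner_Integration.simple_bochner_integral M (\<lambda>x. norm (t i x - t j x))"
      using simple_bochner_integrable_compose2[of "(-)" M "t i" "t j"] sbt
      by (auto intro!: simple_bochner_integral_norm_bound)
    also have "\<dots> = (\<integral>\<^sup>+x. norm (t i x - t j x) \<partial>M)"
      using simple_bochner_integrable_compose2[of "\<lambda>x y. norm (x - y)" M "t i" "t j"] sbt
      by (auto intro!: simple_bochner_integral_eq_nn_integral)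
    also have "\<dots> \<le> (\<integral>\<^sup>+x. ennreal (norm (F x - t i x) + norm (F x - t j x)) \<partial>M)"
      by (intro nn_integral_mono ennreal_leI) (metis norm_diff_triangle_le norm_minus_commute order_refl)
    also have "\<dots> = ennreal (\<integral>x. norm (F x - t i x) + norm (F x - t j x) \<partial>M)"
      using ii by (intro nn_integral_eq_integral) auto
    also have "\<dots> = ennreal (?d i + ?d j)" using ii by simp
    finally show ?thesis by (subst (asm) ennreal_le_iff) (auto intro!: add_nonneg_nonneg integral_nonneg_AE)
  qed
  have "Cauchy ?S"
  proof (rule CauchyI)
    fix e :: real assume "e > 0"
    then have "\<forall>\<^sub>F i in sequentially. ?d i < e / 2" using order_tendstoD(2)[OF iI, of "e/2"] by simp
    then obtain N where "\<forall>i\<ge>N. ?d i < e / 2" by (auto simp: eventually_sequentially)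
    then have "norm (?S m - ?S n) < e" if "m \<ge> N" "n \<ge> N" for m n 
      using bd[of m n] that \<open>\<forall>i\<ge>N. ?d i < e / 2\<close>[rule_format, of m] \<open>\<forall>i\<ge>N. ?d i < e /
          2\<close>[rule_format, of n] by linarith
    then show "\<exists>M. \<forall>m\<ge>M. \<forall>n\<ge>M. norm (?S m - ?S n) < e" by blast
  qed
  then obtain x where "?S \<longlonglongrightarrow> x" using Cauchy_convergent convergent_def by blast
  then show ?thesis unfolding has_bochner_int_def using F sbt l0 by blast
qed

text \<open>Two candidate values have the same inner product with every \<open>e\<close>, in
  particular with their difference. This makes the definite description in
  \<open>bochner_int\<close> meaningful and characterizes the integral by its pairings.\<close>

lemma bochner_int_inner:
  fixes F :: "'a \<Rightarrow> 'h::{real_inner,banach}"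
  assumes F: "strongly_measurable M F" "F \<in> borel_measurable M" and int: "integrable M (\<lambda>x. norm (F x))"
  shows "has_bochner_integral M (\<lambda>y. F y \<bullet> e) (bochner_int M F \<bullet> e)"
proof -
  obtain x where x: "has_bochner_int M F x" using has_bochner_int_exists[OF assms] by blast
  have "y = x" if "has_bochner_int M F y" for y
  proof -
    have "(y - x) \<bullet> e = 0" for e
      using has_bochner_integral_eq[OF has_bochner_int_inner[OF that, of e] has_bochner_int_inner[OF x, of e]]
      by (simp add: inner_diff_left)
    from this[of "y - x"] show ?thesis by simp
  qed
  with x have "(THE x. has_bochner_int M F x) = x" by blast
  with x have "bochner_int M F = x" unfolding bochner_int_def by auto
  with has_bochner_int_inner[OF x] show ?thesis by simp
qed

section \<open>Convolution on the line\<close>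

text \<open>Kernels and data are extended by zero to \<open>t \<le> 0\<close>, so that the convolution becomes an integral over
  the whole line.\<close>

definition rconv :: "(real \<Rightarrow> real) \<Rightarrow> (real \<Rightarrow> real) \<Rightarrow> real \<Rightarrow> real" where
  "rconv a w t = (\<integral>s. a (t - s) * w s \<partial>lebesgue)"

abbreviation rconv_integrable :: "(real \<Rightarrow> real) \<Rightarrow> (real \<Rightarrow> real) \<Rightarrow> real \<Rightarrow> bool" where
  "rconv_integrable a w t \<equiv> integrable lebesgue (\<lambda>s. a (t - s) * w s)"

abbreviation norm_sq :: "('a \<Rightarrow> 'b::real_normed_vector) \<Rightarrow> 'a \<Rightarrow> real" where
  "norm_sq h \<equiv> \<lambda>s. (norm (h s))\<^sup>2"

text \<open>For \<open>w\<close> vanishing on the negative axis this is the primitive from 0, that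
  is, the convolution of \<open>w\<close> with the constant kernel 1.\<close>

definition cumul :: "(real \<Rightarrow> real) \<Rightarrow> real \<Rightarrow> real" where
  "cumul w t = (\<integral>s. indicator {..<t} s * w s \<partial>lebesgue)"

definition locint :: "(real \<Rightarrow> real) \<Rightarrow> bool" where
  "locint w \<longleftrightarrow> (\<forall>s\<le>0. w s = 0) \<and> w \<in> borel_measurable lebesgue \<and>
     (\<forall>T. integrable lebesgue (\<lambda>s. indicator {..<T} s * w s))"

text \<open>Borel rather than Lebesgue measurability is asked of the kernel because it is composed
  with differences of two variables in Fubini arguments, where preimages of Lebesgue null sets would
  have to be controlled.\<close>

definition mono_kernel :: "(real \<Rightarrow> real) \<Rightarrow> bool" where
  "mono_kernel a \<longleftrightarrow> locint a \<and> a \<in> borel_measurable borel \<and> (\<forall>s. 0 \<le> a s) \<and>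
     (\<forall>s t. 0 < s \<longrightarrow> s \<le> t \<longrightarrow> a t \<le> a s)"

section \<open>Shifts, commutativity and associativity of convolution\<close>

lemma sigma_finite_lebesgue: "sigma_finite_measure (lebesgue :: real measure)"
proof
  show "\<exists>A. countable A \<and> A \<subseteq> sets (lebesgue::real measure) \<and> \<Union>A = space lebesgue \<and>
      (\<forall>a\<in>A. emeasure lebesgue a \<noteq> \<infinity>)"
  proof (intro exI[of _ "range (\<lambda>n::nat. {- real n..real n})"] conjI)
    have "\<exists>n::nat. - real n \<le> x \<and> x \<le> real n" for x :: real
      using real_arch_simple[of "\<bar>x\<bar>"] by (metis abs_le_iff minus_le_iff)
    then show "\<Union>(range (\<lambda>n::nat. {- real n..real n})) = space lebesgue" by auto
  qed auto
qed

interpretation leb2: pair_sigma_finite "lebesgue :: real measure" "lebesgue :: real measure"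
  unfolding pair_sigma_finite_def using sigma_finite_lebesgue by simp

lemma ident_lebesgue [measurable]: "(\<lambda>x::real. x) \<in> borel_measurable lebesgue"
  by (simp add: measurable_completion)

lemma borel_imp_lebesgue: "(a :: real \<Rightarrow> 'a::topological_space) \<in> borel_measurable borel \<Longrightarrow> a \<in>
    borel_measurable lebesgue"
  by (simp add: measurable_completion)

lemma fst_snd_lebesgue [measurable]:
  "fst \<in> borel_measurable ((lebesgue :: real measure) \<Otimes>\<^sub>M (lebesgue :: real measure))"
  "snd \<in> borel_measurable ((lebesgue :: real measure) \<Otimes>\<^sub>M (lebesgue :: real measure))"
  by (rule measurable_compose[OF measurable_fst ident_lebesgue],
      rule measurable_compose[OF measurable_snd ident_lebesgue])

lemma rconv_integrable_shift:
  fixes a b :: "real \<Rightarrow> real"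
  assumes "rconv_integrable a b t"
  shows "integrable lebesgue (\<lambda>s. a (t + r - s) * b (s - r))"
  using lebesgue_integrable_real_affine[OF assms, of 1 "- r"] by (simp add: algebra_simps)

lemma rconv_shift:
  "(\<integral>s. a (t + r - s) * b (s - r) \<partial>lebesgue) = rconv a b t"
  unfolding rconv_def using lebesgue_integral_real_affine[of 1 "\<lambda>s. a (t - s) * b s" "- r"]
  by (simp add: algebra_simps)

lemma rconv_commute: "rconv a b t = rconv b a t"
  unfolding rconv_def using lebesgue_integral_real_affine[of "-1" "\<lambda>s. a (t - s) * b s" "t"]
  by (simp add: algebra_simps)

lemma rconv_integrable_commute:
  fixes a b :: "real \<Rightarrow> real"
  assumes "rconv_integrable a b t"
  shows "rconv_integrable b a t"
  using lebesgue_integrable_real_affine[OF assms, of "-1" t] by (simp add: algebra_simps)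

text \<open>Fubini for \<open>f r s\<close>. As \<open>a\<close> and \<open>b\<close> are
  nonnegative, the inner integral of the absolute value is the convolution of \<open>a\<close> and
  \<open>b\<close> times |w r|, so integrability of one outer integrand suffices.\<close>

lemma rconv_assoc:
  assumes a [measurable]: "a \<in> borel_measurable borel" and b [measurable]: "b \<in> borel_measurable borel"
    and w [measurable]: "w \<in> borel_measurable lebesgue"
    and a0: "\<And>s. 0 \<le> a s" and b0: "\<And>s. 0 \<le> b s"
    and ab: "\<And>\<tau>. rconv_integrable a b \<tau>"
    and abw: "integrable lebesgue (\<lambda>r. rconv a b (t - r) * w r)"
  shows "rconv a (rconv b w) t = rconv (rconv a b) w t"
    and "rconv_integrable a (\<lambda>s. rconv b w s) t"
proof -
  define f where "f r s = a (t - s) * (b (s - r) * w r)" for r s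
  have m [measurable]: "case_prod f \<in> borel_measurable (lebesgue \<Otimes>\<^sub>M lebesgue)"
    unfolding f_def split_beta' by measurable
  have fi: "integrable lebesgue (f r)" and fn: "(\<integral>s. norm (f r s) \<partial>lebesgue) = norm (rconv a b (t - r) * w r)"
    and fe: "(\<integral>s. f r s \<partial>lebesgue) = rconv a b (t - r) * w r" for r
  proof -
    have eq: "f r = (\<lambda>s. a (t - r + r - s) * b (s - r) * w r)" by (simp add: f_def fun_eq_iff)
    have i: "integrable lebesgue (\<lambda>s. a (t - r + r - s) * b (s - r))"
      by (rule rconv_integrable_shift[OF ab])
    show "integrable lebesgue (f r)" unfolding eq using i by simp
    show "(\<integral>s. f r s \<partial>lebesgue) = rconv a b (t - r) * w r"
      unfolding eq using rconv_shift[of a "t - r" r b] by simp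
    have "(\<integral>s. norm (f r s) \<partial>lebesgue) = (\<integral>s. a (t - r + r - s) * b (s - r) * \<bar>w r\<bar> \<partial>lebesgue)"
      unfolding eq using a0 b0 by (simp add: abs_mult)
    also have "\<dots> = rconv a b (t - r) * \<bar>w r\<bar>" using rconv_shift[of a "t - r" r b] by simp
    also have "\<dots> = norm (rconv a b (t - r) * w r)"
      using a0 b0 by (simp add: abs_mult rconv_def)
    finally show "(\<integral>s. norm (f r s) \<partial>lebesgue) = norm (rconv a b (t - r) * w r)" .
  qed
  have F: "integrable (lebesgue \<Otimes>\<^sub>M lebesgue) (case_prod f)"
    by (rule leb2.Fubini_integrable[OF m]) (use fi fn abw in auto)
  have in2: "(\<integral>r. f r s \<partial>lebesgue) = a (t - s) * rconv b w s" for s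
    by (simp add: f_def rconv_def)
  have "(\<integral>s. (\<integral>r. f r s \<partial>lebesgue) \<partial>lebesgue) = (\<integral>r. (\<integral>s. f r s
      \<partial>lebesgue) \<partial>lebesgue)"
    by (rule leb2.Fubini_integral[OF F])
  then show "rconv a (rconv b w) t = rconv (rconv a b) w t"
    unfolding in2 fe by (simp add: rconv_def)
  show "rconv_integrable a (\<lambda>s. rconv b w s) t"
    using leb2.integrable_snd[OF F] unfolding in2 .
qed

lemma rconv_measurable:
  assumes [measurable]: "b \<in> borel_measurable borel" "w \<in> borel_measurable lebesgue"
  shows "rconv b w \<in> borel_measurable lebesgue"
proof -
  have "(\<lambda>(s, r). b (s - r) * w r) \<in> borel_measurable (lebesgue \<Otimes>\<^sub>M lebesgue)"
    unfolding split_beta' by measurable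
  from sigma_finite_measure.borel_measurable_lebesgue_integral[OF sigma_finite_lebesgue this] show ?thesis
    unfolding rconv_def by simp
qed

lemma locint_measurable [measurable_dest]: "locint w \<Longrightarrow> w \<in> borel_measurable lebesgue"
  by (simp add: locint_def)

lemma locint_nonpos: "locint w \<Longrightarrow> s \<le> 0 \<Longrightarrow> w s = 0"
  by (simp add: locint_def)

lemma locint_integrable: "locint w \<Longrightarrow> integrable lebesgue (\<lambda>s. indicator {..<T} s * w s)"
  by (simp add: locint_def)

lemma locint_abs: "locint w \<Longrightarrow> locint (\<lambda>s. \<bar>w s\<bar>)"
  unfolding locint_def
proof safe
  fix T assume "\<forall>T. integrable lebesgue (\<lambda>s. indicator {..<T} s * w s)"
  then have "integrable lebesgue (\<lambda>s. \<bar>indicator {..<T} s * w s\<bar>)" by (intro integrable_abs) auto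
  then show "integrable lebesgue (\<lambda>s. indicator {..<T} s * \<bar>w s\<bar>)" by (simp add: abs_mult)
qed auto

lemma locint_cmult: "locint w \<Longrightarrow> locint (\<lambda>s. c * w s)"
  unfolding locint_def by (auto simp: mult.left_commute[of _ c])

lemma locint_add: "locint v \<Longrightarrow> locint w \<Longrightarrow> locint (\<lambda>s. v s + w s)"
  unfolding locint_def by (auto simp: distrib_left)

lemma locint_diff: "locint v \<Longrightarrow> locint w \<Longrightarrow> locint (\<lambda>s. v s - w s)"
  unfolding locint_def by (auto simp: right_diff_distrib)

lemma locint_bound:
  assumes v: "locint v" and w: "w \<in> borel_measurable lebesgue" and le: "\<And>s. \<bar>w s\<bar> \<le> v s"
  shows "locint w"
  unfolding locint_def
proof (intro conjI allI impI)
  show "w s = 0" if "s \<le> 0" for s using le[of s] locint_nonpos[OF v that] by simp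
  note w[measurable]
  show "w \<in> borel_measurable lebesgue" by fact
  show "integrable lebesgue (\<lambda>s. indicator {..<T} s * w s)" for T
    by (rule Bochner_Integration.integrable_bound[OF locint_integrable[OF v, of T]])
      (use le in \<open>auto intro!: AE_I2 simp: indicator_def intro: order_trans[OF le abs_ge_self]\<close>)
qed

lemma integrable_indicator_bounded:
  assumes "c \<in> borel_measurable lebesgue" "\<And>s. s < T \<Longrightarrow> \<bar>c s\<bar> \<le> C" "\<And>s. s \<ge> T
      \<Longrightarrow> c s = 0" "locint w"
  shows "integrable lebesgue (\<lambda>s. c s * w s :: real)"
proof (rule Bochner_Integration.integrable_bound[OF integrable_mult_right[OF locint_integrable[OF assms(4), of T], of C]])
  show "(\<lambda>s. c s * w s) \<in> borel_measurable lebesgue" using assms(1,4) by measurable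
  have "\<bar>c s\<bar> * \<bar>w s\<bar> \<le> \<bar>C\<bar> * \<bar>w s\<bar>" if "s < T" for s using assms(2)[OF that] by (intro
      mult_right_mono) auto
  then show "AE s in lebesgue. norm (c s * w s) \<le> norm (C * (indicator {..<T} s * w s))"
    using assms(3) by (intro AE_I2) (auto simp: abs_mult indicator_def not_less)
qed

section \<open>Primitives as convolutions with the unit step\<close>

abbreviation heaviside :: "real \<Rightarrow> real" where "heaviside \<equiv> indicator {0<..}"

lemma cumul_eq_rconv: "cumul w t = rconv heaviside w t"
  unfolding cumul_def rconv_def by (intro Bochner_Integration.integral_cong) (auto simp: indicator_def)

lemma cumul_diff:
  assumes "locint w" "a \<le> b"
  shows "cumul w b - cumul w a = (\<integral>s. indicator {a..<b} s * w s \<partial>lebesgue)"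
  unfolding cumul_def Bochner_Integration.integral_diff[OF locint_integrable[OF assms(1)] locint_integrable[OF assms(1)], symmetric]
  using assms(2) by (intro Bochner_Integration.integral_cong) (auto simp: indicator_def)

lemma integrable_atLeastLessThan:
  assumes "locint w" shows "integrable lebesgue (\<lambda>s. indicator {a..<b} s * w s)"
  by (rule integrable_indicator_bounded[where T = b and C = 1]) (use assms in \<open>auto simp: indicator_def\<close>)

lemma cumul_mono:
  assumes w: "locint w" and "\<And>s. 0 \<le> w s" "a \<le> b"
  shows "cumul w a \<le> cumul w b"
proof -
  have "0 \<le> cumul w b - cumul w a" unfolding cumul_diff[OF w \<open>a \<le> b\<close>]
    using assms(2) by (intro integral_nonneg_AE) auto
  then show ?thesis by simp
qed

lemma cumul_nonpos: "locint w \<Longrightarrow> t \<le> 0 \<Longrightarrow> cumul w t = 0"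
  unfolding cumul_def by (intro integral_eq_zero_AE AE_I2) (auto simp: indicator_def locint_nonpos)

lemma cumul_nonneg: "(\<And>s. 0 \<le> w s) \<Longrightarrow> 0 \<le> cumul w t"
  unfolding cumul_def by (intro integral_nonneg_AE) auto

lemma cumul_at_right_0:
  assumes w: "locint w" shows "(cumul w \<longlongrightarrow> 0) (at_right 0)"
  unfolding tendsto_at_iff_sequentially
proof (intro allI impI)
  fix X assume X: "\<forall>i. X i \<in> {0<..} - {0::real}" and Xl: "X \<longlonglongrightarrow> 0"
  have "eventually (\<lambda>i. X i < 1) sequentially" using Xl by (intro order_tendstoD) auto
  then obtain N where N: "\<And>i. i \<ge> N \<Longrightarrow> X i < 1" by (auto simp: eventually_sequentially)
  have "(\<lambda>i. cumul w (X (i + N))) \<longlonglongrightarrow> (\<integral>s. 0 \<partial>(lebesgue::real measure))"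
    unfolding cumul_def
  proof (rule integral_dominated_convergence)
    show "integrable lebesgue (\<lambda>s. \<bar>indicator {..<1} s * w s\<bar>)" using locint_integrable[OF w] by (rule integrable_abs)
    show "AE s in lebesgue. (\<lambda>i. indicator {..<X (i + N)} s * w s) \<longlonglongrightarrow> 0"
    proof (intro AE_I2)
      fix s :: real
      show "(\<lambda>i. indicator {..<X (i + N)} s * w s) \<longlonglongrightarrow> 0"
      proof (cases "s \<le> 0")
        case True then show ?thesis by (simp add: locint_nonpos[OF w])
      next
        case False
        have "eventually (\<lambda>i. X (i + N) < s) sequentially"
          using LIMSEQ_ignore_initial_segment[OF Xl, of N] False by (intro order_tendstoD) auto
        then have "eventually (\<lambda>i. indicator {..<X (i + N)} s * w s = 0) sequentially" by eventually_elim simp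
        then show ?thesis by (rule tendsto_eventually)
      qed
    qed
    show "AE s in lebesgue. norm (indicator {..<X (i + N)} s * w s) \<le> \<bar>indicator {..<1} s * w s\<bar>" for i
      using N[of "i + N"] by (intro AE_I2) (auto simp: indicator_def)
  qed (use w in measurable)
  then have "(\<lambda>i. cumul w (X (i + N))) \<longlonglongrightarrow> 0" by simp
  then show "(cumul w \<circ> X) \<longlonglongrightarrow> 0" using LIMSEQ_offset[of "\<lambda>i. cumul w (X i)" N] by (simp add: comp_def)
qed

section \<open>Nonincreasing kernels and their translates\<close>

lemma mono_kernelD:
  assumes "mono_kernel a"
  shows "locint a" "a \<in> borel_measurable borel" "0 \<le> a s" "0 < s \<Longrightarrow> s \<le> t \<Longrightarrow> a t \<le> a s" "s
      \<le> 0 \<Longrightarrow> a s = 0"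
  using assms by (auto simp: mono_kernel_def locint_nonpos)

lemma mono_kernel_measurable [measurable_dest]: "mono_kernel a \<Longrightarrow> a \<in> borel_measurable borel"
  by (simp add: mono_kernel_def)

lemma mono_kernel_heaviside: "mono_kernel heaviside"
  unfolding mono_kernel_def locint_def
proof (intro conjI allI impI)
  show "integrable lebesgue (\<lambda>s. indicator {..<T} s * heaviside s)" for T :: real
  proof -
    have "(\<lambda>s. indicator {..<T} s * heaviside s) = indicator {0<..<T}" by (auto simp: indicator_def fun_eq_iff)
    moreover have "integrable lebesgue (indicator {0<..<T} :: real \<Rightarrow> real)"
      by (cases "0 \<le> T") (auto simp: integrable_indicator_iff emeasure_lborel_Ioo)
    ultimately show ?thesis by simp
  qed
qed (auto simp: indicator_def intro!: measurable_completion)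

lemma cumul_shift_integral:
  "(\<integral>y. indicator {..<t} y * a (y + d) \<partial>lebesgue) = cumul a (t + d)"
  unfolding cumul_def
  using lebesgue_integral_real_affine[of 1 "\<lambda>s. indicator {..<t + d} s * a s" d]
  by (auto simp: add.commute indicator_def intro!: Bochner_Integration.integral_cong)

lemma integrable_cumul_shift:
  assumes "locint a" shows "integrable lebesgue (\<lambda>y. indicator {..<t} y * a (y + d))"
proof -
  have "integrable lebesgue (\<lambda>x. indicator {..<t + d} (d + 1 * x) * a (d + 1 * x))"
    by (rule lebesgue_integrable_real_affine[OF locint_integrable[OF assms]]) simp
  moreover have "(\<lambda>x. indicator {..<t + d} (d + 1 * x) * a (d + 1 * x)) = (\<lambda>y. indicator {..<t} y * a (y + d))"
    by (auto simp: indicator_def fun_eq_iff add.commute)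
  ultimately show ?thesis by simp
qed

text \<open>For y > 0 monotonicity removes the absolute value, leaving
  \<open>a y - a (y + d)\<close>; for y < 0 only \<open>a (y + d)\<close> survives. The integrals
  then telescope into values of the primitive. The point y = 0 is exceptional because the kernel has
  value 0 there by convention.\<close>

lemma kernel_translation:
  assumes a: "mono_kernel a" and d: "0 < d"
  shows "(\<integral>y. indicator {..<t} y * \<bar>a (y + d) - a y\<bar> \<partial>lebesgue) \<le> 2 * cumul a d"
    and "integrable lebesgue (\<lambda>y. indicator {..<t} y * \<bar>a (y + d) - a y\<bar>)"
proof -
  note A = mono_kernelD[OF a]
  have i1: "integrable lebesgue (\<lambda>y. indicator {..<t} y * a (y + d))" for t by (rule integrable_cumul_shift[OF A(1)])
  have i2: "integrable lebesgue (\<lambda>y. indicator {..<t} y * a y)" for t by (rule locint_integrable[OF A(1)])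
  let ?m = "min t 0"
  have eq: "indicator {..<t} y * \<bar>a (y + d) - a y\<bar> =
     indicator {..<t} y * a y - indicator {..<t} y * a (y + d) + 2 * (indicator {..<?m} y * a (y + d))" if "y \<noteq> 0" for y
    using A(4)[of y "y + d"] A(5)[of y] A(3)[of "y+d"] d that by (cases "y \<le> 0") (auto simp: indicator_def)
  have AE: "AE y in lebesgue. indicator {..<t} y * \<bar>a (y + d) - a y\<bar> =
     indicator {..<t} y * a y - indicator {..<t} y * a (y + d) + 2 * (indicator {..<?m} y * a (y + d))"
    using eq by (intro AE_I'[of "{0}"]) auto
  have ii: "integrable lebesgue (\<lambda>y. indicator {..<t} y * a y - indicator {..<t} y * a (y + d) + 2 * (indicator {..<?m} y * a (y + d)))"
    using i1 i2 by (intro Bochner_Integration.integrable_add Bochner_Integration.integrable_diff integrable_mult_right)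
  have [measurable]: "a \<in> borel_measurable borel" by fact
  have m: "(\<lambda>y. indicator {..<t} y * \<bar>a (y + d) - a y\<bar>) \<in> borel_measurable lebesgue"
    by (rule borel_imp_lebesgue) measurable
  show "integrable lebesgue (\<lambda>y. indicator {..<t} y * \<bar>a (y + d) - a y\<bar>)"
    using integrable_cong_AE[OF m borel_measurable_integrable[OF ii] AE] ii by simp
  have "(\<integral>y. indicator {..<t} y * \<bar>a (y + d) - a y\<bar> \<partial>lebesgue) = cumul a t - cumul a (t + d) + 2 * cumul a (?m + d)"
    using integral_cong_AE[OF m borel_measurable_integrable[OF ii] AE] i1 i2
    by (simp add: cumul_shift_integral cumul_def[of a t, symmetric])
  also have "\<dots> \<le> 2 * cumul a d"
    using cumul_mono[OF A(1,3), of "?m + d" d] cumul_mono[OF A(1,3), of t "t + d"] d by auto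
  finally show "(\<integral>y. indicator {..<t} y * \<bar>a (y + d) - a y\<bar> \<partial>lebesgue) \<le> 2 * cumul a d" .
qed

lemma rconv_bounded_integrable:
  assumes a: "mono_kernel a" and g: "g \<in> borel_measurable lebesgue" and g0: "\<And>s. s \<le> 0 \<Longrightarrow> g s = 0"
    and gC: "\<And>s. s < t \<Longrightarrow> \<bar>g s\<bar> \<le> C"
  shows "rconv_integrable a g t"
    and "rconv_integrable g a t"
proof -
  note g[measurable]
  have "integrable lebesgue (\<lambda>s. (indicator {0<..} s * g (t - s)) * a s)"
  proof (rule integrable_indicator_bounded)
    have "(\<lambda>x. t + (-1) * x) \<in> lebesgue \<rightarrow>\<^sub>M lebesgue"
      using lebesgue_affine_measurable[where c= "\<lambda>x::real. -1" and t = t] by simp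
    from measurable_compose[OF this g] have [measurable]: "(\<lambda>s. g (t - s)) \<in> borel_measurable lebesgue" by simp
    show "(\<lambda>s. indicator {0<..} s * g (t - s)) \<in> borel_measurable lebesgue" by measurable
    show "indicator {0<..} s * g (t - s) = 0" if "s \<ge> t" for s using that g0 by simp
    show "\<bar>indicator {0<..} s * g (t - s)\<bar> \<le> max C 0" if "s < t" for s
      using gC[of "t - s"] by (auto simp: indicator_def)
  qed (rule mono_kernelD[OF a])
  also have "(\<lambda>s. (indicator {0<..} s * g (t - s)) * a s) = (\<lambda>s. g (t - s) * a s)"
    using mono_kernelD(5)[OF a] by (auto simp: fun_eq_iff indicator_def not_less)
  finally show "rconv_integrable g a t" .
  then show "rconv_integrable a g t" by (rule rconv_integrable_commute)
qed

lemma cumul_local_bound: "locint w \<Longrightarrow> (\<And>s. 0 \<le> w s) \<Longrightarrow> s \<le> T \<Longrightarrow> \<bar>cumul w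
    s\<bar> \<le> cumul w T"
  using cumul_mono[of w s T] cumul_nonneg[of w s] by simp

lemma cumul_measurable: "locint w \<Longrightarrow> cumul w \<in> borel_measurable lebesgue"
proof -
  assume w: "locint w"
  have "rconv heaviside w \<in> borel_measurable lebesgue"
    by (rule rconv_measurable) (use w in \<open>auto simp: locint_def\<close>)
  then show ?thesis by (simp add: cumul_eq_rconv[abs_def])
qed

lemma cumul_kernel_borel:
  assumes "mono_kernel a" shows "cumul a \<in> borel_measurable borel"
proof (rule borel_measurable_mono)
  show "mono (cumul a)" using mono_kernelD[OF assms] by (auto intro!: monoI cumul_mono)
qed

text \<open>Local form of Young's inequality. With times cut off at \<open>T\<close>, the integral
  of \<open>a (t - s)\<close> over t is \<open>cumul a (T - s)\<close>, which is bounded on the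
  support of \<open>w\<close>; Fubini then gives finiteness for almost every time below each
  integer.\<close>

lemma rconv_kernel_integrable_AE:
  assumes a: "mono_kernel a" and w: "locint w"
  shows "AE t in lebesgue. rconv_integrable a w t" and "locint (rconv a w)"
proof -
  note A = mono_kernelD[OF a]
  have [measurable]: "a \<in> borel_measurable borel" by fact
  have [measurable]: "w \<in> borel_measurable lebesgue" using w by measurable
  define f where "f T s t = w s * (indicator {..<T} t * a (t - s))" for T s t :: real
  have m [measurable]: "case_prod (f T) \<in> borel_measurable (lebesgue \<Otimes>\<^sub>M lebesgue)" for T
    unfolding f_def split_beta' by measurable
  have *: "integrable lebesgue (\<lambda>t. indicator {..<T} t * a (t - s))" "(\<integral>t. indicator {..<T} t * a (t - s)
      \<partial>lebesgue) = cumul a (T - s)" for s T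
    using integrable_cumul_shift[OF A(1), of T "- s"] cumul_shift_integral[of T a "- s"] by auto
  have fi: "integrable lebesgue (f T s)" and fn: "(\<integral>t. norm (f T s t) \<partial>lebesgue) = cumul a (T - s) * \<bar>w s\<bar>" for T s
    unfolding f_def using * A(3) by (auto simp: abs_mult)
  have "integrable lebesgue (\<lambda>s. cumul a (T - s) * \<bar>w s\<bar>)" for T
  proof -
    have "integrable lebesgue (\<lambda>s. (indicator {0..} s * cumul a (T - s)) * \<bar>w s\<bar>)"
    proof (rule integrable_indicator_bounded[where T = T and C = "cumul a T"])
      have [measurable]: "cumul a \<in> borel_measurable borel" by (rule cumul_kernel_borel[OF a])
      show "(\<lambda>s. indicator {0..} s * cumul a (T - s)) \<in> borel_measurable lebesgue" by (rule borel_imp_lebesgue) measurable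
      show "\<bar>indicator {0..} s * cumul a (T - s)\<bar> \<le> cumul a T" if "s < T" for s
        using cumul_local_bound[OF A(1,3), of "T - s" T] cumul_nonneg[of a T] A(3) by (auto simp: indicator_def)
      show "indicator {0..} s * cumul a (T - s) = 0" if "s \<ge> T" for s using that cumul_nonpos[OF A(1), of "T - s"] by simp
      show "locint (\<lambda>s. \<bar>w s\<bar>)" by (rule locint_abs[OF w])
    qed
    also have "(\<lambda>s. (indicator {0..} s * cumul a (T - s)) * \<bar>w s\<bar>) = (\<lambda>s. cumul a (T - s) * \<bar>w s\<bar>)"
      using locint_nonpos[OF w] by (auto simp: fun_eq_iff indicator_def)
    finally show ?thesis .
  qed
  note I = this
  have F: "integrable (lebesgue \<Otimes>\<^sub>M lebesgue) (case_prod (f T))" for T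
  proof (intro leb2.Fubini_integrable[OF m] AE_I2)
    show "integrable lebesgue (\<lambda>x. \<integral>y. norm (case (x, y) of (x, y) \<Rightarrow> f T x y) \<partial>lebesgue)"
      unfolding split_conv fn by (rule I)
    show "integrable lebesgue (\<lambda>y. case (x, y) of (x, y) \<Rightarrow> f T x y)" for x
      unfolding split_conv by (rule fi)
  qed
  have "AE t in lebesgue. integrable lebesgue (\<lambda>s. f (real n) s t)" for n
    using leb2.AE_integrable_snd[OF F[of "real n"]] .
  then have "AE t in lebesgue. \<forall>n. integrable lebesgue (\<lambda>s. f (real n) s t)" by (simp add: AE_all_countable)
  then show "AE t in lebesgue. rconv_integrable a w t"
  proof eventually_elim
    case (elim t)
    obtain n where "t < real n" using reals_Archimedean2 by blast
    with elim[rule_format, of n] show ?case by (simp add: f_def mult.commute)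
  qed
  show "locint (rconv a w)" unfolding locint_def
  proof (intro conjI allI impI)
    show "rconv a w s = 0" if "s \<le> 0" for s
    proof -
      have "a (s - r) * w r = 0" for r using that A(5)[of "s - r"] locint_nonpos[OF w, of r] by (cases "r \<le> 0") auto
      then have "(\<lambda>r. a (s - r) * w r) = (\<lambda>r. 0)" by (intro ext)
      then show ?thesis unfolding rconv_def by simp
    qed
    show "rconv a w \<in> borel_measurable lebesgue" by (rule rconv_measurable) measurable
    fix T
    have "(\<integral>s. f T s t \<partial>lebesgue) = indicator {..<T} t * rconv a w t" for t
      unfolding f_def rconv_def by (simp add: mult.left_commute mult.commute[of "w _"] mult.assoc)
    then show "integrable lebesgue (\<lambda>t. indicator {..<T} t * rconv a w t)"
      using leb2.integrable_snd[OF F[of T]] by simp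
  qed
qed

lemma cumul_times_integrable:
  assumes a: "mono_kernel a" and w: "locint w"
  shows "integrable lebesgue (\<lambda>r. cumul a (t - r) * w r)"
proof -
  note A = mono_kernelD[OF a]
  have "integrable lebesgue (\<lambda>s. (indicator {0..} s * cumul a (t - s)) * w s)"
  proof (rule integrable_indicator_bounded[where T = t and C = "cumul a t"])
    have [measurable]: "cumul a \<in> borel_measurable borel" by (rule cumul_kernel_borel[OF a])
    show "(\<lambda>s. indicator {0..} s * cumul a (t - s)) \<in> borel_measurable lebesgue" by (rule borel_imp_lebesgue) measurable
    show "\<bar>indicator {0..} s * cumul a (t - s)\<bar> \<le> cumul a t" if "s < t" for s
      using cumul_local_bound[OF A(1,3), of "t - s" t] cumul_nonneg[of a t] A(3) by (auto simp: indicator_def)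
    show "indicator {0..} s * cumul a (t - s) = 0" if "s \<ge> t" for s using that cumul_nonpos[OF A(1), of "t - s"] by simp
  qed fact
  also have "(\<lambda>s. (indicator {0..} s * cumul a (t - s)) * w s) = (\<lambda>s. cumul a (t - s) * w s)"
    using locint_nonpos[OF w] by (auto simp: fun_eq_iff indicator_def)
  finally show ?thesis .
qed

text \<open>Integration is convolution with \<open>heaviside\<close>, so this is associativity
  applied twice together with commutativity.\<close>

lemma cumul_rconv:
  assumes a: "mono_kernel a" and w: "locint w"
  shows "cumul (rconv a w) t = rconv a (cumul w) t" "rconv_integrable a (\<lambda>s. cumul w s) t"
proof -
  note A = mono_kernelD[OF a] and H = mono_kernelD[OF mono_kernel_heaviside]
  have mw: "w \<in> borel_measurable lebesgue" using w by (simp add: locint_def)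
  have i1: "rconv_integrable heaviside a \<tau>" for \<tau>
  proof -
    have "(\<lambda>s. heaviside (\<tau> - s) * a s) = (\<lambda>s. indicator {..<\<tau>} s * a s)" by (auto simp: indicator_def fun_eq_iff)
    then show ?thesis using locint_integrable[OF A(1), of \<tau>] by simp
  qed
  have i2: "rconv_integrable a heaviside \<tau>" for \<tau> by (rule rconv_integrable_commute[OF i1])
  have e1: "rconv heaviside a = cumul a" by (simp add: cumul_eq_rconv fun_eq_iff)
  have e2: "rconv a heaviside = cumul a" using e1 rconv_commute[of a heaviside] by (simp add: fun_eq_iff)
  have e3: "rconv heaviside w = cumul w" by (simp add: cumul_eq_rconv fun_eq_iff)
  have "cumul (rconv a w) t = rconv (rconv heaviside a) w t"
    unfolding cumul_eq_rconv
    by (rule rconv_assoc(1)[OF H(2) A(2) mw H(3) A(3) i1]) (simp add: e1 cumul_times_integrable[OF a w])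
  moreover have "rconv a (rconv heaviside w) t = rconv (rconv a heaviside) w t"
    by (rule rconv_assoc(1)[OF A(2) H(2) mw A(3) H(3) i2]) (simp add: e2 cumul_times_integrable[OF a w])
  ultimately show "cumul (rconv a w) t = rconv a (cumul w) t" by (simp add: e1 e2 e3)
  show "rconv_integrable a (\<lambda>s. cumul w s) t"
    using rconv_assoc(2)[OF A(2) H(2) mw A(3) H(3) i2, of t] by (simp add: e2 e3 cumul_times_integrable[OF a w])
qed

text \<open>A nonincreasing kernel has at most as much mass on the second half of (0,d) as on the
  first.\<close>

lemma cumul_half:
  assumes a: "mono_kernel a" and d: "0 < d"
  shows "cumul a d \<le> 2 * cumul a (d / 2)"
proof -
  note A = mono_kernelD[OF a]
  have "cumul a d - cumul a (d/2) = (\<integral>s. indicator {d/2..<d} s * a s \<partial>lebesgue)"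
    using d by (intro cumul_diff A) auto
  also have "\<dots> = (\<integral>s. indicator {d/2..<d} (d/2 + 1 * s) * a (d/2 + 1 * s) \<partial>lebesgue)"
    using lebesgue_integral_real_affine[of 1 "\<lambda>s. indicator {d/2..<d} s * a s" "d/2"] by simp
  also have "\<dots> \<le> (\<integral>s. indicator {..<d/2} s * a s \<partial>lebesgue)"
  proof (rule integral_mono_AE)
    show "integrable lebesgue (\<lambda>s. indicator {d/2..<d} (d/2 + 1 * s) * a (d/2 + 1 * s))"
      by (intro lebesgue_integrable_real_affine integrable_atLeastLessThan A) auto
    show "integrable lebesgue (\<lambda>s. indicator {..<d/2} s * a s)" by (rule locint_integrable[OF A(1)])
    have "indicator {d/2..<d} (d/2 + 1 * s) * a (d/2 + 1 * s) \<le> indicator {..<d/2} s * a s" if "s \<noteq> 0" for s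
      using that d A(4)[of s "d/2 + s"] A(3) by (auto simp: indicator_def)
    then show "AE s in lebesgue. indicator {d/2..<d} (d/2 + 1 * s) * a (d/2 + 1 * s) \<le> indicator {..<d/2} s * a s"
      by (intro AE_I'[of "{0}"]) auto
  qed
  finally show ?thesis by (simp add: cumul_def)
qed

lemma cumul_heaviside: "0 \<le> t \<Longrightarrow> cumul heaviside t = t"
proof -
  assume t: "0 \<le> t"
  have "cumul heaviside t = (\<integral>s. indicator {0<..<t} s \<partial>lebesgue)"
    unfolding cumul_def by (intro Bochner_Integration.integral_cong) (auto simp: indicator_def)
  then show ?thesis using t by simp
qed

section \<open>Conjugate kernels\<close>

locale conj_kernels =
  fixes k l :: "real \<Rightarrow> real"
  assumes k: "mono_kernel k" and l: "mono_kernel l" and kl: "\<And>t. 0 < t \<Longrightarrow> rconv k l t = 1"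
begin

lemma conj_kernels_sym: "conj_kernels l k"
  using k l kl by unfold_locales (auto simp: rconv_commute[of l k])

lemma rconv_k_l: "rconv k l = heaviside"
proof
  fix t show "rconv k l t = heaviside t"
  proof (cases "0 < t")
    case False
    have "k (t - s) * l s = 0" for s
      using mono_kernelD(5)[OF k, of "t - s"] mono_kernelD(5)[OF l, of s] False by (cases "s \<le> 0") auto
    then have "(\<lambda>s. k (t - s) * l s) = (\<lambda>s. 0)" by (intro ext)
    then show ?thesis using False by (simp add: rconv_def)
  qed (simp add: kl)
qed

lemma k_l_integrable: "rconv_integrable k l t"
proof (cases "0 < t")
  case True
  show ?thesis
  proof (rule ccontr)
    assume "\<not> rconv_integrable k l t"
    \<comment> \<open>A non-integrable function has integral 0 by default, so the value 1 in the
      conjugacy condition already encodes integrability.\<close>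
    then have "rconv k l t = 0" unfolding rconv_def by (rule not_integrable_integral_eq)
    with kl[OF True] show False by simp
  qed
next
  case False
  have "k (t - s) * l s = 0" for s
    using mono_kernelD(5)[OF k, of "t - s"] mono_kernelD(5)[OF l, of s] False by (cases "s \<le> 0") auto
  then have "(\<lambda>s. k (t - s) * l s) = (\<lambda>s. 0)" by (intro ext)
  then show ?thesis by simp
qed

text \<open>Conjugacy makes \<open>k\<close> undo the convolution with \<open>l\<close> up to one
  integration in time. This is the passage between the Volterra form and the differential form of
  the equation.\<close>

lemma rconv_k_rconv_l:
  assumes w: "locint w"
  shows "rconv k (rconv l w) t = cumul w t" "rconv_integrable k (\<lambda>s. rconv l w s) t"
proof -
  note K = mono_kernelD[OF k] and L = mono_kernelD[OF l]
  have mw: "w \<in> borel_measurable lebesgue" using w by (simp add: locint_def)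
  have eq: "(\<lambda>r. rconv k l (t - r) * w r) = (\<lambda>s. indicator {..<t} s * w s)"
    unfolding rconv_k_l by (auto simp: indicator_def fun_eq_iff)
  have i: "integrable lebesgue (\<lambda>r. rconv k l (t - r) * w r)" unfolding eq by (rule locint_integrable[OF w])
  show "rconv k (rconv l w) t = cumul w t"
    using rconv_assoc(1)[OF K(2) L(2) mw K(3) L(3) k_l_integrable i] by (simp add: rconv_k_l cumul_eq_rconv)
  show "rconv_integrable k (\<lambda>s. rconv l w s) t"
    by (rule rconv_assoc(2)[OF K(2) L(2) mw K(3) L(3) k_l_integrable i])
qed

text \<open>Makes the error of one time step of length \<open>d\<close> in \<open>convex_ineq_increment\<close> of order \<open>o(d)\<close>.\<close>

lemma cumul_k_mult_cumul_l:
  assumes d: "0 < d" shows "cumul k d * cumul l d \<le> 4 * d"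
proof -
  note K = mono_kernelD[OF k] and L = mono_kernelD[OF l]
  \<comment> \<open>The integral of the constant function 1 is rewritten as the convolution of the
    primitive of \<open>l\<close> with \<open>k\<close>. Restricting it to s < d/2 bounds that
    primitive below by its value at d/2, so the two primitives at d/2 have product at most d;
    passing from d/2 to d doubles each of them.\<close>
  have "d = cumul (rconv k l) d" using d by (simp add: rconv_k_l cumul_heaviside)
  also have "\<dots> = rconv (cumul l) k d" using cumul_rconv(1)[OF k L(1)] by (simp add: rconv_commute)
  also have "\<dots> \<ge> (\<integral>s. cumul l (d/2) * (indicator {..<d/2} s * k s) \<partial>lebesgue)"
    unfolding rconv_def
  proof (rule integral_mono)
    show "integrable lebesgue (\<lambda>s. cumul l (d/2) * (indicator {..<d/2} s * k s))"
      by (intro integrable_mult_right locint_integrable K)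
    show "integrable lebesgue (\<lambda>s. cumul l (d - s) * k s)" by (rule cumul_times_integrable[OF l K(1)])
    show "cumul l (d/2) * (indicator {..<d/2} s * k s) \<le> cumul l (d - s) * k s" for s
    proof (cases "s < d/2")
      case True
      then have "cumul l (d/2) \<le> cumul l (d - s)" by (intro cumul_mono L) auto
      then show ?thesis using True K(3)[of s] by (auto intro: mult_right_mono)
    qed (use K(3) cumul_nonneg[of l] L(3) in auto)
  qed
  also have "(\<integral>s. cumul l (d/2) * (indicator {..<d/2} s * k s) \<partial>lebesgue) = cumul l (d/2) * cumul k (d/2)"
    by (simp add: cumul_def)
  finally have 1: "cumul l (d/2) * cumul k (d/2) \<le> d" .
  have "cumul k d * cumul l d \<le> (2 * cumul k (d/2)) * (2 * cumul l (d/2))"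
    by (intro mult_mono cumul_half k l d cumul_nonneg mult_nonneg_nonneg K L) auto
  with 1 show ?thesis by (simp add: mult.commute)
qed

end

text \<open>Since \<open>f\<close> is known only through its pairings, its increment is tested
  against itself. The bound on \<open>g\<close> then leaves the L1 norm of the difference of two
  translates of the kernel.\<close>

lemma rconv_modulus:
  fixes f g :: "real \<Rightarrow> 'h::real_inner"
  assumes a: "mono_kernel a" and g: "strongly_measurable lebesgue g" and g0: "\<And>s. s \<le> 0 \<Longrightarrow> g s = 0"
    and gC: "\<And>s. s < t + d \<Longrightarrow> norm (g s) \<le> C" and d: "0 < d"
    and f: "\<And>e. f t \<bullet> e = rconv a (\<lambda>s. g s \<bullet> e) t" "\<And>e. f (t + d) \<bullet> e = rconv a (\<lambda>s. g s
        \<bullet> e) (t + d)"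
  shows "norm (f (t + d) - f t) \<le> 2 * C * cumul a d"
proof -
  note A = mono_kernelD[OF a]
  define e where "e = f (t + d) - f t"
  have mg: "(\<lambda>s. g s \<bullet> e) \<in> borel_measurable lebesgue"
    by (intro strongly_measurable_inner g strongly_measurable_const)
  have bg: "\<bar>g s \<bullet> e\<bar> \<le> C * norm e" if "s < t + d" for s
    using order_trans[OF Cauchy_Schwarz_ineq2[of "g s" e]] gC[OF that] by (simp add: mult_right_mono)
  have i: "rconv_integrable a (\<lambda>s. g s \<bullet> e) r" if "r \<le> t + d" for r
    by (rule rconv_bounded_integrable(1)[OF a mg, where C = "C * norm e"]) (use g0 bg that in auto)
  have C0: "0 \<le> C" using gC[of t] d norm_ge_zero order_trans by (metis less_add_same_cancel1)
  have "(norm e)\<^sup>2 = f (t + d) \<bullet> e - f t \<bullet> e" by (simp add: power2_norm_eq_inner e_def inner_diff_left)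
  also have "\<dots> = (\<integral>s. a (t + d - s) * (g s \<bullet> e) - a (t - s) * (g s \<bullet> e) \<partial>lebesgue)"
    unfolding f rconv_def using i d by (intro Bochner_Integration.integral_diff[symmetric]) auto
  also have "\<dots> \<le> (\<integral>y. (C * norm e) * (indicator {..<t} (t + (-1) * y) * \<bar>a (t + (-1) * y + d) - a (t + (-1) *
      y)\<bar>) \<partial>lebesgue)"
  proof (rule integral_mono)
    show "integrable lebesgue (\<lambda>s. a (t + d - s) * (g s \<bullet> e) - a (t - s) * (g s \<bullet> e))"
      using i d by (intro Bochner_Integration.integrable_diff) auto
    show "integrable lebesgue (\<lambda>y. (C * norm e) * (indicator {..<t} (t + (-1) * y) * \<bar>a (t + (-1) * y + d) - a (t + (-1) * y)\<bar>))"
      by (intro integrable_mult_right lebesgue_integrable_real_affine[of "\<lambda>y. indicator {..<t} y * \<bar>a (y + d) - a y\<bar>"]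
          kernel_translation(2)[OF a d]) auto
    fix s
    show "a (t + d - s) * (g s \<bullet> e) - a (t - s) * (g s \<bullet> e) \<le> (C * norm e) * (indicator {..<t} (t + (-1) * s) * \<bar>a
        (t + (-1) * s + d) - a (t + (-1) * s)\<bar>)"
    proof (cases "0 < s \<and> s < t + d")
      case True
      have "(a (t + d - s) - a (t - s)) * (g s \<bullet> e) \<le> \<bar>a (t + d - s) - a (t - s)\<bar> * \<bar>g s \<bullet> e\<bar>"
        by (metis abs_ge_self abs_mult)
      also have "\<dots> \<le> \<bar>a (t + d - s) - a (t - s)\<bar> * (C * norm e)" using bg True by (intro mult_left_mono) auto
      finally show ?thesis using True by (simp add: algebra_simps indicator_def)
    next
      case False
      then have "a (t + d - s) * (g s \<bullet> e) = 0" "a (t - s) * (g s \<bullet> e) = 0"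
        using g0[of s] A(5)[of "t + d - s"] A(5)[of "t - s"] d by (auto simp: not_less)
      then show ?thesis using C0 by (simp only:) simp
    qed
  qed
  also have "\<dots> = C * norm e * (\<integral>y. indicator {..<t} y * \<bar>a (y + d) - a y\<bar> \<partial>lebesgue)"
    using lebesgue_integral_real_affine[of "-1" "\<lambda>y. indicator {..<t} y * \<bar>a (y + d) - a y\<bar>" t] by simp
  also have "\<dots> \<le> C * norm e * (2 * cumul a d)"
    by (intro mult_left_mono kernel_translation(1)[OF a d]) (use C0 in auto)
  finally have "norm e * norm e \<le> norm e * (2 * C * cumul a d)" by (simp add: power2_eq_square algebra_simps)
  then show ?thesis unfolding e_def[symmetric]
    using C0 cumul_nonneg[of a d] A(3) by (cases "norm e = 0") auto
qed

lemma continuous_from_modulus: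
  fixes f :: "real \<Rightarrow> 'h::real_normed_vector"
  assumes a: "mono_kernel a"
    and m: "\<And>T. \<exists>C. \<forall>t d. 0 < d \<and> t + d < T \<longrightarrow> norm (f (t + d) - f t) \<le> C * cumul a d"
  shows "continuous_on UNIV f"
  unfolding continuous_on_iff
proof (intro ballI allI impI)
  fix x e :: real assume e: "0 < e"
  obtain C where C: "\<And>t d. 0 < d \<Longrightarrow> t + d < x + 1 \<Longrightarrow> norm (f (t + d) - f t) \<le> C * cumul a d" using m by blast
  have "((\<lambda>d. C * cumul a d) \<longlongrightarrow> C * 0) (at_right 0)"
    by (intro tendsto_intros cumul_at_right_0 mono_kernelD(1)[OF a])
  then have "\<forall>\<^sub>F d in at_right 0. C * cumul a d < e" using e by (intro order_tendstoD(2)) auto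
  then obtain b where b: "b > 0" "\<And>d. 0 < d \<Longrightarrow> d < b \<Longrightarrow> C * cumul a d < e"
    by (auto simp: eventually_at_right_field)
  show "\<exists>d>0. \<forall>x'\<in>UNIV. dist x' x < d \<longrightarrow> dist (f x') (f x) < e"
  proof (intro exI[of _ "min b 1"] conjI ballI impI)
    fix y assume y: "dist y x < min b 1"
    consider "y = x" | "y > x" | "y < x" by linarith
    then show "dist (f y) (f x) < e"
    proof cases
      case 2
      then show ?thesis using C[of "y - x" x] b(2)[of "y - x"] y by (simp add: dist_norm)
    next
      case 3
      then show ?thesis using C[of "x - y" y] b(2)[of "x - y"] y by (simp add: dist_norm norm_minus_commute)
    qed (use e in simp)
  qed (use b in simp)
qed

lemma rconv_continuous:
  fixes f g :: "real \<Rightarrow> 'h::real_inner"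
  assumes a: "mono_kernel a" and g: "strongly_measurable lebesgue g" and g0: "\<And>s. s \<le> 0 \<Longrightarrow> g s = 0"
    and gC: "\<And>T. \<exists>C. \<forall>s<T. norm (g s) \<le> C"
    and f: "\<And>t e. f t \<bullet> e = rconv a (\<lambda>s. g s \<bullet> e) t"
  shows "continuous_on UNIV f"
proof (rule continuous_from_modulus[OF a])
  fix T
  obtain C where "\<forall>s<T. norm (g s) \<le> C" using gC by blast
  then have "\<forall>t d. 0 < d \<and> t + d < T \<longrightarrow> norm (f (t + d) - f t) \<le> 2 * C * cumul a d"
    by (intro allI impI rconv_modulus[OF a g g0]) (auto intro: f)
  then show "\<exists>C. \<forall>t d. 0 < d \<and> t + d < T \<longrightarrow> norm (f (t + d) - f t) \<le> C * cumul a d" by blast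
qed

lemma rconv_continuous_real:
  assumes a: "mono_kernel a" and g: "g \<in> borel_measurable lebesgue" and g0: "\<And>s. s \<le> 0 \<Longrightarrow> g s = 0"
    and gC: "\<And>T. \<exists>C. \<forall>s<T. \<bar>g s\<bar> \<le> C"
  shows "continuous_on UNIV (rconv a g)"
proof (rule rconv_continuous[OF a strongly_measurable_real[OF g] g0])
  show "\<exists>C. \<forall>s<T. norm (g s) \<le> C" for T using gC[of T] by simp
  show "rconv a g t \<bullet> e = rconv a (\<lambda>s. g s \<bullet> e) t" for t e by (simp add: rconv_def mult.assoc[symmetric])
qed

lemma continuous_locally_bounded:
  fixes f :: "real \<Rightarrow> 'a::real_normed_vector"
  assumes "continuous_on UNIV f" "\<And>s. s \<le> 0 \<Longrightarrow> f s = c"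
  shows "\<exists>C\<ge>0. \<forall>s\<le>T. norm (f s) \<le> C"
proof -
  have "compact (f ` {0..T})" by (intro compact_continuous_image continuous_on_subset[OF assms(1)]) auto
  then obtain C where C: "\<forall>x\<in>f ` {0..T}. norm x \<le> C" using compact_imp_bounded bounded_iff by blast
  have "norm (f s) \<le> max C (norm c)" if "s \<le> T" for s
    using that C assms(2)[of s] by (cases "s \<le> 0") (auto simp: le_max_iff_disj)
  then show ?thesis by (intro exI[of _ "max C (norm c)"]) (auto simp: le_max_iff_disj)
qed

section \<open>The convexity inequality\<close>

text \<open>The map \<open>p\<close> is the gradient of \<open>\<psi>\<close>.\<close>

locale smooth_convex =
  fixes \<psi> :: "'h::real_inner \<Rightarrow> real" and p :: "'h \<Rightarrow> 'h" and \<Lambda> :: real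
  assumes grad_lower: "\<And>x y. 0 \<le> \<psi> y - \<psi> x - p x \<bullet> (y - x)"
    and grad_upper: "\<And>x y. \<psi> y - \<psi> x - p x \<bullet> (y - x) \<le> \<Lambda> / 2 * (norm (y - x))\<^sup>2"
    and grad_lipschitz: "\<And>x y. norm (p x - p y) \<le> \<Lambda> * norm (x - y)"
    and \<Lambda>_nonneg: "0 \<le> \<Lambda>"
begin

lemma continuous_p: "continuous_on UNIV p"
proof -
  have "\<Lambda>-lipschitz_on UNIV p" using grad_lipschitz \<Lambda>_nonneg by (intro lipschitz_onI) (auto simp: dist_norm)
  then show ?thesis by (rule lipschitz_on_continuous_on)
qed

lemma continuous_\<psi>: "continuous_on UNIV \<psi>"
  unfolding continuous_on_def
proof (intro ballI)
  fix x
  have "((\<lambda>y. \<psi> x + (p x \<bullet> (y - x) + \<Lambda> / 2 * (norm (y - x))\<^sup>2)) \<longlongrightarrow> \<psi> x + (p x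
      \<bullet> (x - x) + \<Lambda> / 2 * (norm (x - x))\<^sup>2)) (at x)"
    by (intro tendsto_intros)
  moreover have "((\<lambda>y. \<psi> x + p x \<bullet> (y - x)) \<longlongrightarrow> \<psi> x + p x \<bullet> (x - x)) (at x)" by (intro
      tendsto_intros)
  moreover have "\<psi> x + p x \<bullet> (y - x) \<le> \<psi> y" "\<psi> y \<le> \<psi> x + (p x \<bullet> (y - x) + \<Lambda> / 2 * (norm
      (y - x))\<^sup>2)" for y
    using grad_lower[where x = x and y = y] grad_upper[where x = x and y = y] by linarith+
  ultimately show "(\<psi> \<longlongrightarrow> \<psi> x) (at x within UNIV)"
    by (intro tendsto_sandwich[of "\<lambda>y. \<psi> x + p x \<bullet> (y - x)" \<psi> _ "\<lambda>y. \<psi> x + (p x \<bullet> (y - x) +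
        \<Lambda> / 2 * (norm (y - x))\<^sup>2)"])
      (auto intro!: always_eventually)
qed

end

text \<open>Over n equal steps of length d the losses add up to (b - a) times
  \<open>\<epsilon> d\<close>, which vanishes as the steps are refined. No differentiability of
  \<open>F\<close> is involved.\<close>

lemma nondecreasing_from_increments:
  fixes F :: "real \<Rightarrow> real"
  assumes inc: "\<And>t d. 0 < d \<Longrightarrow> F (t - d) - d * \<epsilon> d \<le> F t"
    and lim: "(\<epsilon> \<longlongrightarrow> 0) (at_right 0)" and "a \<le> b"
  shows "F a \<le> F b"
proof (cases "a = b")
  case False
  then have ab: "0 < b - a" using \<open>a \<le> b\<close> by simp
  have it: "F a - real n * (d * \<epsilon> d) \<le> F (a + real n * d)" if "0 < d" for n d
  proof (induction n)
    case (Suc n)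
    show ?case using Suc inc[OF that, of "a + real (Suc n) * d"] by (simp add: algebra_simps)
  qed simp
  have le: "F a - (b - a) * \<epsilon> ((b - a) / real (Suc n)) \<le> F b" for n
    using it[of "(b - a) / real (Suc n)" "Suc n"] ab by (simp del: of_nat_Suc)
  have l0: "(\<lambda>n. (b - a) / real (Suc n)) \<longlonglongrightarrow> 0"
    using LIMSEQ_Suc[OF lim_const_over_n[of "b - a"]] by simp
  have "filterlim (\<lambda>n. (b - a) / real (Suc n)) (at_right 0) sequentially"
    unfolding filterlim_at using l0 ab by (auto intro!: always_eventually)
  then have "(\<lambda>n. \<epsilon> ((b - a) / real (Suc n))) \<longlonglongrightarrow> 0" using lim filterlim_compose by blast
  then have "(\<lambda>n. F a - (b - a) * \<epsilon> ((b - a) / real (Suc n))) \<longlonglongrightarrow> F a - (b - a) * 0" by (intro tendsto_intros)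
  then show ?thesis using le by (intro LIMSEQ_le_const2[of _ "F a" "F b"]) auto
qed simp

lemma nonneg_from_cumul_mono:
  assumes v: "locint v" and c: "continuous_on UNIV v" and m: "\<And>a b. a \<le> b \<Longrightarrow> cumul v a \<le> cumul v b"
  shows "0 \<le> v t"
proof (rule ccontr)
  assume "\<not> 0 \<le> v t"
  then have neg: "v t < 0" by simp
  have "\<forall>e>0. \<exists>d>0. \<forall>x'. dist x' t < d \<longrightarrow> dist (v x') (v t) < e" using c unfolding continuous_on_iff by simp
  then obtain d where d: "d > 0" "\<And>x. dist x t < d \<Longrightarrow> dist (v x) (v t) < - v t / 2" using neg by (metis divide_pos_pos
      neg_0_less_iff_less zero_less_numeral)
  have "cumul v t - cumul v (t - d/2) = (\<integral>s. indicator {t - d/2..<t} s * v s \<partial>lebesgue)"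
    using d by (intro cumul_diff v) auto
  also have "\<dots> \<le> (\<integral>s. indicator {t - d/2..<t} s * (v t / 2) \<partial>lebesgue)"
  proof (rule integral_mono)
    show "integrable lebesgue (\<lambda>s. indicator {t - d/2..<t} s * (v t / 2))"
      by (intro integrable_mult_left) (use d in \<open>auto simp: integrable_indicator_iff\<close>)
    fix s show "indicator {t - d/2..<t} s * v s \<le> indicator {t - d/2..<t} s * (v t / 2)"
      using d(2)[of s] d(1) by (auto simp: indicator_def dist_real_def)
  qed (rule integrable_atLeastLessThan[OF v])
  also have "\<dots> = (d/2) * (v t / 2)" using d by simp
  also have "\<dots> < 0" using neg d by (simp add: mult_pos_neg)
  finally show False using m[of "t - d/2" t] d by simp
qed

lemma locint_locally_bounded:
  assumes g: "g \<in> borel_measurable lebesgue" and g0: "\<And>s. s \<le> 0 \<Longrightarrow> g s = 0"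
    and gC: "\<And>T. \<exists>C. \<forall>s<T. \<bar>g s\<bar> \<le> C"
  shows "locint g"
  unfolding locint_def
proof (intro conjI allI impI)
  show "g s = 0" if "s \<le> 0" for s using g0 that .
  show "g \<in> borel_measurable lebesgue" by fact
  fix T
  obtain C where C: "\<And>s. s < T \<Longrightarrow> \<bar>g s\<bar> \<le> C" using gC by blast
  note g[measurable]
  have "integrable lebesgue (\<lambda>s. (indicator {..<T} s * g s) * heaviside s)"
    by (rule integrable_indicator_bounded[where T = T and C = "\<bar>C\<bar>"])
      (use C mono_kernelD(1)[OF mono_kernel_heaviside] in \<open>auto simp: indicator_def[of "{..<T}"] intro: order_trans[OF C]\<close>)
  also have "(\<lambda>s. (indicator {..<T} s * g s) * heaviside s) = (\<lambda>s. indicator {..<T} s * g s)"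
    using g0 by (auto simp: fun_eq_iff indicator_def not_less)
  finally show "integrable lebesgue (\<lambda>s. indicator {..<T} s * g s)" .
qed

section \<open>From one time step to the full inequality\<close>

context conj_kernels begin

text \<open>A discrete chain rule for the convolution of \<open>k\<close> with \<psi>(u). All values
  of \<open>u\<close> are compared with the tangent of \<psi> at \<open>u t\<close>. On the past the
  weight increment is nonpositive, so the lower tangent bound has the right sign; on the last
  stretch of length \<open>d\<close> it is positive, and the second order upper bound is used with
  the modulus of continuity of \<open>u\<close>.\<close>

lemma convex_ineq_increment:
  fixes h u :: "real \<Rightarrow> 'h::real_inner"
  assumes "smooth_convex \<psi> p \<Lambda>" and \<psi>0: "\<psi> 0 = 0"
    and h: "strongly_measurable lebesgue h" and h0: "\<And>s. s \<le> 0 \<Longrightarrow> h s = 0" and hC: "\<And>s. norm (h s) \<le> C"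
    and u: "\<And>e t. u t \<bullet> e = rconv l (\<lambda>s. h s \<bullet> e) t" and d: "0 < d"
  shows "rconv k (\<lambda>s. \<psi> (u s)) t - rconv k (\<lambda>s. \<psi> (u s)) (t - d)
    \<le> cumul (\<lambda>s. h s \<bullet> p (u s)) t - cumul (\<lambda>s. h s \<bullet> p (u s)) (t - d) + d * (10 * \<Lambda> * C\<^sup>2
        * cumul l d)"
proof -
  interpret smooth_convex \<psi> p \<Lambda> by fact
  note K = mono_kernelD[OF k] and L = mono_kernelD[OF l]
  define w where "w s = \<psi> (u s)" for s
  define g where "g s = h s \<bullet> p (u s)" for s
  have C0: "0 \<le> C" using hC norm_ge_zero order_trans by blast
  have M0: "0 \<le> cumul l r" "0 \<le> cumul k r" for r using cumul_nonneg L(3) K(3) by auto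
  have u0: "u s = 0" if "s \<le> 0" for s
  proof -
    have "l (s - r) * (h r \<bullet> u s) = 0" for r using that L(5)[of "s - r"] h0[of r] by (cases "r \<le> 0") auto
    then have "(\<lambda>r. l (s - r) * (h r \<bullet> u s)) = (\<lambda>r. 0)" by (intro ext)
    then have "u s \<bullet> u s = 0" unfolding u rconv_def by simp
    then show ?thesis by simp
  qed
  have cu: "continuous_on UNIV u" by (rule rconv_continuous[OF l h h0 _ u]) (use hC in auto)
  have cw: "continuous_on UNIV w" unfolding w_def by (rule continuous_on_compose2[OF continuous_\<psi> cu]) auto
  have w0: "w s = 0" if "s \<le> 0" for s using u0[OF that] by (simp add: w_def \<psi>0)
  have mw: "w \<in> borel_measurable lebesgue" using cw by (intro borel_imp_lebesgue borel_measurable_continuous_onI)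
  have wi: "rconv_integrable k w r" for r
  proof -
    obtain Cw where "\<forall>s\<le>r. norm (w s) \<le> Cw" using continuous_locally_bounded[OF cw w0] by blast
    then show ?thesis by (intro rconv_bounded_integrable(1)[OF k mw w0, of r Cw]) auto
  qed
  have mod: "norm (u s - u s') \<le> 2 * C * cumul l d" if "s' \<le> s" "s - s' \<le> d" for s s'
  proof (cases "s' = s")
    case False
    then have "norm (u (s' + (s - s')) - u s') \<le> 2 * C * cumul l (s - s')"
      using that by (intro rconv_modulus[OF l h h0 hC] u) auto
    also have "\<dots> \<le> 2 * C * cumul l d" using that C0 by (intro mult_left_mono cumul_mono L) auto
    finally show ?thesis by simp
  qed (use C0 M0 in simp)
  have cpu: "continuous_on UNIV (\<lambda>s. p (u s))" by (rule continuous_on_compose2[OF continuous_p cu]) auto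
  have mg: "g \<in> borel_measurable lebesgue"
    unfolding g_def by (intro strongly_measurable_inner h strongly_measurable_continuous cpu)
  have lg: "locint g"
  proof (rule locint_locally_bounded[OF mg])
    show "g s = 0" if "s \<le> 0" for s using h0[OF that] by (simp add: g_def)
    fix T
    obtain P where P: "0 \<le> P" "\<forall>s\<le>T. norm (p (u s)) \<le> P" using continuous_locally_bounded[OF cpu, of "p 0" T] by (auto simp: u0)
    have "\<bar>g s\<bar> \<le> C * P" if "s < T" for s
      using order_trans[OF Cauchy_Schwarz_ineq2 mult_mono[OF hC _ C0]] P that by (force simp: g_def)
    then show "\<exists>C. \<forall>s<T. \<bar>g s\<bar> \<le> C" by blast
  qed
  have lhe: "locint (\<lambda>s. h s \<bullet> e)" for e
  proof (rule locint_locally_bounded)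
    show "(\<lambda>s. h s \<bullet> e) \<in> borel_measurable lebesgue" by (intro strongly_measurable_inner h strongly_measurable_const)
    have "\<bar>h s \<bullet> e\<bar> \<le> C * norm e" for s
      using order_trans[OF Cauchy_Schwarz_ineq2[of "h s" e]] hC by (simp add: mult_right_mono)
    then show "\<exists>C. \<forall>s<T. \<bar>h s \<bullet> e\<bar> \<le> C" for T by blast
  qed (use h0 in auto)
  have ku: "rconv k (\<lambda>s. u s \<bullet> e) r = cumul (\<lambda>s. h s \<bullet> e) r" "rconv_integrable k (\<lambda>s. u s \<bullet>
      e) r" for e r
    using rconv_k_rconv_l[OF lhe[of e]] unfolding u[abs_def] by auto
  have "rconv k w t - rconv k w (t - d) \<le> cumul g t - cumul g (t - d) + d * (10 * \<Lambda> * C\<^sup>2 * cumul l d)"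
  proof -
    define P where "P = p (u t)"
    define A where "A = w t - P \<bullet> u t"
    \<comment> \<open>\<open>\<kappa> (t - s)\<close> is the change in the weight carried by time
      \<open>s\<close> when the observation time moves from \<open>t - d\<close> to
      \<open>t\<close>.\<close>
    define \<kappa> where "\<kappa> y = k y - k (y - d)" for y
    define D where "D = \<Lambda> / 2 * (2 * C * cumul l d)\<^sup>2"
    have D0: "0 \<le> D" using \<Lambda>_nonneg by (simp add: D_def)
    have A0: "A \<le> 0" using grad_lower[of 0 "u t"] by (simp add: A_def P_def w_def \<psi>0 inner_diff_right)
    have \<kappa>_int: "integrable lebesgue (\<lambda>s. \<kappa> (t - s) * f s)"
      and \<kappa>_eq: "(\<integral>s. \<kappa> (t - s) * f s \<partial>lebesgue) = rconv k f t - rconv k f (t - d)"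
      if "\<And>r. rconv_integrable k f r" for f
    proof -
      have e: "\<kappa> (t - s) * f s = k (t - s) * f s - k (t - d - s) * f s" for s
        by (simp add: \<kappa>_def algebra_simps)
      show "integrable lebesgue (\<lambda>s. \<kappa> (t - s) * f s)" unfolding e using that by (intro Bochner_Integration.integrable_diff)
      show "(\<integral>s. \<kappa> (t - s) * f s \<partial>lebesgue) = rconv k f t - rconv k f (t - d)"
        unfolding e rconv_def using that by (intro Bochner_Integration.integral_diff)
    qed
    have ih: "rconv_integrable k heaviside r" for r
    proof -
      have "(\<lambda>s. heaviside (r - s) * k s) = (\<lambda>s. indicator {..<r} s * k s)" by (auto simp: indicator_def fun_eq_iff)
      then show ?thesis using rconv_integrable_commute[of heaviside r k] locint_integrable[OF K(1), of r] by simp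
    qed
    have ikd: "integrable lebesgue (\<lambda>s. indicator {..<d} (t - s) * k (t - s))"
      using lebesgue_integrable_real_affine[OF locint_integrable[OF K(1), of d], of "-1" t] by simp
    have vkd: "(\<integral>s. indicator {..<d} (t - s) * k (t - s) \<partial>lebesgue) = cumul k d"
      using lebesgue_integral_real_affine[of "-1" "\<lambda>s. indicator {..<d} s * k s" t] by (simp add: cumul_def)
    \<comment> \<open>At s = t - d the convention \<open>k 0 = 0\<close> gives \<kappa> the wrong
      sign; the inequality is needed only almost everywhere, so this point is left out.\<close>
    have pw: "\<kappa> (t - s) * w s \<le> A * (\<kappa> (t - s) * heaviside s) + \<kappa> (t - s) * (u s \<bullet> P) + D * (indicator
        {..<d} (t - s) * k (t - s))"
      if nd: "s \<noteq> t - d" for s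
    proof (cases "0 < s")
      case False
      then show ?thesis using w0[of s] u0[of s] D0 K(3) by simp
    next
      case s: True
      have lower: "A + u s \<bullet> P \<le> w s"
        using grad_lower[where x = "u t" and y = "u s"] by (simp add: A_def P_def w_def inner_diff_right inner_commute)
      have upper: "w s \<le> A + u s \<bullet> P + \<Lambda> / 2 * (norm (u s - u t))\<^sup>2"
        using grad_upper[where x = "u t" and y = "u s"] by (simp add: A_def P_def w_def inner_diff_right inner_commute)
      consider "t \<le> s" | "t - d < s" "s < t" | "s < t - d" using nd by linarith
      then show ?thesis
      proof cases
        case 1
        then have "k (t - s) = 0" "k (t - s - d) = 0" using K(5) d by auto
        then show ?thesis by (simp add: \<kappa>_def)
      next
        case 2
        then have kap: "\<kappa> (t - s) = k (t - s)" using K(5)[of "t - s - d"] by (simp add: \<kappa>_def)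
        have "\<Lambda> / 2 * (norm (u s - u t))\<^sup>2 \<le> D"
          unfolding D_def using mod[of s t] 2 \<Lambda>_nonneg by (intro mult_left_mono power_mono) (auto simp: norm_minus_commute)
        with upper have "w s \<le> A + u s \<bullet> P + D" by linarith
        then have "k (t - s) * w s \<le> k (t - s) * (A + u s \<bullet> P + D)" using K(3) by (rule mult_left_mono)
        then show ?thesis using 2 s unfolding kap by (simp add: algebra_simps)
      next
        case 3
        then have "\<kappa> (t - s) \<le> 0" using K(4)[of "t - s - d" "t - s"] d by (simp add: \<kappa>_def)
        then have "\<kappa> (t - s) * w s \<le> \<kappa> (t - s) * (A + u s \<bullet> P)" using lower by (intro mult_left_mono_neg)
        then show ?thesis using 3 s by (simp add: algebra_simps)
      qed
    qed
    have "rconv k w t - rconv k w (t - d) = (\<integral>s. \<kappa> (t - s) * w s \<partial>lebesgue)" using \<kappa>_eq[OF wi] by simp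
    also have "\<dots> \<le> (\<integral>s. A * (\<kappa> (t - s) * heaviside s) + \<kappa> (t - s) * (u s \<bullet> P) + D * (indicator
        {..<d} (t - s) * k (t - s)) \<partial>lebesgue)"
    proof (rule integral_mono_AE)
      show "AE s in lebesgue. \<kappa> (t - s) * w s \<le> A * (\<kappa> (t - s) * heaviside s) + \<kappa> (t - s) * (u s \<bullet> P) + D
          * (indicator {..<d} (t - s) * k (t - s))"
        using pw by (intro AE_I'[of "{t - d}"]) auto
      show "integrable lebesgue (\<lambda>s. A * (\<kappa> (t - s) * heaviside s) + \<kappa> (t - s) * (u s \<bullet> P) + D * (indicator
          {..<d} (t - s) * k (t - s)))"
        by (intro Bochner_Integration.integrable_add integrable_mult_right \<kappa>_int ih ku(2) ikd)
    qed (rule \<kappa>_int[OF wi])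
    also have "\<dots> = A * (rconv k heaviside t - rconv k heaviside (t - d)) + (cumul (\<lambda>s. h s \<bullet> P) t - cumul
        (\<lambda>s. h s \<bullet> P) (t - d)) + D * cumul k d"
      using \<kappa>_int[OF ih] \<kappa>_int[OF ku(2)] ikd by (simp add: \<kappa>_eq[OF ih] \<kappa>_eq[OF ku(2)] ku(1) vkd)
    also have "\<dots> \<le> (cumul (\<lambda>s. h s \<bullet> P) t - cumul (\<lambda>s. h s \<bullet> P) (t - d)) + D * cumul k d"
    proof -
      have "rconv k heaviside (t - d) \<le> rconv k heaviside t"
        using cumul_mono[OF K(1,3), of "t - d" t] d by (simp add: cumul_eq_rconv rconv_commute)
      then have "A * (rconv k heaviside t - rconv k heaviside (t - d)) \<le> 0" using A0 by (intro mult_nonpos_nonneg) auto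
      then show ?thesis by simp
    qed
    also have "\<dots> \<le> (cumul g t - cumul g (t - d) + d * (2 * \<Lambda> * C\<^sup>2 * cumul l d)) + 8 * \<Lambda> * C\<^sup>2 * cumul l d * d"
    proof (rule add_mono)
      have "D * cumul k d = 2 * \<Lambda> * C\<^sup>2 * cumul l d * (cumul k d * cumul l d)"
        by (simp add: D_def power2_eq_square)
      also have "\<dots> \<le> 2 * \<Lambda> * C\<^sup>2 * cumul l d * (4 * d)"
        using M0 \<Lambda>_nonneg by (intro mult_left_mono cumul_k_mult_cumul_l d) auto
      finally show "D * cumul k d \<le> 8 * \<Lambda> * C\<^sup>2 * cumul l d * d" by simp
      define E where "E = C * (\<Lambda> * (2 * C * cumul l d))"
      have "cumul (\<lambda>s. h s \<bullet> P) t - cumul (\<lambda>s. h s \<bullet> P) (t - d) = (\<integral>s. indicator {t - d..<t} s *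
          (h s \<bullet> P) \<partial>lebesgue)"
        using d by (intro cumul_diff lhe) auto
      also have "\<dots> \<le> (\<integral>s. indicator {t - d..<t} s * g s + indicator {t - d..<t} s * E \<partial>lebesgue)"
      proof (rule integral_mono)
        show "integrable lebesgue (\<lambda>s. indicator {t - d..<t} s * g s + indicator {t - d..<t} s * E)"
          by (intro Bochner_Integration.integrable_add integrable_atLeastLessThan lg integrable_mult_left)
            (use d in \<open>auto simp: integrable_indicator_iff\<close>)
        fix s
        have "h s \<bullet> P \<le> g s + E" if "t - d \<le> s" "s < t"
        proof -
          have "h s \<bullet> P - g s = h s \<bullet> (P - p (u s))" by (simp add: g_def inner_diff_right)
          also have "\<dots> \<le> norm (h s) * norm (P - p (u s))" by (rule norm_cauchy_schwarz)
          also have "\<dots> \<le> C * (\<Lambda> * norm (u t - u s))"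
            unfolding P_def by (intro mult_mono hC grad_lipschitz C0) auto
          also have "\<dots> \<le> E" unfolding E_def
            using that by (intro mult_left_mono mod C0 \<Lambda>_nonneg) auto
          finally show ?thesis by simp
        qed
        then show "indicator {t - d..<t} s * (h s \<bullet> P) \<le> indicator {t - d..<t} s * g s + indicator {t - d..<t} s * E"
          by (auto simp: indicator_def)
      qed (rule integrable_atLeastLessThan[OF lhe])
      also have "\<dots> = (\<integral>s. indicator {t - d..<t} s * g s \<partial>lebesgue) + (\<integral>s. indicator {t - d..<t} s * E
          \<partial>lebesgue)"
        by (intro Bochner_Integration.integral_add integrable_atLeastLessThan lg integrable_mult_left)
          (use d in \<open>auto simp: integrable_indicator_iff\<close>)
      also have "(\<integral>s. indicator {t - d..<t} s * E \<partial>lebesgue) = d * (2 * \<Lambda> * C\<^sup>2 * cumul l d)"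
        using d by (simp add: E_def power2_eq_square)
      also have "(\<integral>s. indicator {t - d..<t} s * g s \<partial>lebesgue) = cumul g t - cumul g (t - d)"
        using d by (intro cumul_diff[symmetric] lg) auto
      finally show "cumul (\<lambda>s. h s \<bullet> P) t - cumul (\<lambda>s. h s \<bullet> P) (t - d) \<le> cumul g t - cumul g (t - d) +
          d * (2 * \<Lambda> * C\<^sup>2 * cumul l d)" .
    qed
    also have "\<dots> = cumul g t - cumul g (t - d) + d * (10 * \<Lambda> * C\<^sup>2 * cumul l d)" by (simp add: algebra_simps)
    finally show ?thesis .
  qed
  then show ?thesis by (simp add: w_def[abs_def] g_def[abs_def])
qed

text \<open>With w = \<psi>(u) and g = (h, p(u)), the one-step estimate makes \<open>F\<close>, the
  primitive of g minus the convolution of \<open>k\<close> with w, nondecreasing. Convolution with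
  the nonnegative \<open>l\<close> keeps it nondecreasing and turns it into the primitive of
  \<open>rconv l g - w\<close>. This function is continuous, hence nonnegative at every
  time.\<close>

lemma convex_ineq_bounded:
  fixes h u :: "real \<Rightarrow> 'h::real_inner"
  assumes "smooth_convex \<psi> p \<Lambda>" and \<psi>0: "\<psi> 0 = 0"
    and h: "strongly_measurable lebesgue h" and h0: "\<And>s. s \<le> 0 \<Longrightarrow> h s = 0" and hC: "\<And>s. norm (h s) \<le> C"
    and u: "\<And>e t. u t \<bullet> e = rconv l (\<lambda>s. h s \<bullet> e) t"
  shows "\<psi> (u t) \<le> rconv l (\<lambda>s. h s \<bullet> p (u s)) t"
proof -
  interpret smooth_convex \<psi> p \<Lambda> by fact
  interpret sym: conj_kernels l k by (rule conj_kernels_sym)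
  note L = mono_kernelD[OF l]
  define w where "w s = \<psi> (u s)" for s
  define g where "g s = h s \<bullet> p (u s)" for s
  have C0: "0 \<le> C" using hC norm_ge_zero order_trans by blast
  have u0: "u s = 0" if "s \<le> 0" for s
  proof -
    have "l (s - r) * (h r \<bullet> u s) = 0" for r using that L(5)[of "s - r"] h0[of r] by (cases "r \<le> 0") auto
    then have "(\<lambda>r. l (s - r) * (h r \<bullet> u s)) = (\<lambda>r. 0)" by (intro ext)
    then have "u s \<bullet> u s = 0" unfolding u rconv_def by simp
    then show ?thesis by simp
  qed
  have cu: "continuous_on UNIV u" by (rule rconv_continuous[OF l h h0 _ u]) (use hC in auto)
  have cw: "continuous_on UNIV w" unfolding w_def by (rule continuous_on_compose2[OF continuous_\<psi> cu]) auto
  have w0: "w s = 0" if "s \<le> 0" for s using u0[OF that] by (simp add: w_def \<psi>0)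
  have mw: "w \<in> borel_measurable lebesgue" using cw by (intro borel_imp_lebesgue borel_measurable_continuous_onI)
  have bw: "\<exists>C. \<forall>s<T. \<bar>w s\<bar> \<le> C" for T
    using continuous_locally_bounded[OF cw w0, of T] by (auto intro: less_imp_le)
  have lw: "locint w" by (rule locint_locally_bounded[OF mw w0 bw])
  have cpu: "continuous_on UNIV (\<lambda>s. p (u s))" by (rule continuous_on_compose2[OF continuous_p cu]) auto
  have mg: "g \<in> borel_measurable lebesgue"
    unfolding g_def by (intro strongly_measurable_inner h strongly_measurable_continuous cpu)
  have g0: "g s = 0" if "s \<le> 0" for s using h0[OF that] by (simp add: g_def)
  have bg: "\<exists>C. \<forall>s<T. \<bar>g s\<bar> \<le> C" for T
  proof -
    obtain P where P: "0 \<le> P" "\<forall>s\<le>T. norm (p (u s)) \<le> P" using continuous_locally_bounded[OF cpu, of "p 0" T] by (auto simp: u0)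
    have "\<bar>g s\<bar> \<le> C * P" if "s < T" for s
      using order_trans[OF Cauchy_Schwarz_ineq2 mult_mono[OF hC _ C0]] P that by (force simp: g_def)
    then show "\<exists>C. \<forall>s<T. \<bar>g s\<bar> \<le> C" by blast
  qed
  have lg: "locint g" by (rule locint_locally_bounded[OF mg g0 bg])
  define F where "F t = cumul g t - rconv k w t" for t
  have F_mono: "F a \<le> F b" if "a \<le> b" for a b
  proof (rule nondecreasing_from_increments[OF _ _ that, where \<epsilon> = "\<lambda>d. 10 * \<Lambda> * C\<^sup>2 * cumul l d"])
    fix t d :: real assume d: "0 < d"
    show "F (t - d) - d * (10 * \<Lambda> * C\<^sup>2 * cumul l d) \<le> F t"
      using convex_ineq_increment[OF assms(1) \<psi>0 h h0 hC u d, of t] by (simp add: F_def w_def[abs_def] g_def[abs_def])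
  next
    have "((\<lambda>d. 10 * \<Lambda> * C\<^sup>2 * cumul l d) \<longlongrightarrow> 10 * \<Lambda> * C\<^sup>2 * 0) (at_right 0)"
      by (intro tendsto_intros cumul_at_right_0 L)
    then show "((\<lambda>d. 10 * \<Lambda> * C\<^sup>2 * cumul l d) \<longlongrightarrow> 0) (at_right 0)" by simp
  qed
  have il1: "rconv_integrable l (\<lambda>s. cumul g s) t" for t by (rule cumul_rconv(2)[OF l lg])
  have il2: "rconv_integrable l (\<lambda>s. rconv k w s) t" for t by (rule sym.rconv_k_rconv_l(2)[OF lw])
  have ilF: "rconv_integrable l F t" for t
    unfolding F_def right_diff_distrib using il1 il2 by (rule Bochner_Integration.integrable_diff)
  have lF: "rconv l F t = cumul (rconv l g) t - cumul w t" for t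
    using cumul_rconv(1)[OF l lg, of t] sym.rconv_k_rconv_l(1)[OF lw, of t] il1[of t] il2[of t]
    unfolding F_def[abs_def] rconv_def[of l "\<lambda>t. cumul g t - rconv k w t"] right_diff_distrib
    by (simp add: rconv_def[of l])
  have rg: "locint (rconv l g)" by (rule rconv_kernel_integrable_AE(2)[OF l lg])
  have v: "cumul (\<lambda>s. rconv l g s - w s) t = rconv l F t" for t
    unfolding lF cumul_def[of "\<lambda>s. rconv l g s - w s"] right_diff_distrib
    using locint_integrable[OF rg] locint_integrable[OF lw] by (simp add: cumul_def)
  have "0 \<le> rconv l g t - w t"
  proof (rule nonneg_from_cumul_mono[where v = "\<lambda>s. rconv l g s - w s"])
    show "locint (\<lambda>s. rconv l g s - w s)" by (intro locint_diff rg lw)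
    show "continuous_on UNIV (\<lambda>s. rconv l g s - w s)"
      by (intro continuous_on_diff cw rconv_continuous_real[OF l mg g0 bg])
    fix a b :: real assume "a \<le> b"
    have "rconv l F a \<le> rconv l F b"
      unfolding rconv_commute[of l] rconv_def[of F]
    proof (rule integral_mono)
      show "rconv_integrable F l a" "rconv_integrable F l b"
        using ilF by (auto intro: rconv_integrable_commute)
      show "F (a - s) * l s \<le> F (b - s) * l s" for s
        using \<open>a \<le> b\<close> L(3) by (intro mult_right_mono F_mono) auto
    qed
    then show "cumul (\<lambda>s. rconv l g s - w s) a \<le> cumul (\<lambda>s. rconv l g s - w s) b" unfolding v .
  qed
  then show ?thesis by (simp add: w_def g_def[abs_def])
qed

end

section \<open>Vector-valued convolutions\<close>

definition zext :: "(real \<Rightarrow> 'a::zero) \<Rightarrow> real \<Rightarrow> 'a" where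
  "zext f s = (if 0 < s then f s else 0)"

lemma zext_nonpos [simp]: "s \<le> 0 \<Longrightarrow> zext f s = 0"
  by (simp add: zext_def)

lemma zext_pos [simp]: "0 < s \<Longrightarrow> zext f s = f s"
  by (simp add: zext_def)

lemma bochner_int_cong:
  assumes "\<And>x. x \<in> space M \<Longrightarrow> f x = g x"
  shows "bochner_int M f = bochner_int M g"
proof -
  have "f \<in> borel_measurable M \<longleftrightarrow> g \<in> borel_measurable M" by (rule measurable_cong) (rule assms)
  moreover have "(\<integral>\<^sup>+y. norm (f y - s y) \<partial>M) = (\<integral>\<^sup>+y. norm (g y - s y) \<partial>M)" for s
    by (rule nn_integral_cong) (simp add: assms)
  ultimately have "has_bochner_int M f = has_bochner_int M g" by (simp add: has_bochner_int_def fun_eq_iff)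
  then show ?thesis by (simp add: bochner_int_def)
qed

lemma conv_zext: "conv k w t = conv (zext k) (zext w) t"
  unfolding conv_def by (intro bochner_int_cong) auto

lemma strongly_measurable_zext:
  assumes "strongly_measurable lebesgue f" shows "strongly_measurable lebesgue (zext f)"
proof -
  have "zext f = (\<lambda>s. heaviside s *\<^sub>R f s)" by (auto simp: zext_def fun_eq_iff)
  then show ?thesis using assms by (simp add: strongly_measurable_scaleR)
qed

lemma integrable_lebesgue_on_iff:
  fixes f :: "real \<Rightarrow> real"
  shows "S \<in> sets lebesgue \<Longrightarrow> integrable (lebesgue_on S) f \<longleftrightarrow> integrable lebesgue (\<lambda>s.
      indicator S s * f s)"
  by (subst integrable_restrict_space) auto

lemma conv_inner:
  fixes h :: "real \<Rightarrow> 'h::{real_inner,banach}"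
  assumes a: "mono_kernel a" and h: "strongly_measurable lebesgue h" and h0: "\<And>s. s \<le> 0 \<Longrightarrow> h s = 0"
    and i: "rconv_integrable a (\<lambda>s. norm (h s)) t"
  shows "conv a h t \<bullet> e = rconv a (\<lambda>s. h s \<bullet> e) t"
proof -
  note A = mono_kernelD[OF a]
  have [measurable]: "a \<in> borel_measurable borel" by fact
  define F where "F s = a (t - s) *\<^sub>R h s" for s
  have out: "F s = 0" if "s \<notin> {0<..<t}" for s
    using that A(5)[of "t - s"] h0[of s] by (auto simp: F_def not_less)
  have "(\<lambda>s. a (t - s)) \<in> borel_measurable lebesgue" by (rule borel_imp_lebesgue) measurable
  then have F: "strongly_measurable lebesgue F" unfolding F_def by (intro strongly_measurable_scaleR h)
  have "(\<lambda>x. if x \<in> {0<..<t} then F x else 0) = F" using out by auto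
  then have F1: "strongly_measurable (lebesgue_on {0<..<t}) F"
    using F by (subst strongly_measurable_restrict_iff) auto
  have F2: "F \<in> borel_measurable (lebesgue_on {0<..<t})"
    by (rule measurable_restrict_space1[OF strongly_measurable_imp_borel[OF F]])
  have "(\<lambda>s. indicator {0<..<t} s * norm (F s)) = (\<lambda>s. a (t - s) * norm (h s))"
  proof
    fix s show "indicator {0<..<t} s * norm (F s) = a (t - s) * norm (h s)"
      using out[of s] A(3)[of "t - s"] by (cases "s \<in> {0<..<t}") (auto simp: F_def simp del: greaterThanLessThan_iff)
  qed
  then have F3: "integrable (lebesgue_on {0<..<t}) (\<lambda>s. norm (F s))"
    using i by (subst integrable_lebesgue_on_iff) auto
  have "conv a h t \<bullet> e = (\<integral>s. F s \<bullet> e \<partial>lebesgue_on {0<..<t})"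
    using has_bochner_integral_integral_eq[OF bochner_int_inner[OF F1 F2 F3, of e]] by (simp add: conv_def F_def[abs_def])
  also have "\<dots> = (\<integral>s. indicator {0<..<t} s *\<^sub>R (F s \<bullet> e) \<partial>lebesgue)"
    by (subst integral_restrict_space) auto
  also have "\<dots> = rconv a (\<lambda>s. h s \<bullet> e) t" unfolding rconv_def
  proof (intro Bochner_Integration.integral_cong refl)
    fix s show "indicator {0<..<t} s *\<^sub>R (F s \<bullet> e) = a (t - s) * (h s \<bullet> e)"
      using out[of s] by (cases "s \<in> {0<..<t}") (auto simp: F_def simp del: greaterThanLessThan_iff)
  qed
  finally show ?thesis .
qed

lemma conv_real: "conv k w t = rconv (zext k) (zext w) t"
proof -
  have "conv k w t = (\<integral>s. indicator {0<..<t} s *\<^sub>R (k (t - s) * w s) \<partial>lebesgue)"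
    unfolding conv_def bochner_int_eq by (subst integral_restrict_space) auto
  also have "\<dots> = rconv (zext k) (zext w) t"
    unfolding rconv_def by (intro Bochner_Integration.integral_cong) (auto simp: zext_def indicator_def)
  finally show ?thesis .
qed

text \<open>Monotonicity upgrades the Lebesgue measurability contained in local integrability to
  Borel measurability.\<close>

lemma mono_kernel_zext:
  assumes "nonneg_nonincreasing_kernel k" shows "mono_kernel (zext k)"
proof -
  have L1: "\<And>T. 0 < T \<Longrightarrow> integrable (lebesgue_on {0<..<T}) k" and nn: "\<And>t. 0 < t \<Longrightarrow> 0 \<le> k t"
    and am: "antimono_on {0<..} k"
    using assms by (auto simp: nonneg_nonincreasing_kernel_def L1_loc_def)
  have "mono_on {0<..} (\<lambda>t. - k t)" using am by (auto simp: monotone_on_def)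
  then have "(\<lambda>t. - k t) \<in> borel_measurable (restrict_space borel {0<..})" by (rule borel_measurable_mono_on_fnc)
  then have "(\<lambda>t. - (- k t)) \<in> borel_measurable (restrict_space borel {0<..})" by (rule borel_measurable_uminus)
  then have "(\<lambda>x. indicator {0<..} x *\<^sub>R k x) \<in> borel_measurable borel"
    by (subst (asm) borel_measurable_restrict_space_iff) auto
  also have "(\<lambda>x. indicator {0<..} x *\<^sub>R k x) = zext k" by (auto simp: zext_def fun_eq_iff)
  finally have b: "zext k \<in> borel_measurable borel" .
  show ?thesis unfolding mono_kernel_def locint_def
  proof (intro conjI allI impI)
    show "zext k \<in> borel_measurable lebesgue" using b by (rule borel_imp_lebesgue)
    fix T :: real
    show "integrable lebesgue (\<lambda>s. indicator {..<T} s * zext k s)"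
    proof (cases "0 < T")
      case True
      have "(\<lambda>s. indicator {..<T} s * zext k s) = (\<lambda>s. indicator {0<..<T} s * k s)"
        by (auto simp: fun_eq_iff indicator_def zext_def)
      then show ?thesis using L1[OF True] by (simp add: integrable_lebesgue_on_iff)
    next
      case False
      then have "(\<lambda>s. indicator {..<T} s * zext k s) = (\<lambda>s. 0)" by (auto simp: fun_eq_iff indicator_def zext_def)
      then show ?thesis by simp
    qed
  qed (use b nn am in \<open>auto simp: zext_def monotone_on_def\<close>)
qed

lemma conj_kernels_zext:
  assumes "condition_K k l" shows "conj_kernels (zext k) (zext l)"
  using assms by (auto simp: conj_kernels_def condition_K_def conv_real intro: mono_kernel_zext)

lemma rconv_inner_integrable:
  fixes h :: "real \<Rightarrow> 'h::real_inner"
  assumes a: "mono_kernel a" and h: "strongly_measurable lebesgue h"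
    and i: "rconv_integrable a (\<lambda>s. norm (h s)) t"
  shows "rconv_integrable a (\<lambda>s. h s \<bullet> e) t"
proof (rule Bochner_Integration.integrable_bound[OF integrable_mult_left[OF i, of "norm e"]])
  have [measurable]: "a \<in> borel_measurable borel" using a by measurable
  have [measurable]: "(\<lambda>s. a (t - s)) \<in> borel_measurable lebesgue" by (rule borel_imp_lebesgue) measurable
  have [measurable]: "(\<lambda>s. h s \<bullet> e) \<in> borel_measurable lebesgue"
    by (intro strongly_measurable_inner h strongly_measurable_const)
  show "(\<lambda>s. a (t - s) * (h s \<bullet> e)) \<in> borel_measurable lebesgue" by measurable
  have "\<bar>a (t - s)\<bar> * \<bar>h s \<bullet> e\<bar> \<le> \<bar>a (t - s)\<bar> * (norm (h s) * norm e)" for s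
    by (intro mult_left_mono Cauchy_Schwarz_ineq2) auto
  then show "AE s in lebesgue. norm (a (t - s) * (h s \<bullet> e)) \<le> norm (a (t - s) * norm (h s) * norm e)"
    by (intro AE_I2) (simp add: abs_mult mult.assoc)
qed

text \<open>The triangle inequality for integrals, for vectors determined by their pairings: test
  with \<open>X - Y\<close> and cancel one factor of its norm.\<close>

lemma conv_norm_diff:
  fixes h g :: "real \<Rightarrow> 'h::real_inner"
  assumes a: "mono_kernel a" and h: "strongly_measurable lebesgue h" and g: "strongly_measurable lebesgue g"
    and ih: "rconv_integrable a (\<lambda>s. norm (h s)) t"
    and ig: "rconv_integrable a (\<lambda>s. norm (g s)) t"
    and X: "\<And>e. X \<bullet> e = rconv a (\<lambda>s. h s \<bullet> e) t" and Y: "\<And>e. Y \<bullet> e = rconv a (\<lambda>s. g s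
        \<bullet> e) t"
  shows "norm (X - Y) \<le> rconv a (\<lambda>s. norm (h s - g s)) t"
    and "integrable lebesgue (\<lambda>s. a (t - s) * norm (h s - g s))"
proof -
  note A = mono_kernelD[OF a]
  have [measurable]: "a \<in> borel_measurable borel" by fact
  have [measurable]: "(\<lambda>s. a (t - s)) \<in> borel_measurable lebesgue" by (rule borel_imp_lebesgue) measurable
  have [measurable]: "(\<lambda>s. norm (h s - g s)) \<in> borel_measurable lebesgue"
    by (intro strongly_measurable_norm strongly_measurable_diff h g)
  show i: "integrable lebesgue (\<lambda>s. a (t - s) * norm (h s - g s))"
  proof (rule Bochner_Integration.integrable_bound[OF Bochner_Integration.integrable_add[OF ih ig]])
    have "a (t - s) * norm (h s - g s) \<le> a (t - s) * (norm (h s) + norm (g s))" for s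
      using A(3) by (intro mult_left_mono norm_triangle_ineq4)
    then show "AE s in lebesgue. norm (a (t - s) * norm (h s - g s)) \<le> norm (a (t - s) * norm (h s) + a (t - s) * norm (g s))"
      using A(3) by (intro AE_I2) (simp add: abs_mult distrib_left)
  qed measurable
  define e where "e = X - Y"
  have "norm e * norm e = (\<integral>s. a (t - s) * (h s \<bullet> e) - a (t - s) * (g s \<bullet> e) \<partial>lebesgue)"
    using rconv_inner_integrable[OF a h ih, of e] rconv_inner_integrable[OF a g ig, of e] X[of e] Y[of e]
    by (simp add: rconv_def e_def[symmetric] flip: power2_eq_square) (simp add: power2_norm_eq_inner e_def inner_diff_left)
  also have "\<dots> \<le> (\<integral>s. (a (t - s) * norm (h s - g s)) * norm e \<partial>lebesgue)"
  proof (rule integral_mono)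
    show "integrable lebesgue (\<lambda>s. a (t - s) * (h s \<bullet> e) - a (t - s) * (g s \<bullet> e))"
      by (intro Bochner_Integration.integrable_diff rconv_inner_integrable assms)
    show "integrable lebesgue (\<lambda>s. (a (t - s) * norm (h s - g s)) * norm e)" using i by (rule integrable_mult_left)
    fix s
    have "a (t - s) * ((h s - g s) \<bullet> e) \<le> a (t - s) * (norm (h s - g s) * norm e)"
      by (intro mult_left_mono norm_cauchy_schwarz A(3))
    then show "a (t - s) * (h s \<bullet> e) - a (t - s) * (g s \<bullet> e) \<le> (a (t - s) * norm (h s - g s)) * norm e"
      by (simp add: inner_diff_left algebra_simps)
  qed
  also have "\<dots> = rconv a (\<lambda>s. norm (h s - g s)) t * norm e" by (simp add: rconv_def)
  finally have "norm e * norm e \<le> rconv a (\<lambda>s. norm (h s - g s)) t * norm e" .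
  moreover have "0 \<le> rconv a (\<lambda>s. norm (h s - g s)) t" unfolding rconv_def using A(3) by (intro integral_nonneg_AE) auto
  ultimately show "norm (X - Y) \<le> rconv a (\<lambda>s. norm (h s - g s)) t"
    unfolding e_def[symmetric] by (cases "norm e = 0") auto
qed

lemma rconv_nonneg: "mono_kernel a \<Longrightarrow> (\<And>s. 0 \<le> w s) \<Longrightarrow> 0 \<le> rconv a w t"
  unfolding rconv_def by (intro integral_nonneg_AE) (auto simp: mono_kernelD(3))

lemma rconv_mono:
  assumes "mono_kernel a" "rconv_integrable a v t" "rconv_integrable a w t"
    and "\<And>s. s < t \<Longrightarrow> v s \<le> w s"
  shows "rconv a v t \<le> rconv a w t"
  unfolding rconv_def
proof (rule integral_mono[OF assms(2,3)])
  fix s show "a (t - s) * v s \<le> a (t - s) * w s"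
    using assms(4)[of s] mono_kernelD(3)[OF assms(1), of "t - s"] mono_kernelD(5)[OF assms(1), of "t - s"]
    by (cases "s < t") (auto intro: mult_left_mono)
qed

lemma rconv_heaviside: "rconv a heaviside t = cumul a t"
  by (simp add: cumul_eq_rconv rconv_commute)

lemma conv_locally_bounded:
  fixes h :: "real \<Rightarrow> 'h::{real_inner,banach}"
  assumes a: "mono_kernel a" and h: "strongly_measurable lebesgue h" and h0: "\<And>s. s \<le> 0 \<Longrightarrow> h s = 0"
    and hC: "\<And>T. \<exists>C. \<forall>s<T. norm (h s) \<le> C"
  shows "rconv_integrable a (\<lambda>s. norm (h s)) t"
    and "conv a h t \<bullet> e = rconv a (\<lambda>s. h s \<bullet> e) t"
    and "continuous_on UNIV (conv a h)"
proof -
  show i: "rconv_integrable a (\<lambda>s. norm (h s)) t" for t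
  proof -
    obtain C where "\<forall>s<t. norm (h s) \<le> C" using hC by blast
    then show ?thesis by (intro rconv_bounded_integrable(1)[OF a strongly_measurable_norm[OF h], of t C]) (auto simp: h0)
  qed
  show "conv a h t \<bullet> e = rconv a (\<lambda>s. h s \<bullet> e) t" for t e by (rule conv_inner[OF a h h0 i])
  then show "continuous_on UNIV (conv a h)" by (intro rconv_continuous[OF a h h0 hC])
qed

section \<open>Truncation and convolutions of unbounded functions\<close>

definition truncate :: "real \<Rightarrow> (real \<Rightarrow> 'a::real_normed_vector) \<Rightarrow> real \<Rightarrow> 'a" where
  "truncate c h s = (if norm (h s) \<le> c then h s else 0)"

lemma strongly_measurable_truncate:
  assumes h: "strongly_measurable lebesgue h" shows "strongly_measurable lebesgue (truncate c h)"
proof -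
  have [measurable]: "(\<lambda>s. norm (h s)) \<in> borel_measurable lebesgue" by (rule strongly_measurable_norm[OF h])
  have "strongly_measurable lebesgue (\<lambda>s. indicator {s. norm (h s) \<le> c} s *\<^sub>R h s)"
    by (intro strongly_measurable_scaleR h) measurable
  also have "(\<lambda>s. indicator {s. norm (h s) \<le> c} s *\<^sub>R h s) = truncate c h" by (auto simp: truncate_def fun_eq_iff)
  finally show ?thesis .
qed

lemma tendsto_truncate: "(\<lambda>n. truncate (real n) h s) \<longlonglongrightarrow> h s"
proof -
  obtain N where "norm (h s) \<le> real N" using real_arch_simple by blast
  then show ?thesis
    by (intro tendsto_eventually) (auto simp: eventually_sequentially truncate_def intro!: exI[of _ N])
qed

lemma conv_truncate:
  fixes h :: "real \<Rightarrow> 'h::{real_inner,banach}"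
  assumes a: "mono_kernel a" and h: "strongly_measurable lebesgue h" and h0: "\<And>s. s \<le> 0 \<Longrightarrow> h s = 0"
    and i: "rconv_integrable a (\<lambda>s. norm (h s)) t"
  shows "norm (conv a (truncate c h) t) \<le> rconv a (\<lambda>s. norm (h s)) t"
    and "(\<And>e. X \<bullet> e = rconv a (\<lambda>s. h s \<bullet> e) t) \<Longrightarrow> (\<lambda>n. conv a (truncate (real n) h) t)
        \<longlonglongrightarrow> X"
proof -
  note A = mono_kernelD[OF a]
  have [measurable]: "a \<in> borel_measurable borel" by fact
  have [measurable]: "(\<lambda>s. a (r - s)) \<in> borel_measurable lebesgue" for r by (rule borel_imp_lebesgue) measurable
  note hc = strongly_measurable_truncate[OF h]
  have hc0: "truncate c h s = 0" if "s \<le> 0" for c s using h0[OF that] by (simp add: truncate_def)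
  have hcb: "norm (truncate c h s) \<le> norm (h s)" "norm (truncate c h s) \<le> max c 0" for c s by (auto simp: truncate_def)
  have hcb': "\<exists>C. \<forall>s<T. norm (truncate c h s) \<le> C" for c T using hcb(2) by blast
  note cb = conv_locally_bounded[OF a hc hc0 hcb']
  have "norm (conv a (truncate c h) t - 0) \<le> rconv a (\<lambda>s. norm (truncate c h s - 0)) t"
    by (rule conv_norm_diff(1)[OF a hc strongly_measurable_const cb(1) _ cb(2)]) (auto simp: rconv_def)
  also have "\<dots> \<le> rconv a (\<lambda>s. norm (h s)) t" by (rule rconv_mono[OF a]) (use cb(1) i hcb in auto)
  finally show "norm (conv a (truncate c h) t) \<le> rconv a (\<lambda>s. norm (h s)) t" by simp
  assume X: "\<And>e. X \<bullet> e = rconv a (\<lambda>s. h s \<bullet> e) t"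
  have le: "norm (conv a (truncate c h) t - X) \<le> rconv a (\<lambda>s. norm (truncate c h s - h s)) t" for c
    by (rule conv_norm_diff(1)[OF a hc h cb(1) i cb(2) X])
  have "(\<lambda>n. rconv a (\<lambda>s. norm (truncate (real n) h s - h s)) t) \<longlonglongrightarrow> (\<integral>r. 0
      \<partial>(lebesgue::real measure))"
    unfolding rconv_def
  proof (rule integral_dominated_convergence[OF _ _ i])
    show "(\<lambda>s. a (t - s) * norm (truncate (real n) h s - h s)) \<in> borel_measurable lebesgue" for n
      using strongly_measurable_norm[OF strongly_measurable_diff[OF hc h]] by measurable
    show "AE r in lebesgue. (\<lambda>n. a (t - r) * norm (truncate (real n) h r - h r)) \<longlonglongrightarrow> 0"
    proof (intro AE_I2)
      fix r
      have "(\<lambda>n. a (t - r) * norm (truncate (real n) h r - h r)) \<longlonglongrightarrow> a (t - r) * norm (h r - h r)"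
        by (intro tendsto_intros tendsto_truncate)
      then show "(\<lambda>n. a (t - r) * norm (truncate (real n) h r - h r)) \<longlonglongrightarrow> 0" by simp
    qed
    show "AE r in lebesgue. norm (a (t - r) * norm (truncate (real n) h r - h r)) \<le> a (t - r) * norm (h r)" for n
      using A(3) by (intro AE_I2) (auto simp: abs_mult truncate_def)
  qed simp
  then have "(\<lambda>n. rconv a (\<lambda>s. norm (truncate (real n) h s - h s)) t) \<longlonglongrightarrow> 0" by simp
  then have "(\<lambda>n. conv a (truncate (real n) h) t - X) \<longlonglongrightarrow> 0" by (rule Lim_null_comparison[rotated]) (use le in auto)
  then show "(\<lambda>n. conv a (truncate (real n) h) t) \<longlonglongrightarrow> X" by (rule LIM_zero_cancel)
qed

text \<open>Convolutions of the truncated functions are continuous and converge wherever the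
  convolution of the kernel with |h| is finite, that is, at almost every time.\<close>

lemma conv_strongly_measurable:
  fixes h :: "real \<Rightarrow> 'h::{real_inner,banach}"
  assumes a: "mono_kernel a" and h: "strongly_measurable lebesgue h" and h0: "\<And>s. s \<le> 0 \<Longrightarrow> h s = 0"
    and lh: "locint (\<lambda>s. norm (h s))"
  shows "strongly_measurable lebesgue (conv a h)"
    and "AE t in lebesgue. rconv_integrable a (\<lambda>s. norm (h s)) t \<and> (\<forall>e. conv a h t \<bullet> e = rconv a (\<lambda>s.
        h s \<bullet> e) t)"
proof -
  have I: "AE t in lebesgue. rconv_integrable a (\<lambda>s. norm (h s)) t" by (rule rconv_kernel_integrable_AE(1)[OF a lh])
  then show "AE t in lebesgue. rconv_integrable a (\<lambda>s. norm (h s)) t \<and> (\<forall>e. conv a h t \<bullet> e = rconv a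
      (\<lambda>s. h s \<bullet> e) t)"
    by eventually_elim (use conv_inner[OF a h h0] in blast)
  show "strongly_measurable lebesgue (conv a h)"
  proof (rule strongly_measurable_AE_lim)
    show "strongly_measurable lebesgue (conv a (truncate (real n) h))" for n
    proof (intro strongly_measurable_continuous conv_locally_bounded(3)[OF a strongly_measurable_truncate[OF h]])
      show "truncate (real n) h s = 0" if "s \<le> 0" for s using h0[OF that] by (simp add: truncate_def)
      show "\<exists>C. \<forall>s<T. norm (truncate (real n) h s) \<le> C" for T by (intro exI[of _ "real n"]) (simp add: truncate_def)
    qed
    show "AE t in lebesgue. (\<lambda>n. conv a (truncate (real n) h) t) \<longlonglongrightarrow> conv a h t"
      using I
    proof eventually_elim
      case (elim t)
      show ?case by (rule conv_truncate(2)[OF a h h0 elim conv_inner[OF a h h0 elim]])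
    qed
  qed
qed

lemma conv_nonpos:
  fixes h :: "real \<Rightarrow> 'h::{real_inner,banach}"
  assumes a: "mono_kernel a" and h: "strongly_measurable lebesgue h" and h0: "\<And>s. s \<le> 0 \<Longrightarrow> h s = 0" and t: "t \<le> 0"
  shows "conv a h t = 0"
proof -
  have z: "a (t - s) * norm (h s) = 0 \<and> (a (t - s) * (h s \<bullet> e) = 0)" for s e
    using t h0[of s] mono_kernelD(5)[OF a, of "t - s"] by (cases "s \<le> 0") auto
  have "(\<lambda>s. a (t - s) * norm (h s)) = (\<lambda>s. 0)" using z by blast
  then have i: "rconv_integrable a (\<lambda>s. norm (h s)) t" by simp
  have "(\<lambda>s. a (t - s) * (h s \<bullet> e)) = (\<lambda>s. 0)" for e using z by blast
  then have "rconv a (\<lambda>s. h s \<bullet> e) t = 0" for e unfolding rconv_def by (simp only:) simp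
  then have "conv a h t \<bullet> conv a h t = 0" using conv_inner[OF a h h0 i, of "conv a h t"] by simp
  then show ?thesis by simp
qed

section \<open>The convexity inequality for unbounded functions\<close>

context conj_kernels begin

text \<open>The bounded case is applied to truncations of \<open>h\<close>. The inequality is
  claimed at one time \<open>t\<close> only, so the representation of \<open>u\<close> is needed
  exactly at \<open>t\<close>, and almost everywhere under the integral.\<close>

lemma convex_ineq:
  fixes h u :: "real \<Rightarrow> 'h::{real_inner,banach}"
  assumes sc: "smooth_convex \<psi> p \<Lambda>" and \<psi>0: "\<psi> 0 = 0"
    and h: "strongly_measurable lebesgue h" and h0: "\<And>s. s \<le> 0 \<Longrightarrow> h s = 0"
    and it: "rconv_integrable l (\<lambda>s. norm (h s)) t" and ut: "\<And>e. u t \<bullet> e = rconv l (\<lambda>s. h s \<bullet> e) t"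
    and AE: "AE s in lebesgue. rconv_integrable l (\<lambda>r. norm (h r)) s \<and> (\<forall>e. u s \<bullet> e = rconv l (\<lambda>s. h s
        \<bullet> e) s)"
    and dom: "rconv_integrable l (\<lambda>s. norm (h s) * rconv l (\<lambda>s. norm (h s)) s) t"
  shows "\<psi> (u t) \<le> rconv l (\<lambda>s. h s \<bullet> p (u s)) t"
    and "rconv_integrable l (\<lambda>s. h s \<bullet> p (u s)) t"
proof -
  interpret smooth_convex \<psi> p \<Lambda> by fact
  note L = mono_kernelD[OF l]
  have [measurable]: "l \<in> borel_measurable borel" by fact
  have ml [measurable]: "(\<lambda>s. l (r - s)) \<in> borel_measurable lebesgue" for r by (rule borel_imp_lebesgue) measurable
  have nh [measurable]: "(\<lambda>s. norm (h s)) \<in> borel_measurable lebesgue" by (rule strongly_measurable_norm[OF h])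
  define hn where "hn n = truncate (real n) h" for n
  note hn = strongly_measurable_truncate[OF h, of "real n" for n, folded hn_def]
  have hn0: "hn n s = 0" if "s \<le> 0" for n s using h0[OF that] by (simp add: hn_def truncate_def)
  have hnb: "norm (hn n s) \<le> real n" "norm (hn n s) \<le> norm (h s)" for n s
    unfolding hn_def by (auto simp: truncate_def)
  note hnlim = tendsto_truncate[of h s for s, folded hn_def]
  define un where "un n = conv l (hn n)" for n
  have hnb': "\<exists>C. \<forall>s<T. norm (hn n s) \<le> C" for n T using hnb(1) by blast
  note cb = conv_locally_bounded[OF l hn hn0 hnb']
  have un: "un n s \<bullet> e = rconv l (\<lambda>s. hn n s \<bullet> e) s" for n s e unfolding un_def by (rule cb(2))
  have Qbound: "norm (un n s) \<le> rconv l (\<lambda>s. norm (h s)) s" and unlim: "(\<lambda>n. un n s) \<longlonglongrightarrow> u s"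
    if i: "rconv_integrable l (\<lambda>r. norm (h r)) s" and us: "\<And>e. u s \<bullet> e = rconv l (\<lambda>s. h s \<bullet> e) s" for n s
    unfolding un_def hn_def by (rule conv_truncate(1)[OF l h h0 i], simp) (rule conv_truncate(2)[where X = "u s", OF l h h0 i us], simp)
  have ineq: "\<psi> (un n t) \<le> rconv l (\<lambda>s. hn n s \<bullet> p (un n s)) t" for n
    by (rule convex_ineq_bounded[OF sc \<psi>0 hn hn0 hnb(1) un])
  define Q where "Q s = rconv l (\<lambda>s. norm (h s)) s" for s
  \<comment> \<open>Dominating function: the truncated solutions are bounded by \<open>Q\<close>, so
    their gradients are bounded by |p 0| + \<Lambda> Q. The hypothesis \<open>dom\<close> is
    integrability of the second term.\<close>
  define W where "W s = l (t - s) * norm (h s) * norm (p 0) + l (t - s) * (norm (h s) * Q s) * \<Lambda>" for s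
  have W: "integrable lebesgue W" unfolding W_def using it dom by (intro Bochner_Integration.integrable_add integrable_mult_left) (auto
      simp: Q_def[abs_def])
  have mgn: "(\<lambda>s. l (t - s) * (hn n s \<bullet> p (un n s))) \<in> borel_measurable lebesgue" for n
  proof -
    have "continuous_on UNIV (\<lambda>s. p (un n s))" unfolding un_def
      by (rule continuous_on_compose2[OF continuous_p cb(3)]) auto
    then have [measurable]: "(\<lambda>s. hn n s \<bullet> p (un n s)) \<in> borel_measurable lebesgue"
      by (intro strongly_measurable_inner hn strongly_measurable_continuous)
    show ?thesis by measurable
  qed
  have limg: "AE s in lebesgue. (\<lambda>n. l (t - s) * (hn n s \<bullet> p (un n s))) \<longlonglongrightarrow> l (t - s) * (h s \<bullet> p (u s))"
    using AE
  proof eventually_elim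
    case (elim s)
    then have "(\<lambda>n. un n s) \<longlonglongrightarrow> u s" by (intro unlim) auto
    then have "(\<lambda>n. p (un n s)) \<longlonglongrightarrow> p (u s)" by (intro continuous_on_tendsto_compose[OF continuous_p]) auto
    then show ?case by (intro tendsto_intros hnlim)
  qed
  have bnd: "AE s in lebesgue. norm (l (t - s) * (hn n s \<bullet> p (un n s))) \<le> W s" for n
    using AE
  proof eventually_elim
    case (elim s)
    then have "norm (un n s) \<le> Q s" unfolding Q_def by (intro Qbound) auto
    then have "norm (p (un n s)) \<le> norm (p 0) + \<Lambda> * Q s"
      using grad_lipschitz[of "un n s" 0] norm_triangle_ineq2[of "p (un n s)" "p 0"] mult_left_mono[OF _ \<Lambda>_nonneg, of "norm (un n s)" "Q s"]
      by simp
    then have "\<bar>hn n s \<bullet> p (un n s)\<bar> \<le> norm (h s) * (norm (p 0) + \<Lambda> * Q s)"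
      by (intro order_trans[OF Cauchy_Schwarz_ineq2] mult_mono hnb) auto
    then have "l (t - s) * \<bar>hn n s \<bullet> p (un n s)\<bar> \<le> l (t - s) * (norm (h s) * (norm (p 0) + \<Lambda> * Q s))"
      using L(3) by (rule mult_left_mono)
    then show ?case using L(3) by (simp add: W_def abs_mult algebra_simps)
  qed
  have mg: "(\<lambda>s. l (t - s) * (h s \<bullet> p (u s))) \<in> borel_measurable lebesgue"
    by (rule borel_measurable_AE_lim[OF mgn limg])
  show "rconv_integrable l (\<lambda>s. h s \<bullet> p (u s)) t"
    by (rule integrable_dominated_convergence[OF mg mgn W limg bnd])
  have "(\<lambda>n. rconv l (\<lambda>s. hn n s \<bullet> p (un n s)) t) \<longlonglongrightarrow> rconv l (\<lambda>s. h s \<bullet> p (u s)) t"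
    unfolding rconv_def by (rule integral_dominated_convergence[OF mg mgn W limg bnd])
  moreover have "(\<lambda>n. \<psi> (un n t)) \<longlonglongrightarrow> \<psi> (u t)"
    by (intro continuous_on_tendsto_compose[OF continuous_\<psi>] unlim it ut) auto
  ultimately show "\<psi> (u t) \<le> rconv l (\<lambda>s. h s \<bullet> p (u s)) t"
    using ineq by (intro LIMSEQ_le) auto
qed

end

section \<open>Volterra inequalities and equations\<close>

text \<open>In the norm weighted by \<open>exp (- \<omega> t)\<close>, convolution with \<open>c a\<close> becomes a contraction for
  large \<open>\<omega>\<close>.\<close>

lemma exp_weight:
  assumes a: "mono_kernel a" and c: "0 \<le> c"
  shows "\<exists>\<omega>\<ge>0. \<forall>y S t. t < T \<and> y \<in> borel_measurable lebesgue \<and> (\<forall>s\<le>0. y s = 0) \<and>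
      (\<forall>s<t. 0 \<le> y s \<and> y s \<le> S * exp (\<omega> * s))
     \<longrightarrow> c * rconv a y t \<le> S / 2 * exp (\<omega> * t)"
proof -
  note A = mono_kernelD[OF a]
  have [measurable]: "a \<in> borel_measurable borel" by fact
  \<comment> \<open>The operator norm of the convolution in the weighted norm on times below
    \<open>T\<close> is at most this truncated Laplace transform, which tends to 0 as \<omega>
    grows; \<omega> is then chosen with c J(\<omega>) < 1/2.\<close>
  define J where "J \<omega> = (\<integral>s. exp (- \<omega> * s) * (indicator {..<T} s * a s) \<partial>lebesgue)" for \<omega>
  have mJ: "(\<lambda>s. exp (- \<omega> * s) * (indicator {..<T} s * a s)) \<in> borel_measurable lebesgue" for \<omega>
    by (rule borel_imp_lebesgue) measurable
  have bJ: "norm (exp (- \<omega> * s) * (indicator {..<T} s * a s)) \<le> indicator {..<T} s * a s" if "0 \<le> \<omega>" for \<omega> s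
  proof (cases "s \<le> 0")
    case False
    then have "exp (- (\<omega> * s)) \<le> 1" using that by simp
    then show ?thesis using A(3)[of s] by (auto simp: abs_mult indicator_def intro: mult_left_le_one_le)
  qed (simp add: A(5))
  have iJ: "integrable lebesgue (\<lambda>s. exp (- \<omega> * s) * (indicator {..<T} s * a s))" if "0 \<le> \<omega>" for \<omega>
    by (rule Bochner_Integration.integrable_bound[OF locint_integrable[OF A(1), of T] mJ])
      (rule AE_I2, rule order_trans[OF bJ[OF that]], simp)
  have "(\<lambda>n. J (real n)) \<longlonglongrightarrow> (\<integral>s. 0 \<partial>(lebesgue::real measure))" unfolding J_def
  proof (rule integral_dominated_convergence[OF _ mJ locint_integrable[OF A(1), of T]])
    show "AE s in lebesgue. (\<lambda>n. exp (- real n * s) * (indicator {..<T} s * a s)) \<longlonglongrightarrow> 0"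
    proof (intro AE_I2)
      fix s :: real
      show "(\<lambda>n. exp (- real n * s) * (indicator {..<T} s * a s)) \<longlonglongrightarrow> 0"
      proof (cases "s \<le> 0")
        case False
        have "(\<lambda>n. (exp (- s)) ^ n) \<longlonglongrightarrow> 0" using False by (intro LIMSEQ_power_zero) simp
        then have "(\<lambda>n. exp (- real n * s)) \<longlonglongrightarrow> 0" by (simp add: exp_of_nat_mult[symmetric])
        then show ?thesis by (rule tendsto_mult_left_zero)
      qed (simp add: A(5))
    qed
    show "AE s in lebesgue. norm (exp (- real n * s) * (indicator {..<T} s * a s)) \<le> indicator {..<T} s * a s" for n
      using bJ[of "real n"] by simp
  qed simp
  then have "(\<lambda>n. c * J (real n)) \<longlonglongrightarrow> c * 0" by (intro tendsto_intros) simp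
  then have "\<forall>\<^sub>F n in sequentially. c * J (real n) < 1 / 2" by (intro order_tendstoD(2)) auto
  then obtain n where n: "c * J (real n) < 1 / 2" by (auto simp: eventually_sequentially)
  define \<omega> where "\<omega> = real n"
  show ?thesis
  proof (intro exI[of _ \<omega>] conjI allI impI)
    show "0 \<le> \<omega>" by (simp add: \<omega>_def)
    fix y S t
    assume *: "t < T \<and> y \<in> borel_measurable lebesgue \<and> (\<forall>s\<le>0. y s = 0) \<and> (\<forall>s<t. 0 \<le> y s \<and> y
        s \<le> S * exp (\<omega> * s))"
    \<comment> \<open>The sign of \<open>S\<close> is read off from the two-sided bound on
      \<open>y\<close> at one earlier time.\<close>
    then have "0 \<le> S * exp (\<omega> * (t - 1))" by (meson less_add_one diff_less_eq order_trans)
    then have S0: "0 \<le> S" by (simp add: zero_le_mult_iff)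
    have ub: "\<bar>y s\<bar> \<le> S * exp (\<omega> * t)" if "s < t" for s
    proof -
      have "S * exp (\<omega> * s) \<le> S * exp (\<omega> * t)" using that S0 by (intro mult_left_mono) (auto simp: \<omega>_def intro:
          mult_left_mono)
      with * that show ?thesis by (smt (verit))
    qed
    have "rconv a y t = (\<integral>s. y (t - s) * a s \<partial>lebesgue)" by (simp add: rconv_commute[of a] rconv_def[of y])
    also have "\<dots> \<le> (\<integral>s. (S * exp (\<omega> * t)) * (exp (- \<omega> * s) * (indicator {..<T} s * a s)) \<partial>lebesgue)"
    proof (rule integral_mono)
      show "rconv_integrable y a t"
        by (rule rconv_bounded_integrable(2)[OF a, where C = "S * exp (\<omega> * t)"]) (use * ub in auto)
      show "integrable lebesgue (\<lambda>s. (S * exp (\<omega> * t)) * (exp (- \<omega> * s) * (indicator {..<T} s * a s)))"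
        by (intro integrable_mult_right iJ) (simp add: \<omega>_def)
      fix s
      show "y (t - s) * a s \<le> (S * exp (\<omega> * t)) * (exp (- \<omega> * s) * (indicator {..<T} s * a s))"
      proof (cases "s \<le> 0 \<or> t \<le> s")
        case True
        then show ?thesis using A(5)[of s] * S0 A(3)[of s] by auto
      next
        case False
        then have "y (t - s) \<le> S * exp (\<omega> * (t - s))" using * by auto
        then have "y (t - s) * a s \<le> S * exp (\<omega> * (t - s)) * a s" using A(3) by (rule mult_right_mono)
        also have "S * exp (\<omega> * (t - s)) = S * exp (\<omega> * t) * exp (- \<omega> * s)" by (simp add: right_diff_distrib exp_diff
            exp_minus field_simps)
        finally show ?thesis using False * by simp
      qed
    qed
    also have "\<dots> = S * exp (\<omega> * t) * J \<omega>" by (simp add: J_def)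
    finally have "c * rconv a y t \<le> c * (S * exp (\<omega> * t) * J \<omega>)" using c by (rule mult_left_mono)
    also have "\<dots> = (S * exp (\<omega> * t)) * (c * J \<omega>)" by simp
    also have "\<dots> \<le> (S * exp (\<omega> * t)) * (1 / 2)" using n S0 by (intro mult_left_mono) (auto simp: \<omega>_def)
    finally show "c * rconv a y t \<le> S / 2 * exp (\<omega> * t)" by simp
  qed
qed

text \<open>The qualitative bound \<open>Y\<close> never enters an estimate; it makes the weighted
  supremum of \<open>y\<close> finite, so that half of it can be absorbed.\<close>

definition volterra_subsolution ::
    "(real \<Rightarrow> real) \<Rightarrow> real \<Rightarrow> real \<Rightarrow> real \<Rightarrow> (real \<Rightarrow> real)
        \<Rightarrow> bool" where
  "volterra_subsolution a c T b y \<longleftrightarrow> 0 \<le> b \<and> y \<in> borel_measurable lebesgue \<and> (\<forall>s\<le>0. y s = 0) \<and>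
     (\<forall>s<T. 0 \<le> y s) \<and> (\<exists>Y. \<forall>s<T. y s \<le> Y) \<and> (\<forall>t. 0 < t \<and> t < T \<longrightarrow> y
         t \<le> b + c * rconv a y t)"

text \<open>The weighted supremum \<open>S\<close> satisfies \<open>S \<le> b + S / 2\<close>, hence
  \<open>S \<le> 2 * b\<close>. The order of quantifiers matters: \<open>E\<close> depends on the
  kernel, on \<open>c\<close> and on \<open>T\<close> only, so it serves all approximate solutions
  at once.\<close>

lemma volterra_gronwall:
  assumes a: "mono_kernel a" and c: "0 \<le> c"
  shows "\<exists>E\<ge>0. \<forall>y b t. volterra_subsolution a c T b y \<longrightarrow> t < T \<longrightarrow> y t \<le> E * b"
proof -
  obtain \<omega> where \<omega>: "\<omega> \<ge> 0" and w: "\<And>y S t. t < T \<Longrightarrow> y \<in> borel_measurable lebesgue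
      \<Longrightarrow> \<forall>s\<le>0. y s = 0
     \<Longrightarrow> \<forall>s<t. 0 \<le> y s \<and> y s \<le> S * exp (\<omega> * s) \<Longrightarrow> c * rconv a y t \<le> S / 2 *
         exp (\<omega> * t)"
    using exp_weight[OF a c, of T] by metis
  show ?thesis
  proof (intro exI[of _ "2 * exp (\<omega> * \<bar>T\<bar>)"] conjI allI impI)
    fix y b t
    assume "volterra_subsolution a c T b y" and t: "t < T"
    note * = this(1)[unfolded volterra_subsolution_def]
    define Z where "Z = (\<lambda>s. exp (- \<omega> * s) * y s) ` {..<T}"
    obtain Y where Y: "\<And>s. s < T \<Longrightarrow> y s \<le> Y" using * by blast
    have "exp (- \<omega> * s) * y s \<le> max Y 0" if "s < T" for s
    proof (cases "s \<le> 0")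
      case False
      then have "exp (- \<omega> * s) \<le> 1" using \<omega> by simp
      then have "exp (- \<omega> * s) * y s \<le> 1 * y s" using * that by (intro mult_right_mono) auto
      then show ?thesis using Y[OF that] by simp
    qed (use * in auto)
    then have bdd: "bdd_above Z" unfolding Z_def by (intro bdd_aboveI2[of _ _ "max Y 0"]) auto
    define S where "S = Sup Z"
    have le: "exp (- \<omega> * s) * y s \<le> S" if "s < T" for s
      unfolding S_def using bdd that by (intro cSup_upper) (auto simp: Z_def)
    then have le': "y s \<le> S * exp (\<omega> * s)" if "s < T" for s
    proof -
      have "exp (\<omega> * s) * (exp (- \<omega> * s) * y s) \<le> exp (\<omega> * s) * S" using le[OF that] by (intro mult_left_mono) auto
      moreover have "exp (\<omega> * s) * (exp (- \<omega> * s) * y s) = y s" by (simp add: exp_minus)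
      ultimately show ?thesis by (simp only: mult.commute[of S])
    qed
    have S0: "0 \<le> S" using le[of "min 0 t"] t * by auto
    have "exp (- \<omega> * s) * y s \<le> b + S / 2" if s: "s < T" for s
    proof (cases "s \<le> 0")
      case False
      have "c * rconv a y s \<le> S / 2 * exp (\<omega> * s)" using * s le' by (intro w) auto
      then have "y s \<le> b + S / 2 * exp (\<omega> * s)" using * s False by (smt (verit))
      then have "exp (- \<omega> * s) * y s \<le> exp (- \<omega> * s) * (b + S / 2 * exp (\<omega> * s))" by (intro mult_left_mono) auto
      also have "\<dots> = exp (- \<omega> * s) * b + S / 2" by (simp add: distrib_left exp_minus)
      also have "\<dots> \<le> 1 * b + S / 2" using * False \<omega> by (intro add_right_mono mult_right_mono) auto
      finally show ?thesis by simp
    qed (use * S0 in auto)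
    then have "S \<le> b + S / 2" unfolding S_def Z_def using t by (intro cSup_least) auto
    then have S2: "S \<le> 2 * b" by simp
    have "y t \<le> S * exp (\<omega> * t)" using le'[OF t] .
    also have "\<dots> \<le> (2 * b) * exp (\<omega> * \<bar>T\<bar>)"
      using S2 * t \<omega> by (intro mult_mono) (auto intro: mult_left_mono)
    finally show "y t \<le> 2 * exp (\<omega> * \<bar>T\<bar>) * b" by (simp add: mult_ac)
  qed auto
qed

text \<open>Picard iteration starting from \<open>b\<close>. On times below \<open>T\<close> the
  difference of successive iterates decays like 2^-n in an exponentially weighted norm; the weight
  depends on \<open>T\<close>, the iteration does not, so one limit serves all times.\<close>

lemma volterra_solution:
  fixes b :: "real \<Rightarrow> 'h::{real_inner,banach}"
  assumes a: "mono_kernel a" and b: "continuous_on UNIV b" and b0: "\<And>t. t \<le> 0 \<Longrightarrow> b t = u0"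
    and G: "\<Lambda>-lipschitz_on UNIV G"
  shows "\<exists>u. continuous_on UNIV u \<and> (\<forall>t\<le>0. u t = u0) \<and> (\<forall>t. u t = b t + conv a (zext (\<lambda>s. G (u s))) t)"
proof -
  note A = mono_kernelD[OF a]
  have \<Lambda>: "0 \<le> \<Lambda>" and GL: "norm (G x - G y) \<le> \<Lambda> * norm (x - y)" for x y
    using G by (auto simp: lipschitz_on_def dist_norm)
  have cG: "continuous_on UNIV G" by (rule lipschitz_on_continuous_on[OF G])
  define \<Phi> where "\<Phi> u t = b t + conv a (zext (\<lambda>s. G (u s))) t" for u t
  have sm: "strongly_measurable lebesgue (zext (\<lambda>s. G (u s)))" if "continuous_on UNIV u" for u
    by (intro strongly_measurable_zext strongly_measurable_continuous continuous_on_compose2[OF cG that]) auto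
  have zb: "\<exists>C. \<forall>s<T. norm (zext (\<lambda>s. G (u s)) s) \<le> C" if u: "continuous_on UNIV u" "\<And>t. t \<le> 0
      \<Longrightarrow> u t = u0" for u T
  proof -
    have "continuous_on UNIV (\<lambda>s. G (u s))" by (intro continuous_on_compose2[OF cG u(1)]) auto
    then obtain C where "0 \<le> C" "\<forall>s\<le>T. norm (G (u s)) \<le> C"
      using continuous_locally_bounded[of "\<lambda>s. G (u s)" "G u0" T] by (auto simp: u(2))
    then show ?thesis by (intro exI[of _ C]) (auto simp: zext_def)
  qed
  note cb = conv_locally_bounded[OF a sm _ zb]
  have \<Phi>c: "continuous_on UNIV (\<Phi> u)" and \<Phi>0: "t \<le> 0 \<Longrightarrow> \<Phi> u t = u0"
    if u: "continuous_on UNIV u" "\<And>t. t \<le> 0 \<Longrightarrow> u t = u0" for u t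
    using cb(3)[OF u(1) _ u] conv_nonpos[OF a sm[OF u(1)]] b0 b by (auto simp: \<Phi>_def[abs_def] intro!: continuous_on_add)
  have \<Phi>d: "norm (\<Phi> u t - \<Phi> v t) \<le> \<Lambda> * rconv a (\<lambda>s. norm (u s - v s)) t"
    if u: "continuous_on UNIV u" "\<And>t. t \<le> 0 \<Longrightarrow> u t = u0" and v: "continuous_on UNIV v" "\<And>t. t \<le> 0
        \<Longrightarrow> v t = u0" for u v t
  proof -
    have "continuous_on UNIV (\<lambda>s. norm (u s - v s))" using u v by (intro continuous_intros)
    moreover obtain C where "\<forall>s\<le>t. norm (norm (u s - v s)) \<le> C"
      using continuous_locally_bounded[of "\<lambda>s. norm (u s - v s)" 0 t] calculation u(2) v(2) by auto
    ultimately have iuv: "integrable lebesgue (\<lambda>s. a (t - s) * norm (u s - v s))"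
      by (intro rconv_bounded_integrable(1)[OF a, where C = C] borel_imp_lebesgue borel_measurable_continuous_onI) (auto simp: u(2) v(2))
    have "norm (\<Phi> u t - \<Phi> v t) = norm (conv a (zext (\<lambda>s. G (u s))) t - conv a (zext (\<lambda>s. G (v s))) t)" by (simp
        add: \<Phi>_def)
    also have "\<dots> \<le> rconv a (\<lambda>s. norm (zext (\<lambda>s. G (u s)) s - zext (\<lambda>s. G (v s)) s)) t"
      by (rule conv_norm_diff(1)[OF a sm[OF u(1)] sm[OF v(1)] cb(1)[OF u(1) _ u] cb(1)[OF v(1) _ v] cb(2)[OF u(1) _ u] cb(2)[OF v(1) _ v]]) auto
    also have "\<dots> \<le> rconv a (\<lambda>s. \<Lambda> * norm (u s - v s)) t"
    proof (rule rconv_mono[OF a])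
      show "integrable lebesgue (\<lambda>s. a (t - s) * norm (zext (\<lambda>s. G (u s)) s - zext (\<lambda>s. G (v s)) s))"
        by (rule conv_norm_diff(2)[OF a sm[OF u(1)] sm[OF v(1)] cb(1)[OF u(1) _ u] cb(1)[OF v(1) _ v] cb(2)[OF u(1) _ u] cb(2)[OF v(1) _ v]]) auto
      show "rconv_integrable a (\<lambda>s. \<Lambda> * norm (u s - v s)) t"
        using integrable_mult_right[OF iuv, of \<Lambda>] by (simp add: mult_ac)
      show "norm (zext (\<lambda>s. G (u s)) s - zext (\<lambda>s. G (v s)) s) \<le> \<Lambda> * norm (u s - v s)" for s
        using GL \<Lambda> by (auto simp: zext_def)
    qed
    also have "\<dots> = \<Lambda> * rconv a (\<lambda>s. norm (u s - v s)) t" by (simp add: rconv_def mult.left_commute)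
    finally show ?thesis .
  qed
  define U where "U n = (\<Phi> ^^ n) b" for n
  have US: "U (Suc n) = \<Phi> (U n)" for n by (simp add: U_def)
  have U: "continuous_on UNIV (U n) \<and> (\<forall>t\<le>0. U n t = u0)" for n
  proof (induction n)
    case 0 then show ?case using b b0 by (simp add: U_def)
  next
    case (Suc n) then show ?case using \<Phi>c[of "U n"] \<Phi>0[of "U n"] by (simp add: US)
  qed
  define D where "D n t = U (Suc n) t - U n t" for n t
  have cD: "continuous_on UNIV (\<lambda>t. norm (D n t))" for n unfolding D_def using U by (intro continuous_intros) auto
  have D0: "D n t = 0" if "t \<le> 0" for n t using U that by (simp add: D_def)
  have DS: "norm (D (Suc n) t) \<le> \<Lambda> * rconv a (\<lambda>s. norm (D n s)) t" for n t
    using \<Phi>d[of "U (Suc n)" "U n" t] U by (simp add: D_def US[symmetric])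
  have geo: "\<exists>C\<ge>0. \<forall>t<T. \<forall>n. norm (D n t) \<le> C * (1/2)^n" for T
  proof -
    obtain \<omega> where \<omega>: "\<omega> \<ge> 0" and w: "\<And>y S t. t < T \<Longrightarrow> y \<in> borel_measurable lebesgue
        \<Longrightarrow> \<forall>s\<le>0. y s = 0
       \<Longrightarrow> \<forall>s<t. 0 \<le> y s \<and> y s \<le> S * exp (\<omega> * s) \<Longrightarrow> \<Lambda> * rconv a y t \<le>
           S / 2 * exp (\<omega> * t)"
      using exp_weight[OF a \<Lambda>, of T] by metis
    obtain C0 where C0: "0 \<le> C0" "\<forall>s\<le>T. norm (norm (D 0 s)) \<le> C0"
      using continuous_locally_bounded[OF cD[of 0], of 0 T] D0 by auto
    have "\<forall>t<T. norm (D n t) \<le> C0 * (1/2)^n * exp (\<omega> * t)" for n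
    proof (induction n)
      case 0
      have "norm (D 0 t) \<le> C0 * exp (\<omega> * t)" if "t < T" for t
      proof (cases "t \<le> 0")
        case False
        then have "C0 * 1 \<le> C0 * exp (\<omega> * t)" using C0 \<omega> by (intro mult_left_mono) auto
        moreover have "norm (D 0 t) \<le> C0" using C0(2) that by simp
        ultimately show ?thesis by simp
      qed (use C0 D0 in auto)
      then show ?case by simp
    next
      case (Suc n)
      show ?case
      proof (intro allI impI)
        fix t assume t: "t < T"
        have "\<Lambda> * rconv a (\<lambda>s. norm (D n s)) t \<le> (C0 * (1/2)^n) / 2 * exp (\<omega> * t)"
          by (rule w[OF t]) (use Suc t D0 cD in \<open>auto intro!: borel_imp_lebesgue borel_measurable_continuous_onI\<close>)
        with DS[of n t] show "norm (D (Suc n) t) \<le> C0 * (1/2)^Suc n * exp (\<omega> * t)" by simp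
      qed
    qed
    then have *: "norm (D n t) \<le> C0 * (1/2)^n * exp (\<omega> * t)" if "t < T" for n t using that by blast
    have "norm (D n t) \<le> (C0 * exp (\<omega> * \<bar>T\<bar>)) * (1/2)^n" if "t < T" for n t
    proof -
      have "\<omega> * t \<le> \<omega> * \<bar>T\<bar>" using that \<omega> by (intro mult_left_mono) auto
      then have "C0 * (1/2)^n * exp (\<omega> * t) \<le> C0 * (1/2)^n * exp (\<omega> * \<bar>T\<bar>)" using C0 by (intro mult_left_mono) auto
      with *[OF that, of n] show ?thesis by (simp add: mult_ac)
    qed
    then show ?thesis using C0 by (intro exI[of _ "C0 * exp (\<omega> * \<bar>T\<bar>)"]) auto
  qed
  \<comment> \<open>The limit is written as a series of successive differences, to which the
    Weierstrass M-test applies.\<close>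
  define u where "u t = b t + (\<Sum>n. D n t)" for t
  have UD: "U n t = b t + (\<Sum>i<n. D i t)" for n t
    by (induction n) (auto simp: U_def D_def)
  have ul: "uniform_limit {..<T} U u sequentially" for T
  proof -
    obtain C where C: "0 \<le> C" "\<forall>t<T. \<forall>n. norm (D n t) \<le> C * (1/2)^n" using geo by blast
    have "uniform_limit {..<T} (\<lambda>n x. \<Sum>i<n. D i x) (\<lambda>x. \<Sum>i. D i x) sequentially"
      by (rule Weierstrass_m_test[where M = "\<lambda>n. C * (1/2)^n"]) (use C in \<open>auto intro: summable_mult summable_geometric\<close>)
    then have "uniform_limit {..<T} (\<lambda>n x. b x + (\<Sum>i<n. D i x)) (\<lambda>x. b x + (\<Sum>i. D i x)) sequentially"
      by (intro uniform_limit_add uniform_limit_const)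
    then show ?thesis by (simp add: UD[abs_def] u_def[abs_def])
  qed
  have cu: "continuous_on UNIV u"
  proof -
    have "continuous_on {..<T} u" for T
      by (rule uniform_limit_theorem[OF _ ul]) (use U in \<open>auto intro!: always_eventually continuous_on_subset[OF conjunct1[OF U]]\<close>)
    then have "isCont u x" for x using continuous_on_eq_continuous_at[of "{..<x+1}" u] by auto
    then show ?thesis by (simp add: continuous_at_imp_continuous_on)
  qed
  have u00: "u t = u0" if "t \<le> 0" for t using D0[OF that] b0[OF that] by (simp add: u_def)
  have E: "u t = \<Phi> u t" for t
  proof (rule LIMSEQ_unique)
    have lim: "(\<lambda>n. U n t) \<longlonglongrightarrow> u t" by (rule tendsto_uniform_limitI[OF ul[of "t + 1"]]) simp
    then show "(\<lambda>n. U (Suc n) t) \<longlonglongrightarrow> u t" by (rule LIMSEQ_Suc)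
    have "(\<lambda>n. \<Phi> (U n) t - \<Phi> u t) \<longlonglongrightarrow> 0"
    proof (rule LIMSEQ_I)
      fix r :: real assume r: "0 < r"
      \<comment> \<open>A uniform error \<epsilon> before time \<open>t\<close> is amplified by at
        most \<open>\<Lambda> * cumul a t\<close>; the added 1 keeps the quotient defined and the
        final inequality strict.\<close>
      define \<epsilon> where "\<epsilon> = r / (\<Lambda> * cumul a t + 1)"
      have pos: "0 < \<Lambda> * cumul a t + 1" using \<Lambda> cumul_nonneg[of a t] A(3) by (simp add: add_nonneg_pos)
      then have \<epsilon>: "0 < \<epsilon>" using r by (simp add: \<epsilon>_def)
      obtain N where N: "\<And>n s. n \<ge> N \<Longrightarrow> s < t \<Longrightarrow> dist (U n s) (u s) < \<epsilon>"
        using uniform_limitD[OF ul[of t] \<epsilon>] by (auto simp: eventually_sequentially)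
      have "norm (\<Phi> (U n) t - \<Phi> u t - 0) < r" if "n \<ge> N" for n
      proof -
        have c: "continuous_on UNIV (\<lambda>s. norm (U n s - u s))" using U cu by (intro continuous_intros) auto
        have z: "norm (U n s - u s) = 0" if "s \<le> 0" for s using U u00 that by simp
        have "rconv a (\<lambda>s. norm (U n s - u s)) t \<le> rconv a (\<lambda>s. \<epsilon> * heaviside s) t"
        proof (rule rconv_mono[OF a])
          have b: "\<bar>norm (U n s - u s)\<bar> \<le> \<epsilon>" if "s < t" for s using N[OF \<open>n \<ge> N\<close> that] by (simp
              add: dist_norm)
          show "integrable lebesgue (\<lambda>s. a (t - s) * norm (U n s - u s))"
            by (rule rconv_bounded_integrable(1)[OF a _ z b]) (use c in \<open>auto intro!: borel_imp_lebesgue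
                borel_measurable_continuous_onI\<close>)
          show "rconv_integrable a (\<lambda>s. \<epsilon> * heaviside s) t"
            by (rule rconv_bounded_integrable(1)[OF a, where C = \<epsilon>]) (use \<epsilon> in \<open>auto simp: indicator_def[of "{0<..}"]\<close>)
          show "norm (U n s - u s) \<le> \<epsilon> * heaviside s" if "s < t" for s
            using b[OF that] z[of s] by (cases "s \<le> 0") auto
        qed
        also have "\<dots> = \<epsilon> * cumul a t" by (simp add: rconv_heaviside[symmetric] rconv_def mult.left_commute)
        finally have "\<Lambda> * rconv a (\<lambda>s. norm (U n s - u s)) t \<le> \<Lambda> * (\<epsilon> * cumul a t)" using \<Lambda> by
            (rule mult_left_mono)
        also have "\<dots> < \<epsilon> * (\<Lambda> * cumul a t + 1)" using \<epsilon> by (simp add: algebra_simps)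
        also have "\<dots> = r" using pos by (simp add: \<epsilon>_def)
        finally show ?thesis using \<Phi>d[of "U n" u t] U cu u00 by simp
      qed
      then show "\<exists>no. \<forall>n\<ge>no. norm (\<Phi> (U n) t - \<Phi> u t - 0) < r" by blast
    qed
    then show "(\<lambda>n. U (Suc n) t) \<longlonglongrightarrow> \<Phi> u t" unfolding US by (rule LIM_zero_cancel)
  qed
  show ?thesis
    by (intro exI[of _ u] conjI allI impI cu u00) (assumption, rule E[unfolded \<Phi>_def])
qed

section \<open>Moreau--Yosida regularization\<close>

locale convex_lsc =
  fixes \<phi> :: "'h::{real_inner,banach} \<Rightarrow> ereal"
  assumes proper: "proper_functional \<phi>" and lsc: "lsc_functional \<phi>" and cvx: "convex_functional \<phi>"
begin

text \<open>Outside \<open>D\<close> the value \<open>R w\<close> is \<open>0\<close>.\<close>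

definition R :: "'h \<Rightarrow> real" where "R w = real_of_ereal (\<phi> w)"

abbreviation D :: "'h set" where "D \<equiv> eff_dom \<phi>"

lemma \<phi>_eq: "w \<in> D \<Longrightarrow> \<phi> w = ereal (R w)"
  using proper by (auto simp: proper_functional_def eff_dom_def R_def ereal_real)

lemma D_iff: "w \<in> D \<longleftrightarrow> \<phi> w < \<infinity>"
  by (simp add: eff_dom_def)

lemma D_I: "\<phi> w \<le> ereal c \<Longrightarrow> w \<in> D"
  unfolding D_iff by (erule order.strict_trans1) simp

lemma convexD:
  assumes "x \<in> D" "y \<in> D" "0 < a" "a < 1"
  shows "(1 - a) *\<^sub>R x + a *\<^sub>R y \<in> D" "R ((1 - a) *\<^sub>R x + a *\<^sub>R y) \<le> (1 - a) * R x + a * R y"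
proof -
  have *: "\<phi> ((1 - a) *\<^sub>R x + a *\<^sub>R y) \<le> ereal ((1 - a) * R x + a * R y)"
  proof -
    have "\<phi> ((1 - a) *\<^sub>R x + a *\<^sub>R y) \<le> ereal (1 - a) * \<phi> x + ereal a * \<phi> y"
      using cvx assms(3,4) unfolding convex_functional_def by blast
    then show ?thesis by (simp add: \<phi>_eq[OF assms(1)] \<phi>_eq[OF assms(2)])
  qed
  then show d: "(1 - a) *\<^sub>R x + a *\<^sub>R y \<in> D" by (rule D_I)
  show "R ((1 - a) *\<^sub>R x + a *\<^sub>R y) \<le> (1 - a) * R x + a * R y" using * \<phi>_eq[OF d] by simp
qed

lemma lsc_limit:
  assumes "v \<longlonglongrightarrow> z" "\<And>n. \<phi> (v n) \<le> ereal (b n)" "b \<longlonglongrightarrow> \<beta>"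
  shows "\<phi> z \<le> ereal \<beta>"
proof (rule ccontr)
  assume "\<not> \<phi> z \<le> ereal \<beta>"
  then have "ereal \<beta> < \<phi> z" by simp
  then obtain c where c: "ereal \<beta> < c" "c < \<phi> z" using dense by blast
  have "\<forall>\<^sub>F y in nhds z. c < \<phi> y" using lsc c(2) by (simp add: lsc_functional_def)
  then have "\<forall>\<^sub>F n in sequentially. c < \<phi> (v n)" using assms(1) by (rule eventually_compose_filterlim)
  moreover have "(\<lambda>n. ereal (b n)) \<longlonglongrightarrow> ereal \<beta>" using assms(3) by simp
  then have "\<forall>\<^sub>F n in sequentially. ereal (b n) < c" using c(1) by (rule order_tendstoD(2))
  ultimately have "\<forall>\<^sub>F n in sequentially. False"
  proof eventually_elim
    case (elim n) then show ?case using assms(2)[of n] by (metis leD less_trans)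
  qed
  then show False by simp
qed

text \<open>Lower semicontinuity at \<open>x0\<close> bounds \<phi> below by \<open>R x0 - 1\<close>
  on a ball of radius \<open>r\<close>; convexity along the segment from \<open>x0\<close> to
  \<open>v\<close> carries this outward with slope 1/r. The resulting cone plays the part of an
  affine minorant and requires no separation theorem.\<close>

lemma affine_minorant:
  assumes x0: "x0 \<in> D"
  shows "\<exists>r>0. \<forall>v\<in>D. R x0 - 1 - norm (v - x0) / r \<le> R v"
proof -
  have "ereal (R x0 - 1) < \<phi> x0" using \<phi>_eq[OF x0] by simp
  then have "\<forall>\<^sub>F y in nhds x0. ereal (R x0 - 1) < \<phi> y" using lsc unfolding lsc_functional_def by blast
  then obtain d where d: "d > 0" "\<And>y. dist y x0 < d \<Longrightarrow> ereal (R x0 - 1) < \<phi> y"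
    unfolding eventually_nhds_metric by blast
  define r where "r = d / 2"
  have r: "0 < r" using d by (simp add: r_def)
  have near: "R x0 - 1 \<le> R y" if "y \<in> D" "norm (y - x0) \<le> r" for y
    using d(2)[of y] that d(1) \<phi>_eq[OF that(1)] by (simp add: r_def dist_norm)
  show ?thesis
  proof (intro exI[of _ r] conjI ballI r)
    fix v assume v: "v \<in> D"
    show "R x0 - 1 - norm (v - x0) / r \<le> R v"
    proof (cases "norm (v - x0) \<le> r")
      case True
      have "0 \<le> norm (v - x0) / r" using r by simp
      with near[OF v True] show ?thesis by linarith
    next
      case False
      define n where "n = norm (v - x0)"
      \<comment> \<open>This places \<open>y\<close> on the sphere of radius \<open>r\<close> around
        \<open>x0\<close>, where the local bound still holds.\<close>
      define a where "a = r / n"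
      have n: "r < n" using False by (simp add: n_def)
      have a: "0 < a" "a < 1" using r n by (auto simp: a_def)
      define y where "y = (1 - a) *\<^sub>R x0 + a *\<^sub>R v"
      have "y - x0 = a *\<^sub>R (v - x0)" by (simp add: y_def algebra_simps)
      then have "norm (y - x0) = r" using a r n by (simp add: n_def[symmetric]) (simp add: a_def)
      then have "R x0 - 1 \<le> R y" using convexD(1)[OF x0 v a] by (intro near) (auto simp: y_def)
      also have "\<dots> \<le> (1 - a) * R x0 + a * R v" unfolding y_def by (rule convexD(2)[OF x0 v a])
      finally have "a * R x0 - 1 \<le> a * R v" by (simp add: algebra_simps)
      then have "(a * R x0 - 1) / a \<le> R v" using a by (simp add: divide_le_eq mult.commute)
      then have "R x0 - 1 / a \<le> R v" using a by (simp add: diff_divide_distrib)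
      moreover have "1 / a = n / r" by (simp add: a_def)
      ultimately show ?thesis by (simp add: n_def)
    qed
  qed
qed

text \<open>This is the penalized objective as a function of \<open>v\<close>; its minimizer is the
  proximal point and its minimum the Moreau envelope.\<close>

definition moreau :: "real \<Rightarrow> 'h \<Rightarrow> 'h \<Rightarrow> real" where
  "moreau \<theta> x v = R v + (norm (v - x))\<^sup>2 / (2 * \<theta>)"

lemma moreau_bounded_below:
  assumes x0: "x0 \<in> D" and r: "0 < r" and m: "\<forall>v\<in>D. R x0 - 1 - norm (v - x0) / r \<le> R v"
    and v: "v \<in> D" and \<theta>: "0 < \<theta>"
  shows "R x0 - 1 - norm (x - x0) / r - \<theta> / (2 * r\<^sup>2) \<le> moreau \<theta> x v"
proof -
  define n where "n = norm (v - x)"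
  have "norm (v - x0) / r \<le> (n + norm (x - x0)) / r"
    using r norm_triangle_ineq[of "v - x" "x - x0"] by (intro divide_right_mono) (auto simp: n_def)
  \<comment> \<open>Completing the square: n^2 / (2 \<theta>) - n / r is at least -\<theta> / (2
    r^2), so the penalty beats the linear decrease of the cone.\<close>
  moreover have "0 \<le> (n - \<theta> / r)\<^sup>2 / (2 * \<theta>)" using \<theta> by simp
  then have "n / r \<le> n\<^sup>2 / (2 * \<theta>) + \<theta> / (2 * r\<^sup>2)" using \<theta> r by (simp add: power2_eq_square field_simps)
  ultimately show ?thesis using m v unfolding moreau_def n_def[symmetric] by (simp add: add_divide_distrib) force
qed

text \<open>Strong convexity of the objective, from the parallelogram identity for the penalty and
  convexity of \<phi>.\<close>

lemma moreau_midpoint: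
  assumes v: "v \<in> D" and w: "w \<in> D" and \<theta>: "0 < \<theta>"
  shows "(1 - 1/2) *\<^sub>R v + (1/2) *\<^sub>R w \<in> D"
    and "moreau \<theta> x ((1 - 1/2) *\<^sub>R v + (1/2) *\<^sub>R w) + (norm (v - w))\<^sup>2 / (8 * \<theta>) \<le> (moreau \<theta> x v
        + moreau \<theta> x w) / 2"
proof -
  have h: "(0::real) < 1/2" "(1/2::real) < 1" by auto
  show "(1 - 1/2) *\<^sub>R v + (1/2) *\<^sub>R w \<in> D" by (rule convexD(1)[OF v w h])
  have e: "(1 - 1/2) *\<^sub>R v + (1/2) *\<^sub>R w - x = (1/2) *\<^sub>R ((v - x) + (w - x))"
    by (simp add: algebra_simps) (metis scaleR_half_double scaleR_add_right)
  have p: "(norm ((1 - 1/2) *\<^sub>R v + (1/2) *\<^sub>R w - x))\<^sup>2 = (norm (v - x))\<^sup>2 / 2 + (norm (w - x))\<^sup>2 / 2 - (norm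
      (v - w))\<^sup>2 / 4"
  proof -
    have d: "v - w = (v - x) - (w - x)" by simp
    show ?thesis unfolding e unfolding d
      by (simp only: power2_norm_eq_inner inner_add_left inner_add_right inner_diff_left inner_diff_right inner_scaleR_left inner_scaleR_right)
         (simp add: inner_commute field_simps)
  qed
  show "moreau \<theta> x ((1 - 1/2) *\<^sub>R v + (1/2) *\<^sub>R w) + (norm (v - w))\<^sup>2 / (8 * \<theta>) \<le> (moreau \<theta> x v
      + moreau \<theta> x w) / 2"
  proof -
    have "((norm (v - x))\<^sup>2 / 2 + (norm (w - x))\<^sup>2 / 2 - (norm (v - w))\<^sup>2 / 4) / (2 * \<theta>) + (norm (v - w))\<^sup>2
        / (8 * \<theta>)
        = ((norm (v - x))\<^sup>2 / (2 * \<theta>) + (norm (w - x))\<^sup>2 / (2 * \<theta>)) / 2"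
      using \<theta> by (simp add: field_simps)
    then show ?thesis using convexD(2)[OF v w h] unfolding moreau_def p by argo
  qed
qed

text \<open>Near minimizers are close to each other, because the objective at their midpoint cannot
  fall below the infimum. A minimizing sequence is therefore Cauchy and converges strongly, and
  plain lower semicontinuity suffices for the limit.\<close>

lemma prox_exists:
  assumes \<theta>: "0 < \<theta>"
  shows "\<exists>z\<in>D. \<forall>v\<in>D. moreau \<theta> x z \<le> moreau \<theta> x v"
proof -
  obtain x0 where x0: "x0 \<in> D" using proper by (auto simp: proper_functional_def)
  obtain r where r: "0 < r" "\<forall>v\<in>D. R x0 - 1 - norm (v - x0) / r \<le> R v" using affine_minorant[OF x0] by blast
  have bdd: "bdd_below (moreau \<theta> x ` D)"
    using moreau_bounded_below[OF x0 r _ \<theta>] by (intro bdd_belowI2)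
  define m where "m = Inf (moreau \<theta> x ` D)"
  have mle: "m \<le> moreau \<theta> x v" if "v \<in> D" for v unfolding m_def using bdd that by (intro cInf_lower) auto
  have "\<exists>v\<in>D. moreau \<theta> x v < m + 1 / real (Suc n)" for n
    using cInf_lessD[of "moreau \<theta> x ` D" "m + 1 / real (Suc n)"] x0 by (auto simp: m_def)
  then obtain v where v: "\<And>n. v n \<in> D" "\<And>n. moreau \<theta> x (v n) < m + 1 / real (Suc n)" by metis
  have dist: "(norm (v i - v j))\<^sup>2 \<le> 8 * \<theta> / real (Suc N)" if "N \<le> i" "N \<le> j" for i j N
  proof -
    have "m + (norm (v i - v j))\<^sup>2 / (8 * \<theta>) \<le> (moreau \<theta> x (v i) + moreau \<theta> x (v j)) / 2"
      using moreau_midpoint(2)[OF v(1)[of i] v(1)[of j] \<theta>, where x = x]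
        mle[OF moreau_midpoint(1)[OF v(1)[of i] v(1)[of j] \<theta>]] by linarith
    moreover have "1 / real (Suc i) \<le> 1 / real (Suc N)" "1 / real (Suc j) \<le> 1 / real (Suc N)"
      using that by (auto intro!: divide_left_mono)
    ultimately have "(norm (v i - v j))\<^sup>2 / (8 * \<theta>) \<le> 1 / real (Suc N)" using v(2)[of i] v(2)[of j] by argo
    then show ?thesis using \<theta> by (simp add: divide_le_eq mult.commute)
  qed
  have "Cauchy v"
  proof (rule CauchyI)
    fix e :: real assume e: "0 < e"
    obtain N where N: "8 * \<theta> / real (Suc N) < e\<^sup>2"
    proof -
      obtain N where "8 * \<theta> / e\<^sup>2 < real N" using reals_Archimedean2 by blast
      then have "8 * \<theta> < real N * e\<^sup>2" using e by (simp add: divide_less_eq)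
      also have "\<dots> \<le> real (Suc N) * e\<^sup>2" by (intro mult_right_mono) auto
      finally have "8 * \<theta> < real (Suc N) * e\<^sup>2" .
      then show ?thesis by (intro that[of N]) (simp add: divide_less_eq mult.commute del: of_nat_Suc)
    qed
    have "norm (v i - v j) < e" if "N \<le> i" "N \<le> j" for i j
    proof (rule power2_less_imp_less)
      show "(norm (v i - v j))\<^sup>2 < e\<^sup>2" using dist[OF that] N by (rule order.strict_trans1)
    qed (use e in simp)
    then show "\<exists>M. \<forall>m\<ge>M. \<forall>n\<ge>M. norm (v m - v n) < e" by blast
  qed
  then obtain z where z: "v \<longlonglongrightarrow> z" using Cauchy_convergent convergent_def by blast
  \<comment> \<open>The convergent penalty term is moved to the right-hand side, so that lower
    semicontinuity is applied to \<phi> alone.\<close>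
  have "\<phi> z \<le> ereal (m + 0 - (norm (z - x))\<^sup>2 / (2 * \<theta>))"
  proof (rule lsc_limit[OF z])
    show "\<phi> (v n) \<le> ereal (m + 1 / real (Suc n) - (norm (v n - x))\<^sup>2 / (2 * \<theta>))" for n
      using v(2)[of n] \<phi>_eq[OF v(1)[of n]] by (simp add: moreau_def)
    have "(\<lambda>n. 1 / real (Suc n)) \<longlonglongrightarrow> 0" using LIMSEQ_Suc[OF lim_const_over_n[of 1]] by simp
    then show "(\<lambda>n. m + 1 / real (Suc n) - (norm (v n - x))\<^sup>2 / (2 * \<theta>)) \<longlonglongrightarrow> m + 0 - (norm (z -
        x))\<^sup>2 / (2 * \<theta>)"
      using \<theta> by (intro tendsto_intros z) auto
  qed
  then have zD: "z \<in> D" and "moreau \<theta> x z \<le> m"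
    using D_I \<phi>_eq[of z] by (auto simp: moreau_def)
  then show ?thesis using mle order_trans by blast
qed

definition prox :: "real \<Rightarrow> 'h \<Rightarrow> 'h" where
  "prox \<theta> x = (SOME z. z \<in> D \<and> (\<forall>v\<in>D. moreau \<theta> x z \<le> moreau \<theta> x v))"

definition yosida :: "real \<Rightarrow> 'h \<Rightarrow> 'h" where
  "yosida \<theta> x = (1 / \<theta>) *\<^sub>R (x - prox \<theta> x)"

definition envelope :: "real \<Rightarrow> 'h \<Rightarrow> real" where
  "envelope \<theta> x = moreau \<theta> x (prox \<theta> x)"

lemma prox:
  assumes "0 < \<theta>"
  shows "prox \<theta> x \<in> D" "v \<in> D \<Longrightarrow> envelope \<theta> x \<le> moreau \<theta> x v"
  using someI_ex[of "\<lambda>z. z \<in> D \<and> (\<forall>v\<in>D. moreau \<theta> x z \<le> moreau \<theta> x v)"] prox_exists[OF assms, of x]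
  unfolding prox_def[symmetric] envelope_def by auto

lemma prox_eq: "0 < \<theta> \<Longrightarrow> prox \<theta> x = x - \<theta> *\<^sub>R yosida \<theta> x"
  by (simp add: yosida_def)

lemma envelope_eq: "0 < \<theta> \<Longrightarrow> envelope \<theta> x = R (prox \<theta> x) + \<theta> / 2 * (norm (yosida \<theta> x))\<^sup>2"
proof -
  assume \<theta>: "0 < \<theta>"
  have "norm (prox \<theta> x - x) = \<theta> * norm (yosida \<theta> x)" using \<theta> by (simp add: prox_eq)
  then show ?thesis using \<theta> by (simp add: envelope_def moreau_def power2_eq_square)
qed

lemma envelope_le: "0 < \<theta> \<Longrightarrow> x \<in> D \<Longrightarrow> envelope \<theta> x \<le> R x"
  using prox(2)[of \<theta> x x] by (simp add: moreau_def)

text \<open>The minimizer \<open>J\<close> is compared with the points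
  \<open>(1 - a) *\<^sub>R J + a *\<^sub>R v\<close>; after division by \<open>a\<close> the
  remaining error is of order \<open>a\<close>. In other words, \<open>yosida \<theta> x\<close> is
  a subgradient of \<phi> at the proximal point.\<close>

lemma yosida_subgradient:
  assumes \<theta>: "0 < \<theta>" and v: "v \<in> D"
  shows "R (prox \<theta> x) + yosida \<theta> x \<bullet> (v - prox \<theta> x) \<le> R v"
proof -
  define J where "J = prox \<theta> x"
  define N where "N = (norm (v - J))\<^sup>2 / (2 * \<theta>)"
  have JD: "J \<in> D" using prox(1)[OF \<theta>] by (simp add: J_def)
  have N0: "0 \<le> N" using \<theta> by (simp add: N_def)
  have key: "R J - R v + yosida \<theta> x \<bullet> (v - J) \<le> a * N" if a: "0 < a" "a < 1" for a
  proof -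
    define y where "y = (1 - a) *\<^sub>R J + a *\<^sub>R v"
    have "R J + (norm (J - x))\<^sup>2 / (2 * \<theta>) \<le> R y + (norm (y - x))\<^sup>2 / (2 * \<theta>)"
      using prox(2)[OF \<theta> convexD(1)[OF JD v a], of x] by (simp add: envelope_def moreau_def J_def y_def)
    also have "\<dots> \<le> (1 - a) * R J + a * R v + (norm (y - x))\<^sup>2 / (2 * \<theta>)"
      using convexD(2)[OF JD v a] by (simp add: y_def)
    also have "(norm (y - x))\<^sup>2 = (norm (J - x))\<^sup>2 + 2 * a * ((J - x) \<bullet> (v - J)) + a\<^sup>2 * (norm (v - J))\<^sup>2"
    proof -
      have "y - x = (J - x) + a *\<^sub>R (v - J)" by (simp add: y_def algebra_simps)
      then show ?thesis
        by (simp only: power2_norm_eq_inner inner_add_left inner_add_right inner_scaleR_left inner_scaleR_right)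
          (simp add: inner_commute power2_eq_square algebra_simps)
    qed
    also have "(J - x) \<bullet> (v - J) = - \<theta> * (yosida \<theta> x \<bullet> (v - J))"
      using \<theta> by (simp add: yosida_def J_def inner_diff_left)
    also have "((norm (J - x))\<^sup>2 + 2 * a * (- \<theta> * (yosida \<theta> x \<bullet> (v - J))) + a\<^sup>2 * (norm (v - J))\<^sup>2)
        / (2 * \<theta>)
        = (norm (J - x))\<^sup>2 / (2 * \<theta>) - a * (yosida \<theta> x \<bullet> (v - J)) + a * (a * N)"
      using \<theta> by (simp add: add_divide_distrib diff_divide_distrib N_def power2_eq_square mult.assoc)
    finally have "a * (R J - R v + yosida \<theta> x \<bullet> (v - J)) \<le> a * (a * N)"
      by (simp add: algebra_simps)
    then show ?thesis using a by simp
  qed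
  have "R J - R v + yosida \<theta> x \<bullet> (v - J) \<le> 0"
  proof (rule field_le_epsilon)
    fix e :: real assume e: "0 < e"
    \<comment> \<open>The first entry keeps \<open>a\<close> inside (0,1), the second makes
      \<open>a * N\<close> at most \<open>e\<close>; the added 1 covers N = 0.\<close>
    define a where "a = min (1/2) (e / (N + 1))"
    have a: "0 < a" "a < 1" using e N0 by (auto simp: a_def)
    have "a * N \<le> e / (N + 1) * N" using N0 by (intro mult_right_mono) (auto simp: a_def)
    also have "\<dots> \<le> e" using e N0 by (simp add: field_simps)
    finally show "R J - R v + yosida \<theta> x \<bullet> (v - J) \<le> 0 + e" using key[OF a] by simp
  qed
  then show ?thesis by (simp add: J_def)
qed

lemma yosida_monotone:
  assumes \<theta>: "0 < \<theta>" and \<mu>: "0 < \<mu>"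
  shows "0 \<le> (yosida \<theta> x - yosida \<mu> y) \<bullet> (prox \<theta> x - prox \<mu> y)"
  using yosida_subgradient[OF \<theta> prox(1)[OF \<mu>, of y], of x] yosida_subgradient[OF \<mu> prox(1)[OF \<theta>, of x], of y]
  by (simp add: inner_diff_left inner_diff_right)

text \<open>Yosida approximations with different parameters are monotone up to a defect. Writing x
  as its proximal point plus \<theta> times \<xi>, the proximal parts pair nonnegatively and the
  mixed term is split by Young's inequality. The defect is linear in the parameters, which yields
  the convergence rate.\<close>

lemma yosida_monotone_approx:
  assumes \<theta>: "0 < \<theta>" and \<mu>: "0 < \<mu>"
  shows "- (\<theta> + \<mu>) / 2 * ((norm (yosida \<theta> x))\<^sup>2 + (norm (yosida \<mu> y))\<^sup>2) \<le> (yosida \<theta> x -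
      yosida \<mu> y) \<bullet> (x - y)"
proof -
  define \<xi> where "\<xi> = yosida \<theta> x"
  define \<eta> where "\<eta> = yosida \<mu> y"
  have "(\<xi> - \<eta>) \<bullet> (x - y) = (\<xi> - \<eta>) \<bullet> (prox \<theta> x - prox \<mu> y) + (\<xi> - \<eta>) \<bullet>
      (\<theta> *\<^sub>R \<xi> - \<mu> *\<^sub>R \<eta>)"
    by (simp add: prox_eq[OF \<theta>] prox_eq[OF \<mu>] \<xi>_def \<eta>_def inner_diff_right)
  moreover have "0 \<le> (\<xi> - \<eta>) \<bullet> (prox \<theta> x - prox \<mu> y)" using yosida_monotone[OF \<theta> \<mu>] by (simp
      add: \<xi>_def \<eta>_def)
  moreover have "(\<xi> - \<eta>) \<bullet> (\<theta> *\<^sub>R \<xi> - \<mu> *\<^sub>R \<eta>) = \<theta> * (norm \<xi>)\<^sup>2 + \<mu> *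
      (norm \<eta>)\<^sup>2 - (\<theta> + \<mu>) * (\<xi> \<bullet> \<eta>)"
    by (simp add: inner_diff_left inner_diff_right power2_norm_eq_inner inner_commute algebra_simps)
  moreover have "(\<theta> + \<mu>) * (\<xi> \<bullet> \<eta>) \<le> (\<theta> + \<mu>) * (((norm \<xi>)\<^sup>2 + (norm \<eta>)\<^sup>2) / 2)"
  proof (rule mult_left_mono)
    have "0 \<le> (norm (\<xi> - \<eta>))\<^sup>2" by simp
    then show "\<xi> \<bullet> \<eta> \<le> ((norm \<xi>)\<^sup>2 + (norm \<eta>)\<^sup>2) / 2"
      by (simp add: power2_norm_eq_inner inner_diff_left inner_diff_right inner_commute)
  qed (use \<theta> \<mu> in simp)
  moreover have "0 \<le> \<theta> * (norm \<xi>)\<^sup>2" "0 \<le> \<mu> * (norm \<eta>)\<^sup>2" using \<theta> \<mu> by auto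
  ultimately show ?thesis unfolding \<xi>_def[symmetric] \<eta>_def[symmetric] by argo
qed

lemma yosida_lipschitz:
  assumes \<theta>: "0 < \<theta>"
  shows "norm (yosida \<theta> x - yosida \<theta> y) \<le> 1 / \<theta> * norm (x - y)"
proof -
  define \<delta> where "\<delta> = yosida \<theta> x - yosida \<theta> y"
  have "0 \<le> \<delta> \<bullet> (prox \<theta> x - prox \<theta> y)" unfolding \<delta>_def by (rule yosida_monotone[OF \<theta> \<theta>])
  also have "prox \<theta> x - prox \<theta> y = (x - y) - \<theta> *\<^sub>R \<delta>" by (simp add: prox_eq[OF \<theta>] \<delta>_def algebra_simps)
  finally have "\<theta> * (norm \<delta>)\<^sup>2 \<le> \<delta> \<bullet> (x - y)" by (simp add: inner_diff_right power2_norm_eq_inner)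
  also have "\<dots> \<le> norm \<delta> * norm (x - y)" by (rule norm_cauchy_schwarz)
  finally have "norm \<delta> * (\<theta> * norm \<delta>) \<le> norm \<delta> * norm (x - y)" by (simp add: power2_eq_square mult_ac)
  then have "\<theta> * norm \<delta> \<le> norm (x - y)" by (cases "norm \<delta> = 0") auto
  then show ?thesis using \<theta> by (simp add: \<delta>_def field_simps)
qed

text \<open>The lower bound is the subgradient inequality between the two proximal points plus a
  square. For the upper bound, the proximal point of \<open>x\<close> is used as a competitor in the
  minimization at \<open>y\<close>.\<close>

lemma smooth_convex_envelope:
  assumes \<theta>: "0 < \<theta>"
  shows "smooth_convex (envelope \<theta>) (yosida \<theta>) (1 / \<theta>)"
proof
  fix x y
  define \<xi> where "\<xi> = yosida \<theta> x"
  define \<eta> where "\<eta> = yosida \<theta> y"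
  have "R (prox \<theta> x) + \<xi> \<bullet> (prox \<theta> y - prox \<theta> x) \<le> R (prox \<theta> y)"
    unfolding \<xi>_def by (rule yosida_subgradient[OF \<theta> prox(1)[OF \<theta>]])
  moreover have "prox \<theta> y - prox \<theta> x = (y - x) - \<theta> *\<^sub>R (\<eta> - \<xi>)"
    by (simp add: prox_eq[OF \<theta>] \<xi>_def \<eta>_def algebra_simps)
  moreover have "0 \<le> \<theta> / 2 * (norm (\<eta> - \<xi>))\<^sup>2" using \<theta> by simp
  then have "\<theta> * (\<xi> \<bullet> \<eta>) - \<theta> * (\<xi> \<bullet> \<xi>) \<le> \<theta> / 2 * (norm \<eta>)\<^sup>2 - \<theta>
      / 2 * (norm \<xi>)\<^sup>2"
    by (simp add: power2_norm_eq_inner inner_diff_left inner_diff_right inner_commute algebra_simps)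
  ultimately show "0 \<le> envelope \<theta> y - envelope \<theta> x - yosida \<theta> x \<bullet> (y - x)"
    by (simp add: envelope_eq[OF \<theta>] \<xi>_def[symmetric] \<eta>_def[symmetric] inner_diff_right algebra_simps)
  have "envelope \<theta> y \<le> moreau \<theta> y (prox \<theta> x)" by (rule prox(2)[OF \<theta> prox(1)[OF \<theta>]])
  also have "\<dots> = envelope \<theta> x + \<xi> \<bullet> (y - x) + (norm (y - x))\<^sup>2 / (2 * \<theta>)"
  proof -
    have "prox \<theta> x - y = (prox \<theta> x - x) - (y - x)" by simp
    then have "(norm (prox \<theta> x - y))\<^sup>2 = (norm (prox \<theta> x - x))\<^sup>2 - 2 * ((prox \<theta> x - x) \<bullet> (y - x))
        + (norm (y - x))\<^sup>2"
      by (simp only: power2_norm_eq_inner inner_diff_left inner_diff_right) (simp add: inner_commute)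
    also have "(prox \<theta> x - x) \<bullet> (y - x) = - \<theta> * (\<xi> \<bullet> (y - x))"
      by (simp add: prox_eq[OF \<theta>] \<xi>_def)
    finally show ?thesis using \<theta> by (simp add: moreau_def envelope_def field_simps)
  qed
  finally show "envelope \<theta> y - envelope \<theta> x - yosida \<theta> x \<bullet> (y - x) \<le> 1 / \<theta> / 2 * (norm (y - x))\<^sup>2"
    by (simp add: \<xi>_def algebra_simps)
next
  show "norm (yosida \<theta> x - yosida \<theta> y) \<le> 1 / \<theta> * norm (x - y)" for x y by (rule yosida_lipschitz[OF \<theta>])
  show "0 \<le> 1 / \<theta>" using \<theta> by simp
qed

lemma subdiff_iff:
  "\<xi> \<in> subdiff \<phi> z \<longleftrightarrow> z \<in> D \<and> (\<forall>v\<in>D. R z + \<xi> \<bullet> (v - z) \<le> R v)"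
  unfolding subdiff_def by (auto simp: \<phi>_eq algebra_simps)

end

section \<open>Strongly convergent convex combinations\<close>

text \<open>Convex weights supported on the indices from \<open>n\<close> up to, but excluding,
  \<open>N\<close>. As \<open>n\<close> grows, combinations see only the tail and inherit every
  limit of the sequence.\<close>

definition tail_weights :: "nat \<Rightarrow> nat \<Rightarrow> (nat \<Rightarrow> real) \<Rightarrow> bool" where
  "tail_weights n N c \<longleftrightarrow> (\<forall>j. 0 \<le> c j) \<and> (\<forall>j<n. c j = 0) \<and> (\<forall>j\<ge>N. c j = 0)
      \<and> (\<Sum>j<N. c j) = 1"

lemma tail_weightsD:
  assumes "tail_weights n N c"
  shows "0 \<le> c j" "j < n \<Longrightarrow> c j = 0" "N \<le> j \<Longrightarrow> c j = 0" "(\<Sum>j<N. c j) = 1"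
  using assms by (auto simp: tail_weights_def)

lemma tail_weights_mono: "tail_weights n N c \<Longrightarrow> m \<le> n \<Longrightarrow> tail_weights m N c"
  by (auto simp: tail_weights_def)

lemma sum_weights_extend:
  fixes x :: "nat \<Rightarrow> 'a::real_vector"
  assumes "\<And>j. N \<le> j \<Longrightarrow> c j = 0" "N \<le> N'"
  shows "(\<Sum>j<N'. c j *\<^sub>R x j) = (\<Sum>j<N. c j *\<^sub>R x j)"
  using assms by (intro sum.mono_neutral_right) auto

lemma tail_weights_unit: "tail_weights n (Suc n) (\<lambda>j. if j = n then 1 else 0)"
  by (auto simp: tail_weights_def)

lemma tail_weights_midpoint:
  assumes "tail_weights n N c" "tail_weights n N' c'"
  shows "tail_weights n (max N N') (\<lambda>j. (c j + c' j) / 2)"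
proof -
  note C = tail_weightsD[OF assms(1)] and C' = tail_weightsD[OF assms(2)]
  have "(\<Sum>j<max N N'. c j) = 1" "(\<Sum>j<max N N'. c' j) = 1"
    using sum_weights_extend[of N c "max N N'" "\<lambda>_. 1::real"] sum_weights_extend[of N' c' "max N N'" "\<lambda>_. 1::real"] C C' by auto
  then show ?thesis using C C' by (auto simp: tail_weights_def sum.distrib sum_divide_distrib[symmetric])
qed

text \<open>Jensen's inequality, as nonnegativity of the weighted variance around the mean
  \<open>y\<close>.\<close>

lemma norm_sq_convex_comb:
  fixes x :: "nat \<Rightarrow> 'h::real_inner"
  assumes "tail_weights n N c"
  shows "(norm (\<Sum>j<N. c j *\<^sub>R x j))\<^sup>2 \<le> (\<Sum>j<N. c j * (norm (x j))\<^sup>2)"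
proof -
  note C = tail_weightsD[OF assms]
  define y where "y = (\<Sum>j<N. c j *\<^sub>R x j)"
  have "0 \<le> (\<Sum>j<N. c j * (norm (x j - y))\<^sup>2)" using C(1) by (intro sum_nonneg) auto
  also have "\<dots> = (\<Sum>j<N. c j * (norm (x j))\<^sup>2 - 2 * ((c j *\<^sub>R x j) \<bullet> y) + c j * (norm y)\<^sup>2)"
    by (intro sum.cong) (auto simp: power2_norm_eq_inner inner_diff_left inner_diff_right inner_commute algebra_simps)
  also have "\<dots> = (\<Sum>j<N. c j * (norm (x j))\<^sup>2) - 2 * (y \<bullet> y) + (norm y)\<^sup>2"
    by (simp add: sum.distrib sum_subtractf y_def inner_sum_left sum_distrib_left C(4) flip: sum_distrib_right)
  finally show ?thesis by (simp add: y_def[symmetric] power2_norm_eq_inner)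
qed

lemma tail_weights_limit:
  fixes a :: "nat \<Rightarrow> real"
  assumes w: "\<And>n. tail_weights n (N n) (c n)" and a: "a \<longlonglongrightarrow> \<alpha>"
  shows "(\<lambda>n. \<Sum>j<N n. c n j * a j) \<longlonglongrightarrow> \<alpha>"
proof (rule LIMSEQ_I)
  fix r :: real assume r: "0 < r"
  then obtain M where M: "\<And>j. j \<ge> M \<Longrightarrow> \<bar>a j - \<alpha>\<bar> < r / 2" using LIMSEQ_D[OF a, of "r/2"] by auto
  have "norm ((\<Sum>j<N n. c n j * a j) - \<alpha>) < r" if n: "n \<ge> M" for n
  proof -
    note C = tail_weightsD[OF w[of n]]
    have "(\<Sum>j<N n. c n j * a j) - \<alpha> = (\<Sum>j<N n. c n j * (a j - \<alpha>))"
      using C(4) by (simp add: right_diff_distrib sum_subtractf flip: sum_distrib_right)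
    also have "\<bar>\<dots>\<bar> \<le> (\<Sum>j<N n. \<bar>c n j * (a j - \<alpha>)\<bar>)" by (rule sum_abs)
    also have "\<dots> \<le> (\<Sum>j<N n. c n j * (r / 2))"
    proof (intro sum_mono)
      fix j show "\<bar>c n j * (a j - \<alpha>)\<bar> \<le> c n j * (r / 2)"
      proof (cases "j < n")
        case False
        then have "\<bar>a j - \<alpha>\<bar> \<le> r / 2" using M[of j] n by simp
        then show ?thesis using C(1)[of j] by (simp only: abs_mult abs_of_nonneg mult_left_mono)
      qed (use C(2) r in simp)
    qed
    also have "\<dots> = r / 2" unfolding sum_distrib_right[symmetric] C(4) by simp
    finally show ?thesis using r by simp
  qed
  then show "\<exists>no. \<forall>n\<ge>no. norm ((\<Sum>j<N n. c n j * a j) - \<alpha>) < r" by blast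
qed

lemma strongly_measurable_sum:
  fixes f :: "nat \<Rightarrow> 'a \<Rightarrow> 'b::real_normed_vector"
  assumes "\<And>j. strongly_measurable M (f j)"
  shows "strongly_measurable M (\<lambda>t. \<Sum>j<N. c j *\<^sub>R f j t)"
proof (induction N)
  case 0 then show ?case by (simp add: strongly_measurable_const)
next
  case (Suc N)
  then show ?case using strongly_measurable_scaleR[of "\<lambda>_. c N", OF _ assms[of N]] by (simp add: strongly_measurable_add)
qed

text \<open>Monotone convergence gives the sum a finite integral, hence finite values almost
  everywhere. It serves to turn integral bounds with geometric decay into pointwise
  convergence.\<close>

lemma AE_summable_imp_tendsto:
  fixes g :: "nat \<Rightarrow> 'a \<Rightarrow> real"
  assumes m: "\<And>k. g k \<in> borel_measurable M" and nn: "\<And>k x. 0 \<le> g k x"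
    and b: "\<And>k. (\<integral>\<^sup>+x. g k x \<partial>M) \<le> ennreal (b k)" and b0: "\<And>k. 0 \<le> b k" and s: "summable b"
  shows "AE x in M. summable (\<lambda>k. g k x)"
proof -
  note m[measurable]
  have "(\<integral>\<^sup>+x. (\<Sum>k. ennreal (g k x)) \<partial>M) = (\<Sum>k. \<integral>\<^sup>+x. g k x \<partial>M)" by (intro
      nn_integral_suminf) measurable
  also have "\<dots> \<le> (\<Sum>k. ennreal (b k))" using b by (intro suminf_le) auto
  also have "\<dots> = ennreal (\<Sum>k. b k)" using b0 s by (intro suminf_ennreal_eq summable_sums)
  finally have "(\<integral>\<^sup>+x. (\<Sum>k. ennreal (g k x)) \<partial>M) \<noteq> \<infinity>" by (metis ennreal_less_top
      infinity_ennreal_def leD)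
  then have "AE x in M. (\<Sum>k. ennreal (g k x)) \<noteq> \<infinity>" by (intro nn_integral_PInf_AE) measurable
  then show ?thesis
  proof eventually_elim
    case (elim x) then show ?case using nn by (intro summable_suminf_not_top) auto
  qed
qed

text \<open>The combinations nearly minimize the \<open>L\<^sup>2\<close> norm over the convex hull of the tail; the parallelogram
  identity makes them a Cauchy sequence.\<close>

lemma convex_combinations_L2:
  fixes \<xi> :: "nat \<Rightarrow> real \<Rightarrow> 'h::{real_inner,banach}"
  assumes sm: "\<And>j. strongly_measurable lebesgue (\<xi> j)"
    and bound: "\<And>j. (\<integral>\<^sup>+t. (norm (\<xi> j t))\<^sup>2 \<partial>lebesgue) \<le> ennreal C" and C: "0 \<le> C"
  shows "\<exists>c N \<eta>. (\<forall>n. tail_weights n (N n) (c n)) \<and> strongly_measurable lebesgue \<eta> \<and>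
     (AE t in lebesgue. (\<lambda>n. \<Sum>j<N n. c n j *\<^sub>R \<xi> j t) \<longlonglongrightarrow> \<eta> t) \<and>
     (\<lambda>n. \<integral>\<^sup>+t. (norm ((\<Sum>j<N n. c n j *\<^sub>R \<xi> j t) - \<eta> t))\<^sup>2 \<partial>lebesgue)
         \<longlonglongrightarrow> 0 \<and>
     (\<integral>\<^sup>+t. (norm (\<eta> t))\<^sup>2 \<partial>lebesgue) \<le> ennreal C"
proof -
  define S where "S c N t = (\<Sum>j<N. c j *\<^sub>R \<xi> j t)" for c :: "nat \<Rightarrow> real" and N :: nat and t
  define q where "q c N = (\<integral>t. (norm (S c N t))\<^sup>2 \<partial>lebesgue)" for c N
  have smS: "strongly_measurable lebesgue (S c N)" for c N unfolding S_def by (rule strongly_measurable_sum[OF sm])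
  have mS [measurable]: "(\<lambda>t. norm (S c N t)) \<in> borel_measurable lebesgue" for c N by (rule strongly_measurable_norm[OF smS])
  have nS: "(\<integral>\<^sup>+t. (norm (S c N t))\<^sup>2 \<partial>lebesgue) \<le> ennreal C" if w: "tail_weights n N c" for n N c
  proof -
    note W = tail_weightsD[OF w]
    have [measurable]: "(\<lambda>t. norm (\<xi> j t)) \<in> borel_measurable lebesgue" for j by (rule strongly_measurable_norm[OF sm])
    have "(\<integral>\<^sup>+t. (norm (S c N t))\<^sup>2 \<partial>lebesgue) \<le> (\<integral>\<^sup>+t. (\<Sum>j<N. ennreal (c j) *
        ennreal ((norm (\<xi> j t))\<^sup>2)) \<partial>lebesgue)"
    proof (intro nn_integral_mono)
      fix t
      have "ennreal ((norm (S c N t))\<^sup>2) \<le> ennreal (\<Sum>j<N. c j * (norm (\<xi> j t))\<^sup>2)"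
        unfolding S_def by (intro ennreal_leI norm_sq_convex_comb[OF w])
      also have "\<dots> = (\<Sum>j<N. ennreal (c j) * ennreal ((norm (\<xi> j t))\<^sup>2))"
        using W(1) by (subst sum_ennreal[symmetric]) (auto simp: ennreal_mult)
      finally show "ennreal ((norm (S c N t))\<^sup>2) \<le> (\<Sum>j<N. ennreal (c j) * ennreal ((norm (\<xi> j t))\<^sup>2))" .
    qed
    also have "\<dots> = (\<Sum>j<N. ennreal (c j) * (\<integral>\<^sup>+t. (norm (\<xi> j t))\<^sup>2 \<partial>lebesgue))"
      by (simp add: nn_integral_sum nn_integral_cmult)
    also have "\<dots> \<le> (\<Sum>j<N. ennreal (c j) * ennreal C)" by (intro sum_mono mult_left_mono bound) auto
    also have "\<dots> = ennreal (\<Sum>j<N. c j * C)" using W(1) C by (simp add: ennreal_mult[symmetric] sum_ennreal)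
    also have "\<dots> = ennreal C" using W(4) by (simp flip: sum_distrib_right)
    finally show ?thesis .
  qed
  have iS: "integrable lebesgue (norm_sq (S c N))" if "tail_weights n N c" for n N c
    using nS[OF that] by (intro integrableI_nonneg) (auto intro: order.strict_trans1)
  have qC: "q c N \<le> C" and q0: "0 \<le> q c N" if "tail_weights n N c" for n N c
  proof -
    show "0 \<le> q c N" unfolding q_def by (intro integral_nonneg_AE) auto
    have "ennreal (q c N) \<le> ennreal C" unfolding q_def using nS[OF that] iS[OF that] by (subst nn_integral_eq_integral[symmetric]) auto
    then show "q c N \<le> C" using C by simp
  qed
  \<comment> \<open>\<open>d n\<close> is the infimum of the squared L2 norm over combinations of
    the tail from \<open>n\<close>. Smaller tails have larger infima and all are bounded by
    \<open>C\<close>, so \<open>d\<close> increases to a limit \<open>D\<close>.\<close>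
  define Q where "Q n = {q c N |c N. tail_weights n N c}" for n
  have Qne: "Q n \<noteq> {}" for n unfolding Q_def using tail_weights_unit by blast
  have Qbdd: "bdd_below (Q n)" for n unfolding Q_def using q0 by (intro bdd_belowI[of _ 0]) auto
  define d where "d n = Inf (Q n)" for n
  have d_le: "d n \<le> q c N" if "tail_weights n N c" for n N c unfolding d_def using Qbdd that by (intro cInf_lower) (auto simp: Q_def)
  have d_mono: "d n \<le> d m" if "n \<le> m" for n m
    unfolding d_def using tail_weights_mono[OF _ that] Qbdd Qne by (intro cInf_superset_mono) (auto simp: Q_def)
  have dC: "d n \<le> C" for n using d_le[OF tail_weights_unit] qC[OF tail_weights_unit] order_trans by blast
  have "\<exists>c N. tail_weights n N c \<and> q c N < d n + 1 / real (Suc n)" for n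
    using cInf_lessD[OF Qne, of n "d n + 1 / real (Suc n)"] by (auto simp: Q_def d_def)
  then obtain c N where w: "\<And>n. tail_weights n (N n) (c n)" and qd: "\<And>n. q (c n) (N n) < d n + 1 / real (Suc n)" by metis
  define s where "s n = S (c n) (N n)" for n
  have iS2: "integrable lebesgue (norm_sq (s n))" for n unfolding s_def by (rule iS[OF w])
  have sms: "strongly_measurable lebesgue (s n)" for n unfolding s_def by (rule smS)
  have msd [measurable]: "(\<lambda>t. norm (s n t - s m t)) \<in> borel_measurable lebesgue" for n m
    by (intro strongly_measurable_norm strongly_measurable_diff sms)
  define D where "D = (SUP n. d n)"
  have bddd: "bdd_above (range d)" using dC by (intro bdd_aboveI2)
  have dlim: "d \<longlonglongrightarrow> D" unfolding D_def using bddd d_mono by (intro LIMSEQ_incseq_SUP incseq_def[THEN iffD2]) auto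
  have dD: "d n \<le> D" for n unfolding D_def using bddd by (intro cSUP_upper) auto
  \<comment> \<open>The midpoint of the combinations with indices n \<le> m is admissible for the
    tail from n, so its squared norm is at least \<open>d n\<close>. The parallelogram identity
    bounds the squared distance by 2 q_n + 2 q_m - 4 d_n, and near minimality turns this into
    \<open>\<epsilon> n\<close>.\<close>
  define \<epsilon> where "\<epsilon> n = 2 * (D - d n) + 4 / real (Suc n)" for n
  have ii: "integrable lebesgue (\<lambda>t. (norm (s n t - s m t))\<^sup>2)" for n m
  proof (rule Bochner_Integration.integrable_bound[of _ "\<lambda>t. 2 * (norm (s n t))\<^sup>2 + 2 * (norm (s m t))\<^sup>2"])
    show "integrable lebesgue (\<lambda>t. 2 * (norm (s n t))\<^sup>2 + 2 * (norm (s m t))\<^sup>2)" using iS2 by simp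
    have "(norm (s n t - s m t))\<^sup>2 \<le> 2 * (norm (s n t))\<^sup>2 + 2 * (norm (s m t))\<^sup>2" for t
    proof -
      have "0 \<le> (norm (s n t + s m t))\<^sup>2" by simp
      then show ?thesis by (simp add: power2_norm_eq_inner inner_add_left inner_add_right inner_diff_left inner_diff_right inner_commute)
    qed
    then show "AE t in lebesgue. norm ((norm (s n t - s m t))\<^sup>2) \<le> norm (2 * (norm (s n t))\<^sup>2 + 2 * (norm (s m t))\<^sup>2)"
      by (intro AE_I2) simp
  qed measurable
  have cau: "(\<integral>t. (norm (s n t - s m t))\<^sup>2 \<partial>lebesgue) \<le> \<epsilon> n" if nm: "n \<le> m" for n m
  proof -
    define c' where "c' = (\<lambda>j. (c n j + c m j) / 2)"
    define N' where "N' = max (N n) (N m)"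
    have w': "tail_weights n N' c'" unfolding c'_def N'_def by (intro tail_weights_midpoint w tail_weights_mono[OF w nm])
    have mid: "S c' N' t = (1/2) *\<^sub>R (s n t + s m t)" for t
    proof -
      have "S c' N' t = (1/2) *\<^sub>R ((\<Sum>j<N'. c n j *\<^sub>R \<xi> j t) + (\<Sum>j<N'. c m j *\<^sub>R \<xi> j t))"
        unfolding S_def c'_def by (simp add: scaleR_sum_right scaleR_add_left add_divide_distrib sum.distrib scaleR_add_right)
      also have "\<dots> = (1/2) *\<^sub>R (s n t + s m t)"
        unfolding s_def S_def using tail_weightsD(3)[OF w] by (subst (1 2) sum_weights_extend[of "N _" "c _" N', symmetric]) (auto simp: N'_def)
      finally show ?thesis .
    qed
    have par: "(norm (S c' N' t))\<^sup>2 = (norm (s n t))\<^sup>2 / 2 + (norm (s m t))\<^sup>2 / 2 - (norm (s n t - s m t))\<^sup>2 / 4" for t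
      unfolding mid by (simp add: power2_norm_eq_inner inner_add_left inner_add_right inner_diff_left inner_diff_right inner_commute field_simps)
    have "d n \<le> q c' N'" by (rule d_le[OF w'])
    also have "\<dots> = q (c n) (N n) / 2 + q (c m) (N m) / 2 - (\<integral>t. (norm (s n t - s m t))\<^sup>2 \<partial>lebesgue) / 4"
      unfolding q_def par using iS2 ii by (simp add: s_def[symmetric])
    finally have "(\<integral>t. (norm (s n t - s m t))\<^sup>2 \<partial>lebesgue) \<le> 2 * q (c n) (N n) + 2 * q (c m) (N m) - 4 * d n" by simp
    moreover have "1 / real (Suc m) \<le> 1 / real (Suc n)" using nm by (intro divide_left_mono) auto
    moreover have "I \<le> 2 * (D' - x) + 4 / e" if "I \<le> 2 * a + 2 * b - 4 * x" "1 / e' \<le> 1 / e" "a < x + 1 / e" "b < y + 1 / e'" "y \<le> D'"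
      for I a b x y e e' D' :: real
    proof -
      define r r' where "r = 1 / e" and "r' = 1 / e'"
      have "4 / e = 4 * r" by (simp add: r_def)
      moreover have "I \<le> 2 * (D' - x) + 4 * r" using that unfolding r_def[symmetric] r'_def[symmetric] by argo
      ultimately show ?thesis by simp
    qed
    ultimately show ?thesis using qd[of n] qd[of m] dD[of m] unfolding \<epsilon>_def by blast
  qed
  have \<epsilon>0: "\<epsilon> \<longlonglongrightarrow> 0"
  proof -
    have "(\<lambda>n. 4 / real (Suc n)) \<longlonglongrightarrow> 0" using LIMSEQ_Suc[OF lim_const_over_n[of 4]] by simp
    then have "(\<lambda>n. 2 * (D - d n) + 4 / real (Suc n)) \<longlonglongrightarrow> 2 * (D - D) + 0" by (intro tendsto_intros dlim)
    then show ?thesis by (simp add: \<epsilon>_def[abs_def])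
  qed
  have ex: "\<exists>m\<ge>k. \<epsilon> m < (1/16)^k" for k
  proof -
    have "\<forall>\<^sub>F m in sequentially. \<epsilon> m < (1/16)^k" using \<epsilon>0 by (intro order_tendstoD(2)) auto
    then have "\<forall>\<^sub>F m in sequentially. \<epsilon> m < (1/16)^k \<and> m \<ge> k" using eventually_ge_at_top by (rule eventually_conj)
    then show ?thesis by (auto simp: eventually_sequentially)
  qed
  obtain r where r: "strict_mono r" "\<And>k. \<epsilon> (r k) < (1/16)^k"
  proof -
    have "\<exists>r. strict_mono r \<and> (\<forall>k. \<epsilon> (r k) < (1/16)^k)"
    proof -
      have "\<exists>f. \<forall>n. \<epsilon> (f n) < (1/16)^n \<and> f n < f (Suc n)"
      proof (rule dependent_nat_choice)
        show "\<exists>x. \<epsilon> x < (1/16)^0" using ex[of 0] by auto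
        fix x n
        have "\<forall>\<^sub>F m in sequentially. \<epsilon> m < (1/16)^Suc n" using \<epsilon>0 by (intro order_tendstoD(2)) auto
        then have "\<forall>\<^sub>F m in sequentially. \<epsilon> m < (1/16)^Suc n \<and> m > x" using eventually_gt_at_top by (rule eventually_conj)
        then show "\<exists>y. \<epsilon> y < (1/16)^Suc n \<and> x < y" by (auto simp: eventually_sequentially)
      qed
      then show ?thesis by (auto simp: strict_mono_Suc_iff)
    qed
    then show ?thesis using that by blast
  qed
  have rk: "k \<le> r k" for k using r(1) by (rule strict_mono_imp_increasing)
  \<comment> \<open>The subsequence has squared L2 steps below 16^-k. The factor 4^k spends half of
    that decay: the sum of the \<open>g k\<close> stays integrable, and boundedness of
    \<open>g k t\<close> in \<open>k\<close> makes the steps at \<open>t\<close> decay like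
    2^-k.\<close>
  define g where "g k t = 4^k * (norm (s (r k) t - s (r (Suc k)) t))\<^sup>2" for k t
  have "AE t in lebesgue. summable (\<lambda>k. g k t)"
  proof (rule AE_summable_imp_tendsto[where b = "\<lambda>k. (1/4)^k"])
    show "g k \<in> borel_measurable lebesgue" for k unfolding g_def by measurable
    have rr: "r k \<le> r (Suc k)" for k using r(1) by (simp add: strict_mono_less_eq)
    have ig: "integrable lebesgue (g k)" for k unfolding g_def using ii by simp
    show "(\<integral>\<^sup>+t. g k t \<partial>lebesgue) \<le> ennreal ((1/4)^k)" for k
    proof -
      have "(\<integral>\<^sup>+t. g k t \<partial>lebesgue) = ennreal (\<integral>t. g k t \<partial>lebesgue)" by (rule
          nn_integral_eq_integral[OF ig]) (simp add: g_def)
      also have "(\<integral>t. g k t \<partial>lebesgue) = 4^k * (\<integral>t. (norm (s (r k) t - s (r (Suc k)) t))\<^sup>2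
          \<partial>lebesgue)" unfolding g_def by simp
      also have "\<dots> \<le> 4^k * (1/16)^k" using cau[OF rr[of k]] r(2)[of k] by (intro mult_left_mono) auto
      also have "\<dots> = (1/4)^k" by (simp flip: power_mult_distrib)
      finally show ?thesis by (simp add: ennreal_leI)
    qed
  qed (auto simp: g_def summable_geometric)
  then have conv: "AE t in lebesgue. convergent (\<lambda>k. s (r k) t)"
  proof eventually_elim
    case (elim t)
    then have "bounded (range (\<lambda>k. g k t))" using summable_LIMSEQ_zero convergent_imp_bounded by blast
    then obtain b where b: "\<And>k. norm (g k t) \<le> b" unfolding bounded_iff by blast
    have b0: "0 \<le> b" using b norm_ge_zero order_trans by blast
    have "norm (s (r (Suc k)) t - s (r k) t) \<le> sqrt b * (1/2)^k" for k
    proof (rule power2_le_imp_le)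
      have "4^k * (norm (s (r (Suc k)) t - s (r k) t))\<^sup>2 \<le> b" using b[of k] by (simp add: g_def norm_minus_commute)
      then have "(norm (s (r (Suc k)) t - s (r k) t))\<^sup>2 \<le> b / 4^k" by (simp add: field_simps)
      also have "\<dots> = (sqrt b * (1/2)^k)\<^sup>2"
      proof -
        have "((1/2::real)^k)\<^sup>2 = ((1/2)\<^sup>2)^k" by (metis power_mult mult.commute)
        also have "\<dots> = 1 / 4^k" by (simp add: power2_eq_square power_divide)
        finally show ?thesis using b0 by (simp add: power_mult_distrib)
      qed
      finally show "(norm (s (r (Suc k)) t - s (r k) t))\<^sup>2 \<le> (sqrt b * (1/2)^k)\<^sup>2" .
    qed (use b0 in simp)
    then have le: "norm (norm (s (r (Suc k)) t - s (r k) t)) \<le> sqrt b * (1/2)^k" for k by simp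
    have "summable (\<lambda>k. sqrt b * (1/2::real)^k)" by (intro summable_mult summable_geometric) simp
    then have "summable (\<lambda>k. norm (s (r (Suc k)) t - s (r k) t))"
      by (rule summable_comparison_test'[where N = 0]) (rule le)
    then have "summable (\<lambda>k. s (r (Suc k)) t - s (r k) t)" by (rule summable_norm_cancel)
    then have "convergent (\<lambda>n. \<Sum>k<n. s (r (Suc k)) t - s (r k) t)" by (simp add: summable_iff_convergent)
    then have "convergent (\<lambda>n. s (r n) t - s (r 0) t)" by (simp only: sum_lessThan_telescope[of "\<lambda>k. s (r k) t"])
    then have "convergent (\<lambda>n. (s (r n) t - s (r 0) t) + s (r 0) t)" by (intro convergent_add convergent_const)
    then show ?case by simp
  qed
  define \<eta> where "\<eta> t = lim (\<lambda>k. s (r k) t)" for t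
  have lim: "AE t in lebesgue. (\<lambda>k. s (r k) t) \<longlonglongrightarrow> \<eta> t"
    using conv by eventually_elim (simp add: \<eta>_def convergent_LIMSEQ_iff)
  have sm\<eta>: "strongly_measurable lebesgue \<eta>" by (rule strongly_measurable_AE_lim[OF sms lim])
  \<comment> \<open>Used twice: with \<open>x = s (r k)\<close> for convergence in L2, and with
    \<open>x = 0\<close> for the bound on the limit.\<close>
  have fatou: "(\<integral>\<^sup>+t. (norm (x t - \<eta> t))\<^sup>2 \<partial>lebesgue) \<le> ennreal b"
    if x: "strongly_measurable lebesgue x" and b: "\<forall>\<^sub>F k in sequentially. (\<integral>\<^sup>+t. (norm (x t - s (r k)
        t))\<^sup>2 \<partial>lebesgue) \<le> ennreal b" for x b
  proof -
    have [measurable]: "(\<lambda>t. norm (x t - s (r k) t)) \<in> borel_measurable lebesgue" for k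
      by (intro strongly_measurable_norm strongly_measurable_diff x sms)
    have "AE t in lebesgue. ennreal ((norm (x t - \<eta> t))\<^sup>2) = liminf (\<lambda>k. ennreal ((norm (x t - s (r k) t))\<^sup>2))"
      using lim
    proof eventually_elim
      case (elim t)
      then have "(\<lambda>k. ennreal ((norm (x t - s (r k) t))\<^sup>2)) \<longlonglongrightarrow> ennreal ((norm (x t - \<eta> t))\<^sup>2)"
        by (intro tendsto_ennrealI tendsto_intros)
      then show ?case by (rule lim_imp_Liminf[OF trivial_limit_sequentially, symmetric])
    qed
    then have "(\<integral>\<^sup>+t. (norm (x t - \<eta> t))\<^sup>2 \<partial>lebesgue) = (\<integral>\<^sup>+t. liminf (\<lambda>k.
        ennreal ((norm (x t - s (r k) t))\<^sup>2)) \<partial>lebesgue)"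
      by (rule nn_integral_cong_AE)
    also have "\<dots> \<le> liminf (\<lambda>k. \<integral>\<^sup>+t. (norm (x t - s (r k) t))\<^sup>2 \<partial>lebesgue)"
      by (rule nn_integral_liminf) measurable
    also have "\<dots> \<le> ennreal b"
    proof -
      have "liminf (\<lambda>k. \<integral>\<^sup>+t. (norm (x t - s (r k) t))\<^sup>2 \<partial>lebesgue) \<le> liminf (\<lambda>k.
          ennreal b)" by (rule Liminf_mono[OF b])
      then show ?thesis by (simp add: Liminf_const)
    qed
    finally show ?thesis .
  qed
  have "(\<lambda>k. \<integral>\<^sup>+t. (norm (s (r k) t - \<eta> t))\<^sup>2 \<partial>lebesgue) \<longlonglongrightarrow> 0"
  proof (rule tendsto_sandwich[OF _ _ tendsto_const])
    have "(\<integral>\<^sup>+t. (norm (s (r k) t - \<eta> t))\<^sup>2 \<partial>lebesgue) \<le> ennreal ((1/16)^k)" for k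
    proof (rule fatou[OF sms])
      show "\<forall>\<^sub>F m in sequentially. (\<integral>\<^sup>+t. (norm (s (r k) t - s (r m) t))\<^sup>2 \<partial>lebesgue) \<le>
          ennreal ((1/16)^k)"
        using eventually_ge_at_top[of k]
      proof eventually_elim
        case (elim m)
        then have "r k \<le> r m" using r(1) by (simp add: strict_mono_less_eq)
        then have "(\<integral>t. (norm (s (r k) t - s (r m) t))\<^sup>2 \<partial>lebesgue) \<le> (1/16)^k" using cau[of "r k" "r m"]
            r(2)[of k] by linarith
        then show ?case using ii by (subst nn_integral_eq_integral) (auto intro: ennreal_leI)
      qed
    qed
    then show "\<forall>\<^sub>F k in sequentially. (\<integral>\<^sup>+t. (norm (s (r k) t - \<eta> t))\<^sup>2 \<partial>lebesgue) \<le>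
        ennreal ((1/16)^k)" by simp
    have "(\<lambda>k. ennreal ((1/16)^k)) \<longlonglongrightarrow> ennreal 0" by (intro tendsto_ennrealI LIMSEQ_power_zero) simp
    then show "(\<lambda>k. ennreal ((1/16)^k)) \<longlonglongrightarrow> 0" by simp
  qed simp
  moreover have "(\<integral>\<^sup>+t. (norm (\<eta> t))\<^sup>2 \<partial>lebesgue) \<le> ennreal C"
    using fatou[of "\<lambda>_. 0" C] nS[OF w] by (simp add: strongly_measurable_const s_def)
  moreover have "tail_weights k (N (r k)) (c (r k))" for k by (rule tail_weights_mono[OF w rk])
  ultimately show ?thesis using lim sm\<eta>
    by (intro exI[of _ "\<lambda>k. c (r k)"] exI[of _ "\<lambda>k. N (r k)"] exI[of _ \<eta>]) (auto simp: s_def S_def)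
qed

section \<open>Data with bounded convolved square\<close>

text \<open>The bound on the convolved square is required at every time and not just almost
  everywhere, since the estimates are pointwise. The class is stable under sums and contains the
  locally bounded functions, so the right-hand side of the regularized equation stays in it.\<close>

definition conv_sq_bounded :: "(real \<Rightarrow> real) \<Rightarrow> (real \<Rightarrow> 'h::real_normed_vector) \<Rightarrow> bool" where
  "conv_sq_bounded l h \<longleftrightarrow> strongly_measurable lebesgue h \<and> (\<forall>s\<le>0. h s = 0) \<and>
     (\<forall>T. \<exists>C. \<forall>t<T. rconv_integrable l (norm_sq h) t \<and> rconv l (norm_sq h) t \<le> C)"

lemma conv_sq_boundedD:
  assumes "conv_sq_bounded l h"
  shows "strongly_measurable lebesgue h" "s \<le> 0 \<Longrightarrow> h s = 0"
    "rconv_integrable l (norm_sq h) t"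
    "\<exists>C\<ge>0. \<forall>t<T. rconv l (norm_sq h) t \<le> C"
proof -
  show "strongly_measurable lebesgue h" "s \<le> 0 \<Longrightarrow> h s = 0" using assms by (auto simp: conv_sq_bounded_def)
  have *: "\<exists>C. \<forall>t<T. rconv_integrable l (norm_sq h) t \<and> rconv l (norm_sq h) t \<le> C" for T
    using assms by (simp add: conv_sq_bounded_def)
  from *[of "t + 1"] show "rconv_integrable l (norm_sq h) t" by auto
  from *[of T] obtain C where "\<forall>t<T. rconv l (norm_sq h) t \<le> C" by blast
  then show "\<exists>C\<ge>0. \<forall>t<T. rconv l (norm_sq h) t \<le> C"
    by (intro exI[of _ "max C 0"]) (auto simp: le_max_iff_disj)
qed

section \<open>Calculus of real convolutions\<close>

lemma integrable_kernel_bound: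
  fixes g h :: "real \<Rightarrow> real"
  assumes a: "mono_kernel a" and g: "g \<in> borel_measurable lebesgue"
    and h: "rconv_integrable a h t" and le: "\<And>s. s < t \<Longrightarrow> \<bar>g s\<bar> \<le> h s"
  shows "rconv_integrable a g t"
proof (rule Bochner_Integration.integrable_bound[OF h])
  have [measurable]: "a \<in> borel_measurable borel" using a by measurable
  have [measurable]: "(\<lambda>s. a (t - s)) \<in> borel_measurable lebesgue" by (rule borel_imp_lebesgue) measurable
  show "(\<lambda>s. a (t - s) * g s) \<in> borel_measurable lebesgue" using g by measurable
  have "\<bar>a (t - s)\<bar> * \<bar>g s\<bar> \<le> \<bar>a (t - s)\<bar> * \<bar>h s\<bar>" for s
    using le[of s] mono_kernelD(5)[OF a, of "t - s"] by (cases "s < t") (auto intro!: mult_left_mono)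
  then show "AE s in lebesgue. norm (a (t - s) * g s) \<le> norm (a (t - s) * h s)" by (intro AE_I2) (simp add: abs_mult)
qed

lemma rconv_cmult: "rconv a (\<lambda>s. c * w s) t = c * rconv a w t"
proof -
  have "(\<lambda>s. a (t - s) * (c * w s)) = (\<lambda>s. c * (a (t - s) * w s))" by (simp add: mult.left_commute fun_eq_iff)
  then show ?thesis by (simp add: rconv_def)
qed

lemma rconv_add:
  assumes "rconv_integrable a v t" "rconv_integrable a w t"
  shows "rconv a (\<lambda>s. v s + w s) t = rconv a v t + rconv a w t"
  unfolding rconv_def distrib_left by (rule Bochner_Integration.integral_add[OF assms])

lemma rconv_diff:
  assumes "rconv_integrable a v t" "rconv_integrable a w t"
  shows "rconv a (\<lambda>s. v s - w s) t = rconv a v t - rconv a w t"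
  unfolding rconv_def right_diff_distrib by (rule Bochner_Integration.integral_diff[OF assms])

lemma integrable_kernel_cmult:
  fixes a w :: "real \<Rightarrow> real"
  assumes "rconv_integrable a w t"
  shows "rconv_integrable a (\<lambda>s. c * w s) t"
  using integrable_mult_right[OF assms, of c] by (simp add: mult.left_commute)

lemma integrable_kernel_add:
  fixes a v w :: "real \<Rightarrow> real"
  assumes "rconv_integrable a v t" "rconv_integrable a w t"
  shows "rconv_integrable a (\<lambda>s. v s + w s) t"
  unfolding distrib_left by (rule Bochner_Integration.integrable_add[OF assms])

lemma integrable_kernel_heaviside: "mono_kernel a \<Longrightarrow> rconv_integrable a heaviside t"
  by (rule rconv_bounded_integrable(1)[where C = 1]) (auto simp: indicator_def[of "{0<..}"])

lemma conv_sq_bounded_integrable: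
  assumes a: "mono_kernel l" and h: "conv_sq_bounded l h"
  shows "rconv_integrable l (\<lambda>s. norm (h s)) t"
    and "\<exists>C\<ge>0. \<forall>t<T. rconv l (\<lambda>s. norm (h s)) t \<le> C"
proof -
  note H = conv_sq_boundedD[OF h]
  have le: "norm (h s) \<le> heaviside s + (norm (h s))\<^sup>2" for s
  proof (cases "s \<le> 0")
    case False
    have "0 \<le> (norm (h s) - 1/2)\<^sup>2" by simp
    then show ?thesis using False by (simp add: power2_eq_square algebra_simps)
  qed (use H(2) in simp)
  have i2: "rconv_integrable l (\<lambda>s. heaviside s + (norm (h s))\<^sup>2) t" for t
    unfolding distrib_left by (intro Bochner_Integration.integrable_add integrable_kernel_heaviside a H)
  show i1: "rconv_integrable l (\<lambda>s. norm (h s)) t" for t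
    by (rule integrable_kernel_bound[OF a strongly_measurable_norm[OF H(1)] i2]) (use le in simp)
  obtain C where C: "0 \<le> C" "\<forall>t<T. rconv l (norm_sq h) t \<le> C" using H(4) by blast
  have "rconv l (\<lambda>s. norm (h s)) t \<le> cumul l T + C" if t: "t < T" for t
  proof -
    have "rconv l (\<lambda>s. norm (h s)) t \<le> rconv l (\<lambda>s. heaviside s + (norm (h s))\<^sup>2) t"
      by (rule rconv_mono[OF a i1 i2 le])
    also have "\<dots> = cumul l t + rconv l (norm_sq h) t"
      unfolding rconv_heaviside[symmetric] unfolding rconv_def distrib_left
      by (intro Bochner_Integration.integral_add integrable_kernel_heaviside a H)
    also have "\<dots> \<le> cumul l T + C" using C t mono_kernelD[OF a] by (intro add_mono cumul_mono) auto
    finally show ?thesis .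
  qed
  then show "\<exists>C\<ge>0. \<forall>t<T. rconv l (\<lambda>s. norm (h s)) t \<le> C"
    using C cumul_nonneg[of l T] mono_kernelD(3)[OF a] by (intro exI[of _ "cumul l T + C"]) auto
qed

text \<open>Truncation replaces large values by 0, so the discarded part has norm at most |h|^2 / n.
  Convolved with \<open>l\<close> this is O(1/n) uniformly on times below \<open>T\<close>, and the
  convolution is a locally uniform limit of continuous functions.\<close>

lemma conv_sq_bounded_conv:
  fixes h :: "real \<Rightarrow> 'h::{real_inner,banach}"
  assumes a: "mono_kernel l" and h: "conv_sq_bounded l h"
  shows "conv l h t \<bullet> e = rconv l (\<lambda>s. h s \<bullet> e) t" and "continuous_on UNIV (conv l h)"
proof -
  note H = conv_sq_boundedD[OF h] and i = conv_sq_bounded_integrable(1)[OF a h]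
  show ci: "conv l h t \<bullet> e = rconv l (\<lambda>s. h s \<bullet> e) t" for t e by (rule conv_inner[OF a H(1,2) i])
  define hn where "hn n = truncate (real n) h" for n
  note hn = strongly_measurable_truncate[OF H(1), of "real n" for n, folded hn_def]
  have hn0: "hn n s = 0" if "s \<le> 0" for n s using H(2)[OF that] by (simp add: hn_def truncate_def)
  have hnb: "\<exists>C. \<forall>s<T. norm (hn n s) \<le> C" for n T by (intro exI[of _ "real n"]) (simp add: hn_def truncate_def)
  note cb = conv_locally_bounded[OF a hn hn0 hnb]
  have ul: "uniform_limit {..<T} (\<lambda>n. conv l (hn n)) (conv l h) sequentially" for T
  proof (rule uniform_limitI)
    fix e :: real assume e: "0 < e"
    obtain C where C: "0 \<le> C" "\<forall>t<T. rconv l (norm_sq h) t \<le> C" using H(4) by blast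
    obtain M where M: "C / e < real M" using reals_Archimedean2 by blast
    have M0: "0 < real M" using M C e by (metis divide_nonneg_pos le_less_trans)
    have "\<forall>t\<in>{..<T}. dist (conv l (hn n) t) (conv l h t) < e" if n: "n \<ge> M" for n
    proof
      fix t assume t: "t \<in> {..<T}"
      have "norm (conv l h t - conv l (hn n) t) \<le> rconv l (\<lambda>s. norm (h s - hn n s)) t"
        by (rule conv_norm_diff(1)[OF a H(1) hn i cb(1) ci cb(2)])
      also have "\<dots> \<le> rconv l (\<lambda>s. (1 / real M) * (norm (h s))\<^sup>2) t"
      proof (rule rconv_mono[OF a conv_norm_diff(2)[OF a H(1) hn i cb(1) ci cb(2)]])
        show "rconv_integrable l (\<lambda>s. (1 / real M) * (norm (h s))\<^sup>2) t"
          using integrable_mult_right[OF H(3), of "1 / real M"] by (simp add: mult_ac)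
        fix s
        show "norm (h s - hn n s) \<le> (1 / real M) * (norm (h s))\<^sup>2"
        proof (cases "norm (h s) \<le> real n")
          case False
          then have "real M * norm (h s) \<le> norm (h s) * norm (h s)" using n by (intro mult_right_mono) auto
          then show ?thesis using False M0 by (simp add: hn_def truncate_def field_simps power2_eq_square)
        qed (use M0 in \<open>simp add: hn_def truncate_def\<close>)
      qed
      also have "\<dots> = (1 / real M) * rconv l (norm_sq h) t"
        by (rule rconv_cmult)
      also have "\<dots> \<le> (1 / real M) * C" using C t M0 by (intro mult_left_mono) auto
      also have "\<dots> < e" using M M0 e by (simp add: field_simps)
      finally show "dist (conv l (hn n) t) (conv l h t) < e" by (simp add: dist_norm norm_minus_commute)
    qed
    then show "\<forall>\<^sub>F n in sequentially. \<forall>t\<in>{..<T}. dist (conv l (hn n) t) (conv l h t) < e"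
      by (auto simp: eventually_sequentially)
  qed
  have "continuous_on {..<T} (conv l h)" for T
    by (rule uniform_limit_theorem[OF _ ul]) (auto intro!: always_eventually continuous_on_subset[OF cb(3)])
  then have "isCont (conv l h) x" for x using continuous_on_eq_continuous_at[of "{..<x+1}" "conv l h"] by auto
  then show "continuous_on UNIV (conv l h)" by (simp add: continuous_at_imp_continuous_on)
qed

lemma conv_sq_bounded_add:
  fixes g h :: "real \<Rightarrow> 'h::real_inner"
  assumes a: "mono_kernel l" and g: "conv_sq_bounded l g" and h: "conv_sq_bounded l h"
  shows "conv_sq_bounded l (\<lambda>s. g s + h s)"
  unfolding conv_sq_bounded_def
proof (intro conjI allI impI)
  note G = conv_sq_boundedD[OF g] and H = conv_sq_boundedD[OF h]
  show sm: "strongly_measurable lebesgue (\<lambda>s. g s + h s)" by (intro strongly_measurable_add G H)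
  show "g s + h s = 0" if "s \<le> 0" for s using G(2) H(2) that by simp
  fix T
  have le: "(norm (g s + h s))\<^sup>2 \<le> 2 * (norm (g s))\<^sup>2 + 2 * (norm (h s))\<^sup>2" for s
  proof -
    have "0 \<le> (norm (g s - h s))\<^sup>2" by simp
    then show ?thesis by (simp add: power2_norm_eq_inner inner_add_left inner_add_right inner_diff_left inner_diff_right inner_commute)
  qed
  have e: "l (t - s) * (2 * (norm (g s))\<^sup>2 + 2 * (norm (h s))\<^sup>2) = 2 * (l (t - s) * (norm (g s))\<^sup>2) + 2 * (l (t - s) *
      (norm (h s))\<^sup>2)" for t s
    by (simp add: algebra_simps)
  have i2: "rconv_integrable l (\<lambda>s. 2 * (norm (g s))\<^sup>2 + 2 * (norm (h s))\<^sup>2) t" for t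
    unfolding e using G(3) H(3) by (intro Bochner_Integration.integrable_add integrable_mult_right)
  have m: "(\<lambda>s. (norm (g s + h s))\<^sup>2) \<in> borel_measurable lebesgue" using strongly_measurable_norm[OF sm] by measurable
  have i1: "rconv_integrable l (\<lambda>s. (norm (g s + h s))\<^sup>2) t" for t
    by (rule integrable_kernel_bound[OF a m i2]) (use le in simp)
  obtain C where C: "\<forall>t<T. rconv l (norm_sq g) t \<le> C" using G(4) by blast
  obtain C' where C': "\<forall>t<T. rconv l (norm_sq h) t \<le> C'" using H(4) by blast
  have "rconv l (\<lambda>s. (norm (g s + h s))\<^sup>2) t \<le> 2 * C + 2 * C'" if "t < T" for t
  proof -
    have "rconv l (\<lambda>s. (norm (g s + h s))\<^sup>2) t \<le> rconv l (\<lambda>s. 2 * (norm (g s))\<^sup>2 + 2 * (norm (h s))\<^sup>2) t"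
      by (rule rconv_mono[OF a i1 i2 le])
    also have "\<dots> = 2 * rconv l (norm_sq g) t + 2 * rconv l (norm_sq h) t"
      unfolding rconv_def e using G(3) H(3) by simp
    finally show ?thesis using C C' that by force
  qed
  then show "\<exists>C. \<forall>t<T. rconv_integrable l (\<lambda>s. (norm (g s + h s))\<^sup>2) t \<and> rconv l (\<lambda>s. (norm (g s
      + h s))\<^sup>2) t \<le> C"
    using i1 by blast
qed

lemma conv_sq_bounded_local:
  fixes h :: "real \<Rightarrow> 'h::real_inner"
  assumes a: "mono_kernel l" and h: "strongly_measurable lebesgue h" and h0: "\<And>s. s \<le> 0 \<Longrightarrow> h s = 0"
    and hb: "\<And>T. \<exists>C. \<forall>s<T. norm (h s) \<le> C"
  shows "conv_sq_bounded l h"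
  unfolding conv_sq_bounded_def
proof (intro conjI allI impI h h0)
  fix T
  obtain C where C: "\<forall>s<T. norm (h s) \<le> C" using hb by blast
  have sq: "(norm (h s))\<^sup>2 \<le> C\<^sup>2" if "s < T" for s using C that by (intro power_mono) auto
  have m: "(norm_sq h) \<in> borel_measurable lebesgue" using strongly_measurable_norm[OF h] by measurable
  have i1: "rconv_integrable l (norm_sq h) t" if "t < T" for t
    by (rule rconv_bounded_integrable(1)[OF a m, where C = "C\<^sup>2"]) (use h0 sq that in auto)
  have i2: "rconv_integrable l (\<lambda>s. C\<^sup>2 * heaviside s) t" for t
    using integrable_mult_right[OF integrable_kernel_heaviside[OF a], of "C\<^sup>2"] by (simp add: mult_ac)
  have "rconv l (norm_sq h) t \<le> C\<^sup>2 * cumul l T" if t: "t < T" for t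
  proof -
    have "rconv l (norm_sq h) t \<le> rconv l (\<lambda>s. C\<^sup>2 * heaviside s) t"
    proof (rule rconv_mono[OF a i1[OF t] i2])
      fix s assume "s < t" then show "(norm (h s))\<^sup>2 \<le> C\<^sup>2 * heaviside s" using sq[of s] t h0[of s] by (cases "s \<le> 0") auto
    qed
    also have "\<dots> = C\<^sup>2 * cumul l t" by (simp add: rconv_cmult rconv_heaviside)
    also have "\<dots> \<le> C\<^sup>2 * cumul l T" using t mono_kernelD[OF a] by (intro mult_left_mono cumul_mono) auto
    finally show ?thesis .
  qed
  then show "\<exists>C. \<forall>t<T. rconv_integrable l (norm_sq h) t \<and> rconv l (norm_sq h) t \<le> C"
    using i1 by blast
qed

lemma conv_sq_bounded_uminus:
  assumes "conv_sq_bounded l h" shows "conv_sq_bounded l (\<lambda>s. - h s)"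
  using assms strongly_measurable_compose[of lebesgue h uminus, OF _ continuous_on_minus[OF continuous_on_id]]
  by (auto simp: conv_sq_bounded_def)

text \<open>In this class the convolution of \<open>l\<close> with |h| is locally bounded, so the
  domination condition reduces to integrability of a multiple of |h|, and the inequality holds at
  every time.\<close>

lemma (in conj_kernels) convex_ineq_sq:
  fixes h u :: "real \<Rightarrow> 'h::{real_inner,banach}"
  assumes sc: "smooth_convex \<psi> p \<Lambda>" and \<psi>0: "\<psi> 0 = 0" and h: "conv_sq_bounded l h"
    and u: "\<And>t e. u t \<bullet> e = rconv l (\<lambda>s. h s \<bullet> e) t"
  shows "\<psi> (u t) \<le> rconv l (\<lambda>s. h s \<bullet> p (u s)) t"
    and "rconv_integrable l (\<lambda>s. h s \<bullet> p (u s)) t"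
proof -
  note H = conv_sq_boundedD[OF h]
  note i = conv_sq_bounded_integrable(1)[OF l h]
  have nn: "0 \<le> rconv l (\<lambda>s. norm (h s)) s" for s by (rule rconv_nonneg[OF l]) auto
  obtain C where C: "0 \<le> C" "\<forall>s<t. rconv l (\<lambda>s. norm (h s)) s \<le> C"
    using conv_sq_bounded_integrable(2)[OF l h] by blast
  have dom: "rconv_integrable l (\<lambda>s. norm (h s) * rconv l (\<lambda>s. norm (h s)) s) t"
  proof (rule integrable_kernel_bound[OF l, where h = "\<lambda>s. norm (h s) * C"])
    have [measurable]: "(\<lambda>s. norm (h s)) \<in> borel_measurable lebesgue" by (rule strongly_measurable_norm[OF H(1)])
    have [measurable]: "rconv l (\<lambda>s. norm (h s)) \<in> borel_measurable lebesgue"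
      by (rule rconv_measurable) (use mono_kernelD(2)[OF l] in auto)
    show "(\<lambda>s. norm (h s) * rconv l (\<lambda>s. norm (h s)) s) \<in> borel_measurable lebesgue" by measurable
    show "rconv_integrable l (\<lambda>s. norm (h s) * C) t"
      using integrable_mult_left[OF i[of t], of C] by (simp add: mult.assoc)
    show "\<bar>norm (h s) * rconv l (\<lambda>s. norm (h s)) s\<bar> \<le> norm (h s) * C" if "s < t" for s
      using C that nn by (simp add: abs_mult mult_left_mono)
  qed
  have AE: "AE s in lebesgue. rconv_integrable l (\<lambda>r. norm (h r)) s \<and> (\<forall>e. u s \<bullet> e = rconv l (\<lambda>s. h s
      \<bullet> e) s)"
    using i u by auto
  show "\<psi> (u t) \<le> rconv l (\<lambda>s. h s \<bullet> p (u s)) t"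
    by (rule convex_ineq(1)[where u = u and h = h, OF sc \<psi>0 H(1,2) i u AE dom])
  show "rconv_integrable l (\<lambda>s. h s \<bullet> p (u s)) t"
    by (rule convex_ineq(2)[where u = u and h = h, OF sc \<psi>0 H(1,2) i u AE dom])
qed

text \<open>The convexity inequality concerns \<open>u - u0\<close> and a functional vanishing at 0;
  the shift adapts the Moreau envelope to this.\<close>

lemma smooth_convex_shift:
  assumes "smooth_convex \<psi> p \<Lambda>"
  shows "smooth_convex (\<lambda>x. \<psi> (a + x) - \<psi> a) (\<lambda>x. p (a + x)) \<Lambda>"
proof -
  interpret smooth_convex \<psi> p \<Lambda> by fact
  show ?thesis
  proof
    show "0 \<le> \<psi> (a + y) - \<psi> a - (\<psi> (a + x) - \<psi> a) - p (a + x) \<bullet> (y - x)" for x y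
      using grad_lower[where x = "a + x" and y = "a + y"] by simp
    show "\<psi> (a + y) - \<psi> a - (\<psi> (a + x) - \<psi> a) - p (a + x) \<bullet> (y - x) \<le> \<Lambda> / 2 * (norm (y - x))\<^sup>2" for x y
      using grad_upper[where x = "a + x" and y = "a + y"] by simp
    show "norm (p (a + x) - p (a + y)) \<le> \<Lambda> * norm (x - y)" for x y using grad_lipschitz[of "a + x" "a + y"] by simp
  qed (rule \<Lambda>_nonneg)
qed

lemma smooth_convex_half_norm_sq: "smooth_convex (\<lambda>x::'h::real_inner. (norm x)\<^sup>2 / 2) (\<lambda>x. x) 1"
proof
  fix x y :: 'h
  have "(norm y)\<^sup>2 / 2 - (norm x)\<^sup>2 / 2 - x \<bullet> (y - x) = (norm (y - x))\<^sup>2 / 2"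
    by (simp add: power2_norm_eq_inner inner_diff_left inner_diff_right inner_commute field_simps)
  then show "0 \<le> (norm y)\<^sup>2 / 2 - (norm x)\<^sup>2 / 2 - x \<bullet> (y - x)"
    "(norm y)\<^sup>2 / 2 - (norm x)\<^sup>2 / 2 - x \<bullet> (y - x) \<le> 1 / 2 * (norm (y - x))\<^sup>2"
    by (simp_all only:) auto
qed auto

section \<open>The regularized problems\<close>

locale evolution = conj_kernels k l + convex_lsc \<phi>
  for k l :: "real \<Rightarrow> real" and \<phi> :: "'h::{real_inner,banach} \<Rightarrow> ereal" +
  fixes B :: "'h \<Rightarrow> 'h" and LB :: real and f :: "real \<Rightarrow> 'h" and u0 :: 'h
  assumes B: "LB-lipschitz_on UNIV B" and u0: "u0 \<in> D" and f: "conv_sq_bounded l f"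
begin

lemma LB_nonneg: "0 \<le> LB" and B_lipschitz: "norm (B x - B y) \<le> LB * norm (x - y)"
  using B by (auto simp: lipschitz_on_def dist_norm)

lemma continuous_B: "continuous_on UNIV B"
  by (rule lipschitz_on_continuous_on[OF B])

text \<open>Only the terms evaluated along \<open>u\<close> need to be cut off at nonpositive times,
  where \<open>u\<close> equals \<open>u0\<close>; the source \<open>f\<close> already vanishes
  there.\<close>

definition rhs :: "real \<Rightarrow> (real \<Rightarrow> 'h) \<Rightarrow> real \<Rightarrow> 'h" where
  "rhs \<theta> u s = f s - zext (\<lambda>s. yosida \<theta> (u s) + B (u s)) s"

text \<open>The Volterra form with the maximal monotone term replaced by its Yosida approximation,
  tested against all vectors. It contains no time derivative.\<close>

definition regularized :: "real \<Rightarrow> (real \<Rightarrow> 'h) \<Rightarrow> bool" where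
  "regularized \<theta> u \<longleftrightarrow> continuous_on UNIV u \<and> (\<forall>t\<le>0. u t = u0) \<and> conv_sq_bounded l (rhs
      \<theta> u) \<and>
     (\<forall>t e. (u t - u0) \<bullet> e = rconv l (\<lambda>s. rhs \<theta> u s \<bullet> e) t)"

lemma zext_continuous_bounded:
  fixes w :: "real \<Rightarrow> 'a::real_normed_vector"
  assumes "continuous_on UNIV w" "\<And>t. t \<le> 0 \<Longrightarrow> w t = c"
  shows "\<exists>C. \<forall>s<T. norm (zext w s) \<le> C"
proof -
  obtain C where "0 \<le> C" "\<forall>s\<le>T. norm (w s) \<le> C" using continuous_locally_bounded[of w c T] assms by blast
  then show ?thesis by (intro exI[of _ C]) (auto simp: zext_def)
qed

lemma continuous_yosida: "0 < \<theta> \<Longrightarrow> continuous_on UNIV (yosida \<theta>)"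
  using smooth_convex.continuous_p[OF smooth_convex_envelope] .

text \<open>The source is only square integrable in the convolved sense, so it is put into the
  inhomogeneity through its continuous convolution with \<open>l\<close>. What remains under the
  integral is a Lipschitz function of \<open>u\<close>.\<close>

lemma regularized_exists:
  assumes \<theta>: "0 < \<theta>"
  shows "\<exists>u. regularized \<theta> u"
proof -
  define G where "G w = - (yosida \<theta> w + B w)" for w
  have G: "(1 / \<theta> + LB)-lipschitz_on UNIV G"
  proof (rule lipschitz_onI)
    fix x y
    have "norm (G x - G y) = norm ((yosida \<theta> x - yosida \<theta> y) + (B x - B y))"
      by (subst norm_minus_cancel[symmetric]) (simp add: G_def algebra_simps)
    also have "\<dots> \<le> 1 / \<theta> * norm (x - y) + LB * norm (x - y)"
      by (intro norm_triangle_le add_mono yosida_lipschitz[OF \<theta>] B_lipschitz)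
    finally show "dist (G x) (G y) \<le> (1 / \<theta> + LB) * dist x y" by (simp add: dist_norm algebra_simps)
  qed (use \<theta> LB_nonneg in simp)
  note F = conv_sq_boundedD[OF f] and cf = conv_sq_bounded_conv[OF l f]
  have "continuous_on UNIV (\<lambda>t. u0 + conv l f t)" by (intro continuous_on_add continuous_on_const cf)
  moreover have "u0 + conv l f t = u0" if "t \<le> 0" for t using conv_nonpos[OF l F(1,2) that] by simp
  ultimately obtain u where u: "continuous_on UNIV u" "\<And>t. t \<le> 0 \<Longrightarrow> u t = u0"
    "\<And>t. u t = u0 + conv l f t + conv l (zext (\<lambda>s. G (u s))) t"
    using volterra_solution[OF l _ _ G, of "\<lambda>t. u0 + conv l f t" u0] by blast
  have cG: "continuous_on UNIV (\<lambda>s. G (u s))"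
    by (rule continuous_on_compose2[OF lipschitz_on_continuous_on[OF G] u(1)]) auto
  have zG: "strongly_measurable lebesgue (zext (\<lambda>s. G (u s)))" "\<And>T. \<exists>C. \<forall>s<T. norm (zext (\<lambda>s. G (u s))
      s) \<le> C"
    using cG zext_continuous_bounded[OF cG, of "G u0"] u(2) by (auto intro: strongly_measurable_zext strongly_measurable_continuous)
  have sqG: "conv_sq_bounded l (zext (\<lambda>s. G (u s)))" by (rule conv_sq_bounded_local[OF l zG(1) _ zG(2)]) simp
  have rhs: "rhs \<theta> u = (\<lambda>s. f s + zext (\<lambda>s. G (u s)) s)" by (auto simp: rhs_def zext_def G_def)
  have "(u t - u0) \<bullet> e = rconv l (\<lambda>s. rhs \<theta> u s \<bullet> e) t" for t e
  proof -
    have "(u t - u0) \<bullet> e = conv l f t \<bullet> e + conv l (zext (\<lambda>s. G (u s))) t \<bullet> e"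
      by (subst u(3)) (simp add: inner_add_left)
    also have "\<dots> = rconv l (\<lambda>s. f s \<bullet> e) t + rconv l (\<lambda>s. zext (\<lambda>s. G (u s)) s \<bullet> e) t"
      using cf(1) conv_sq_bounded_conv(1)[OF l sqG] by simp
    also have "\<dots> = rconv l (\<lambda>s. rhs \<theta> u s \<bullet> e) t"
      unfolding rhs rconv_def inner_add_left distrib_left
      using rconv_inner_integrable[OF l F(1) conv_sq_bounded_integrable(1)[OF l f]]
        rconv_inner_integrable[OF l zG(1) conv_sq_bounded_integrable(1)[OF l sqG]]
      by (intro Bochner_Integration.integral_add[symmetric])
    finally show ?thesis .
  qed
  moreover have "conv_sq_bounded l (rhs \<theta> u)" unfolding rhs by (rule conv_sq_bounded_add[OF l f sqG])
  ultimately show ?thesis using u(1,2) unfolding regularized_def by blast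
qed

lemma regularizedD:
  assumes "regularized \<theta> u"
  shows "continuous_on UNIV u" "t \<le> 0 \<Longrightarrow> u t = u0" "conv_sq_bounded l (rhs \<theta> u)"
    "(u t - u0) \<bullet> e = rconv l (\<lambda>s. rhs \<theta> u s \<bullet> e) t"
  using assms by (auto simp: regularized_def)

end

section \<open>Estimates uniform in the regularization parameter\<close>

context evolution begin

lemma regularized_measurable:
  assumes u: "regularized \<theta> u" and \<theta>: "0 < \<theta>"
  shows "strongly_measurable lebesgue (zext (\<lambda>s. yosida \<theta> (u s)))"
    and "\<exists>C. \<forall>s<T. norm (zext (\<lambda>s. yosida \<theta> (u s)) s) \<le> C"
    and "strongly_measurable lebesgue (zext (\<lambda>s. B (u s)))"
    and "\<exists>C. \<forall>s<T. norm (zext (\<lambda>s. B (u s)) s) \<le> C"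
proof -
  note U = regularizedD[OF u]
  have c1: "continuous_on UNIV (\<lambda>s. yosida \<theta> (u s))" by (rule continuous_on_compose2[OF continuous_yosida[OF \<theta>] U(1)]) auto
  have c2: "continuous_on UNIV (\<lambda>s. B (u s))" by (rule continuous_on_compose2[OF continuous_B U(1)]) auto
  show "strongly_measurable lebesgue (zext (\<lambda>s. yosida \<theta> (u s)))" "strongly_measurable lebesgue (zext (\<lambda>s. B (u s)))"
    by (intro strongly_measurable_zext strongly_measurable_continuous c1 c2)+
  show "\<exists>C. \<forall>s<T. norm (zext (\<lambda>s. yosida \<theta> (u s)) s) \<le> C"
    by (rule zext_continuous_bounded[OF c1, of "yosida \<theta> u0"]) (simp add: U(2))
  show "\<exists>C. \<forall>s<T. norm (zext (\<lambda>s. B (u s)) s) \<le> C"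
    by (rule zext_continuous_bounded[OF c2, of "B u0"]) (simp add: U(2))
qed

lemma integrable_kernel_sq:
  fixes v :: "real \<Rightarrow> 'h"
  assumes v: "continuous_on UNIV v" "\<forall>t\<le>0. v t = 0"
  shows "rconv_integrable l (norm_sq v) t"
    and "(norm_sq v) \<in> borel_measurable lebesgue" and "\<exists>Y. \<forall>s<T. (norm (v s))\<^sup>2 \<le> Y"
proof -
  have c: "continuous_on UNIV (norm_sq v)" using v(1) by (intro continuous_intros)
  show m: "(norm_sq v) \<in> borel_measurable lebesgue" by (intro borel_imp_lebesgue borel_measurable_continuous_onI c)
  have b: "\<exists>C\<ge>0. \<forall>s\<le>T. norm ((norm (v s))\<^sup>2) \<le> C" for T by (rule continuous_locally_bounded[OF c, of 0])
      (simp add: v(2))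
  then obtain C where "\<forall>s\<le>t. norm ((norm (v s))\<^sup>2) \<le> C" by blast
  then show "rconv_integrable l (norm_sq v) t"
    by (intro rconv_bounded_integrable(1)[OF l m, where C = C]) (auto simp: v(2))
  from b[of T] obtain C where "\<forall>s\<le>T. norm ((norm (v s))\<^sup>2) \<le> C" by blast
  then show "\<exists>Y. \<forall>s<T. (norm (v s))\<^sup>2 \<le> Y" by (intro exI[of _ C]) auto
qed

text \<open>The convexity inequality for the half squared norm of \<open>u - u0\<close>. The Yosida
  term is not merely monotone here: convexity of the envelope bounds its pairing with
  \<open>u - u0\<close> below by \<open>envelope \<theta> (u s) - R u0\<close>, and the cone
  minorant controls the envelope uniformly for \<theta> \<le> 1. Gronwall's inequality closes the
  estimate.\<close>

lemma apriori_bound: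
  "\<exists>E\<ge>0. \<forall>\<theta> u. 0 < \<theta> \<and> \<theta> \<le> 1 \<and> regularized \<theta> u \<longrightarrow>
      (\<forall>t<T. (norm (u t - u0))\<^sup>2 \<le> E)"
proof -
  obtain r where r: "0 < r" "\<forall>v\<in>D. R u0 - 1 - norm (v - u0) / r \<le> R v" using affine_minorant[OF u0] by blast
  \<comment> \<open>\<open>c1\<close> collects the constants of the cone bound and of
    \<open>B u0\<close>. In \<open>c2\<close> the 3/2 stands for three Young halves of the squared
    norm of \<open>u - u0\<close>, from the slope of the cone, from \<open>f\<close> and from
    \<open>B u0\<close>.\<close>
  define c1 where "c1 = 1 + 1 / r\<^sup>2 + (norm (B u0))\<^sup>2 / 2"
  define c2 where "c2 = LB + 3 / 2"
  have c1: "0 \<le> c1" by (simp add: c1_def)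
  have c2: "0 \<le> 2 * c2" using LB_nonneg by (simp add: c2_def)
  obtain E where E: "0 \<le> E" "\<And>y b t. volterra_subsolution l (2 * c2) T b y \<Longrightarrow> t < T \<Longrightarrow> y t \<le> E * b"
    using volterra_gronwall[OF l c2, of T] by blast
  obtain Cf where Cf: "0 \<le> Cf" "\<forall>t<T. rconv l (norm_sq f) t \<le> Cf" using conv_sq_boundedD(4)[OF f] by blast
  define b where "b = Cf + 2 * c1 * cumul l T"
  have lT: "0 \<le> cumul l T" using cumul_nonneg mono_kernelD(3)[OF l] by auto
  have b: "0 \<le> b" using Cf c1 lT by (simp add: b_def)
  show ?thesis
  proof (intro exI[of _ "E * b"] conjI allI impI)
    show "0 \<le> E * b" using E(1) b by simp
    fix \<theta> u t assume "0 < \<theta> \<and> \<theta> \<le> 1 \<and> regularized \<theta> u" and t: "t < T"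
    then have \<theta>: "0 < \<theta>" "\<theta> \<le> 1" and reg: "regularized \<theta> u" by auto
    note U = regularizedD[OF reg]
    define v where "v s = u s - u0" for s
    have cv: "continuous_on UNIV v" "\<And>s. s \<le> 0 \<Longrightarrow> v s = 0" unfolding v_def using U by (auto intro: continuous_intros)
    have cv0: "\<forall>s\<le>0. v s = 0" using cv(2) by blast
    note V = integrable_kernel_sq[OF cv(1) cv0]
    have pt: "rhs \<theta> u s \<bullet> v s \<le> (1/2) * (norm (f s))\<^sup>2 + (c1 * heaviside s + c2 * (norm (v s))\<^sup>2)" for s
    proof (cases "s \<le> 0")
      case True then show ?thesis using cv(2) conv_sq_boundedD(2)[OF f] by simp
    next
      case False
      define n where "n = norm (v s)"
      interpret sc: smooth_convex "envelope \<theta>" "yosida \<theta>" "1 / \<theta>" by (rule smooth_convex_envelope[OF \<theta>(1)])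
      have "envelope \<theta> (u s) - R u0 \<le> yosida \<theta> (u s) \<bullet> v s"
        using sc.grad_lower[where x = "u s" and y = u0] envelope_le[OF \<theta>(1) u0] by (simp add: v_def inner_diff_right)
      moreover have "R u0 - 1 - n / r - \<theta> / (2 * r\<^sup>2) \<le> envelope \<theta> (u s)"
        using moreau_bounded_below[OF u0 r prox(1)[OF \<theta>(1)] \<theta>(1)] by (simp add: n_def v_def envelope_def)
      moreover have "\<theta> / (2 * r\<^sup>2) \<le> (1 / r\<^sup>2) / 2"
        using divide_right_mono[OF \<theta>(2), of "2 * r\<^sup>2"] by (simp add: mult.commute)
      moreover have "n / r \<le> (1 / r\<^sup>2) / 2 + n\<^sup>2 / 2"
      proof -
        have "0 \<le> (n - 1 / r)\<^sup>2" by simp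
        then show ?thesis by (simp add: power2_diff power_divide)
      qed
      moreover have "f s \<bullet> v s \<le> (norm (f s))\<^sup>2 / 2 + n\<^sup>2 / 2"
      proof -
        have "0 \<le> (norm (f s - v s))\<^sup>2" by simp
        then show ?thesis by (simp add: n_def power2_norm_eq_inner inner_diff_left inner_diff_right inner_commute)
      qed
      moreover have "- (B (u s) \<bullet> v s) \<le> (norm (B u0))\<^sup>2 / 2 + n\<^sup>2 / 2 + LB * n\<^sup>2"
      proof -
        have "- (B (u s) \<bullet> v s) \<le> norm (B (u s)) * n"
          using norm_cauchy_schwarz[of "- B (u s)" "v s"] by (simp add: n_def)
        also have "norm (B (u s)) \<le> norm (B u0) + LB * n"
          using norm_triangle_sub[of "B (u s)" "B u0"] B_lipschitz[of "u s" u0] by (simp add: n_def v_def)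
        finally have "- (B (u s) \<bullet> v s) \<le> (norm (B u0) + LB * n) * n" by (simp add: n_def mult_right_mono)
        moreover have "0 \<le> (norm (B u0) - n)\<^sup>2" by simp
        ultimately show ?thesis by (simp add: power2_eq_square algebra_simps)
      qed
      ultimately show ?thesis using False unfolding n_def[symmetric]
        by (simp add: rhs_def inner_diff_left inner_add_left c1_def c2_def algebra_simps)
    qed
    have y: "(norm (v t))\<^sup>2 \<le> b + 2 * c2 * rconv l (norm_sq v) t" if t: "t < T" for t
    proof -
      have "(norm (v t))\<^sup>2 / 2 \<le> rconv l (\<lambda>s. rhs \<theta> u s \<bullet> v s) t"
        by (rule convex_ineq_sq(1)[OF smooth_convex_half_norm_sq _ U(3)]) (simp_all add: v_def U(4))
      also have "\<dots> \<le> rconv l (\<lambda>s. (1/2) * (norm (f s))\<^sup>2 + (c1 * heaviside s + c2 * (norm (v s))\<^sup>2)) t"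
      proof (rule rconv_mono[OF l _ _ pt])
        show "rconv_integrable l (\<lambda>s. rhs \<theta> u s \<bullet> v s) t"
          by (rule convex_ineq_sq(2)[OF smooth_convex_half_norm_sq _ U(3)]) (simp_all add: v_def U(4))
        show "rconv_integrable l (\<lambda>s. (1/2) * (norm (f s))\<^sup>2 + (c1 * heaviside s + c2 * (norm (v s))\<^sup>2)) t"
          by (intro integrable_kernel_add integrable_kernel_cmult integrable_kernel_heaviside l V conv_sq_boundedD(3)[OF f])
      qed
      also have "\<dots> = (1/2) * rconv l (norm_sq f) t + (c1 * cumul l t + c2 * rconv l (norm_sq v) t)"
      proof -
        note i1 = integrable_kernel_cmult[OF conv_sq_boundedD(3)[OF f], of t "1/2"]
        note i2 = integrable_kernel_cmult[OF integrable_kernel_heaviside[OF l], of t c1]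
        note i3 = integrable_kernel_cmult[OF V(1), of t c2]
        show ?thesis
          unfolding rconv_add[OF i1 integrable_kernel_add[OF i2 i3]] rconv_add[OF i2 i3] rconv_cmult rconv_heaviside ..
      qed
      also have "\<dots> \<le> (1/2) * Cf + (c1 * cumul l T + c2 * rconv l (norm_sq v) t)"
        using Cf t c1 c2 mono_kernelD[OF l] by (intro add_mono mult_left_mono cumul_mono) auto
      finally show ?thesis by (simp add: b_def algebra_simps)
    qed
    have "(norm (v t))\<^sup>2 \<le> E * b"
      by (rule E(2)[where y = "\<lambda>s. (norm (v s))\<^sup>2", OF _ t]) (use b V(2,3) y cv in \<open>auto simp: volterra_subsolution_def\<close>)
    then show "(norm (u t - u0))\<^sup>2 \<le> E * b" by (simp add: v_def)
  qed
qed

text \<open>The convexity inequality for the Moreau envelope shifted to \<open>u0\<close>: its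
  gradient along the solution is the Yosida term itself, so the equation produces minus its squared
  norm, half of which survives on the left. The envelope then splits into the value at the proximal
  point and \<theta>/2 times that squared norm.\<close>

lemma energy_bound:
  "\<exists>E\<ge>0. \<forall>\<theta> u. 0 < \<theta> \<and> \<theta> \<le> 1 \<and> regularized \<theta> u \<longrightarrow>
     (\<forall>t<T. rconv_integrable l (\<lambda>s. (norm (zext (\<lambda>s. yosida \<theta> (u s)) s))\<^sup>2) t \<and>
        rconv l (\<lambda>s. (norm (zext (\<lambda>s. yosida \<theta> (u s)) s))\<^sup>2) t \<le> E \<and> R (prox \<theta> (u t)) \<le> E \<and>
        \<theta> * (norm (yosida \<theta> (u t)))\<^sup>2 \<le> E)"
proof -
  obtain r where r: "0 < r" "\<forall>v\<in>D. R u0 - 1 - norm (v - u0) / r \<le> R v" using affine_minorant[OF u0] by blast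
  obtain E0 where E0: "0 \<le> E0" "\<And>\<theta> u t. 0 < \<theta> \<Longrightarrow> \<theta> \<le> 1 \<Longrightarrow> regularized
      \<theta> u \<Longrightarrow> t < T \<Longrightarrow> (norm (u t - u0))\<^sup>2 \<le> E0"
    using apriori_bound[of T] by blast
  obtain Cf where Cf: "0 \<le> Cf" "\<forall>t<T. rconv l (norm_sq f) t \<le> Cf" using conv_sq_boundedD(4)[OF f] by blast
  define n where "n = sqrt E0"
  have n: "0 \<le> n" using E0(1) by (simp add: n_def)
  define CB where "CB = (norm (B u0) + LB * n)\<^sup>2"
  define m where "m = R u0 - 1 - n / r - 1 / (2 * r\<^sup>2)"
  define X where "X = R u0 + Cf + CB * cumul l T"
  \<comment> \<open>The nested maxima collect, in this order, the bounds for the convolved square of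
    the Yosida term, for \<phi> at the proximal point, and for \<theta> times the squared Yosida
    term.\<close>
  define E where "E = max 0 (max (2 * (X - m)) (max X (4 * (X - (R u0 - 1 - n / r - 1 / r\<^sup>2)))))"
  show ?thesis
  proof (intro exI[of _ E] conjI[of "0 \<le> E"] allI impI)
    show "0 \<le> E" by (simp add: E_def)
    fix \<theta> u t assume "0 < \<theta> \<and> \<theta> \<le> 1 \<and> regularized \<theta> u" and t: "t < T"
    then have \<theta>: "0 < \<theta>" "\<theta> \<le> 1" and reg: "regularized \<theta> u" by auto
    note U = regularizedD[OF reg] and S = regularized_measurable[OF reg \<theta>(1)]
    have vn: "norm (u s - u0) \<le> n" if "s < T" for s
      using E0(2)[OF \<theta> reg that] unfolding n_def by (rule real_le_rsqrt)
    define X' where "X' = zext (\<lambda>s. yosida \<theta> (u s))"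
    have iX: "rconv_integrable l (norm_sq X') t" for t
      using conv_sq_boundedD(3)[OF conv_sq_bounded_local[OF l S(1) _ S(2)]] by (simp add: X'_def)
    define \<psi> where "\<psi> x = envelope \<theta> (u0 + x) - envelope \<theta> u0" for x
    have sc: "smooth_convex \<psi> (\<lambda>x. yosida \<theta> (u0 + x)) (1 / \<theta>)"
      unfolding \<psi>_def by (rule smooth_convex_shift[OF smooth_convex_envelope[OF \<theta>(1)]])
    have "\<psi> (u t - u0) \<le> rconv l (\<lambda>s. rhs \<theta> u s \<bullet> yosida \<theta> (u0 + (u s - u0))) t"
      by (rule convex_ineq_sq(1)[OF sc _ U(3) U(4)]) (simp add: \<psi>_def)
    moreover have i1: "rconv_integrable l (\<lambda>s. rhs \<theta> u s \<bullet> yosida \<theta> (u0 + (u s - u0))) t"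
      by (rule convex_ineq_sq(2)[OF sc _ U(3) U(4)]) (simp add: \<psi>_def)
    moreover have "rconv l (\<lambda>s. rhs \<theta> u s \<bullet> yosida \<theta> (u0 + (u s - u0))) t
        \<le> rconv l (\<lambda>s. ((norm (f s))\<^sup>2 + CB * heaviside s) + (- 1/2) * (norm (X' s))\<^sup>2) t"
    proof (rule rconv_mono[OF l i1])
      show "rconv_integrable l (\<lambda>s. ((norm (f s))\<^sup>2 + CB * heaviside s) + (- 1/2) * (norm (X' s))\<^sup>2) t"
        by (intro integrable_kernel_add integrable_kernel_cmult integrable_kernel_heaviside l iX conv_sq_boundedD(3)[OF f])
      fix s assume "s < t"
      then have sT: "s < T" using t by simp
      show "rhs \<theta> u s \<bullet> yosida \<theta> (u0 + (u s - u0)) \<le> ((norm (f s))\<^sup>2 + CB * heaviside s) + (- 1/2) * (norm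
          (X' s))\<^sup>2"
      proof (cases "s \<le> 0")
        case True then show ?thesis using conv_sq_boundedD(2)[OF f] by (simp add: rhs_def X'_def)
      next
        case False
        define \<xi> where "\<xi> = yosida \<theta> (u s)"
        define b where "b = B (u s)"
        have "norm b \<le> norm (B u0) + LB * n"
        proof -
          have "LB * norm (u s - u0) \<le> LB * n" using vn[OF sT] LB_nonneg by (rule mult_left_mono)
          then show ?thesis using norm_triangle_sub[of "B (u s)" "B u0"] B_lipschitz[of "u s" u0] by (simp add: b_def)
        qed
        then have "(norm b)\<^sup>2 \<le> CB" unfolding CB_def by (intro power_mono) auto
        moreover have "(f s - (\<xi> + b)) \<bullet> \<xi> \<le> (norm (f s))\<^sup>2 + (norm b)\<^sup>2 - (norm \<xi>)\<^sup>2 / 2"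
        proof -
          \<comment> \<open>This sum of squares is exactly the difference of the two sides of the
            claim.\<close>
          have "0 \<le> (norm (f s + b))\<^sup>2 / 2 + (norm (f s - b - \<xi>))\<^sup>2 / 2" by simp
          then show ?thesis
            by (simp add: power2_norm_eq_inner inner_add_left inner_add_right inner_diff_left inner_diff_right inner_commute field_simps)
        qed
        ultimately show ?thesis using False by (simp add: rhs_def \<xi>_def[symmetric] b_def[symmetric] X'_def)
      qed
    qed
    moreover have "rconv l (\<lambda>s. ((norm (f s))\<^sup>2 + CB * heaviside s) + (- 1/2) * (norm (X' s))\<^sup>2) t
        = rconv l (norm_sq f) t + CB * cumul l t + (- 1/2) * rconv l (norm_sq X') t"
    proof -
      note i1 = conv_sq_boundedD(3)[OF f, of t]
      note i2 = integrable_kernel_cmult[OF integrable_kernel_heaviside[OF l], of t CB]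
      note i3 = integrable_kernel_cmult[OF iX, of t "- 1/2"]
      show ?thesis
        unfolding rconv_add[OF integrable_kernel_add[OF i1 i2] i3] rconv_add[OF i1 i2] rconv_cmult rconv_heaviside ..
    qed
    moreover have "CB * cumul l t \<le> CB * cumul l T"
      using t mono_kernelD[OF l] by (intro mult_left_mono cumul_mono) (auto simp: CB_def)
    moreover have "rconv l (norm_sq f) t \<le> Cf" using Cf t by blast
    ultimately have main: "envelope \<theta> (u t) + rconv l (norm_sq X') t / 2 \<le> X"
      using envelope_le[OF \<theta>(1) u0] unfolding \<psi>_def X_def by simp
    have nn: "0 \<le> rconv l (norm_sq X') t" by (rule rconv_nonneg[OF l]) simp
    have "norm (u t - u0) / r \<le> n / r" using vn[OF t] r by (intro divide_right_mono) auto
    moreover have "\<theta> / (2 * r\<^sup>2) \<le> 1 / (2 * r\<^sup>2)" using \<theta> r by (intro divide_right_mono) auto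
    ultimately have "m \<le> envelope \<theta> (u t)"
      using moreau_bounded_below[OF u0 r prox(1)[OF \<theta>(1), of "u t"] \<theta>(1), of "u t"] unfolding m_def envelope_def by linarith
    with main have "rconv l (norm_sq X') t \<le> 2 * (X - m)" by simp
    then have 1: "rconv l (norm_sq X') t \<le> E" by (simp add: E_def)
    define y where "y = norm (yosida \<theta> (u t))"
    have env: "R (prox \<theta> (u t)) + \<theta> / 2 * y\<^sup>2 \<le> X" using main nn by (simp add: envelope_eq[OF \<theta>(1)] y_def)
    have "0 \<le> \<theta> / 2 * y\<^sup>2" using \<theta> by simp
    with env have "R (prox \<theta> (u t)) \<le> X" by linarith
    then have 2: "R (prox \<theta> (u t)) \<le> E" by (simp add: E_def)
    \<comment> \<open>\<phi> may be negative at the proximal point, so the square cannot be read off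
      from the energy alone. The cone bound loses only a term linear in \<theta> y, which Young's
      inequality absorbs into half of the square; this yields the factor 4 in
      \<open>E\<close>.\<close>
    have "norm (prox \<theta> (u t) - u0) \<le> n + \<theta> * y"
    proof -
      have "prox \<theta> (u t) - u0 = (u t - u0) - \<theta> *\<^sub>R yosida \<theta> (u t)" by (simp add: prox_eq[OF \<theta>(1)])
      then have "norm (prox \<theta> (u t) - u0) \<le> norm (u t - u0) + norm (\<theta> *\<^sub>R yosida \<theta> (u t))"
        by (simp only: norm_triangle_ineq4)
      then show ?thesis using vn[OF t] \<theta> by (simp add: y_def)
    qed
    then have "norm (prox \<theta> (u t) - u0) / r \<le> (n + \<theta> * y) / r" using r by (intro divide_right_mono) auto
    moreover have "R u0 - 1 - norm (prox \<theta> (u t) - u0) / r \<le> R (prox \<theta> (u t))" using r prox(1)[OF \<theta>(1)] by blast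
    ultimately have "R u0 - 1 - (n + \<theta> * y) / r + \<theta> / 2 * y\<^sup>2 \<le> X" using env by linarith
    moreover have "\<theta> * y / r \<le> \<theta> / 4 * y\<^sup>2 + 1 / r\<^sup>2"
    proof -
      have "0 \<le> \<theta> * (y / 2 - 1 / r)\<^sup>2" using \<theta> by simp
      then have "\<theta> * y / r \<le> \<theta> / 4 * y\<^sup>2 + \<theta> * (1 / r\<^sup>2)" using r by (simp add: power2_eq_square field_simps)
      also have "\<theta> * (1 / r\<^sup>2) \<le> 1 * (1 / r\<^sup>2)" using \<theta> by (intro mult_right_mono) auto
      finally show ?thesis by simp
    qed
    moreover have "(n + \<theta> * y) / r = n / r + \<theta> * y / r" by (simp add: add_divide_distrib)
    ultimately have "\<theta> * y\<^sup>2 \<le> 4 * (X - (R u0 - 1 - n / r - 1 / r\<^sup>2))" by argo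
    then have 3: "\<theta> * y\<^sup>2 \<le> E" by (simp add: E_def)
    show "rconv_integrable l (\<lambda>s. (norm (zext (\<lambda>s. yosida \<theta> (u s)) s))\<^sup>2) t \<and>
        rconv l (\<lambda>s. (norm (zext (\<lambda>s. yosida \<theta> (u s)) s))\<^sup>2) t \<le> E \<and> R (prox \<theta> (u t)) \<le> E \<and>
        \<theta> * (norm (yosida \<theta> (u t)))\<^sup>2 \<le> E"
      using iX[of t] 1 2 3 by (simp add: X'_def y_def)
  qed
qed

text \<open>The convexity inequality for the half squared norm of the difference. The defect of
  monotonicity is (\<theta> + \<mu>)/2 times the squared Yosida terms, whose convolutions with
  \<open>l\<close> are bounded by the energy estimate; the Lipschitz term goes into Gronwall's
  inequality.\<close>

lemma cauchy_bound:
  "\<exists>E\<ge>0. \<forall>\<theta> u \<mu> v. 0 < \<theta> \<and> \<theta> \<le> 1 \<and> 0 < \<mu> \<and> \<mu> \<le> 1 \<and>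
      regularized \<theta> u \<and> regularized \<mu> v \<longrightarrow>
     (\<forall>t<T. (norm (u t - v t))\<^sup>2 \<le> E * (\<theta> + \<mu>))"
proof -
  obtain X where X: "0 \<le> X" "\<And>\<theta> u t. 0 < \<theta> \<Longrightarrow> \<theta> \<le> 1 \<Longrightarrow> regularized \<theta>
      u \<Longrightarrow> t < T \<Longrightarrow>
      rconv_integrable l (\<lambda>s. (norm (zext (\<lambda>s. yosida \<theta> (u s)) s))\<^sup>2) t \<and>
      rconv l (\<lambda>s. (norm (zext (\<lambda>s. yosida \<theta> (u s)) s))\<^sup>2) t \<le> X"
    using energy_bound[of T] by blast
  have LB2: "0 \<le> 2 * LB" using LB_nonneg by simp
  obtain E where E: "0 \<le> E" "\<And>y b t. volterra_subsolution l (2 * LB) T b y \<Longrightarrow> t < T \<Longrightarrow> y t \<le> E * b"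
    using volterra_gronwall[OF l LB2, of T] by blast
  show ?thesis
  proof (intro exI[of _ "E * (2 * X)"] conjI allI impI)
    show "0 \<le> E * (2 * X)" using E X by simp
    fix \<theta> u \<mu> v t
    assume "0 < \<theta> \<and> \<theta> \<le> 1 \<and> 0 < \<mu> \<and> \<mu> \<le> 1 \<and> regularized \<theta> u \<and> regularized
        \<mu> v" and t: "t < T"
    then have \<theta>: "0 < \<theta>" "\<theta> \<le> 1" and \<mu>: "0 < \<mu>" "\<mu> \<le> 1" and ru: "regularized \<theta> u" and rv:
        "regularized \<mu> v" by auto
    note U = regularizedD[OF ru] and V = regularizedD[OF rv]
    define d where "d s = u s - v s" for s
    define Xu where "Xu = zext (\<lambda>s. yosida \<theta> (u s))"
    define Xv where "Xv = zext (\<lambda>s. yosida \<mu> (v s))"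
    define h where "h s = rhs \<theta> u s + - rhs \<mu> v s" for s
    have sq: "conv_sq_bounded l h" unfolding h_def by (intro conv_sq_bounded_add conv_sq_bounded_uminus l U V)
    have cd: "continuous_on UNIV d" "\<And>s. s \<le> 0 \<Longrightarrow> d s = 0" unfolding d_def using U V by (auto intro: continuous_intros)
    have cd0: "\<forall>s\<le>0. d s = 0" using cd(2) by blast
    note W = integrable_kernel_sq[OF cd(1) cd0]
    have weak: "d t \<bullet> e = rconv l (\<lambda>s. h s \<bullet> e) t" for t e
    proof -
      have i: "rconv_integrable l (\<lambda>s. rhs \<theta> u s \<bullet> e) t" "rconv_integrable l (\<lambda>s. rhs \<mu> v s \<bullet> e) t"
        using U(3) V(3) by (auto intro!: rconv_inner_integrable l conv_sq_bounded_integrable dest: conv_sq_boundedD)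
      have "d t \<bullet> e = (u t - u0) \<bullet> e - (v t - u0) \<bullet> e" by (simp add: d_def inner_diff_left)
      also have "\<dots> = rconv l (\<lambda>s. rhs \<theta> u s \<bullet> e - rhs \<mu> v s \<bullet> e) t" unfolding U(4) V(4) by (rule
          rconv_diff[OF i, symmetric])
      finally show ?thesis by (simp add: h_def inner_diff_left)
    qed
    define b where "b = (\<theta> + \<mu>) * (2 * X)"
    have y: "(norm (d t))\<^sup>2 \<le> b + 2 * LB * rconv l (norm_sq d) t" if t: "t < T" for t
    proof -
      have iu: "rconv_integrable l (norm_sq Xu) t" "rconv l (norm_sq Xu) t \<le> X"
        and iv: "rconv_integrable l (norm_sq Xv) t" "rconv l (norm_sq Xv) t \<le> X"
        using X(2)[OF \<theta> ru t] X(2)[OF \<mu> rv t] by (auto simp: Xu_def Xv_def)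
      have "(norm (d t))\<^sup>2 / 2 \<le> rconv l (\<lambda>s. h s \<bullet> d s) t"
        by (rule convex_ineq_sq(1)[OF smooth_convex_half_norm_sq _ sq weak]) simp
      also have "\<dots> \<le> rconv l (\<lambda>s. (\<theta> + \<mu>) / 2 * ((norm (Xu s))\<^sup>2 + (norm (Xv s))\<^sup>2) + LB * (norm
          (d s))\<^sup>2) t"
      proof (rule rconv_mono[OF l])
        show "rconv_integrable l (\<lambda>s. h s \<bullet> d s) t"
          by (rule convex_ineq_sq(2)[OF smooth_convex_half_norm_sq _ sq weak]) simp
        show "rconv_integrable l (\<lambda>s. (\<theta> + \<mu>) / 2 * ((norm (Xu s))\<^sup>2 + (norm (Xv s))\<^sup>2) + LB * (norm (d s))\<^sup>2) t"
          by (intro integrable_kernel_add integrable_kernel_cmult iu iv W)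
        fix s
        show "h s \<bullet> d s \<le> (\<theta> + \<mu>) / 2 * ((norm (Xu s))\<^sup>2 + (norm (Xv s))\<^sup>2) + LB * (norm (d s))\<^sup>2"
        proof (cases "s \<le> 0")
          case True then show ?thesis using cd(2) by (simp add: Xu_def Xv_def)
        next
          case False
          have "- ((B (u s) - B (v s)) \<bullet> d s) \<le> norm (B (u s) - B (v s)) * norm (d s)"
            using norm_cauchy_schwarz[of "- (B (u s) - B (v s))" "d s"] by (simp only: norm_minus_cancel inner_minus_left)
          also have "\<dots> \<le> (LB * norm (d s)) * norm (d s)" unfolding d_def by (intro mult_right_mono B_lipschitz) auto
          finally have "- ((B (u s) - B (v s)) \<bullet> d s) \<le> LB * (norm (d s))\<^sup>2" by (simp add: power2_eq_square mult.assoc)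
          moreover have "- (\<theta> + \<mu>) / 2 * ((norm (Xu s))\<^sup>2 + (norm (Xv s))\<^sup>2) \<le> (Xu s - Xv s) \<bullet> d s"
            using yosida_monotone_approx[OF \<theta>(1) \<mu>(1), of "u s" "v s"] False by (simp add: Xu_def Xv_def d_def)
          moreover have "h s = - (Xu s - Xv s) - (B (u s) - B (v s))"
            using False by (simp add: h_def rhs_def Xu_def Xv_def)
          ultimately show ?thesis by (simp only: inner_diff_left inner_minus_left)
        qed
      qed
      also have "\<dots> = (\<theta> + \<mu>) / 2 * (rconv l (norm_sq Xu) t + rconv l (norm_sq Xv) t) + LB * rconv l (norm_sq d) t"
      proof -
        note j = integrable_kernel_cmult[OF integrable_kernel_add[OF iu(1) iv(1)], where c = "(\<theta> + \<mu>) / 2"]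
        show ?thesis
          unfolding rconv_add[OF j integrable_kernel_cmult[OF W(1)]] rconv_cmult rconv_add[OF iu(1) iv(1)] ..
      qed
      also have "\<dots> \<le> (\<theta> + \<mu>) / 2 * (X + X) + LB * rconv l (norm_sq d) t"
        using iu(2) iv(2) \<theta> \<mu> by (intro add_right_mono mult_left_mono add_mono) auto
      also have "(\<theta> + \<mu>) / 2 * (X + X) = b / 2" by (simp add: b_def)
      finally show ?thesis by simp
    qed
    have "(norm (d t))\<^sup>2 \<le> E * b"
    proof (rule E(2)[where y = "\<lambda>s. (norm (d s))\<^sup>2", OF _ t])
      have "0 \<le> b" using X \<theta> \<mu> by (simp add: b_def)
      then show "volterra_subsolution l (2 * LB) T b (norm_sq d)"
        using W(2,3) y cd by (auto simp: volterra_subsolution_def)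
    qed
    then show "(norm (u t - v t))\<^sup>2 \<le> E * (2 * X) * (\<theta> + \<mu>)" by (simp add: d_def b_def mult_ac)
  qed
qed

end

section \<open>Passage to the limit\<close>

lemma rconv_small:
  assumes a: "mono_kernel a" and g: "g \<in> borel_measurable lebesgue" and le: "\<And>s. s < t \<Longrightarrow> \<bar>g s\<bar> \<le>
      \<delta> * heaviside s"
  shows "\<bar>rconv a g t\<bar> \<le> \<delta> * cumul a t" and "rconv_integrable a g t"
proof -
  have ih: "rconv_integrable a (\<lambda>s. \<delta> * heaviside s) t"
    by (intro integrable_kernel_cmult integrable_kernel_heaviside a)
  show ig: "rconv_integrable a g t" by (rule integrable_kernel_bound[OF a g ih le])
  have ig': "rconv_integrable a (\<lambda>s. - 1 * g s) t" by (rule integrable_kernel_cmult[OF ig])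
  have "rconv a g t \<le> rconv a (\<lambda>s. \<delta> * heaviside s) t" by (rule rconv_mono[OF a ig ih]) (use le in force)
  moreover have "rconv a (\<lambda>s. - 1 * g s) t \<le> rconv a (\<lambda>s. \<delta> * heaviside s) t" by (rule rconv_mono[OF a ig' ih])
      (use le in force)
  ultimately show "\<bar>rconv a g t\<bar> \<le> \<delta> * cumul a t" unfolding rconv_cmult rconv_heaviside by linarith
qed

lemma locint_inner:
  fixes h :: "real \<Rightarrow> 'h::real_inner"
  assumes h: "strongly_measurable lebesgue h" and sq: "locint (norm_sq h)"
  shows "locint (\<lambda>s. h s \<bullet> e)"
proof (rule locint_bound)
  show "locint (\<lambda>s. (norm (h s))\<^sup>2 + (norm e)\<^sup>2 * heaviside s)"
    by (intro locint_add sq locint_cmult mono_kernelD(1)[OF mono_kernel_heaviside])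
  show "(\<lambda>s. h s \<bullet> e) \<in> borel_measurable lebesgue" by (intro strongly_measurable_inner h strongly_measurable_const)
  fix s
  show "\<bar>h s \<bullet> e\<bar> \<le> (norm (h s))\<^sup>2 + (norm e)\<^sup>2 * heaviside s"
  proof (cases "s \<le> 0")
    case True
    then have "h s = 0" using locint_nonpos[OF sq True] by simp
    then show ?thesis using True by simp
  next
    case False
    have "0 \<le> (norm (h s) - norm e)\<^sup>2 + (norm (h s))\<^sup>2 + (norm e)\<^sup>2" by simp
    then have "norm (h s) * norm e \<le> (norm (h s))\<^sup>2 + (norm e)\<^sup>2" by (simp add: power2_diff)
    then show ?thesis using False Cauchy_Schwarz_ineq2[of "h s" e] by simp
  qed
qed

lemma cumul_add: "locint v \<Longrightarrow> locint w \<Longrightarrow> cumul (\<lambda>s. v s + w s) t = cumul v t + cumul w t"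
  using locint_integrable[of v t] locint_integrable[of w t] by (simp add: cumul_def distrib_left)

lemma cumul_minus: "locint v \<Longrightarrow> locint w \<Longrightarrow> cumul (\<lambda>s. v s - w s) t = cumul v t - cumul w t"
  using locint_integrable[of v t] locint_integrable[of w t] by (simp add: cumul_def right_diff_distrib)

lemma cumul_sum:
  fixes c :: "nat \<Rightarrow> real"
  assumes "\<And>j. locint (v j)"
  shows "cumul (\<lambda>s. \<Sum>j<N. c j * v j s) t = (\<Sum>j<N. c j * cumul (v j) t)" and "locint (\<lambda>s. \<Sum>j<N. c j * v j s)"
proof (induction N)
  case 0
  { case 1 then show ?case by (simp add: cumul_def) next case 2 then show ?case by (simp add: locint_def) }
next
  case (Suc N)
  have c: "cumul (\<lambda>s. c N * v N s) t = c N * cumul (v N) t" unfolding cumul_eq_rconv by (rule rconv_cmult)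
  { case 1
    have "cumul (\<lambda>s. (\<Sum>j<N. c j * v j s) + c N * v N s) t = (\<Sum>j<N. c j * cumul (v j) t) + c N * cumul (v N) t"
      by (subst cumul_add[OF Suc(2) locint_cmult[OF assms]]) (simp only: Suc(1) c)
    then show ?case by simp
  next
    case 2 show ?case using locint_add[OF Suc(2) locint_cmult[OF assms[of N], of "c N"]] by simp }
qed

lemma locint_sq_local:
  fixes h :: "real \<Rightarrow> 'h::real_normed_vector"
  assumes h: "strongly_measurable lebesgue h" and h0: "\<forall>s\<le>0. h s = 0" and hb: "\<And>T. \<exists>C. \<forall>s<T. norm (h s) \<le> C"
  shows "locint (norm_sq h)"
proof (rule locint_locally_bounded)
  show "(norm_sq h) \<in> borel_measurable lebesgue" using strongly_measurable_norm[OF h] by measurable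
  show "\<exists>C. \<forall>s<T. \<bar>(norm (h s))\<^sup>2\<bar> \<le> C" for T
  proof -
    obtain C where C: "\<forall>s<T. norm (h s) \<le> C" using hb by blast
    then have "(norm (h s))\<^sup>2 \<le> C\<^sup>2" if "s < T" for s using that by (intro power_mono) auto
    then show ?thesis by (intro exI[of _ "C\<^sup>2"]) auto
  qed
qed (use h0 in auto)

text \<open>Cauchy-Schwarz in time, carried out as a weighted Young inequality with a small
  parameter in front of the constant |e|^2.\<close>

lemma cumul_inner_tendsto:
  fixes d :: "nat \<Rightarrow> real \<Rightarrow> 'h::real_inner"
  assumes d: "\<And>n. strongly_measurable lebesgue (d n)" and sq: "\<And>n. locint (norm_sq (d n))"
    and lim: "(\<lambda>n. cumul (norm_sq (d n)) t) \<longlonglongrightarrow> 0" and t: "0 \<le> t"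
  shows "(\<lambda>n. cumul (\<lambda>s. d n s \<bullet> e) t) \<longlonglongrightarrow> 0"
proof (rule LIMSEQ_I)
  fix \<epsilon> :: real assume \<epsilon>: "0 < \<epsilon>"
  \<comment> \<open>Chosen so that the constant part contributes at most \<epsilon>/2 on (0,t); the
    added 1 avoids division by zero.\<close>
  define r where "r = \<epsilon> / (2 * ((norm e)\<^sup>2 * t + 1))"
  have p: "0 < (norm e)\<^sup>2 * t + 1" using t by (simp add: add_nonneg_pos)
  have r: "0 < r" using \<epsilon> p by (simp add: r_def)
  obtain M where M: "\<And>n. n \<ge> M \<Longrightarrow> \<bar>cumul (norm_sq (d n)) t\<bar> < \<epsilon> * r / 2"
    using LIMSEQ_D[OF lim, of "\<epsilon> * r / 2"] \<epsilon> r by auto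
  have "norm (cumul (\<lambda>s. d n s \<bullet> e) t - 0) < \<epsilon>" if n: "n \<ge> M" for n
  proof -
    have li: "locint (\<lambda>s. d n s \<bullet> e)" by (rule locint_inner[OF d sq])
    have lb: "locint (\<lambda>s. (1 / r) * (norm (d n s))\<^sup>2 + (r * (norm e)\<^sup>2) * heaviside s)"
      by (intro locint_add locint_cmult sq mono_kernelD(1)[OF mono_kernel_heaviside])
    have "\<bar>cumul (\<lambda>s. d n s \<bullet> e) t\<bar> \<le> (\<integral>s. norm (indicator {..<t} s * (d n s \<bullet> e))
        \<partial>lebesgue)"
      unfolding cumul_def using integral_norm_bound[of lebesgue "\<lambda>s. indicator {..<t} s * (d n s \<bullet> e)"] by simp
    also have "\<dots> \<le> cumul (\<lambda>s. (1 / r) * (norm (d n s))\<^sup>2 + (r * (norm e)\<^sup>2) * heaviside s) t"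
      unfolding cumul_def
    proof (rule integral_mono[OF integrable_norm[OF locint_integrable[OF li]] locint_integrable[OF lb]])
      fix s
      have "\<bar>d n s \<bullet> e\<bar> \<le> (1 / r) * (norm (d n s))\<^sup>2 + (r * (norm e)\<^sup>2) * heaviside s"
      proof (cases "s \<le> 0")
        case True
        then have "d n s = 0" using locint_nonpos[OF sq[of n] True] by simp
        then show ?thesis using True by simp
      next
        case False
        define a b where "a = norm (d n s)" and "b = norm e"
        have "0 \<le> (a - r * b)\<^sup>2 + a\<^sup>2 + (r * b)\<^sup>2" by simp
        then have "r * (a * b) \<le> a\<^sup>2 + r\<^sup>2 * b\<^sup>2" by (simp add: power2_diff power_mult_distrib algebra_simps)
        also have "\<dots> = r * ((1 / r) * a\<^sup>2 + (r * b\<^sup>2))" using r by (simp add: field_simps power2_eq_square)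
        finally have "a * b \<le> (1 / r) * a\<^sup>2 + (r * b\<^sup>2)" using r by simp
        then show ?thesis using False Cauchy_Schwarz_ineq2[of "d n s" e] by (simp add: a_def b_def)
      qed
      then show "norm (indicator {..<t} s * (d n s \<bullet> e)) \<le> indicator {..<t} s * ((1 / r) * (norm (d n s))\<^sup>2 + (r * (norm
          e)\<^sup>2) * heaviside s)"
        by (simp add: abs_mult mult_left_mono)
    qed
    also have "\<dots> = (1 / r) * cumul (norm_sq (d n)) t + (r * (norm e)\<^sup>2) * t"
    proof -
      have c: "cumul (\<lambda>s. c * w s) t = c * cumul w t" for c w unfolding cumul_eq_rconv by (rule rconv_cmult)
      show ?thesis
        using cumul_add[OF locint_cmult[OF sq[of n], of "1 / r"] locint_cmult[OF mono_kernelD(1)[OF mono_kernel_heaviside], of "r * (norm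
            e)\<^sup>2"], of t]
        unfolding c cumul_heaviside[OF t] .
    qed
    also have "\<dots> < (1 / r) * (\<epsilon> * r / 2) + \<epsilon> / 2"
    proof (rule add_less_le_mono)
      show "(1 / r) * cumul (norm_sq (d n)) t < (1 / r) * (\<epsilon> * r / 2)"
        using M[OF n] r by (intro mult_strict_left_mono) auto
      have "(r * (norm e)\<^sup>2) * t \<le> r * ((norm e)\<^sup>2 * t + 1)" using r by (simp add: algebra_simps)
      also have "\<dots> = \<epsilon> / 2" using p by (simp add: r_def field_simps)
      finally show "(r * (norm e)\<^sup>2) * t \<le> \<epsilon> / 2" .
    qed
    also have "\<dots> = \<epsilon>" using r by simp
    finally show ?thesis by simp
  qed
  then show "\<exists>no. \<forall>n\<ge>no. norm (cumul (\<lambda>s. d n s \<bullet> e) t - 0) < \<epsilon>" by blast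
qed

text \<open>A positive weight \<rho>, decreasing fast enough against the local bounds, turns the
  sequence into a bounded one in L2 of the line. The combinations found for the weighted sequence
  work on every bounded interval, where \<rho> is bounded below, so no diagonal argument over
  intervals is required.\<close>

lemma convex_combinations_L2_loc:
  fixes X :: "nat \<Rightarrow> real \<Rightarrow> 'h::{real_inner,banach}"
  assumes sm: "\<And>j. strongly_measurable lebesgue (X j)" and sq: "\<And>j. locint (norm_sq (X j))"
    and bound: "\<And>T. \<exists>C\<ge>0. \<forall>j. cumul (norm_sq (X j)) T \<le> C"
  shows "\<exists>c N \<eta>. (\<forall>n. tail_weights n (N n) (c n)) \<and> strongly_measurable lebesgue \<eta> \<and> locint (norm_sq
      \<eta>) \<and>
     (AE t in lebesgue. (\<lambda>n. \<Sum>j<N n. c n j *\<^sub>R X j t) \<longlonglongrightarrow> \<eta> t) \<and>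
     (\<forall>n. locint (\<lambda>s. (norm ((\<Sum>j<N n. c n j *\<^sub>R X j s) - \<eta> s))\<^sup>2)) \<and>
     (\<forall>T. (\<lambda>n. cumul (\<lambda>s. (norm ((\<Sum>j<N n. c n j *\<^sub>R X j s) - \<eta> s))\<^sup>2) T) \<longlonglongrightarrow> 0)"
proof -
  have X0: "X j s = 0" if "s \<le> 0" for j s using locint_nonpos[OF sq[of j] that] by simp
  have mX [measurable]: "(\<lambda>s. norm (X j s)) \<in> borel_measurable lebesgue" for j by (rule strongly_measurable_norm[OF sm])
  obtain C where C: "\<And>n::nat. 0 \<le> C n" "\<And>n j. cumul (norm_sq (X j)) (real n) \<le> C n"
  proof -
    have "\<forall>n::nat. \<exists>C\<ge>0. \<forall>j. cumul (norm_sq (X j)) (real n) \<le> C" using bound by blast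
    then obtain C where "\<forall>n::nat. 0 \<le> C n \<and> (\<forall>j. cumul (norm_sq (X j)) (real n) \<le> C n)" by metis
    then show ?thesis using that by blast
  qed
  \<comment> \<open>\<open>w n\<close> is the weight on times between n and n + 1. Division by the
    bound \<open>C (Suc n)\<close> makes this stretch contribute at most 2^-n, so the total is at
    most 2; the added 1 keeps the denominator positive.\<close>
  define w where "w n = (1/2)^n / (1 + C (Suc n))" for n
  have w: "0 < w n" for n using C(1)[of "Suc n"] by (simp add: w_def)
  have wC: "w n * C (Suc n) \<le> (1/2)^n" for n
    using C(1)[of "Suc n"] by (simp add: w_def divide_le_eq mult_left_mono)
  define \<rho> where "\<rho> s = w (nat \<lfloor>s\<rfloor>)" for s :: real
  have \<rho>: "0 < \<rho> s" for s using w by (simp add: \<rho>_def)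
  have \<rho>m: "\<rho> \<in> borel_measurable borel" unfolding \<rho>_def by measurable
  define \<sigma> where "\<sigma> s = sqrt (\<rho> s)" for s
  have \<sigma>: "0 < \<sigma> s" "(\<sigma> s)\<^sup>2 = \<rho> s" for s using \<rho>[of s] by (auto simp: \<sigma>_def)
  have [measurable]: "\<sigma> \<in> borel_measurable borel" unfolding \<sigma>_def using \<rho>m by measurable
  have m\<sigma>: "\<sigma> \<in> borel_measurable lebesgue" "(\<lambda>s. 1 / \<sigma> s) \<in> borel_measurable lebesgue"
    by (rule borel_imp_lebesgue, measurable)+
  define Z where "Z j s = \<sigma> s *\<^sub>R X j s" for j s
  have smZ: "strongly_measurable lebesgue (Z j)" for j unfolding Z_def by (intro strongly_measurable_scaleR m\<sigma> sm)
  have bZ: "(\<integral>\<^sup>+t. (norm (Z j t))\<^sup>2 \<partial>lebesgue) \<le> ennreal 2" for j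
  proof -
    define F where "F n s = w n * (indicator {..<real (Suc n)} s * (norm (X j s))\<^sup>2)" for n s
    have F0: "0 \<le> F n s" for n s using w[of n] by (simp add: F_def)
    have mF [measurable]: "F n \<in> borel_measurable lebesgue" for n unfolding F_def by measurable
    have "(\<integral>\<^sup>+t. (norm (Z j t))\<^sup>2 \<partial>lebesgue) \<le> (\<integral>\<^sup>+t. (\<Sum>n. ennreal (F n t))
        \<partial>lebesgue)"
    proof (rule nn_integral_mono)
      fix t
      show "ennreal ((norm (Z j t))\<^sup>2) \<le> (\<Sum>n. ennreal (F n t))"
      proof (cases "t \<le> 0")
        case False
        define n where "n = nat \<lfloor>t\<rfloor>"
        have "t < real (Suc n)" using False unfolding n_def by linarith
        then have "(norm (Z j t))\<^sup>2 = F n t"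
          using \<sigma>(2)[of t] \<sigma>(1)[of t] by (simp add: Z_def F_def \<rho>_def n_def[symmetric] power_mult_distrib)
        then show ?thesis using sum_le_suminf[of "\<lambda>n. ennreal (F n t)" "{n}"] by (simp add: summableI)
      qed (simp add: X0 Z_def)
    qed
    also have "\<dots> = (\<Sum>n. \<integral>\<^sup>+t. F n t \<partial>lebesgue)" by (intro nn_integral_suminf) measurable
    also have "\<dots> \<le> (\<Sum>n. ennreal ((1/2)^n))"
    proof (intro suminf_le summableI)
      fix n
      have "(\<integral>\<^sup>+t. F n t \<partial>lebesgue) = ennreal (\<integral>t. F n t \<partial>lebesgue)"
        using F0 by (intro nn_integral_eq_integral) (auto simp: F_def intro!: integrable_mult_right locint_integrable[OF sq, simplified])
      also have "(\<integral>t. F n t \<partial>lebesgue) = w n * cumul (norm_sq (X j)) (real (Suc n))"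
        unfolding F_def cumul_def by simp
      also have "\<dots> \<le> (1/2)^n" using C(2)[of j "Suc n"] w[of n] wC[of n] by (meson mult_left_mono less_imp_le order_trans)
      finally show "(\<integral>\<^sup>+t. F n t \<partial>lebesgue) \<le> ennreal ((1/2)^n)" by (simp add: ennreal_leI)
    qed
    also have "\<dots> = ennreal (\<Sum>n. (1/2)^n)" by (intro suminf_ennreal_eq) (auto intro: summable_sums summable_geometric)
    also have "(\<Sum>n. (1/2::real)^n) = 2" by (subst suminf_geometric) auto
    finally show ?thesis .
  qed
  obtain c N \<zeta> where cN': "\<forall>n. tail_weights n (N n) (c n)" and sm\<zeta>: "strongly_measurable lebesgue \<zeta>"
    and lim: "AE t in lebesgue. (\<lambda>n. \<Sum>j<N n. c n j *\<^sub>R Z j t) \<longlonglongrightarrow> \<zeta> t"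
    and L2: "(\<lambda>n. \<integral>\<^sup>+t. (norm ((\<Sum>j<N n. c n j *\<^sub>R Z j t) - \<zeta> t))\<^sup>2 \<partial>lebesgue)
        \<longlonglongrightarrow> 0"
    and n\<zeta>: "(\<integral>\<^sup>+t. (norm (\<zeta> t))\<^sup>2 \<partial>lebesgue) \<le> ennreal 2"
    using convex_combinations_L2[of Z 2, OF smZ bZ zero_le_numeral] by (elim exE conjE) (rule that; assumption)
  have cN: "tail_weights n (N n) (c n)" for n using cN' by blast
  define \<eta> where "\<eta> = zext (\<lambda>s. (1 / \<sigma> s) *\<^sub>R \<zeta> s)"
  have sm\<eta>: "strongly_measurable lebesgue \<eta>"
    unfolding \<eta>_def by (intro strongly_measurable_zext strongly_measurable_scaleR m\<sigma> sm\<zeta>)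
  define S where "S n s = (\<Sum>j<N n. c n j *\<^sub>R X j s)" for n s
  define S' where "S' n s = (\<Sum>j<N n. c n j *\<^sub>R Z j s)" for n s
  have S0: "S n s = 0" if "s \<le> 0" for n s using X0[OF that] by (simp add: S_def)
  have SS: "S n s = (1 / \<sigma> s) *\<^sub>R S' n s" for n s
    using \<sigma>(1)[of s] by (simp add: S_def S'_def Z_def scaleR_sum_right)
  have smS: "strongly_measurable lebesgue (S n)" for n unfolding S_def by (rule strongly_measurable_sum[OF sm])
  have smS': "strongly_measurable lebesgue (S' n)" for n unfolding S'_def by (rule strongly_measurable_sum[OF smZ])
  have lim\<eta>: "AE t in lebesgue. (\<lambda>n. S n t) \<longlonglongrightarrow> \<eta> t"
    using lim
  proof eventually_elim
    case (elim t)
    show ?case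
    proof (cases "t \<le> 0")
      case False
      have "(\<lambda>n. (1 / \<sigma> t) *\<^sub>R S' n t) \<longlonglongrightarrow> (1 / \<sigma> t) *\<^sub>R \<zeta> t" unfolding
          S'_def by (intro tendsto_intros elim)
      then show ?thesis using False by (simp add: SS \<eta>_def)
    qed (simp add: S0 \<eta>_def)
  qed
  \<comment> \<open>A sum in place of a maximum: it dominates the reciprocal weight on all of
    (0,T).\<close>
  define \<kappa> where "\<kappa> T = (\<Sum>n\<le>nat \<lfloor>T\<rfloor>. 1 / w n)" for T :: real
  have \<kappa>0: "0 \<le> \<kappa> T" for T unfolding \<kappa>_def using w by (intro sum_nonneg) (auto intro: less_imp_le)
  have loc: "locint (norm_sq y) \<and> (\<forall>T. ennreal (cumul (norm_sq y) T) \<le> ennreal (\<kappa> T) * (\<integral>\<^sup>+t. (norm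
      (x t))\<^sup>2 \<partial>lebesgue)) "
    if y: "strongly_measurable lebesgue y" and x: "strongly_measurable lebesgue x" and fin: "(\<integral>\<^sup>+t. (norm (x t))\<^sup>2
        \<partial>lebesgue) < \<infinity>"
      and y0: "\<forall>s\<le>0. y s = 0" and yx: "\<forall>s>0. y s = (1 / \<sigma> s) *\<^sub>R x s" for x y :: "real \<Rightarrow> 'h"
  proof -
    have my [measurable]: "(\<lambda>s. norm (y s)) \<in> borel_measurable lebesgue" by (rule strongly_measurable_norm[OF y])
    have mx [measurable]: "(\<lambda>s. norm (x s)) \<in> borel_measurable lebesgue" by (rule strongly_measurable_norm[OF x])
    have *: "(\<integral>\<^sup>+s. indicator {..<T} s * (norm (y s))\<^sup>2 \<partial>lebesgue) \<le> ennreal (\<kappa> T) *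
        (\<integral>\<^sup>+t. (norm (x t))\<^sup>2 \<partial>lebesgue)" for T
    proof -
      have pw: "indicator {..<T} s * (norm (y s))\<^sup>2 \<le> \<kappa> T * (norm (x s))\<^sup>2" for s
      proof (cases "0 < s \<and> s < T")
        case True
        then have "nat \<lfloor>s\<rfloor> \<le> nat \<lfloor>T\<rfloor>" by (intro nat_mono floor_mono) simp
        then have "1 / \<rho> s \<le> \<kappa> T" unfolding \<kappa>_def \<rho>_def using w by (intro member_le_sum) (auto intro: less_imp_le)
        then have "(1 / \<rho> s) * (norm (x s))\<^sup>2 \<le> \<kappa> T * (norm (x s))\<^sup>2" by (rule mult_right_mono) simp
        moreover have "(norm (y s))\<^sup>2 = (1 / \<rho> s) * (norm (x s))\<^sup>2"
          using yx True \<sigma>[of s] by (simp add: power_mult_distrib power_divide)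
        ultimately show ?thesis using True by simp
      qed (use y0 \<kappa>0[of T] in \<open>auto simp: indicator_def not_less\<close>)
      have "(\<integral>\<^sup>+s. indicator {..<T} s * (norm (y s))\<^sup>2 \<partial>lebesgue) \<le> (\<integral>\<^sup>+s. ennreal
          (\<kappa> T) * ennreal ((norm (x s))\<^sup>2) \<partial>lebesgue)"
      proof (rule nn_integral_mono)
        fix s
        have "ennreal (indicator {..<T} s * (norm (y s))\<^sup>2) \<le> ennreal (\<kappa> T * (norm (x s))\<^sup>2)" by (rule ennreal_leI[OF pw])
        then show "ennreal (indicator {..<T} s * (norm (y s))\<^sup>2) \<le> ennreal (\<kappa> T) * ennreal ((norm (x s))\<^sup>2)" using
            \<kappa>0[of T] by (simp add: ennreal_mult)
      qed
      also have "\<dots> = ennreal (\<kappa> T) * (\<integral>\<^sup>+t. (norm (x t))\<^sup>2 \<partial>lebesgue)" by (rule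
          nn_integral_cmult) measurable
      finally show ?thesis .
    qed
    have int: "integrable lebesgue (\<lambda>s. indicator {..<T} s * (norm (y s))\<^sup>2)" for T
    proof (rule integrableI_nonneg)
      note *[of T]
      moreover have "ennreal (\<kappa> T) * (\<integral>\<^sup>+t. (norm (x t))\<^sup>2 \<partial>lebesgue) < \<infinity>" using fin by
          (simp add: ennreal_mult_less_top)
      ultimately show "(\<integral>\<^sup>+s. indicator {..<T} s * (norm (y s))\<^sup>2 \<partial>lebesgue) < \<infinity>" by (rule
          order.strict_trans1)
    qed auto
    have "locint (norm_sq y)" unfolding locint_def using int y0 by auto
    moreover have "ennreal (cumul (norm_sq y) T) = (\<integral>\<^sup>+s. indicator {..<T} s * (norm (y s))\<^sup>2 \<partial>lebesgue)" for T
      unfolding cumul_def by (rule nn_integral_eq_integral[OF int, symmetric]) auto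
    ultimately show ?thesis using * by simp
  qed
  have l\<eta>: "locint (norm_sq \<eta>)"
  proof -
    have "(\<integral>\<^sup>+t. (norm (\<zeta> t))\<^sup>2 \<partial>lebesgue) < \<infinity>" using n\<zeta> by (rule order.strict_trans1) simp
    then show ?thesis by (intro conjunct1[OF loc[OF sm\<eta> sm\<zeta>]]) (auto simp: \<eta>_def)
  qed
  have S'fin: "(\<integral>\<^sup>+t. (norm (S' n t - \<zeta> t))\<^sup>2 \<partial>lebesgue) < \<infinity>" for n
  proof -
    have mS: "(\<lambda>t. norm (S' n t)) \<in> borel_measurable lebesgue" and m\<zeta>: "(\<lambda>t. norm (\<zeta> t)) \<in>
        borel_measurable lebesgue"
      by (auto intro: strongly_measurable_norm smS' sm\<zeta>)
    note mS[measurable] m\<zeta>[measurable]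
    have "(\<integral>\<^sup>+t. (norm (S' n t))\<^sup>2 \<partial>lebesgue) \<le> (\<integral>\<^sup>+t. (\<Sum>j<N n. ennreal (c n j) *
        ennreal ((norm (Z j t))\<^sup>2)) \<partial>lebesgue)"
    proof (intro nn_integral_mono)
      fix t
      have "ennreal ((norm (S' n t))\<^sup>2) \<le> ennreal (\<Sum>j<N n. c n j * (norm (Z j t))\<^sup>2)"
        unfolding S'_def by (intro ennreal_leI norm_sq_convex_comb[OF cN])
      also have "\<dots> = (\<Sum>j<N n. ennreal (c n j) * ennreal ((norm (Z j t))\<^sup>2))"
        using tail_weightsD(1)[OF cN] by (subst sum_ennreal[symmetric]) (auto simp: ennreal_mult)
      finally show "ennreal ((norm (S' n t))\<^sup>2) \<le> (\<Sum>j<N n. ennreal (c n j) * ennreal ((norm (Z j t))\<^sup>2))" .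
    qed
    also have "\<dots> = (\<Sum>j<N n. ennreal (c n j) * (\<integral>\<^sup>+t. (norm (Z j t))\<^sup>2 \<partial>lebesgue))"
    proof -
      have [measurable]: "(\<lambda>t. norm (Z j t)) \<in> borel_measurable lebesgue" for j by (rule strongly_measurable_norm[OF smZ])
      show ?thesis by (simp add: nn_integral_sum nn_integral_cmult)
    qed
    also have "\<dots> \<le> (\<Sum>j<N n. ennreal (c n j) * ennreal 2)" by (intro sum_mono mult_left_mono bZ) auto
    also have "\<dots> < \<infinity>" by (simp add: ennreal_mult_less_top)
    finally have f1: "(\<integral>\<^sup>+t. (norm (S' n t))\<^sup>2 \<partial>lebesgue) < \<infinity>" .
    have f2: "(\<integral>\<^sup>+t. (norm (\<zeta> t))\<^sup>2 \<partial>lebesgue) < \<infinity>" using n\<zeta> by (rule order.strict_trans1) simp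
    have "(\<integral>\<^sup>+t. (norm (S' n t - \<zeta> t))\<^sup>2 \<partial>lebesgue) \<le> (\<integral>\<^sup>+t. 2 * ennreal ((norm
        (S' n t))\<^sup>2) + 2 * ennreal ((norm (\<zeta> t))\<^sup>2) \<partial>lebesgue)"
    proof (rule nn_integral_mono)
      fix t
      have "0 \<le> (norm (S' n t + \<zeta> t))\<^sup>2" by simp
      then have "(norm (S' n t - \<zeta> t))\<^sup>2 \<le> 2 * (norm (S' n t))\<^sup>2 + 2 * (norm (\<zeta> t))\<^sup>2"
        by (simp add: power2_norm_eq_inner inner_add_left inner_add_right inner_diff_left inner_diff_right inner_commute)
      then have "ennreal ((norm (S' n t - \<zeta> t))\<^sup>2) \<le> ennreal (2 * (norm (S' n t))\<^sup>2 + 2 * (norm (\<zeta>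
          t))\<^sup>2)" by (rule ennreal_leI)
      then show "ennreal ((norm (S' n t - \<zeta> t))\<^sup>2) \<le> 2 * ennreal ((norm (S' n t))\<^sup>2) + 2 * ennreal ((norm (\<zeta> t))\<^sup>2)"
        by (simp add: ennreal_plus ennreal_mult)
    qed
    also have "\<dots> = 2 * (\<integral>\<^sup>+t. (norm (S' n t))\<^sup>2 \<partial>lebesgue) + 2 * (\<integral>\<^sup>+t. (norm (\<zeta>
        t))\<^sup>2 \<partial>lebesgue)"
      by (simp add: nn_integral_add nn_integral_cmult)
    also have "\<dots> < \<infinity>" using f1 f2 by (simp add: ennreal_mult_less_top)
    finally show ?thesis .
  qed
  have ld: "locint (\<lambda>s. (norm (S n s - \<eta> s))\<^sup>2) \<and> (\<forall>T. ennreal (cumul (\<lambda>s. (norm (S n s - \<eta>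
      s))\<^sup>2) T) \<le> ennreal (\<kappa> T) * (\<integral>\<^sup>+t. (norm (S' n t - \<zeta> t))\<^sup>2 \<partial>lebesgue))" for n
    by (rule loc[OF strongly_measurable_diff[OF smS sm\<eta>] strongly_measurable_diff[OF smS' sm\<zeta>] S'fin])
      (simp add: \<eta>_def S0, simp add: \<eta>_def SS scaleR_diff_right)
  have "(\<lambda>n. cumul (\<lambda>s. (norm (S n s - \<eta> s))\<^sup>2) T) \<longlonglongrightarrow> 0" for T
  proof -
    have "(\<lambda>n. ennreal (cumul (\<lambda>s. (norm (S n s - \<eta> s))\<^sup>2) T)) \<longlonglongrightarrow> 0"
    proof (rule tendsto_sandwich[OF _ _ tendsto_const])
      show "\<forall>\<^sub>F n in sequentially. ennreal (cumul (\<lambda>s. (norm (S n s - \<eta> s))\<^sup>2) T) \<le> ennreal (\<kappa>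
          T) * (\<integral>\<^sup>+t. (norm (S' n t - \<zeta> t))\<^sup>2 \<partial>lebesgue)"
        using ld by (intro always_eventually) blast
      have "(\<lambda>n. ennreal (\<kappa> T) * (\<integral>\<^sup>+t. (norm (S' n t - \<zeta> t))\<^sup>2 \<partial>lebesgue))
          \<longlonglongrightarrow> ennreal (\<kappa> T) * 0"
        using L2 unfolding S'_def by (intro tendsto_mult_ennreal tendsto_const) auto
      then show "(\<lambda>n. ennreal (\<kappa> T) * (\<integral>\<^sup>+t. (norm (S' n t - \<zeta> t))\<^sup>2 \<partial>lebesgue))
          \<longlonglongrightarrow> 0" by simp
    qed simp
    then have "(\<lambda>n. ennreal (cumul (\<lambda>s. (norm (S n s - \<eta> s))\<^sup>2) T)) \<longlonglongrightarrow> ennreal 0" by simp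
    then show ?thesis by (subst (asm) tendsto_ennreal_iff) (auto intro!: always_eventually cumul_nonneg)
  qed
  then show ?thesis using cN sm\<eta> l\<eta> lim\<eta> ld unfolding S_def
    by (intro exI[of _ c] exI[of _ N] exI[of _ \<eta>]) blast
qed

section \<open>Convergence of the regularized solutions\<close>

context evolution begin

text \<open>The energy estimate bounds the convolution of \<open>l\<close> with the squared Yosida
  term. Convolving this bound with \<open>k\<close> produces the primitive of the square, hence a
  plain L2 bound.\<close>

lemma yosida_sequence_bound:
  assumes reg: "\<And>j. regularized (\<theta> j) (U j)" and \<theta>: "\<And>j. 0 < \<theta> j" "\<And>j. \<theta> j \<le> 1"
  shows "\<exists>C\<ge>0. \<forall>j. cumul (\<lambda>s. (norm (zext (\<lambda>s. yosida (\<theta> j) (U j s)) s))\<^sup>2) T \<le> C"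
proof -
  define X where "X j = zext (\<lambda>s. yosida (\<theta> j) (U j s))" for j
  note S = regularized_measurable[OF reg \<theta>(1)]
  have sq: "locint (norm_sq (X j))" for j unfolding X_def by (rule locint_sq_local[OF S(1) _ S(2)]) simp
  obtain E where E: "0 \<le> E" "\<And>\<theta> u t. 0 < \<theta> \<Longrightarrow> \<theta> \<le> 1 \<Longrightarrow> regularized \<theta>
      u \<Longrightarrow> t < T \<Longrightarrow>
      rconv l (\<lambda>s. (norm (zext (\<lambda>s. yosida \<theta> (u s)) s))\<^sup>2) t \<le> E"
    using energy_bound[of T] by blast
  have "cumul (norm_sq (X j)) T \<le> E * cumul k T" for j
  proof -
    have ll: "locint (rconv l (norm_sq (X j)))" by (rule rconv_kernel_integrable_AE(2)[OF l sq])
    have nn: "0 \<le> rconv l (norm_sq (X j)) s" for s by (rule rconv_nonneg[OF l]) simp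
    have le: "\<bar>rconv l (norm_sq (X j)) s\<bar> \<le> E * heaviside s" if "s < T" for s
    proof (cases "s \<le> 0")
      case True then show ?thesis using locint_nonpos[OF ll True] by simp
    next
      case False then show ?thesis using E(2)[OF \<theta>(1) \<theta>(2) reg that, of j] nn[of s] by (simp add: X_def)
    qed
    have "\<bar>rconv k (rconv l (norm_sq (X j))) T\<bar> \<le> E * cumul k T"
      by (rule rconv_small(1)[OF k locint_measurable[OF ll] le])
    then show ?thesis unfolding rconv_k_rconv_l(1)[OF sq] by simp
  qed
  then show ?thesis using E(1) cumul_nonneg[of k T] mono_kernelD(3)[OF k]
    by (intro exI[of _ "E * cumul k T"]) (auto simp: X_def)
qed

text \<open>The rate of convergence is retained and not just the limit: its summability along a
  geometric sequence of parameters is what identifies the subgradient later.\<close>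

lemma regularized_limit:
  assumes reg: "\<And>j. regularized (\<theta> j) (U j)" and \<theta>: "\<And>j. 0 < \<theta> j" "\<And>j. \<theta> j \<le> 1" "\<theta>
      \<longlonglongrightarrow> 0"
  shows "\<exists>u. continuous_on UNIV u \<and> (\<forall>t\<le>0. u t = u0) \<and> (\<forall>T. \<exists>E\<ge>0. \<forall>t<T.
      \<forall>j. (norm (U j t - u t))\<^sup>2 \<le> E * \<theta> j)"
proof -
  have cb: "\<exists>E\<ge>0. \<forall>t<T. \<forall>i j. (norm (U i t - U j t))\<^sup>2 \<le> E * (\<theta> i + \<theta> j)" for T
    using cauchy_bound[of T]
  proof (elim exE conjE)
    fix E assume E: "0 \<le> E" and *: "\<forall>\<theta> u \<mu> v. 0 < \<theta> \<and> \<theta> \<le> 1 \<and> 0 < \<mu> \<and> \<mu>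
        \<le> 1 \<and> regularized \<theta> u \<and> regularized \<mu> v \<longrightarrow>
       (\<forall>t<T. (norm (u t - v t))\<^sup>2 \<le> E * (\<theta> + \<mu>))"
    have "(norm (U i t - U j t))\<^sup>2 \<le> E * (\<theta> i + \<theta> j)" if "t < T" for t i j
      by (rule *[rule_format]) (intro conjI \<theta> reg, rule that)
    with E show ?thesis by blast
  qed
  have cau: "Cauchy (\<lambda>j. U j t)" for t
  proof (rule CauchyI)
    fix e :: real assume e: "0 < e"
    obtain E where E: "0 \<le> E" "\<And>i j. (norm (U i t - U j t))\<^sup>2 \<le> E * (\<theta> i + \<theta> j)" using cb[of "t + 1"] by fastforce
    have "(\<lambda>j. E * (2 * \<theta> j)) \<longlonglongrightarrow> E * (2 * 0)" by (intro tendsto_intros \<theta>)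
    then have "\<forall>\<^sub>F j in sequentially. E * (2 * \<theta> j) < e\<^sup>2" using e by (intro order_tendstoD(2)) auto
    then obtain M where M: "\<And>j. j \<ge> M \<Longrightarrow> E * (2 * \<theta> j) < e\<^sup>2" by (auto simp: eventually_sequentially)
    have "norm (U i t - U j t) < e" if "i \<ge> M" "j \<ge> M" for i j
    proof (rule power2_less_imp_less)
      have "E * (\<theta> i + \<theta> j) = (E * (2 * \<theta> i)) / 2 + (E * (2 * \<theta> j)) / 2" by (simp add: algebra_simps)
      then show "(norm (U i t - U j t))\<^sup>2 < e\<^sup>2" using E(2)[of i j] M[OF that(1)] M[OF that(2)] by linarith
    qed (use e in simp)
    then show "\<exists>M. \<forall>m\<ge>M. \<forall>n\<ge>M. norm (U m t - U n t) < e" by blast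
  qed
  define u where "u t = lim (\<lambda>j. U j t)" for t
  have lim: "(\<lambda>j. U j t) \<longlonglongrightarrow> u t" for t
    using Cauchy_convergent[OF cau] by (simp add: u_def convergent_LIMSEQ_iff)
  have bnd: "\<exists>E\<ge>0. \<forall>t<T. \<forall>j. (norm (U j t - u t))\<^sup>2 \<le> E * \<theta> j" for T
  proof -
    obtain E where E: "0 \<le> E" "\<forall>t<T. \<forall>i j. (norm (U i t - U j t))\<^sup>2 \<le> E * (\<theta> i + \<theta> j)" using cb by blast
    have "(norm (U j t - u t))\<^sup>2 \<le> E * \<theta> j" if "t < T" for t j
    proof (rule LIMSEQ_le)
      show "(\<lambda>i. (norm (U j t - U i t))\<^sup>2) \<longlonglongrightarrow> (norm (U j t - u t))\<^sup>2" by (intro tendsto_intros lim)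
      have "(\<lambda>i. E * (\<theta> j + \<theta> i)) \<longlonglongrightarrow> E * (\<theta> j + 0)" by (intro tendsto_intros \<theta>)
      then show "(\<lambda>i. E * (\<theta> j + \<theta> i)) \<longlonglongrightarrow> E * \<theta> j" by simp
    qed (use E that in blast)
    then show ?thesis using E(1) by blast
  qed
  have "continuous_on {..<T} u" for T
  proof (rule uniform_limit_theorem[where f = U and F = sequentially])
    show "\<forall>\<^sub>F n in sequentially. continuous_on {..<T} (U n)"
      using regularizedD(1)[OF reg] continuous_on_subset by (intro always_eventually) blast
    show "uniform_limit {..<T} U u sequentially"
    proof (rule uniform_limitI)
      fix e :: real assume e: "0 < e"
      obtain E where E: "0 \<le> E" "\<forall>t<T. \<forall>j. (norm (U j t - u t))\<^sup>2 \<le> E * \<theta> j" using bnd by blast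
      have "(\<lambda>j. E * \<theta> j) \<longlonglongrightarrow> E * 0" by (intro tendsto_intros \<theta>)
      then have "\<forall>\<^sub>F j in sequentially. E * \<theta> j < e\<^sup>2" using e by (intro order_tendstoD(2)) auto
      then show "\<forall>\<^sub>F j in sequentially. \<forall>t\<in>{..<T}. dist (U j t) (u t) < e"
      proof eventually_elim
        case (elim j)
        show ?case
        proof
          fix t assume "t \<in> {..<T}"
          then have "(norm (U j t - u t))\<^sup>2 \<le> E * \<theta> j" using E(2) by auto
          also have "\<dots> < e\<^sup>2" by (rule elim)
          finally have "(norm (U j t - u t))\<^sup>2 < e\<^sup>2" .
          then show "dist (U j t) (u t) < e" using e by (simp add: dist_norm power2_less_imp_less)
        qed
      qed
    qed
  qed simp
  then have "isCont u x" for x using continuous_on_eq_continuous_at[of "{..<x+1}" u] by auto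
  then have "continuous_on UNIV u" by (simp add: continuous_at_imp_continuous_on)
  moreover have "u t = u0" if "t \<le> 0" for t
    using lim[of t] regularizedD(2)[OF reg that] LIMSEQ_unique[OF _ tendsto_const] by simp
  ultimately show ?thesis using bnd by blast
qed

text \<open>The equation is kept in the form obtained by convolving with \<open>k\<close>, where the
  Yosida term enters linearly through its primitive; there the limit of convex combinations can be
  taken for each test vector. The subgradient relation is recovered separately, at almost every
  time.\<close>

lemma evolution_solution:
  assumes f2: "locint (norm_sq f)"
  shows "\<exists>u \<eta>. continuous_on UNIV u \<and> (\<forall>t\<le>0. u t = u0) \<and> strongly_measurable lebesgue \<eta> \<and>
     locint (norm_sq \<eta>) \<and> (AE s in lebesgue. 0 < s \<longrightarrow> \<eta> s \<in> subdiff \<phi> (u s)) \<and>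
     (\<forall>T. \<exists>C. \<forall>t<T. 0 < t \<longrightarrow> \<phi> (u t) \<le> ereal C) \<and>
     (\<forall>t e. rconv k (\<lambda>s. (u s - u0) \<bullet> e) t = cumul (\<lambda>s. (f s - \<eta> s - zext (\<lambda>s. B (u s)) s)
         \<bullet> e) t)"
proof -
  \<comment> \<open>Geometric decay makes the products of squared errors and squared Yosida terms
    summable in mean.\<close>
  define \<theta> :: "nat \<Rightarrow> real" where "\<theta> j = (1/4)^j" for j
  have \<theta>: "0 < \<theta> j" "\<theta> j \<le> 1" for j by (auto simp: \<theta>_def power_le_one)
  have \<theta>0: "\<theta> \<longlonglongrightarrow> 0" unfolding \<theta>_def by (rule LIMSEQ_power_zero) simp
  obtain U where reg: "\<And>j. regularized (\<theta> j) (U j)" using regularized_exists[OF \<theta>(1)] by metis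
  obtain u where cu: "continuous_on UNIV u" and u00: "\<And>t. t \<le> 0 \<Longrightarrow> u t = u0"
    and bnd: "\<And>T. \<exists>E\<ge>0. \<forall>t<T. \<forall>j. (norm (U j t - u t))\<^sup>2 \<le> E * \<theta> j"
    using regularized_limit[OF reg \<theta> \<theta>0] by blast
  note Ud = regularizedD[OF reg] and S = regularized_measurable[OF reg \<theta>(1)] and F = conv_sq_boundedD[OF f]
  define X where "X j = zext (\<lambda>s. yosida (\<theta> j) (U j s))" for j
  have smX: "strongly_measurable lebesgue (X j)" for j unfolding X_def by (rule S(1))
  have sqX: "locint (norm_sq (X j))" for j unfolding X_def by (rule locint_sq_local[OF S(1) _ S(2)]) simp
  have bX: "\<exists>C\<ge>0. \<forall>j. cumul (norm_sq (X j)) T \<le> C" for T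
    unfolding X_def by (rule yosida_sequence_bound[OF reg \<theta>])
  obtain c N \<eta> where cN: "\<And>n. tail_weights n (N n) (c n)" and sm\<eta>: "strongly_measurable lebesgue \<eta>"
    and sq\<eta>: "locint (norm_sq \<eta>)"
    and lim\<eta>: "AE t in lebesgue. (\<lambda>n. \<Sum>j<N n. c n j *\<^sub>R X j t) \<longlonglongrightarrow> \<eta> t"
    and sqd: "\<And>n. locint (\<lambda>s. (norm ((\<Sum>j<N n. c n j *\<^sub>R X j s) - \<eta> s))\<^sup>2)"
    and lim2: "\<And>T. (\<lambda>n. cumul (\<lambda>s. (norm ((\<Sum>j<N n. c n j *\<^sub>R X j s) - \<eta> s))\<^sup>2) T)
        \<longlonglongrightarrow> 0"
    using convex_combinations_L2_loc[OF smX sqX bX] by blast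
  define Bu where "Bu = zext (\<lambda>s. B (u s))"
  define BU where "BU j = zext (\<lambda>s. B (U j s))" for j
  have cBu: "continuous_on UNIV (\<lambda>s. B (u s))" by (rule continuous_on_compose2[OF continuous_B cu]) auto
  have smBu: "strongly_measurable lebesgue Bu" unfolding Bu_def by (intro strongly_measurable_zext strongly_measurable_continuous cBu)
  have sqBu: "locint (norm_sq Bu)"
    unfolding Bu_def by (rule locint_sq_local[OF smBu[unfolded Bu_def] _ zext_continuous_bounded[OF cBu, of "B u0"]]) (auto simp: u00)
  have smBU: "strongly_measurable lebesgue (BU j)" for j unfolding BU_def by (rule S(3))
  have sqBU: "locint (norm_sq (BU j))" for j unfolding BU_def by (rule locint_sq_local[OF S(3) _ S(4)]) simp
  have main: "rconv k (\<lambda>s. (u s - u0) \<bullet> e) t = cumul (\<lambda>s. (f s - \<eta> s - Bu s) \<bullet> e) t" for t e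
  proof (cases "0 \<le> t")
    case False
    then have t: "t \<le> 0" by simp
    have "locint (\<lambda>s. (f s - \<eta> s - Bu s) \<bullet> e)"
      using locint_diff[OF locint_diff[OF locint_inner[OF F(1) f2] locint_inner[OF sm\<eta> sq\<eta>]] locint_inner[OF smBu sqBu], of e e e]
      by (simp add: inner_diff_left)
    then have "cumul (\<lambda>s. (f s - \<eta> s - Bu s) \<bullet> e) t = 0" using t by (rule cumul_nonpos)
    moreover have "k (t - s) * ((u s - u0) \<bullet> e) = 0" for s
      using t mono_kernelD(5)[OF k, of "t - s"] u00[of s] by (cases "s \<le> 0") auto
    then have "(\<lambda>s. k (t - s) * ((u s - u0) \<bullet> e)) = (\<lambda>s. 0)" by (intro ext)
    then have "rconv k (\<lambda>s. (u s - u0) \<bullet> e) t = 0" by (simp add: rconv_def)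
    ultimately show ?thesis by simp
  next
    case t: True
    note lf = locint_inner[OF F(1) f2, of e] and lX = locint_inner[OF smX sqX, of _ e] and lBU = locint_inner[OF smBU sqBU, of _ e]
      and lBu = locint_inner[OF smBu sqBu, of e] and l\<eta> = locint_inner[OF sm\<eta> sq\<eta>, of e]
    \<comment> \<open>\<open>a j\<close> is the regularized equation solved for the primitive of the
      Yosida term; it tends to \<alpha>, the same expression at the limit \<open>u\<close>. Its
      convex combinations therefore also tend to \<alpha>, while strong convergence sends them to
      the primitive of \<eta>.\<close>
    define a where "a j = cumul (\<lambda>s. f s \<bullet> e) t - cumul (\<lambda>s. BU j s \<bullet> e) t - rconv k (\<lambda>s. (U j s -
        u0) \<bullet> e) t" for j
    define \<alpha> where "\<alpha> = cumul (\<lambda>s. f s \<bullet> e) t - cumul (\<lambda>s. Bu s \<bullet> e) t - rconv k (\<lambda>s.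
        (u s - u0) \<bullet> e) t"
    have aX: "a j = cumul (\<lambda>s. X j s \<bullet> e) t" for j
    proof -
      have rhs: "rhs (\<theta> j) (U j) s \<bullet> e = f s \<bullet> e - X j s \<bullet> e - BU j s \<bullet> e" for s
        by (auto simp: rhs_def X_def BU_def zext_def inner_diff_left inner_add_left)
      have lr: "locint (\<lambda>s. rhs (\<theta> j) (U j) s \<bullet> e)" unfolding rhs by (intro locint_diff lf lX lBU)
      have "rconv k (\<lambda>s. (U j s - u0) \<bullet> e) t = rconv k (rconv l (\<lambda>s. rhs (\<theta> j) (U j) s \<bullet> e)) t"
        by (simp add: Ud(4)[abs_def])
      also have "\<dots> = cumul (\<lambda>s. rhs (\<theta> j) (U j) s \<bullet> e) t" by (rule rconv_k_rconv_l(1)[OF lr])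
      also have "\<dots> = cumul (\<lambda>s. f s \<bullet> e) t - cumul (\<lambda>s. X j s \<bullet> e) t - cumul (\<lambda>s. BU j s \<bullet> e) t"
        unfolding rhs using lf lX[of j] lBU[of j] by (simp add: cumul_minus locint_diff)
      finally show ?thesis by (simp add: a_def)
    qed
    obtain E where E: "0 \<le> E" "\<forall>s<t. \<forall>j. (norm (U j s - u s))\<^sup>2 \<le> E * \<theta> j" using bnd by blast
    define \<delta> where "\<delta> j = sqrt (E * \<theta> j)" for j
    have \<delta>: "norm (U j s - u s) \<le> \<delta> j" if "s < t" for s j
      using E(2) that unfolding \<delta>_def by (intro real_le_rsqrt) blast
    have \<delta>0: "\<delta> \<longlonglongrightarrow> 0"
    proof -
      have "(\<lambda>j. sqrt (E * \<theta> j)) \<longlonglongrightarrow> sqrt (E * 0)" by (intro tendsto_intros \<theta>0)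
      then show ?thesis by (simp add: \<delta>_def[abs_def])
    qed
    have cUu: "continuous_on UNIV (\<lambda>s. (U j s - u s) \<bullet> e)" for j using Ud(1) cu by (intro continuous_intros) auto
    have ab: "\<bar>a j - \<alpha>\<bar> \<le> LB * \<delta> j * norm e * t + \<delta> j * norm e * cumul k t" for j
    proof -
      have 1: "\<bar>rconv heaviside (\<lambda>s. BU j s \<bullet> e - Bu s \<bullet> e) t\<bar> \<le> (LB * \<delta> j * norm e) * cumul heaviside t"
      proof (rule rconv_small(1)[OF mono_kernel_heaviside])
        show "(\<lambda>s. BU j s \<bullet> e - Bu s \<bullet> e) \<in> borel_measurable lebesgue"
          using locint_measurable[OF lBU[of j]] locint_measurable[OF lBu] by measurable
        fix s assume s: "s < t"
        show "\<bar>BU j s \<bullet> e - Bu s \<bullet> e\<bar> \<le> LB * \<delta> j * norm e * heaviside s"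
        proof (cases "s \<le> 0")
          case False
          have "\<bar>(B (U j s) - B (u s)) \<bullet> e\<bar> \<le> norm (B (U j s) - B (u s)) * norm e" by (rule Cauchy_Schwarz_ineq2)
          also have "\<dots> \<le> (LB * \<delta> j) * norm e"
            using order_trans[OF B_lipschitz mult_left_mono[OF \<delta>[OF s] LB_nonneg]] by (intro mult_right_mono) auto
          finally show ?thesis using False by (simp add: BU_def Bu_def inner_diff_left)
        qed (simp add: BU_def Bu_def)
      qed
      have 2: "\<bar>rconv k (\<lambda>s. (U j s - u s) \<bullet> e) t\<bar> \<le> (\<delta> j * norm e) * cumul k t"
      proof (rule rconv_small(1)[OF k])
        show "(\<lambda>s. (U j s - u s) \<bullet> e) \<in> borel_measurable lebesgue" by (intro borel_imp_lebesgue
            borel_measurable_continuous_onI cUu)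
        fix s assume s: "s < t"
        have "\<bar>(U j s - u s) \<bullet> e\<bar> \<le> \<delta> j * norm e"
          using order_trans[OF Cauchy_Schwarz_ineq2 mult_right_mono[OF \<delta>[OF s]]] by auto
        then show "\<bar>(U j s - u s) \<bullet> e\<bar> \<le> \<delta> j * norm e * heaviside s"
          using Ud(2)[of s j] u00[of s] by (cases "s \<le> 0") auto
      qed
      have iw: "rconv_integrable k (\<lambda>s. (w s - u0) \<bullet> e) t" if w: "continuous_on UNIV w" "\<And>s. s \<le> 0
          \<Longrightarrow> w s = u0" for w
      proof -
        have c: "continuous_on UNIV (\<lambda>s. (w s - u0) \<bullet> e)" using w(1) by (intro continuous_intros)
        obtain C where "\<forall>s\<le>t. norm ((w s - u0) \<bullet> e) \<le> C"
          using continuous_locally_bounded[OF c, of 0 t] w(2) by auto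
        then show ?thesis
          by (intro rconv_bounded_integrable(1)[OF k, where C = C] borel_imp_lebesgue borel_measurable_continuous_onI c) (auto simp: w(2))
      qed
      have "rconv k (\<lambda>s. (U j s - u0) \<bullet> e - (u s - u0) \<bullet> e) t = rconv k (\<lambda>s. (U j s - u0) \<bullet> e) t -
          rconv k (\<lambda>s. (u s - u0) \<bullet> e) t"
        by (rule rconv_diff[OF iw[OF Ud(1) Ud(2)] iw[OF cu u00]])
      then have 3: "rconv k (\<lambda>s. (U j s - u s) \<bullet> e) t = rconv k (\<lambda>s. (U j s - u0) \<bullet> e) t - rconv k
          (\<lambda>s. (u s - u0) \<bullet> e) t"
        by (simp add: inner_diff_left)
      have 4: "rconv heaviside (\<lambda>s. BU j s \<bullet> e - Bu s \<bullet> e) t = cumul (\<lambda>s. BU j s \<bullet> e) t - cumul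
          (\<lambda>s. Bu s \<bullet> e) t"
        using cumul_minus[OF lBU lBu, of j t] by (simp add: cumul_eq_rconv)
      show ?thesis using 1 2 unfolding 3 4 a_def \<alpha>_def cumul_heaviside[OF t] by linarith
    qed
    have "(\<lambda>j. LB * \<delta> j * norm e * t + \<delta> j * norm e * cumul k t) \<longlonglongrightarrow> LB * 0 * norm e * t + 0 *
        norm e * cumul k t"
      by (intro tendsto_intros \<delta>0)
    then have "(\<lambda>j. LB * \<delta> j * norm e * t + \<delta> j * norm e * cumul k t) \<longlonglongrightarrow> 0" by simp
    then have "(\<lambda>j. a j - \<alpha>) \<longlonglongrightarrow> 0" by (rule Lim_null_comparison[rotated]) (use ab in auto)
    then have "a \<longlonglongrightarrow> \<alpha>" by (rule LIM_zero_cancel)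
    then have lim_a: "(\<lambda>n. \<Sum>j<N n. c n j * a j) \<longlonglongrightarrow> \<alpha>" by (rule tail_weights_limit[OF cN])
    have smd: "strongly_measurable lebesgue (\<lambda>s. (\<Sum>j<N n. c n j *\<^sub>R X j s) - \<eta> s)" for n
      by (intro strongly_measurable_diff strongly_measurable_sum smX sm\<eta>)
    have "(\<lambda>n. cumul (\<lambda>s. ((\<Sum>j<N n. c n j *\<^sub>R X j s) - \<eta> s) \<bullet> e) t) \<longlonglongrightarrow> 0"
      by (rule cumul_inner_tendsto[OF smd sqd lim2 t])
    moreover have "cumul (\<lambda>s. ((\<Sum>j<N n. c n j *\<^sub>R X j s) - \<eta> s) \<bullet> e) t = (\<Sum>j<N n. c n j * a j) - cumul
        (\<lambda>s. \<eta> s \<bullet> e) t" for n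
      unfolding aX inner_diff_left inner_sum_left inner_scaleR_left
      by (subst cumul_minus[OF cumul_sum(2)[OF lX] l\<eta>]) (simp only: cumul_sum(1)[OF lX])
    ultimately have "(\<lambda>n. (\<Sum>j<N n. c n j * a j) - cumul (\<lambda>s. \<eta> s \<bullet> e) t) \<longlonglongrightarrow> 0" by simp
    then have "(\<lambda>n. \<Sum>j<N n. c n j * a j) \<longlonglongrightarrow> cumul (\<lambda>s. \<eta> s \<bullet> e) t" by (rule LIM_zero_cancel)
    with lim_a have "\<alpha> = cumul (\<lambda>s. \<eta> s \<bullet> e) t" by (rule LIMSEQ_unique)
    then show ?thesis
      unfolding inner_diff_left \<alpha>_def using lf l\<eta> lBu by (simp add: cumul_minus locint_diff)
  qed
  have prox_lim: "(\<lambda>j. prox (\<theta> j) (U j t)) \<longlonglongrightarrow> u t" and prox_le: "\<exists>C. \<forall>t<T.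
      \<forall>j. R (prox (\<theta> j) (U j t)) \<le> C" for t T
  proof -
    have eb: "\<exists>E\<ge>0. \<forall>t<T. \<forall>j. R (prox (\<theta> j) (U j t)) \<le> E \<and> \<theta> j * (norm (yosida (\<theta>
        j) (U j t)))\<^sup>2 \<le> E" for T
      using energy_bound[of T]
    proof (elim exE conjE)
      fix E assume E: "0 \<le> E" and *: "\<forall>\<theta> u. 0 < \<theta> \<and> \<theta> \<le> 1 \<and> regularized \<theta> u \<longrightarrow>
         (\<forall>t<T. rconv_integrable l (\<lambda>s. (norm (zext (\<lambda>s. yosida \<theta> (u s)) s))\<^sup>2) t \<and>
            rconv l (\<lambda>s. (norm (zext (\<lambda>s. yosida \<theta> (u s)) s))\<^sup>2) t \<le> E \<and> R (prox \<theta> (u t)) \<le> E \<and>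
            \<theta> * (norm (yosida \<theta> (u t)))\<^sup>2 \<le> E)"
      have "R (prox (\<theta> j) (U j t)) \<le> E \<and> \<theta> j * (norm (yosida (\<theta> j) (U j t)))\<^sup>2 \<le> E" if "t < T" for t j
        using *[rule_format, OF conjI[OF \<theta>(1) conjI[OF \<theta>(2) reg]] that, of j] by blast
      with E show ?thesis by blast
    qed
    then show "\<exists>C. \<forall>t<T. \<forall>j. R (prox (\<theta> j) (U j t)) \<le> C" by blast
    obtain E where E: "0 \<le> E" "\<And>j. \<theta> j * (norm (yosida (\<theta> j) (U j t)))\<^sup>2 \<le> E" using eb[of "t + 1"] by fastforce
    obtain E' where E': "0 \<le> E'" "\<And>j. (norm (U j t - u t))\<^sup>2 \<le> E' * \<theta> j" using bnd[of "t + 1"] by fastforce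
    \<comment> \<open>The energy bound on \<theta> times the squared Yosida term leaves one spare
      factor \<theta> in the squared distance between \<open>U j t\<close> and its proximal
      point.\<close>
    have le1: "norm (\<theta> j *\<^sub>R yosida (\<theta> j) (U j t)) \<le> sqrt (E * \<theta> j)" for j
    proof (rule real_le_rsqrt)
      have "(norm (\<theta> j *\<^sub>R yosida (\<theta> j) (U j t)))\<^sup>2 = \<theta> j * (\<theta> j * (norm (yosida (\<theta> j) (U j
          t)))\<^sup>2)"
        by (simp add: power_mult_distrib power2_eq_square)
      also have "\<dots> \<le> \<theta> j * E" using E(2)[of j] \<theta>(1)[of j] by (intro mult_left_mono) auto
      finally show "(norm (\<theta> j *\<^sub>R yosida (\<theta> j) (U j t)))\<^sup>2 \<le> E * \<theta> j" by (simp add: mult.commute)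
    qed
    have le2: "norm (U j t - u t) \<le> sqrt (E' * \<theta> j)" for j by (rule real_le_rsqrt[OF E'(2)])
    have le: "norm (prox (\<theta> j) (U j t) - u t) \<le> sqrt (E' * \<theta> j) + sqrt (E * \<theta> j)" for j
    proof -
      have "prox (\<theta> j) (U j t) - u t = (U j t - u t) - \<theta> j *\<^sub>R yosida (\<theta> j) (U j t)" by (simp add: prox_eq[OF \<theta>(1)])
      then have "norm (prox (\<theta> j) (U j t) - u t) \<le> norm (U j t - u t) + norm (\<theta> j *\<^sub>R yosida (\<theta> j) (U j t))"
        by (simp only: norm_triangle_ineq4)
      then show ?thesis using le1[of j] le2[of j] by linarith
    qed
    have "(\<lambda>j. sqrt (E' * \<theta> j) + sqrt (E * \<theta> j)) \<longlonglongrightarrow> sqrt (E' * 0) + sqrt (E * 0)" by (intro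
        tendsto_intros \<theta>0)
    then have "(\<lambda>j. sqrt (E' * \<theta> j) + sqrt (E * \<theta> j)) \<longlonglongrightarrow> 0" by simp
    then have "(\<lambda>j. prox (\<theta> j) (U j t) - u t) \<longlonglongrightarrow> 0" by (rule Lim_null_comparison[rotated]) (use le in auto)
    then show "(\<lambda>j. prox (\<theta> j) (U j t)) \<longlonglongrightarrow> u t" by (rule LIM_zero_cancel)
  qed
  have energy: "\<exists>C. \<forall>t<T. 0 < t \<longrightarrow> \<phi> (u t) \<le> ereal C" for T
  proof -
    obtain C where C: "\<forall>t<T. \<forall>j. R (prox (\<theta> j) (U j t)) \<le> C" using prox_le by blast
    have "\<phi> (u t) \<le> ereal C" if "t < T" for t
    proof (rule lsc_limit[OF prox_lim])
      show "\<phi> (prox (\<theta> j) (U j t)) \<le> ereal C" for j using C that by (simp add: \<phi>_eq[OF prox(1)[OF \<theta>(1)]])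
    qed simp
    then show ?thesis by blast
  qed
  have uD: "u t \<in> D" if "0 < t" for t
  proof -
    obtain C where "\<forall>r<t + 1. 0 < r \<longrightarrow> \<phi> (u r) \<le> ereal C" using energy by blast
    then have "\<phi> (u t) \<le> ereal C" using that by simp
    then show ?thesis by (rule D_I)
  qed
  \<comment> \<open>At a fixed time the Yosida terms need not be bounded. Their integrals of squares
    are bounded, though, and the squared errors decay like 4^-j, so the products are summable at
    almost every time and the error term in the subgradient inequality vanishes.\<close>
  define g where "g j s = (norm (U j s - u s))\<^sup>2 * (norm (X j s))\<^sup>2" for j s
  have "AE s in lebesgue. s < real n \<longrightarrow> summable (\<lambda>j. g j s)" for n
  proof -
    obtain E where E: "0 \<le> E" "\<forall>s<real n. \<forall>j. (norm (U j s - u s))\<^sup>2 \<le> E * \<theta> j" using bnd by blast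
    obtain C where C: "0 \<le> C" "\<And>j. cumul (norm_sq (X j)) (real n) \<le> C" using bX by blast
    have mX [measurable]: "(\<lambda>s. norm (X j s)) \<in> borel_measurable lebesgue" for j by (rule strongly_measurable_norm[OF smX])
    have mU [measurable]: "(\<lambda>s. norm (U j s - u s)) \<in> borel_measurable lebesgue" for j
      using Ud(1) cu by (intro strongly_measurable_norm strongly_measurable_diff strongly_measurable_continuous)
    have "AE s in lebesgue. summable (\<lambda>j. indicator {..<real n} s * g j s)"
    proof (rule AE_summable_imp_tendsto[where b = "\<lambda>j. (E * C) * (1/4)^j"])
      show "(\<lambda>s. indicator {..<real n} s * g j s) \<in> borel_measurable lebesgue" for j unfolding g_def by measurable
      fix j
      have i: "integrable lebesgue (\<lambda>s. (E * \<theta> j) * (indicator {..<real n} s * (norm (X j s))\<^sup>2))"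
        by (intro integrable_mult_right locint_integrable[OF sqX])
      have "(\<integral>\<^sup>+s. indicator {..<real n} s * g j s \<partial>lebesgue) \<le> (\<integral>\<^sup>+s. (E * \<theta> j) *
          (indicator {..<real n} s * (norm (X j s))\<^sup>2) \<partial>lebesgue)"
        using E by (intro nn_integral_mono ennreal_leI) (auto simp: g_def indicator_def intro!: mult_right_mono)
      also have "\<dots> = ennreal (\<integral>s. (E * \<theta> j) * (indicator {..<real n} s * (norm (X j s))\<^sup>2) \<partial>lebesgue)"
        using E(1) \<theta>(1)[of j] by (intro nn_integral_eq_integral[OF i]) (auto intro!: AE_I2 mult_nonneg_nonneg)
      also have "(\<integral>s. (E * \<theta> j) * (indicator {..<real n} s * (norm (X j s))\<^sup>2) \<partial>lebesgue) = (E * \<theta>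
          j) * cumul (norm_sq (X j)) (real n)"
        by (simp add: cumul_def)
      also have "\<dots> \<le> (E * \<theta> j) * C" using C(2) E(1) \<theta>(1)[of j] by (intro mult_left_mono) auto
      finally show "(\<integral>\<^sup>+s. indicator {..<real n} s * g j s \<partial>lebesgue) \<le> ennreal ((E * C) * (1/4)^j)"
        by (simp add: \<theta>_def mult_ac ennreal_leI)
    qed (use E C in \<open>auto simp: g_def intro!: summable_mult summable_geometric mult_nonneg_nonneg\<close>)
    then show ?thesis by eventually_elim auto
  qed
  then have "AE s in lebesgue. \<forall>n. s < real n \<longrightarrow> summable (\<lambda>j. g j s)" by (intro AE_all_countable[THEN iffD2] allI)
  then have sub: "AE s in lebesgue. 0 < s \<longrightarrow> \<eta> s \<in> subdiff \<phi> (u s)"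
    using lim\<eta>
  proof eventually_elim
    case (elim s)
    show ?case
    proof
      assume s: "0 < s"
      obtain n where "s < real n" using reals_Archimedean2 by blast
      then have "summable (\<lambda>j. g j s)" using elim(1) by blast
      then have "(\<lambda>j. sqrt (g j s)) \<longlonglongrightarrow> sqrt 0" by (intro tendsto_real_sqrt summable_LIMSEQ_zero)
      then have \<delta>0: "(\<lambda>j. norm (U j s - u s) * norm (X j s)) \<longlonglongrightarrow> 0"
        by (simp add: g_def real_sqrt_mult)
      define q where "q j = norm (U j s - u s) * norm (X j s)" for j
      have "R (u s) + \<eta> s \<bullet> (v - u s) \<le> R v" if v: "v \<in> D" for v
      proof (rule field_le_epsilon)
        fix \<epsilon> :: real assume \<epsilon>: "0 < \<epsilon>"
        \<comment> \<open>The values at the proximal points are only known not to drop below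
          \<open>R (u s)\<close> in the limit, whence the argument with an arbitrary
          \<epsilon>.\<close>
        have "ereal (R (u s) - \<epsilon>) < \<phi> (u s)" using \<epsilon> by (simp add: \<phi>_eq[OF uD[OF s]])
        then have "\<forall>\<^sub>F y in nhds (u s). ereal (R (u s) - \<epsilon>) < \<phi> y" using lsc by (simp add: lsc_functional_def)
        then have "\<forall>\<^sub>F j in sequentially. ereal (R (u s) - \<epsilon>) < \<phi> (prox (\<theta> j) (U j s))"
          using prox_lim by (rule eventually_compose_filterlim)
        then obtain M where M: "\<And>j. j \<ge> M \<Longrightarrow> R (u s) - \<epsilon> < R (prox (\<theta> j) (U j s))"
          by (auto simp: eventually_sequentially \<phi>_eq[OF prox(1)[OF \<theta>(1)]])
        \<comment> \<open>The subgradient inequality at the proximal point, rewritten at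
          \<open>u s\<close>: the shift from the proximal point to \<open>U j s\<close> contributes
          a nonnegative term that is dropped, and the shift from \<open>U j s\<close> to
          \<open>u s\<close> costs \<open>q j\<close>. The result is affine in \<open>X j s\<close>
          and can be averaged with convex weights.\<close>
        have qj: "R (u s) - \<epsilon> \<le> R v + q j - X j s \<bullet> (v - u s)" if "j \<ge> M" for j
        proof -
          have Xj: "X j s = yosida (\<theta> j) (U j s)" using s by (simp add: X_def)
          have "R (prox (\<theta> j) (U j s)) + X j s \<bullet> (v - prox (\<theta> j) (U j s)) \<le> R v"
            unfolding Xj by (rule yosida_subgradient[OF \<theta>(1) v])
          moreover have "v - prox (\<theta> j) (U j s) = (v - u s) - (U j s - u s) + \<theta> j *\<^sub>R X j s"
            by (simp add: prox_eq[OF \<theta>(1)] Xj)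
          then have "X j s \<bullet> (v - prox (\<theta> j) (U j s)) = X j s \<bullet> (v - u s) - X j s \<bullet> (U j s - u s) + \<theta>
              j * (X j s \<bullet> X j s)"
            by (simp only: inner_add_right inner_diff_right[of _ "v - u s"] inner_scaleR_right)
          moreover have "X j s \<bullet> (U j s - u s) \<le> q j" using norm_cauchy_schwarz[of "X j s" "U j s - u s"] by (simp add: q_def
              mult.commute)
          moreover have "0 \<le> \<theta> j * (X j s \<bullet> X j s)" using \<theta>(1)[of j] by simp
          ultimately show ?thesis using M[OF that] by linarith
        qed
        have le: "R (u s) - \<epsilon> \<le> R v + (\<Sum>j<N n. c n j * q j) - (\<Sum>j<N n. c n j *\<^sub>R X j s) \<bullet> (v - u s)"
            if n: "n \<ge> M" for n
        proof -
          note C = tail_weightsD[OF cN[of n]]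
          have "(\<Sum>j<N n. c n j * (R (u s) - \<epsilon>)) \<le> (\<Sum>j<N n. c n j * (R v + q j - X j s \<bullet> (v - u s)))"
          proof (rule sum_mono)
            fix j
            show "c n j * (R (u s) - \<epsilon>) \<le> c n j * (R v + q j - X j s \<bullet> (v - u s))"
            proof (cases "j < n")
              case False then show ?thesis using qj[of j] n C(1) by (intro mult_left_mono) auto
            qed (use C(2) in simp)
          qed
          moreover have "(\<Sum>j<N n. c n j * (R (u s) - \<epsilon>)) = R (u s) - \<epsilon>" unfolding sum_distrib_right[symmetric] C(4) by simp
          moreover have "(\<Sum>j<N n. c n j * (R v + q j - X j s \<bullet> (v - u s))) = R v + (\<Sum>j<N n. c n j * q j) - (\<Sum>j<N n.
              c n j *\<^sub>R X j s) \<bullet> (v - u s)"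
          proof -
            have "(\<Sum>j<N n. c n j * (R v + q j - X j s \<bullet> (v - u s))) = (\<Sum>j<N n. c n j * R v) + (\<Sum>j<N n. c n j * q j)
                - (\<Sum>j<N n. c n j * (X j s \<bullet> (v - u s)))"
              by (simp add: right_diff_distrib distrib_left sum.distrib sum_subtractf)
            also have "(\<Sum>j<N n. c n j * R v) = R v" unfolding sum_distrib_right[symmetric] C(4) by simp
            finally show ?thesis by (simp add: inner_sum_left)
          qed
          ultimately show ?thesis by simp
        qed
        have "(\<lambda>n. R v + (\<Sum>j<N n. c n j * q j) - (\<Sum>j<N n. c n j *\<^sub>R X j s) \<bullet> (v - u s))
            \<longlonglongrightarrow> R v + 0 - \<eta> s \<bullet> (v - u s)"
          by (intro tendsto_intros elim(2) tail_weights_limit[OF cN]) (use \<delta>0 in \<open>simp add: q_def[abs_def]\<close>)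
        then have "R (u s) - \<epsilon> \<le> R v + 0 - \<eta> s \<bullet> (v - u s)" by (rule LIMSEQ_le_const) (use le in blast)
        then show "R (u s) + \<eta> s \<bullet> (v - u s) \<le> R v + \<epsilon>" by simp
      qed
      then show "\<eta> s \<in> subdiff \<phi> (u s)" unfolding subdiff_iff using uD[OF s] by blast
    qed
  qed
  show ?thesis
    by (intro exI[of _ u] exI[of _ \<eta>] conjI allI cu sm\<eta> sq\<eta> sub energy main[unfolded Bu_def]) (auto simp: u00)
qed

end

section \<open>Test functions and the lemma of du Bois-Reymond\<close>

definition smooth :: "(real \<Rightarrow> real) \<Rightarrow> bool" where
  "smooth f \<longleftrightarrow> (\<forall>n t. ((deriv ^^ n) f) field_differentiable (at t))"

lemma smooth_closed_family:
  assumes "\<And>f. f \<in> \<F> \<Longrightarrow> \<exists>f'\<in>\<F>. \<forall>x. (f has_real_derivative f' x) (at x)" "f \<in> \<F>"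
  shows "smooth f"
proof -
  have "(deriv ^^ n) f \<in> \<F>" for n
  proof (induction n)
    case (Suc n)
    obtain f' where f': "f' \<in> \<F>" "\<forall>x. ((deriv ^^ n) f has_real_derivative f' x) (at x)" using assms(1)[OF Suc] by blast
    then have "deriv ((deriv ^^ n) f) = f'" using DERIV_imp_deriv by (intro ext) blast
    with f'(1) show ?case by simp
  qed (use assms in simp)
  then show ?thesis unfolding smooth_def field_differentiable_def using assms(1) by blast
qed

lemma smooth_antiderivative:
  assumes "\<And>x. (F has_real_derivative f x) (at x)" "smooth f"
  shows "smooth F"
proof -
  have "deriv F = f" using assms(1) by (intro ext DERIV_imp_deriv)
  then have "(deriv ^^ Suc n) F = (deriv ^^ n) f" for n by (simp add: funpow_Suc_right del: funpow.simps)
  then have "(deriv ^^ n) F field_differentiable at t" for n t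
  proof (cases n)
    case 0 then show ?thesis using assms(1) by (auto simp: field_differentiable_def)
  qed (use assms(2) in \<open>simp add: smooth_def del: funpow.simps\<close>)
  then show ?thesis by (simp add: smooth_def)
qed

lemma smooth_diff:
  assumes f: "smooth f" and g: "smooth g" shows "smooth (\<lambda>x. f x - g x)"
proof -
  have d: "(deriv ^^ n) (\<lambda>x. f x - g x) = (\<lambda>x. (deriv ^^ n) f x - (deriv ^^ n) g x)" for n
  proof (induction n)
    case (Suc n)
    show ?case unfolding funpow.simps comp_def Suc
      using f g by (intro ext deriv_diff) (auto simp: smooth_def)
  qed simp
  show ?thesis unfolding smooth_def d using f g by (auto simp: smooth_def intro: field_differentiable_diff)
qed

lemma smooth_affine:
  assumes f: "smooth f" shows "smooth (\<lambda>x. f (r * (x - a)))"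
proof -
  have D: "((\<lambda>x. (deriv ^^ n) f (r * (x - a))) has_real_derivative r * (deriv ^^ Suc n) f (r * (x - a))) (at x)" for n x
  proof -
    have "((deriv ^^ n) f has_real_derivative (deriv ^^ Suc n) f (r * (x - a))) (at (r * (x - a)))"
      using f by (simp add: smooth_def DERIV_deriv_iff_field_differentiable)
    moreover have "((\<lambda>x. r * (x - a)) has_real_derivative r) (at x)" by (auto intro!: derivative_eq_intros)
    ultimately have "((\<lambda>x. (deriv ^^ n) f (r * (x - a))) has_real_derivative (deriv ^^ Suc n) f (r * (x - a)) * r) (at x)"
      by (rule DERIV_chain2)
    then show ?thesis by (simp only: mult.commute)
  qed
  have d: "(deriv ^^ n) (\<lambda>x. f (r * (x - a))) = (\<lambda>x. r ^ n * (deriv ^^ n) f (r * (x - a)))" for n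
  proof (induction n)
    case (Suc n)
    have "((\<lambda>x. r ^ n * (deriv ^^ n) f (r * (x - a))) has_real_derivative r ^ n * (r * (deriv ^^ Suc n) f (r * (x - a)))) (at x)" for x
      by (rule DERIV_cmult[OF D])
    then have "deriv (\<lambda>x. r ^ n * (deriv ^^ n) f (r * (x - a))) = (\<lambda>x. r ^ n * (r * (deriv ^^ Suc n) f (r * (x - a))))"
      by (intro ext DERIV_imp_deriv)
    then show ?case using Suc by (simp add: mult_ac)
  qed simp
  have "((\<lambda>x. r ^ n * (deriv ^^ n) f (r * (x - a))) has_real_derivative r ^ n * (r * (deriv ^^ Suc n) f (r * (t - a)))) (at t)" for n t
    by (rule DERIV_cmult[OF D])
  then show ?thesis unfolding smooth_def d field_differentiable_def by blast
qed

lemma smooth_cmult: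
  assumes f: "smooth f" shows "smooth (\<lambda>x. c * f x)"
proof -
  have d: "(deriv ^^ n) (\<lambda>x. c * f x) = (\<lambda>x. c * (deriv ^^ n) f x)" for n
  proof (induction n)
    case (Suc n)
    show ?case unfolding funpow.simps comp_def Suc
      using f by (intro ext deriv_cmult) (auto simp: smooth_def)
  qed simp
  have "(\<lambda>x. c * (deriv ^^ n) f x) field_differentiable at t" for n t
    using f by (intro field_differentiable_mult field_differentiable_const) (auto simp: smooth_def)
  then show ?thesis unfolding smooth_def d by blast
qed

section \<open>A smooth bump function\<close>

definition flat :: "real poly \<Rightarrow> real \<Rightarrow> real" where
  "flat p x = (if 0 < x then poly p (1 / x) * exp (- (1 / x)) else 0)"

lemma poly_exp_tendsto_0: "((\<lambda>z. poly p z * exp (- z)) \<longlongrightarrow> (0::real)) at_top"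
proof -
  have "((\<lambda>z. \<Sum>i\<le>degree p. coeff p i * (z ^ i / exp z)) \<longlongrightarrow> (\<Sum>i\<le>degree p. coeff p i * 0)) at_top"
    by (intro tendsto_intros tendsto_power_div_exp_0)
  moreover have "poly p z * exp (- z) = (\<Sum>i\<le>degree p. coeff p i * (z ^ i / exp z))" for z
    by (simp add: poly_altdef sum_distrib_right exp_minus divide_inverse mult.assoc)
  ultimately show ?thesis by simp
qed

text \<open>With z = 1/x the derivative of p(z) exp(-z) in x is z^2 (p(z) - p'(z)) exp(-z), so the
  family is closed under differentiation; \<open>[:0, 0, 1:]\<close> is the polynomial z^2. At 0
  exponential decay defeats every polynomial in z.\<close>

lemma flat_has_derivative:
  "(flat p has_real_derivative flat ([:0, 0, 1:] * (p - pderiv p)) x) (at x)"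
proof -
  consider "0 < x" | "x < 0" | "x = 0" by linarith
  then show ?thesis
  proof cases
    case 1
    have "((\<lambda>x. poly p (1 / x) * exp (- (1 / x))) has_real_derivative flat ([:0, 0, 1:] * (p - pderiv p)) x) (at x)"
      using 1 by (auto intro!: derivative_eq_intros DERIV_chain'[where f = "\<lambda>x. 1 / x" and g = "poly p"] poly_DERIV
          simp: flat_def field_simps power2_eq_square)
    then show ?thesis
      by (rule has_field_derivative_transform_within_open[of _ _ _ "{0<..}"]) (use 1 in \<open>auto simp: flat_def\<close>)
  next
    case 2
    have "((\<lambda>x. 0) has_real_derivative 0) (at x)" by simp
    then have "(flat p has_real_derivative 0) (at x)"
      by (rule has_field_derivative_transform_within_open[of _ _ _ "{..<0}"]) (use 2 in \<open>auto simp: flat_def\<close>)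
    then show ?thesis using 2 by (simp add: flat_def)
  next
    case 3
    have "((\<lambda>y. (flat p y - flat p 0) / (y - 0)) \<longlongrightarrow> 0) (at 0)"
    proof (rule filterlim_split_at)
      show "((\<lambda>y. (flat p y - flat p 0) / (y - 0)) \<longlongrightarrow> 0) (at_left 0)"
        by (rule tendsto_eventually) (auto simp: eventually_at_filter flat_def)
      \<comment> \<open>Dividing by y multiplies the polynomial in z by z, which is
        \<open>pCons 0 p\<close>; the difference quotient is again a polynomial times the
        exponential.\<close>
      have "((\<lambda>y. poly (pCons 0 p) (inverse y) * exp (- inverse y)) \<longlongrightarrow> 0) (at_right (0::real))"
        by (rule filterlim_compose[OF poly_exp_tendsto_0 filterlim_inverse_at_top_right])
      moreover have "eventually (\<lambda>y. poly (pCons 0 p) (inverse y) * exp (- inverse y) = (flat p y - flat p 0) / (y - 0)) (at_right 0)"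
        by (auto simp: eventually_at_filter flat_def inverse_eq_divide)
      ultimately show "((\<lambda>y. (flat p y - flat p 0) / (y - 0)) \<longlongrightarrow> 0) (at_right 0)" by (rule Lim_transform_eventually)
    qed
    then show ?thesis using 3 by (simp add: has_field_derivative_iff flat_def)
  qed
qed

text \<open>Derivatives of elements are again elements, which gives smoothness without formulas for the higher
  derivatives.\<close>

inductive_set bumps :: "(real \<Rightarrow> real) set" where
  bumps_prod: "(\<lambda>x. flat p x * flat q (1 - x)) \<in> bumps"
| bumps_add: "f \<in> bumps \<Longrightarrow> g \<in> bumps \<Longrightarrow> (\<lambda>x. f x + g x) \<in> bumps"

lemma bumps_smooth: "f \<in> bumps \<Longrightarrow> smooth f"
proof (rule smooth_closed_family[of bumps])
  fix f assume "f \<in> bumps"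
  then show "\<exists>f'\<in>bumps. \<forall>x. (f has_real_derivative f' x) (at x)"
  proof (induction rule: bumps.induct)
    case (bumps_prod p q)
    define Dp where "Dp = [:0, 0, 1:] * (p - pderiv p)"
    define Dq where "Dq = [:0, 0, 1:] * (q - pderiv q)"
    have q: "((\<lambda>x. flat q (1 - x)) has_real_derivative flat (- Dq) (1 - x)) (at x)" for x
    proof -
      have "((\<lambda>x. flat q (1 - x)) has_real_derivative flat Dq (1 - x) * (- 1)) (at x)"
        by (rule DERIV_chain2[OF flat_has_derivative[of q, folded Dq_def]]) (auto intro!: derivative_eq_intros)
      moreover have "flat Dq (1 - x) * (- 1) = flat (- Dq) (1 - x)" by (simp add: flat_def)
      ultimately show ?thesis by simp
    qed
    have "((\<lambda>x. flat p x * flat q (1 - x)) has_real_derivative flat Dp x * flat q (1 - x) + flat p x * flat (- Dq) (1 - x)) (at x)" for x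
      using DERIV_mult[OF flat_has_derivative[of p x, folded Dp_def] q[of x]] by (simp add: algebra_simps)
    moreover have "(\<lambda>x. flat Dp x * flat q (1 - x) + flat p x * flat (- Dq) (1 - x)) \<in> bumps"
      by (intro bumps.intros)
    ultimately show ?case by (intro bexI[of _ "\<lambda>x. flat Dp x * flat q (1 - x) + flat p x * flat (- Dq) (1 - x)"] allI)
  next
    case (bumps_add f g)
    then obtain f' g' where "f' \<in> bumps" "\<forall>x. (f has_real_derivative f' x) (at x)" "g' \<in> bumps" "\<forall>x. (g
        has_real_derivative g' x) (at x)" by blast
    then show ?case by (intro bexI[of _ "\<lambda>x. f' x + g' x"]) (auto intro: bumps.intros DERIV_add)
  qed
qed

text \<open>\<beta> is a product of two flat functions, one ending at 0 and one at 1; its primitive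
  \<Phi> is a smooth step that is constant outside (0,1). Differences of two scaled steps are
  compactly supported, which is how test functions are obtained from \<Phi>.\<close>

lemma bump_exists:
  "\<exists>\<beta> \<Phi>. smooth \<beta> \<and> smooth \<Phi> \<and> (\<forall>x. 0 \<le> \<beta> x) \<and> (\<forall>x. x \<notin>
      {0<..<1} \<longrightarrow> \<beta> x = 0) \<and> (\<forall>x\<in>{0<..<1}. 0 < \<beta> x) \<and>
     (\<forall>x. (\<Phi> has_real_derivative \<beta> x) (at x)) \<and> (\<forall>x\<le>0. \<Phi> x = 0) \<and> (\<forall>x\<ge>1. \<Phi> x
         = \<Phi> 1)"
proof -
  define \<beta> where "\<beta> x = flat 1 x * flat 1 (1 - x)" for x
  have sb: "smooth \<beta>" unfolding \<beta>_def[abs_def] by (intro bumps_smooth bumps.intros)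
  have out: "\<beta> x = 0" if "x \<notin> {0<..<1}" for x using that by (auto simp: \<beta>_def flat_def)
  have pos: "0 \<le> \<beta> x" for x by (auto simp: \<beta>_def flat_def)
  have half: "\<forall>x\<in>{0<..<1}. 0 < \<beta> x" by (simp add: \<beta>_def flat_def)
  have "\<beta> field_differentiable at x" for x using sb by (metis smooth_def funpow_0)
  then have cb: "continuous_on S \<beta>" for S
    by (meson continuous_at_imp_continuous_on field_differentiable_imp_continuous_at)
  \<comment> \<open>Integration starts at -1, where \<beta> still vanishes, so that the points
    around 0 are interior when the integral is differentiated.\<close>
  define \<Phi> where "\<Phi> x = integral {-1..x} \<beta>" for x
  have \<Phi>0: "\<Phi> x = 0" if "x \<le> 0" for x
    unfolding \<Phi>_def using out that by (intro integral_unique has_integral_is_0) auto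
  have D: "(\<Phi> has_real_derivative \<beta> x) (at x)" for x
  proof (cases "-1 < x")
    case True
    have "(\<Phi> has_real_derivative \<beta> x) (at x within {-1..x + 1})"
      unfolding \<Phi>_def using True by (intro integral_has_real_derivative cb) auto
    moreover have "at x within {-1..x + 1} = at x" using True by (intro at_within_interior) auto
    ultimately show ?thesis by simp
  next
    case False
    have "((\<lambda>x. 0) has_real_derivative 0) (at x)" by simp
    then have "(\<Phi> has_real_derivative 0) (at x)"
      by (rule has_field_derivative_transform_within_open[of _ _ _ "{..<0}"]) (use False \<Phi>0 in auto)
    then show ?thesis using out[of x] False by simp
  qed
  have "\<Phi> x = \<Phi> 1" if "1 \<le> x" for x
  proof (cases "x = 1")
    case False
    have "\<exists>z. 1 < z \<and> z < x \<and> \<Phi> x - \<Phi> 1 = (x - 1) * \<beta> z" using D that False by (intro MVT2) auto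
    then show ?thesis using out by auto
  qed simp
  then show ?thesis using sb smooth_antiderivative[OF D sb] pos out half D \<Phi>0 by blast
qed

text \<open>The test function is the difference of two steps, one rising just after a and one just
  after b. Its derivative is the difference of two bumps, so the averages of \<open>G\<close> near a
  and b agree; concentrating the bumps gives equality of the values by continuity.\<close>

lemma du_Bois_Reymond:
  fixes G :: "real \<Rightarrow> real"
  assumes T: "0 < T" and G: "continuous_on {0..T} G"
    and test: "\<And>\<psi>. test_function T \<psi> \<Longrightarrow> (\<integral>t. indicator {0<..<T} t * (deriv \<psi> t * G t)
        \<partial>lebesgue) = 0"
    and t: "0 \<le> t" "t \<le> T"
  shows "G t = G 0"
proof -
  obtain \<beta> \<Phi> where sb: "smooth \<beta>" and sp: "smooth \<Phi>" and pos': "\<forall>x. 0 \<le> \<beta> x" and out': "\<forall>x.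
      x \<notin> {0<..<1} \<longrightarrow> \<beta> x = 0"
    and half': "\<forall>x\<in>{0<..<1}. 0 < \<beta> x" and D': "\<forall>x. (\<Phi> has_real_derivative \<beta> x) (at x)" and \<Phi>0':
        "\<forall>x\<le>0. \<Phi> x = 0"
    and \<Phi>1': "\<forall>x\<ge>1. \<Phi> x = \<Phi> 1"
    using bump_exists by (elim exE conjE) (rule that; assumption)
  note pos = pos'[rule_format] and out = out'[rule_format] and half = half'[rule_format] and D = D'[rule_format]
    and \<Phi>0 = \<Phi>0'[rule_format] and \<Phi>1 = \<Phi>1'[rule_format]
  have "\<beta> field_differentiable at x" for x using sb by (metis smooth_def funpow_0)
  then have cb: "continuous_on S \<beta>" for S
    by (meson continuous_at_imp_continuous_on field_differentiable_imp_continuous_at)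
  have ib: "integrable lebesgue \<beta>" and Ib: "(\<integral>x. \<beta> x \<partial>lebesgue) = \<Phi> 1"
  proof -
    have "has_bochner_integral lborel (\<lambda>x. indicator {0..1} x *\<^sub>R \<beta> x) (\<Phi> 1 - \<Phi> 0)"
      using D by (intro has_bochner_integral_FTC_Icc cb)
        (auto simp: has_real_derivative_iff_has_vector_derivative[symmetric] intro: has_field_derivative_at_within)
    moreover have "(\<lambda>x. indicator {0..1} x *\<^sub>R \<beta> x) = \<beta>"
    proof
      fix x show "indicator {0..1} x *\<^sub>R \<beta> x = \<beta> x" using out[of x] by (cases "x \<in> {0<..<1}") auto
    qed
    ultimately have h: "has_bochner_integral lborel \<beta> (\<Phi> 1)" using \<Phi>0[of 0] by simp
    have mb: "\<beta> \<in> borel_measurable lborel" using cb[of UNIV] by (simp add: borel_measurable_continuous_onI)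
    show "integrable lebesgue \<beta>" using h mb by (simp add: integrable_completion has_bochner_integral_iff)
    show "(\<integral>x. \<beta> x \<partial>lebesgue) = \<Phi> 1" using h mb by (simp add: integral_completion has_bochner_integral_iff)
  qed
  have \<Phi>pos: "0 < \<Phi> 1"
  proof -
    have mono: "\<Phi> a \<le> \<Phi> b" if "a \<le> b" for a b
      by (rule DERIV_nonneg_imp_nondecreasing[OF that]) (use D pos in blast)
    have "\<Phi> 0 \<le> \<Phi> (1/4)" "\<Phi> (3/4) \<le> \<Phi> 1" by (rule mono, simp)+
    moreover have "\<Phi> (1/4) < \<Phi> (3/4)"
    proof -
      have "\<exists>z>1/4. z < 3/4 \<and> \<Phi> (3/4) - \<Phi> (1/4) = (3/4 - 1/4) * \<beta> z" using D by (intro MVT2) auto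
      then obtain z where z: "1/4 < z" "z < 3/4" "\<Phi> (3/4) - \<Phi> (1/4) = (3/4 - 1/4) * \<beta> z" by blast
      then have "0 < \<beta> z" by (intro half) auto
      then show ?thesis using z(3) by simp
    qed
    ultimately show ?thesis using \<Phi>0[of 0] by simp
  qed
  \<comment> \<open>Constant extension beyond [0,T], bounded and continuous, so that the averages
    can be rescaled over the whole line.\<close>
  define G' where "G' t = G (max 0 (min t T))" for t
  have cG': "continuous_on UNIV G'"
    unfolding G'_def by (rule continuous_on_compose2[OF G]) (use T in \<open>auto intro!: continuous_intros\<close>)
  have G'b: "\<exists>C\<ge>0. \<forall>t. \<bar>G' t\<bar> \<le> C"
  proof -
    have "compact (G ` {0..T})" by (intro compact_continuous_image G) auto
    then obtain C where C: "\<forall>x\<in>G ` {0..T}. norm x \<le> C" using compact_imp_bounded bounded_iff by blast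
    have "max 0 (min t T) \<in> {0..T}" for t using T by auto
    then have "\<bar>G' t\<bar> \<le> C" for t using C unfolding G'_def by (metis image_eqI real_norm_def)
    then show ?thesis by (meson abs_ge_zero order_trans)
  qed
  then obtain C where C: "0 \<le> C" "\<And>t. \<bar>G' t\<bar> \<le> C" by blast
  have m\<beta>: "\<beta> \<in> borel_measurable borel" and mG': "G' \<in> borel_measurable borel"
    using cb cG' by (auto intro: borel_measurable_continuous_onI)
  note m\<beta>[measurable] mG'[measurable]
  have limJ: "(\<lambda>n. \<integral>y. \<beta> y * G' (a + y / real (Suc n)) \<partial>lebesgue) \<longlonglongrightarrow> \<Phi> 1 * G' a" for a
  proof -
    have "(\<lambda>n. \<integral>y. \<beta> y * G' (a + y / real (Suc n)) \<partial>lebesgue) \<longlonglongrightarrow> (\<integral>y.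
        \<beta> y * G' a \<partial>lebesgue)"
    proof (rule integral_dominated_convergence)
      show "integrable lebesgue (\<lambda>y. \<beta> y * C)" using ib by simp
      show "(\<lambda>y. \<beta> y * G' a) \<in> borel_measurable lebesgue" "\<And>n. (\<lambda>y. \<beta> y * G' (a + y / real (Suc n)))
          \<in> borel_measurable lebesgue"
        by (rule borel_imp_lebesgue, measurable)+
      show "AE y in lebesgue. (\<lambda>n. \<beta> y * G' (a + y / real (Suc n))) \<longlonglongrightarrow> \<beta> y * G' a"
      proof (intro AE_I2 tendsto_mult tendsto_const)
        fix y :: real
        have "(\<lambda>n. a + y / real (Suc n)) \<longlonglongrightarrow> a + 0" by (intro tendsto_add tendsto_const LIMSEQ_Suc[OF lim_const_over_n])
        then show "(\<lambda>n. G' (a + y / real (Suc n))) \<longlonglongrightarrow> G' a"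
          by (intro continuous_on_tendsto_compose[OF cG']) auto
      qed
      show "AE y in lebesgue. norm (\<beta> y * G' (a + y / real (Suc n))) \<le> \<beta> y * C" for n
        using C(2) pos by (intro AE_I2) (simp add: abs_mult mult_left_mono)
    qed
    then show ?thesis using Ib by simp
  qed
  have const: "G' a = G' b" if ab: "0 < a" "a < b" "b < T" for a b
  proof -
    obtain M where M: "1 / (T - b) < real M" using reals_Archimedean2 by blast
    have eq: "(\<integral>y. \<beta> y * G' (a + y / r) \<partial>lebesgue) = (\<integral>y. \<beta> y * G' (b + y / r) \<partial>lebesgue)"
      if r: "real M \<le> r" for r
    proof -
      have "1 / (T - b) < r" using M r by linarith
      then have r1: "1 < r * (T - b)" using ab by (simp add: field_simps)
      then have r0: "0 < r" using ab by (smt (verit) mult_nonpos_nonneg)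
      then have "1 / r < T - b" using r1 by (simp add: divide_less_eq mult.commute)
      then have rb: "b + 1 / r < T" by simp
      \<comment> \<open>The factor 1/r cancels the inner derivative. The support lies in
        [a, b + 1/r], which is inside (0,T) once r is large.\<close>
      define \<psi> where "\<psi> t = (1 / r) * (\<Phi> (r * (t - a)) - \<Phi> (r * (t - b)))" for t
      have D\<psi>: "(\<psi> has_real_derivative \<beta> (r * (t - a)) - \<beta> (r * (t - b))) (at t)" for t
      proof -
        have "((\<lambda>t. \<Phi> (r * (t - c))) has_real_derivative \<beta> (r * (t - c)) * r) (at t)" for c
          by (rule DERIV_chain2[OF D]) (auto intro!: derivative_eq_intros)
        from DERIV_cmult[OF DERIV_diff[OF this this], of "1 / r" a b] show ?thesis
          using r0 by (simp add: \<psi>_def[abs_def] left_diff_distrib[symmetric])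
      qed
      have s1: "\<beta> (r * (t - c)) = 0" if "t \<notin> {c<..<c + 1 / r}" for t c
        using that r0 by (intro out) (auto simp: field_simps zero_less_mult_iff not_less)
      have "test_function T \<psi>"
        unfolding test_function_def
      proof (intro conjI exI[of _ "{a..b + 1 / r}"])
        have "smooth \<psi>" unfolding \<psi>_def[abs_def] by (intro smooth_cmult smooth_diff smooth_affine sp)
        then show "\<forall>n t. (deriv ^^ n) \<psi> field_differentiable at t" by (simp add: smooth_def)
        show "{a..b + 1 / r} \<subseteq> {0<..<T}" using ab rb by auto
        show "\<forall>t. t \<notin> {a..b + 1 / r} \<longrightarrow> \<psi> t = 0"
        proof (intro allI impI)
          fix t assume "t \<notin> {a..b + 1 / r}"
          then consider "t < a" | "b + 1 / r < t" by force
          then show "\<psi> t = 0"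
          proof cases
            case 1
            then show ?thesis using r0 ab by (simp add: \<psi>_def \<Phi>0 mult_nonneg_nonpos)
          next
            case 2
            then have "1 \<le> r * (t - b)" using r0 by (simp add: field_simps)
            moreover have "r * (t - b) \<le> r * (t - a)" using r0 ab by (intro mult_left_mono) auto
            ultimately show ?thesis using \<Phi>1[of "r * (t - a)"] \<Phi>1[of "r * (t - b)"] by (simp add: \<psi>_def)
          qed
        qed
      qed simp
      from test[OF this] have z: "(\<integral>t. indicator {0<..<T} t * ((\<beta> (r * (t - a)) - \<beta> (r * (t - b))) * G t)
          \<partial>lebesgue) = 0"
        using DERIV_imp_deriv[OF D\<psi>] by simp
      have e: "indicator {0<..<T} t * ((\<beta> (r * (t - a)) - \<beta> (r * (t - b))) * G t) = \<beta> (r * (t - a)) * G' t - \<beta> (r *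
          (t - b)) * G' t" for t
      proof (cases "t \<in> {0<..<T}")
        case True then show ?thesis by (simp add: G'_def algebra_simps)
      next
        case False
        then have "t \<notin> {a<..<a + 1 / r}" "t \<notin> {b<..<b + 1 / r}" using ab rb by auto
        then show ?thesis using False s1 by simp
      qed
      have aff: "(\<integral>t. \<beta> (r * (t - c)) * G' t \<partial>lebesgue) = (1 / r) * (\<integral>y. \<beta> y * G' (c + y / r)
          \<partial>lebesgue)" for c
        using lebesgue_integral_real_affine[of "1 / r" "\<lambda>t. \<beta> (r * (t - c)) * G' t" c] r0 by simp
      have i: "integrable lebesgue (\<lambda>t. \<beta> (r * (t - c)) * G' t)" for c
      proof (rule Bochner_Integration.integrable_bound[of _ "\<lambda>t. \<beta> (- (r * c) + r * t) * C"])
        show "integrable lebesgue (\<lambda>t. \<beta> (- (r * c) + r * t) * C)"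
          using lebesgue_integrable_real_affine[OF ib, of r "- (r * c)"] r0 by simp
        show "(\<lambda>t. \<beta> (r * (t - c)) * G' t) \<in> borel_measurable lebesgue" by (rule borel_imp_lebesgue) measurable
        have "- (r * c) + r * t = r * (t - c)" for t by (simp add: algebra_simps)
        then show "AE t in lebesgue. norm (\<beta> (r * (t - c)) * G' t) \<le> norm (\<beta> (- (r * c) + r * t) * C)"
          using C pos by (intro AE_I2) (simp add: abs_mult mult_left_mono)
      qed
      have "(\<integral>t. \<beta> (r * (t - a)) * G' t \<partial>lebesgue) - (\<integral>t. \<beta> (r * (t - b)) * G' t \<partial>lebesgue) = 0"
        using z unfolding e by (simp add: Bochner_Integration.integral_diff[OF i i])
      then show ?thesis unfolding aff using r0 by simp
    qed
    have "\<forall>\<^sub>F n in sequentially. (\<integral>y. \<beta> y * G' (a + y / real (Suc n)) \<partial>lebesgue) = (\<integral>y.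
        \<beta> y * G' (b + y / real (Suc n)) \<partial>lebesgue)"
      unfolding eventually_sequentially by (intro exI[of _ M] allI impI eq) simp
    then have "(\<lambda>n. \<integral>y. \<beta> y * G' (b + y / real (Suc n)) \<partial>lebesgue) \<longlonglongrightarrow> \<Phi> 1 * G' a"
      by (rule Lim_transform_eventually[OF limJ])
    then have "\<Phi> 1 * G' a = \<Phi> 1 * G' b" using limJ LIMSEQ_unique by blast
    then show ?thesis using \<Phi>pos by simp
  qed
  have in2: "G x = G' (T / 2)" if "x \<in> {0<..<T}" for x
  proof -
    have "G' x = G' (T / 2)"
    proof (cases x "T / 2" rule: linorder_cases)
      case less then show ?thesis using that T by (intro const) auto
    next
      case greater then show ?thesis using that T by (intro const[symmetric]) auto
    next
      case equal then show ?thesis by (simp only:)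
    qed
    then show ?thesis using that by (simp add: G'_def)
  qed
  have cl: "closure {0<..<T} = {0..T}" using T by (simp add: closure_greaterThanLessThan)
  have "G x = G' (T / 2)" if "x \<in> {0..T}" for x
    by (rule continuous_constant_on_closure[of "{0<..<T}" G]) (use G in2 that cl in auto)
  then show ?thesis using t T by simp
qed

section \<open>Weak derivatives of primitives\<close>

lemma continuous_cumul:
  assumes w: "locint w" shows "continuous_on UNIV (cumul w)"
  unfolding continuous_on_sequentially
proof (intro allI ballI impI)
  fix x :: "nat \<Rightarrow> real" and a assume "a \<in> UNIV" "(\<forall>n. x n \<in> UNIV) \<and> x \<longlonglongrightarrow> a"
  then have x: "x \<longlonglongrightarrow> a" by simp
  have "eventually (\<lambda>i. x i < a + 1) sequentially" using x by (intro order_tendstoD) auto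
  then obtain N where N: "\<And>i. i \<ge> N \<Longrightarrow> x i < a + 1" by (auto simp: eventually_sequentially)
  note m = locint_measurable[OF w]
  note m[measurable]
  have "(\<lambda>i. cumul w (x (i + N))) \<longlonglongrightarrow> cumul w a"
    unfolding cumul_def
  proof (rule integral_dominated_convergence)
    show "integrable lebesgue (\<lambda>s. \<bar>indicator {..<a + 1} s * w s\<bar>)" using locint_integrable[OF w] by (rule integrable_abs)
    have "(\<lambda>i. indicator {..<x (i + N)} s * w s) \<longlonglongrightarrow> indicator {..<a} s * w s" if "s \<noteq> a" for s
    proof -
      have x': "(\<lambda>i. x (i + N)) \<longlonglongrightarrow> a" by (rule LIMSEQ_ignore_initial_segment[OF x])
      have "eventually (\<lambda>i. (indicator {..<x (i + N)} s :: real) = indicator {..<a} s) sequentially"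
      proof (cases "s < a")
        case True
        then have "eventually (\<lambda>i. s < x (i + N)) sequentially" using x' by (intro order_tendstoD)
        then show ?thesis by eventually_elim (use True in simp)
      next
        case False
        then have "eventually (\<lambda>i. x (i + N) < s) sequentially" using x' that by (intro order_tendstoD) auto
        then show ?thesis by eventually_elim (use False in simp)
      qed
      then have "eventually (\<lambda>i. indicator {..<x (i + N)} s * w s = indicator {..<a} s * w s) sequentially" by eventually_elim simp
      then show ?thesis by (rule tendsto_eventually)
    qed
    then show "AE s in lebesgue. (\<lambda>i. indicator {..<x (i + N)} s * w s) \<longlonglongrightarrow> indicator {..<a} s * w s"
      by (intro AE_I'[of "{a}"]) auto
    show "AE s in lebesgue. norm (indicator {..<x (i + N)} s * w s) \<le> \<bar>indicator {..<a + 1} s * w s\<bar>" for i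
      using N[of "i + N"] by (intro AE_I2) (auto simp: indicator_def)
  qed measurable
  then show "(cumul w \<circ> x) \<longlonglongrightarrow> cumul w a" using LIMSEQ_offset[of "\<lambda>i. cumul w (x i)" N] by (simp add: comp_def)
qed

lemma FTC_lebesgue:
  fixes F f :: "real \<Rightarrow> real"
  assumes D: "\<And>x. (F has_real_derivative f x) (at x)" and c: "continuous_on UNIV f" and ab: "a \<le> b"
  shows "(\<integral>x. indicator {a<..<b} x * f x \<partial>lebesgue) = F b - F a"
proof -
  have fb: "f \<in> borel_measurable borel" using c by (rule borel_measurable_continuous_onI)
  have [measurable]: "f \<in> borel_measurable lborel" using fb by simp
  have "(\<lambda>x. indicator {a<..<b} x * f x) \<in> borel_measurable lborel" by measurable
  from integral_completion[OF this]
  have "(\<integral>x. indicator {a<..<b} x * f x \<partial>lebesgue) = (\<integral>x. indicator {a<..<b} x * f x \<partial>lborel)" .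
  also have "\<dots> = (\<integral>x. indicator {a..b} x *\<^sub>R f x \<partial>lborel)"
  proof (rule integral_cong_AE)
    have "AE x in lborel. x \<noteq> a \<and> x \<noteq> b" using AE_lborel_singleton[of a] AE_lborel_singleton[of b] by eventually_elim simp
    then show "AE x in lborel. indicator {a<..<b} x * f x = indicator {a..b} x *\<^sub>R f x"
      by eventually_elim (auto simp: indicator_def)
  qed measurable
  also have "\<dots> = F b - F a"
    using D ab by (intro integral_FTC_Icc continuous_on_subset[OF c])
      (auto simp: has_real_derivative_iff_has_vector_derivative[symmetric] intro: has_field_derivative_at_within)
  finally show ?thesis .
qed

lemma test_functionD:
  assumes "test_function T \<psi>"
  shows "(\<psi> has_real_derivative deriv \<psi> t) (at t)" "continuous_on UNIV (deriv \<psi>)" "continuous_on UNIV \<psi>"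
    "t \<notin> {0<..<T} \<Longrightarrow> \<psi> t = 0"
proof -
  have s: "\<And>n t. ((deriv ^^ n) \<psi>) field_differentiable (at t)" using assms by (simp add: test_function_def)
  show D: "(\<psi> has_real_derivative deriv \<psi> t) (at t)" for t using s[of 0 t] by (simp add: DERIV_deriv_iff_field_differentiable)
  have "deriv \<psi> field_differentiable (at t)" for t using s[of 1 t] by simp
  then show "continuous_on UNIV (deriv \<psi>)" by (meson continuous_at_imp_continuous_on field_differentiable_imp_continuous_at)
  show "continuous_on UNIV \<psi>" using D by (meson DERIV_isCont continuous_at_imp_continuous_on)
  show "t \<notin> {0<..<T} \<Longrightarrow> \<psi> t = 0" using assms by (auto simp: test_function_def)
qed

text \<open>Fubini in place of absolute continuity: the primitive is written as an integral over s <
  t, the order is exchanged, and the fundamental theorem is applied to the smooth \<psi> on (s,T),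
  where \<psi> vanishes at T.\<close>

lemma cumul_by_parts:
  assumes h: "locint h" and \<psi>: "test_function T \<psi>" and T: "0 < T"
  shows "(\<integral>t. indicator {0<..<T} t * (deriv \<psi> t * cumul h t) \<partial>lebesgue) = - (\<integral>t. indicator {0<..<T} t *
      (\<psi> t * h t) \<partial>lebesgue)"
proof -
  note P = test_functionD[OF \<psi>]
  have [measurable]: "deriv \<psi> \<in> borel_measurable borel" using P(2) by (rule borel_measurable_continuous_onI)
  have [measurable]: "h \<in> borel_measurable lebesgue" by (rule locint_measurable[OF h])
  have "compact (deriv \<psi> ` {0..T})" by (intro compact_continuous_image continuous_on_subset[OF P(2)]) auto
  then obtain C where C: "\<forall>x\<in>deriv \<psi> ` {0..T}. norm x \<le> C" using compact_imp_bounded bounded_iff by blast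
  then have C: "\<bar>deriv \<psi> t\<bar> \<le> C" if "t \<in> {0<..<T}" for t using that by auto
  have C0: "0 \<le> C" using C[of "T/2"] T by auto
  define f where "f s t = (indicator {0<..<T} t * deriv \<psi> t) * (indicator {0<..} (t - s) * h s)" for s t :: real
  have m [measurable]: "case_prod f \<in> borel_measurable (lebesgue \<Otimes>\<^sub>M lebesgue)"
    unfolding f_def split_beta' by measurable
  have i1: "integrable lebesgue (\<lambda>t. indicator {0<..<T} t * (deriv \<psi> t * indicator {0<..} (t - s)))" for s
  proof (rule Bochner_Integration.integrable_bound[of _ "\<lambda>t. C * indicator {0<..<T} t"])
    show "integrable lebesgue (\<lambda>t. C * indicator {0<..<T} t)" using T by (intro integrable_mult_right) (simp add: integrable_indicator_iff)
    show "(\<lambda>t. indicator {0<..<T} t * (deriv \<psi> t * indicator {0<..} (t - s))) \<in> borel_measurable lebesgue" by (rule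
        borel_imp_lebesgue) measurable
    show "AE t in lebesgue. norm (indicator {0<..<T} t * (deriv \<psi> t * indicator {0<..} (t - s))) \<le> norm (C * indicator {0<..<T} t)"
      using C C0 by (intro AE_I2) (auto simp: indicator_def)
  qed
  have fi: "integrable lebesgue (f s)" for s
    using integrable_mult_left[OF i1, of s "h s"] by (simp add: f_def[abs_def] mult_ac)
  have fs: "(\<integral>t. f s t \<partial>lebesgue) = - (indicator {0<..<T} s * (\<psi> s * h s))" for s
  proof -
    have "(\<integral>t. f s t \<partial>lebesgue) = (\<integral>t. indicator {0<..<T} t * (deriv \<psi> t * indicator {0<..} (t - s))
        \<partial>lebesgue) * h s"
      using i1[of s] by (simp add: f_def mult_ac flip: integral_mult_left_zero)
    also have "\<dots> = - (indicator {0<..<T} s * (\<psi> s * h s))"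
    proof (cases "0 < s")
      case False then show ?thesis using locint_nonpos[OF h, of s] by simp
    next
      case s: True
      have "(\<integral>t. indicator {0<..<T} t * (deriv \<psi> t * indicator {0<..} (t - s)) \<partial>lebesgue) = (\<integral>t.
          indicator {s<..<T} t * deriv \<psi> t \<partial>lebesgue)"
        using s by (intro Bochner_Integration.integral_cong) (auto simp: indicator_def)
      also have "\<dots> = - indicator {0<..<T} s * \<psi> s"
      proof (cases "s < T")
        case True
        then show ?thesis using FTC_lebesgue[OF P(1,2), of s T] P(4)[of T] s by simp
      next
        case False
        then have "(\<lambda>t. indicator {s<..<T} t * deriv \<psi> t) = (\<lambda>t. 0)" by (auto simp: fun_eq_iff indicator_def)
        then show ?thesis using False by simp
      qed
      finally show ?thesis by simp
    qed
    finally show ?thesis .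
  qed
  have ft: "(\<integral>s. f s t \<partial>lebesgue) = indicator {0<..<T} t * (deriv \<psi> t * cumul h t)" for t
    by (simp add: f_def cumul_eq_rconv rconv_def)
  have nb: "integrable lebesgue (\<lambda>s. \<integral>t. norm (f s t) \<partial>lebesgue)"
  proof (rule Bochner_Integration.integrable_bound[of _ "\<lambda>s. (C * T) * \<bar>indicator {..<T} s * h s\<bar>"])
    show "integrable lebesgue (\<lambda>s. (C * T) * \<bar>indicator {..<T} s * h s\<bar>)"
      by (intro integrable_mult_right integrable_abs locint_integrable[OF h])
    have "(\<lambda>(s, t). norm (f s t)) \<in> borel_measurable (lebesgue \<Otimes>\<^sub>M lebesgue)" using m by measurable
    from sigma_finite_measure.borel_measurable_lebesgue_integral[OF sigma_finite_lebesgue this]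
    show "(\<lambda>s. \<integral>t. norm (f s t) \<partial>lebesgue) \<in> borel_measurable lebesgue" by simp
    have "(\<integral>t. norm (f s t) \<partial>lebesgue) \<le> (C * T) * \<bar>indicator {..<T} s * h s\<bar>" for s
    proof -
      have "(\<integral>t. norm (f s t) \<partial>lebesgue) \<le> (\<integral>t. (C * \<bar>indicator {..<T} s * h s\<bar>) * indicator
          {0<..<T} t \<partial>lebesgue)"
      proof (rule integral_mono)
        show "integrable lebesgue (\<lambda>t. norm (f s t))" using fi by (rule integrable_norm)
        show "integrable lebesgue (\<lambda>t. (C * \<bar>indicator {..<T} s * h s\<bar>) * indicator {0<..<T} t)"
          using T by (intro integrable_mult_right) (simp add: integrable_indicator_iff)
        show "norm (f s t) \<le> (C * \<bar>indicator {..<T} s * h s\<bar>) * indicator {0<..<T} t" for t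
          using C[of t] C0 by (auto simp: f_def indicator_def abs_mult intro!: mult_mono)
      qed
      then show ?thesis using T by (simp add: mult_ac)
    qed
    then show "AE s in lebesgue. norm (\<integral>t. norm (f s t) \<partial>lebesgue) \<le> norm ((C * T) * \<bar>indicator {..<T} s * h s\<bar>)"
      using C0 T by (intro AE_I2) (simp add: abs_mult)
  qed
  have F: "integrable (lebesgue \<Otimes>\<^sub>M lebesgue) (case_prod f)"
  proof (intro leb2.Fubini_integrable[OF m] AE_I2)
    show "integrable lebesgue (\<lambda>x. \<integral>y. norm (case (x, y) of (x, y) \<Rightarrow> f x y) \<partial>lebesgue)" using nb by simp
    show "integrable lebesgue (\<lambda>y. case (x, y) of (x, y) \<Rightarrow> f x y)" for x using fi by simp
  qed
  have "(\<integral>t. (\<integral>s. f s t \<partial>lebesgue) \<partial>lebesgue) = (\<integral>s. (\<integral>t. f s t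
      \<partial>lebesgue) \<partial>lebesgue)"
    by (rule leb2.Fubini_integral[OF F])
  then show ?thesis unfolding fs ft by simp
qed

text \<open>The positive and the negative part of \<open>q\<close> below \<open>T\<close> are
  densities of finite measures that agree on all half-lines. The measures coincide, hence so do the
  densities, almost everywhere.\<close>

lemma cumul_zero_imp_AE:
  assumes q: "locint q" and z: "\<And>t. t \<le> T \<Longrightarrow> cumul q t = 0"
  shows "AE s in lebesgue. s < T \<longrightarrow> q s = 0"
proof -
  define p where "p s = indicator {..<T} s * q s" for s
  have ip: "integrable lebesgue p" unfolding p_def by (rule locint_integrable[OF q])
  \<comment> \<open>Measures are compared on Borel sets, so \<open>p\<close> is replaced by a Borel
    representative.\<close>
  obtain p' where p' [measurable]: "p' \<in> borel_measurable lborel" and pp: "AE s in lborel. p s = p' s"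
    using completion_ex_borel_measurable_real[OF borel_measurable_integrable[OF ip]] by blast
  have pp': "AE s in lebesgue. p s = p' s" using pp by (rule AE_completion)
  have ip': "integrable lborel p'"
  proof -
    have "integrable lebesgue p'"
      using integrable_cong_AE[OF borel_measurable_integrable[OF ip] measurable_completion[OF p'] pp'] ip by blast
    then show ?thesis using p' by (simp add: integrable_completion)
  qed
  have tail: "(\<integral>s. indicator {x<..} s * p' s \<partial>lborel) = 0" for x
  proof -
    have "(\<integral>s. indicator {x<..} s * p' s \<partial>lborel) = (\<integral>s. indicator {x<..} s * p' s \<partial>lebesgue)"
      by (rule integral_completion[symmetric]) measurable
    also have "\<dots> = (\<integral>s. indicator {min x T..<T} s * q s \<partial>lebesgue)"
    proof (rule integral_cong_AE)
      show "(\<lambda>s. indicator {x<..} s * p' s) \<in> borel_measurable lebesgue" by (rule measurable_completion) measurable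
      show "(\<lambda>s. indicator {min x T..<T} s * q s) \<in> borel_measurable lebesgue" using locint_measurable[OF q] by measurable
      have "AE s in lebesgue. s \<noteq> x" by (intro AE_I'[of "{x}"]) auto
      with pp' show "AE s in lebesgue. indicator {x<..} s * p' s = indicator {min x T..<T} s * q s"
      proof eventually_elim
        case (elim s) then show ?case by (cases "x \<le> T") (auto simp: p_def indicator_def split: if_splits)
      qed
    qed
    also have "\<dots> = cumul q T - cumul q (min x T)" by (rule cumul_diff[OF q, symmetric]) simp
    also have "\<dots> = 0" using z by simp
    finally show ?thesis .
  qed
  have dens: "emeasure (density lborel (\<lambda>s. ennreal (r s))) {x<..} = ennreal (\<integral>s. indicator {x<..} s * max 0 (r s)
      \<partial>lborel)"
    and di: "integrable lborel (\<lambda>s. indicator {x<..} s * max 0 (r s))"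
    if r: "integrable lborel r" for r :: "real \<Rightarrow> real" and x
  proof -
    have [measurable]: "r \<in> borel_measurable lborel" using r by simp
    show i: "integrable lborel (\<lambda>s. indicator {x<..} s * max 0 (r s))"
    proof (rule Bochner_Integration.integrable_bound[OF r])
      show "(\<lambda>s. indicator {x<..} s * max 0 (r s)) \<in> borel_measurable lborel" by measurable
    qed (auto intro!: AE_I2 simp: indicator_def)
    have "emeasure (density lborel (\<lambda>s. ennreal (r s))) {x<..} = (\<integral>\<^sup>+s. ennreal (r s) * indicator {x<..} s \<partial>lborel)"
      by (rule emeasure_density) measurable
    also have "\<dots> = (\<integral>\<^sup>+s. ennreal (indicator {x<..} s * max 0 (r s)) \<partial>lborel)"
      by (intro nn_integral_cong) (auto simp: indicator_def max_def ennreal_neg)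
    also have "\<dots> = ennreal (\<integral>s. indicator {x<..} s * max 0 (r s) \<partial>lborel)"
      by (rule nn_integral_eq_integral[OF i]) (auto intro!: AE_I2)
    finally show "emeasure (density lborel (\<lambda>s. ennreal (r s))) {x<..} = ennreal (\<integral>s. indicator {x<..} s * max 0 (r s)
        \<partial>lborel)" .
  qed
  have im: "integrable lborel (\<lambda>s. - p' s)" using ip' by simp
  \<comment> \<open>\<open>ennreal\<close> sends negative numbers to 0, so the two densities are the
    positive and the negative part of \<open>p'\<close>.\<close>
  have eq: "density lborel (\<lambda>s. ennreal (p' s)) = density lborel (\<lambda>s. ennreal (- p' s))"
  proof (rule measure_eqI_lessThan)
    fix x
    show "emeasure (density lborel (\<lambda>s. ennreal (p' s))) {x<..} < \<infinity>" by (simp add: dens[OF ip'])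
    have e: "indicator {x<..} s * max 0 (p' s) - indicator {x<..} s * max 0 (- p' s) = indicator {x<..} s * p' s" for s
      by (auto simp: indicator_def max_def)
    have "(\<integral>s. indicator {x<..} s * max 0 (p' s) \<partial>lborel) - (\<integral>s. indicator {x<..} s * max 0 (- p' s)
        \<partial>lborel) = 0"
      using Bochner_Integration.integral_diff[OF di[OF ip', of x] di[OF im, of x]] tail[of x] unfolding e by simp
    then show "emeasure (density lborel (\<lambda>s. ennreal (p' s))) {x<..} = emeasure (density lborel (\<lambda>s. ennreal (- p' s))) {x<..}"
      by (simp add: dens[OF ip'] dens[OF im])
  qed auto
  have "AE s in lborel. ennreal (p' s) = ennreal (- p' s)"
    by (rule sigma_finite_measure.density_unique[OF sigma_finite_lborel _ _ eq]) measurable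
  then have "AE s in lborel. p' s = 0"
    by eventually_elim (metis ennreal_eq_0_iff ennreal_inj neg_0_le_iff_le le_cases neg_equal_0_iff_equal order_antisym)
  then have "AE s in lebesgue. p' s = 0" by (rule AE_completion)
  with pp' show ?thesis by eventually_elim (auto simp: p_def)
qed

text \<open>The exceptional null set depends on \<open>e\<close>; strong measurability reduces to countably many \<open>e\<close>.\<close>

lemma AE_zero_from_inner:
  fixes q :: "real \<Rightarrow> 'h::real_inner"
  assumes q: "strongly_measurable lebesgue q" and z: "\<And>e. AE s in lebesgue. s < T \<longrightarrow> q s \<bullet> e = 0"
  shows "AE s in lebesgue. s < T \<longrightarrow> q s = 0"
proof -
  obtain x where x: "\<And>i::nat. simple_function lebesgue (x i)" "AE s in lebesgue. (\<lambda>i. x i s) \<longlonglongrightarrow> q s"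
    using q unfolding strongly_measurable_def by blast
  define E where "E = (\<Union>i. range (x i))"
  have "finite (range (x i))" for i using simple_functionD(1)[OF x(1)[of i]] by simp
  then have E: "countable E" unfolding E_def by (intro countable_UN[OF countableI_type] countable_finite)
  have "AE s in lebesgue. \<forall>e\<in>E. s < T \<longrightarrow> q s \<bullet> e = 0"
    by (rule AE_ball_countable[OF E, THEN iffD2]) (intro ballI z)
  with x(2) show ?thesis
  proof eventually_elim
    case (elim s)
    show ?case
    proof
      assume s: "s < T"
      have "(\<lambda>i. q s \<bullet> x i s) \<longlonglongrightarrow> q s \<bullet> q s" by (intro tendsto_intros elim)
      moreover have "q s \<bullet> x i s = 0" for i using elim(2) s by (auto simp: E_def)
      ultimately have "q s \<bullet> q s = 0" by (simp add: LIMSEQ_const_iff)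
      then show "q s = 0" by simp
    qed
  qed
qed

section \<open>Strong solutions as Volterra equations\<close>

definition cut :: "real \<Rightarrow> (real \<Rightarrow> 'a::zero) \<Rightarrow> real \<Rightarrow> 'a" where
  "cut T F t = (if t \<in> {0<..<T} then F t else 0)"

lemma cut_simps [simp]: "t \<in> {0<..<T} \<Longrightarrow> cut T F t = F t" "t \<le> 0 \<Longrightarrow> cut T F t = 0" "T \<le> t
    \<Longrightarrow> cut T F t = 0"
  by (auto simp: cut_def)

lemma cut_eq_scaleR:
  fixes F :: "real \<Rightarrow> 'a::real_vector"
  shows "cut T F = (\<lambda>t. indicator {0<..<T} t *\<^sub>R F t)"
  by (auto simp: cut_def fun_eq_iff)

lemma AE_lebesgue_on: "S \<in> sets lebesgue \<Longrightarrow> (AE t in lebesgue_on S. P t) \<longleftrightarrow> (AE t in lebesgue. t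
    \<in> S \<longrightarrow> P t)"
  by (subst AE_restrict_space_iff) auto

lemma L2_on_cut: "L2_on T F \<longleftrightarrow> strongly_measurable lebesgue (cut T F) \<and> integrable lebesgue (norm_sq (cut T F))"
proof -
  have "strongly_measurable (lebesgue_on {0<..<T}) F \<longleftrightarrow> strongly_measurable lebesgue (cut T F)"
    unfolding cut_def[abs_def] by (rule strongly_measurable_restrict_iff) simp
  moreover have "integrable (lebesgue_on {0<..<T}) (norm_sq F) \<longleftrightarrow> integrable lebesgue (norm_sq (cut T F))"
    by (subst integrable_lebesgue_on_iff) (auto intro!: arg_cong[where f = "integrable lebesgue"] simp: cut_def fun_eq_iff)
  ultimately show ?thesis by (simp add: L2_on_def)
qed

lemma locint_cut:
  assumes "L2_on T F" shows "locint (norm_sq (cut T F))"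
  unfolding locint_def
proof (intro conjI allI impI)
  have i: "integrable lebesgue (norm_sq (cut T F))" using assms by (simp add: L2_on_cut)
  then show "(norm_sq (cut T F)) \<in> borel_measurable lebesgue" by (rule borel_measurable_integrable)
  show "integrable lebesgue (\<lambda>s. indicator {..<T'} s * (norm (cut T F s))\<^sup>2)" for T'
    using integrable_mult_indicator[OF _ i, of "{..<T'}"] by simp
qed simp

lemma locint_norm:
  fixes h :: "real \<Rightarrow> 'h::real_normed_vector"
  assumes h: "strongly_measurable lebesgue h" and sq: "locint (norm_sq h)"
  shows "locint (\<lambda>s. norm (h s))"
proof (rule locint_bound)
  show "locint (\<lambda>s. (norm (h s))\<^sup>2 + heaviside s)"
    by (intro locint_add sq mono_kernelD(1)[OF mono_kernel_heaviside])
  show "(\<lambda>s. norm (h s)) \<in> borel_measurable lebesgue" by (rule strongly_measurable_norm[OF h])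
  fix s
  show "\<bar>norm (h s)\<bar> \<le> (norm (h s))\<^sup>2 + heaviside s"
  proof (cases "s \<le> 0")
    case True then show ?thesis using locint_nonpos[OF sq True] by simp
  next
    case False
    have "0 \<le> (norm (h s) - 1)\<^sup>2 + (norm (h s))\<^sup>2" by simp
    then have "2 * norm (h s) \<le> 2 * (norm (h s))\<^sup>2 + 1" by (simp add: power2_diff)
    then show ?thesis using False by simp
  qed
qed

lemma locint_sq_diff:
  fixes a b :: "real \<Rightarrow> 'h::real_inner"
  assumes a: "strongly_measurable lebesgue a" "locint (norm_sq a)"
    and b: "strongly_measurable lebesgue b" "locint (norm_sq b)"
  shows "locint (\<lambda>s. (norm (a s - b s))\<^sup>2)"
proof (rule locint_bound)
  show "locint (\<lambda>s. 2 * (norm (a s))\<^sup>2 + 2 * (norm (b s))\<^sup>2)" by (intro locint_add locint_cmult a b)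
  show "(\<lambda>s. (norm (a s - b s))\<^sup>2) \<in> borel_measurable lebesgue"
    using strongly_measurable_norm[OF strongly_measurable_diff[OF a(1) b(1)]] by measurable
  fix s
  have "0 \<le> (norm (a s + b s))\<^sup>2" by simp
  then have "(norm (a s - b s))\<^sup>2 \<le> 2 * (norm (a s))\<^sup>2 + 2 * (norm (b s))\<^sup>2"
    by (simp add: power2_norm_eq_inner inner_diff_left inner_diff_right inner_add_left inner_add_right inner_commute)
  then show "\<bar>(norm (a s - b s))\<^sup>2\<bar> \<le> 2 * (norm (a s))\<^sup>2 + 2 * (norm (b s))\<^sup>2" by simp
qed

lemma L2_on_locint:
  assumes X: "strongly_measurable lebesgue X" "locint (norm_sq X)"
  shows "L2_on T X"
  unfolding L2_on_cut
proof
  show "strongly_measurable lebesgue (cut T X)" unfolding cut_eq_scaleR by (intro strongly_measurable_scaleR X) simp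
  have "indicator {..<T} s * (norm (X s))\<^sup>2 = (norm (cut T X s))\<^sup>2" for s
    using locint_nonpos[OF X(2), of s] by (cases "s \<le> 0") (auto simp: cut_def)
  then show "integrable lebesgue (norm_sq (cut T X))" using locint_integrable[OF X(2), of T] by simp
qed

lemma L2_on_continuous:
  assumes F: "continuous_on UNIV F"
  shows "L2_on T F"
  unfolding L2_on_cut
proof
  show m: "strongly_measurable lebesgue (cut T F)"
    unfolding cut_eq_scaleR by (intro strongly_measurable_scaleR strongly_measurable_continuous F) simp
  have "compact (F ` {0..T})" by (intro compact_continuous_image continuous_on_subset[OF F]) auto
  then obtain C where C: "\<forall>x\<in>F ` {0..T}. norm x \<le> C" using compact_imp_bounded bounded_iff by blast
  show "integrable lebesgue (norm_sq (cut T F))"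
  proof (rule Bochner_Integration.integrable_bound)
    show "integrable lebesgue (\<lambda>t. C\<^sup>2 * indicator {0<..<T} t :: real)"
      using emeasure_bounded_finite[of "{0<..<T}"] by (intro integrable_mult_right) (simp add: integrable_indicator_iff)
    show "(norm_sq (cut T F)) \<in> borel_measurable lebesgue" using strongly_measurable_norm[OF m] by measurable
    show "AE t in lebesgue. norm ((norm (cut T F t))\<^sup>2) \<le> norm (C\<^sup>2 * indicator {0<..<T} t)"
      using C by (intro AE_I2) (auto simp: cut_def intro!: power_mono)
  qed
qed

text \<open>Translates the vector integrals in the definition of the weak derivative into real
  integrals over the line.\<close>

lemma bochner_pairing:
  fixes F :: "real \<Rightarrow> 'h::{real_inner,banach}"
  assumes F: "L2_on T F" and a: "continuous_on UNIV a"
  shows "bochner_int (lebesgue_on {0<..<T}) (\<lambda>t. a t *\<^sub>R F t) \<bullet> e = (\<integral>t. indicator {0<..<T} t * (a t * (F t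
      \<bullet> e)) \<partial>lebesgue)"
    and "integrable lebesgue (\<lambda>t. indicator {0<..<T} t * (a t * (F t \<bullet> e)))"
proof -
  let ?M = "lebesgue_on {0<..<T}" and ?G = "\<lambda>t. a t *\<^sub>R F t"
  have S: "{0<..<T} \<in> sets lebesgue" by simp
  have "a \<in> borel_measurable borel" using a by (rule borel_measurable_continuous_onI)
  then have am: "a \<in> borel_measurable lebesgue" by (rule borel_imp_lebesgue)
  have Fm: "strongly_measurable lebesgue (cut T F)" using F by (simp add: L2_on_cut)
  have cG: "cut T ?G = (\<lambda>t. a t *\<^sub>R cut T F t)" by (auto simp: cut_def fun_eq_iff)
  have Gm: "strongly_measurable lebesgue (cut T ?G)" unfolding cG by (rule strongly_measurable_scaleR[OF am Fm])
  then have 1: "strongly_measurable ?M ?G" by (simp add: strongly_measurable_restrict_iff cut_def[abs_def])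
  have "cut T ?G \<in> borel_measurable ?M" by (rule measurable_restrict_space1[OF strongly_measurable_imp_borel[OF Gm]])
  then have 2: "?G \<in> borel_measurable ?M" by (rule measurable_cong[THEN iffD1, rotated]) simp
  have "compact (a ` {0..T})" by (intro compact_continuous_image continuous_on_subset[OF a]) auto
  then obtain C where C: "\<forall>x\<in>a ` {0..T}. norm x \<le> C" using compact_imp_bounded bounded_iff by blast
  have lc: "locint (\<lambda>s. norm (cut T F s))" by (rule locint_norm[OF Fm locint_cut[OF F]])
  have "integrable lebesgue (\<lambda>t. norm (cut T ?G t))"
  proof (rule Bochner_Integration.integrable_bound)
    show "integrable lebesgue (\<lambda>t. C * (indicator {..<T} t * norm (cut T F t)))"
      by (intro integrable_mult_right locint_integrable[OF lc])
    show "(\<lambda>t. norm (cut T ?G t)) \<in> borel_measurable lebesgue" by (rule strongly_measurable_norm[OF Gm])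
    have "norm (cut T ?G t) \<le> C * (indicator {..<T} t * norm (cut T F t))" for t
      using C by (auto simp: cut_def intro!: mult_right_mono)
    then show "AE t in lebesgue. norm (norm (cut T ?G t)) \<le> norm (C * (indicator {..<T} t * norm (cut T F t)))"
      by (intro AE_I2) (metis abs_ge_self abs_norm_cancel order_trans real_norm_def)
  qed
  then have 3: "integrable ?M (\<lambda>t. norm (?G t))"
    unfolding integrable_lebesgue_on_iff[OF S] by (rule Bochner_Integration.integrable_cong[THEN iffD1, rotated 2]) (auto simp: cut_def)
  note b = bochner_int_inner[OF 1 2 3, of e]
  have e: "integral\<^sup>L ?M (\<lambda>t. ?G t \<bullet> e) = (\<integral>t. indicator {0<..<T} t * (a t * (F t \<bullet> e)) \<partial>lebesgue)"
    by (subst integral_restrict_space) (auto simp: S)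
  show "bochner_int ?M ?G \<bullet> e = (\<integral>t. indicator {0<..<T} t * (a t * (F t \<bullet> e)) \<partial>lebesgue)"
    using has_bochner_integral_integral_eq[OF b] e by simp
  show "integrable lebesgue (\<lambda>t. indicator {0<..<T} t * (a t * (F t \<bullet> e)))"
    using integrable.intros[OF b] unfolding integrable_lebesgue_on_iff[OF S] by simp
qed

text \<open>Let \<open>h\<close> be the weak derivative \<open>g'\<close> cut to (0,T). By du
  Bois-Reymond \<open>g\<close> is the primitive of \<open>h\<close>, the initial condition fixing
  the constant. As \<open>g\<close> is the convolution of \<open>k\<close> with
  \<open>v - u0\<close>, a further convolution with \<open>l\<close> equates the primitives of
  \<open>v - u0\<close> and of the convolution of \<open>l\<close> with \<open>h\<close>; the
  functions then agree almost everywhere.\<close>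

lemma strong_solution_volterra:
  fixes v :: "real \<Rightarrow> 'h::{real_inner,banach}"
  assumes kl: "condition_K k l" and v: "strong_solution \<phi> k B f u0 T v" and T: "0 < T"
  shows "\<exists>h. strongly_measurable lebesgue h \<and> (\<forall>s. s \<notin> {0<..<T} \<longrightarrow> h s = 0) \<and> locint
      (norm_sq h) \<and>
    (AE s in lebesgue. 0 < s \<and> s < T \<longrightarrow> v s - u0 = conv (zext l) h s \<and> f s - h s - B (v s) \<in> subdiff \<phi> (v s))"
proof -
  define K where "K = zext k"
  define L where "L = zext l"
  interpret conj_kernels K L unfolding K_def L_def by (rule conj_kernels_zext[OF kl])
  interpret sym: conj_kernels L K by (rule conj_kernels_sym)
  note Lb = mono_kernelD(2)[OF l] and Kb = mono_kernelD(2)[OF k]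
  have S: "{0<..<T} \<in> sets lebesgue" by simp
  from v obtain g g' \<xi> where vL: "L2_on T v" and g: "AE t in lebesgue_on {0<..<T}. g t = conv k (\<lambda>s. v s - u0) t"
    and gc: "continuous_on {0..T} g" and W: "W12_on T g g'" and g0: "g 0 = 0"
    and eq: "AE t in lebesgue_on {0<..<T}. \<xi> t \<in> subdiff \<phi> (v t) \<and> g' t + \<xi> t + B (v t) = f t"
    unfolding strong_solution_def by (elim exE conjE) (rule that; assumption)
  have gL: "L2_on T g" and g'L: "L2_on T g'" and Wi: "\<And>\<psi>. test_function T \<psi> \<Longrightarrow>
        bochner_int (lebesgue_on {0<..<T}) (\<lambda>t. deriv \<psi> t *\<^sub>R g t) = - bochner_int (lebesgue_on {0<..<T}) (\<lambda>t.
            \<psi> t *\<^sub>R g' t)"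
    using W by (auto simp: W12_on_def)
  define h where "h = cut T g'"
  have hm: "strongly_measurable lebesgue h" using g'L by (simp add: L2_on_cut h_def)
  have hs: "locint (norm_sq h)" unfolding h_def by (rule locint_cut[OF g'L])
  have h0: "h s = 0" if "s \<le> 0" for s using that by (simp add: h_def)
  have hn: "locint (\<lambda>s. norm (h s))" by (rule locint_norm[OF hm hs])
  have he: "locint (\<lambda>s. h s \<bullet> e)" for e by (rule locint_inner[OF hm hs])
  define w where "w = cut T (\<lambda>s. v s - u0)"
  have wL: "L2_on T (\<lambda>s. v s - u0)"
  proof -
    have "cut T (\<lambda>s. v s - u0) = (\<lambda>s. cut T v s - cut T (\<lambda>s. u0) s)" by (auto simp: cut_def fun_eq_iff)
    moreover have c: "L2_on T (\<lambda>s. u0)" by (rule L2_on_continuous) simp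
    ultimately have m: "strongly_measurable lebesgue (cut T (\<lambda>s. v s - u0))" and i: "locint (\<lambda>s. (norm (cut T (\<lambda>s.
        v s - u0) s))\<^sup>2)"
      using strongly_measurable_diff locint_sq_diff[OF _ locint_cut[OF vL] _ locint_cut[OF c]] vL by (auto simp: L2_on_cut)
    have "L2_on T (cut T (\<lambda>s. v s - u0))" by (rule L2_on_locint[OF m i])
    moreover have "cut T (cut T (\<lambda>s. v s - u0)) = cut T (\<lambda>s. v s - u0)" by (auto simp: cut_def fun_eq_iff)
    ultimately show ?thesis by (simp add: L2_on_cut)
  qed
  have wm: "strongly_measurable lebesgue w" using wL by (simp add: L2_on_cut w_def)
  have ws: "locint (norm_sq w)" unfolding w_def by (rule locint_cut[OF wL])
  have w0: "w s = 0" if "s \<le> 0" for s using that by (simp add: w_def)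
  have wn: "locint (\<lambda>s. norm (w s))" by (rule locint_norm[OF wm ws])
  have we: "locint (\<lambda>s. w s \<bullet> e)" for e by (rule locint_inner[OF wm ws])
  have ge: "g t \<bullet> e = cumul (\<lambda>s. h s \<bullet> e) t" if t: "0 \<le> t" "t \<le> T" for t e
  proof -
    let ?q = "\<lambda>s. h s \<bullet> e"
    define G where "G t = g t \<bullet> e - cumul ?q t" for t
    have "G t = G 0"
    proof (rule du_Bois_Reymond[OF T _ _ t])
      show "continuous_on {0..T} G"
        unfolding G_def by (intro continuous_intros gc continuous_on_subset[OF continuous_cumul[OF he]]) auto
      fix \<psi> assume \<psi>: "test_function T \<psi>"
      note P = test_functionD[OF \<psi>]
      have cL: "L2_on T (cumul ?q)" by (rule L2_on_continuous[OF continuous_cumul[OF he]])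
      \<comment> \<open>The primitive is real valued; the pairing with e = 1 is multiplication by
        1.\<close>
      note i2 = bochner_pairing(2)[OF cL P(2), of 1] and i1 = bochner_pairing(2)[OF gL P(2), of e]
      have e: "indicator {0<..<T} t * (deriv \<psi> t * G t) = indicator {0<..<T} t * (deriv \<psi> t * (g t \<bullet> e)) - indicator
          {0<..<T} t * (deriv \<psi> t * cumul ?q t)" for t
        by (simp add: G_def algebra_simps)
      have "(\<integral>t. indicator {0<..<T} t * (deriv \<psi> t * G t) \<partial>lebesgue) =
          (\<integral>t. indicator {0<..<T} t * (deriv \<psi> t * (g t \<bullet> e)) \<partial>lebesgue) - (\<integral>t. indicator
              {0<..<T} t * (deriv \<psi> t * cumul ?q t) \<partial>lebesgue)"
        unfolding e by (rule Bochner_Integration.integral_diff[OF i1]) (use i2 in simp)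
      also have "\<dots> = - (\<integral>t. indicator {0<..<T} t * (\<psi> t * (g' t \<bullet> e)) \<partial>lebesgue) + (\<integral>t.
          indicator {0<..<T} t * (\<psi> t * ?q t) \<partial>lebesgue)"
        unfolding cumul_by_parts[OF he \<psi> T] bochner_pairing(1)[OF gL P(2), symmetric] bochner_pairing(1)[OF g'L P(3), symmetric] Wi[OF \<psi>]
        by simp
      also have "(\<lambda>t. indicator {0<..<T} t * (\<psi> t * ?q t)) = (\<lambda>t. indicator {0<..<T} t * (\<psi> t * (g' t \<bullet> e)))"
        by (auto simp: fun_eq_iff h_def indicator_def)
      finally show "(\<integral>t. indicator {0<..<T} t * (deriv \<psi> t * G t) \<partial>lebesgue) = 0" by simp
    qed
    then show ?thesis by (simp add: G_def g0 cumul_nonpos[OF he])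
  qed
  have ga: "AE t in lebesgue. t \<in> {0<..<T} \<longrightarrow> g t = conv k (\<lambda>s. v s - u0) t" using g by (simp only: AE_lebesgue_on[OF S])
  have "conv k (\<lambda>s. v s - u0) t = conv K w t" if "t \<in> {0<..<T}" for t
    unfolding conv_def using that by (intro bochner_int_cong) (auto simp: K_def w_def)
  with ga have gw: "AE t in lebesgue. t \<in> {0<..<T} \<longrightarrow> g t = conv K w t" by (simp cong: imp_cong)
  have cw: "AE t in lebesgue. rconv_integrable K (\<lambda>s. norm (w s)) t \<and> (\<forall>e. conv K w t \<bullet> e = rconv K
      (\<lambda>s. w s \<bullet> e) t)"
    by (rule conv_strongly_measurable(2)[OF k wm w0 wn])
  have ch: "AE t in lebesgue. rconv_integrable L (\<lambda>s. norm (h s)) t \<and> (\<forall>e. conv L h t \<bullet> e = rconv L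
      (\<lambda>s. h s \<bullet> e) t)"
    by (rule conv_strongly_measurable(2)[OF l hm h0 hn])
  have Ke: "AE t in lebesgue. t < T \<longrightarrow> rconv K (\<lambda>s. w s \<bullet> e) t = cumul (\<lambda>s. h s \<bullet> e) t" for e
    using gw cw
  proof eventually_elim
    case (elim t)
    show ?case
    proof
      assume t: "t < T"
      show "rconv K (\<lambda>s. w s \<bullet> e) t = cumul (\<lambda>s. h s \<bullet> e) t"
      proof (cases "t \<le> 0")
        case True
        then show ?thesis using locint_nonpos[OF rconv_kernel_integrable_AE(2)[OF k we]] cumul_nonpos[OF he] by metis
      next
        case False
        then have "g t = conv K w t" using elim t by simp
        then show ?thesis using elim(2) ge[of t e] False t by simp
      qed
    qed
  qed
  \<comment> \<open>The identity for the convolution with \<open>K\<close> holds almost everywhere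
    before \<open>T\<close> only. Since \<open>L\<close> vanishes at nonpositive arguments, nothing
    else is used, even for t = T.\<close>
  have z: "cumul (\<lambda>s. w s \<bullet> e - rconv L (\<lambda>s. h s \<bullet> e) s) t = 0" if t: "t \<le> T" for e t
  proof -
    note Lb[measurable]
    have [measurable]: "(\<lambda>s. L (t - s)) \<in> borel_measurable lebesgue" by (rule borel_imp_lebesgue) measurable
    have [measurable]: "rconv K (\<lambda>s. w s \<bullet> e) \<in> borel_measurable lebesgue" "cumul (\<lambda>s. h s \<bullet> e) \<in>
        borel_measurable lebesgue"
      by (intro rconv_measurable Kb locint_measurable[OF we]) (rule cumul_measurable[OF he])
    have "cumul (\<lambda>s. w s \<bullet> e) t = rconv L (rconv K (\<lambda>s. w s \<bullet> e)) t" by (rule sym.rconv_k_rconv_l(1)[OF we,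
        symmetric])
    also have "\<dots> = rconv L (cumul (\<lambda>s. h s \<bullet> e)) t"
      unfolding rconv_def[of L]
    proof (rule integral_cong_AE)
      show "AE s in lebesgue. L (t - s) * rconv K (\<lambda>s. w s \<bullet> e) s = L (t - s) * cumul (\<lambda>s. h s \<bullet> e) s"
        using Ke[of e]
      proof eventually_elim
        case (elim s)
        show ?case
        proof (cases "s < t")
          case True then show ?thesis using elim t by simp
        next
          case False then show ?thesis using mono_kernelD(5)[OF l, of "t - s"] by simp
        qed
      qed
    qed measurable
    also have "\<dots> = cumul (rconv L (\<lambda>s. h s \<bullet> e)) t" by (rule cumul_rconv(1)[OF l he, symmetric])
    finally show ?thesis using cumul_minus[OF we rconv_kernel_integrable_AE(2)[OF l he]] by simp
  qed
  have "AE s in lebesgue. s < T \<longrightarrow> w s - conv L h s = 0"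
  proof (rule AE_zero_from_inner)
    show "strongly_measurable lebesgue (\<lambda>s. w s - conv L h s)"
      by (intro strongly_measurable_diff wm conv_strongly_measurable(1)[OF l hm h0 hn])
    show "AE s in lebesgue. s < T \<longrightarrow> (w s - conv L h s) \<bullet> e = 0" for e
    proof -
      have "AE s in lebesgue. s < T \<longrightarrow> w s \<bullet> e - rconv L (\<lambda>s. h s \<bullet> e) s = 0"
        by (rule cumul_zero_imp_AE[OF locint_diff[OF we rconv_kernel_integrable_AE(2)[OF l he]] z])
      with ch show ?thesis by eventually_elim (simp add: inner_diff_left)
    qed
  qed
  moreover have "AE t in lebesgue. t \<in> {0<..<T} \<longrightarrow> \<xi> t \<in> subdiff \<phi> (v t) \<and> g' t + \<xi> t + B (v t) = f t"
    using eq by (simp only: AE_lebesgue_on[OF S])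
  ultimately have "AE s in lebesgue. 0 < s \<and> s < T \<longrightarrow> v s - u0 = conv L h s \<and> f s - h s - B (v s) \<in> subdiff \<phi> (v s)"
  proof eventually_elim
    case (elim s)
    show ?case
    proof
      assume s: "0 < s \<and> s < T"
      then have "\<xi> s = f s - h s - B (v s)" using elim(2) by (auto simp: h_def algebra_simps)
      then show "v s - u0 = conv L h s \<and> f s - h s - B (v s) \<in> subdiff \<phi> (v s)" using elim s by (simp add: w_def)
    qed
  qed
  then show ?thesis using hm hs unfolding L_def by (intro exI[of _ h] conjI) (auto simp: h_def cut_def)
qed

section \<open>Uniqueness\<close>

lemma locint_bound_AE:
  assumes v: "locint v" and w: "w \<in> borel_measurable lebesgue" and w0: "\<And>s. s \<le> 0 \<Longrightarrow> w s = 0"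
    and le: "AE s in lebesgue. \<bar>w s\<bar> \<le> v s"
  shows "locint w"
  unfolding locint_def
proof (intro conjI allI impI w w0)
  fix T show "integrable lebesgue (\<lambda>s. indicator {..<T} s * w s)"
  proof (rule Bochner_Integration.integrable_bound[OF locint_integrable[OF v, of T]])
    show "(\<lambda>s. indicator {..<T} s * w s) \<in> borel_measurable lebesgue" using w by measurable
    show "AE s in lebesgue. norm (indicator {..<T} s * w s) \<le> norm (indicator {..<T} s * v s)"
      using le by eventually_elim (auto simp: indicator_def)
  qed
qed

text \<open>For \<open>h\<close> merely square integrable on (0,T), the domination condition of the
  convexity inequality is available only almost everywhere: Young's inequality bounds |h| times the
  convolution of \<open>l\<close> with |h| by a locally integrable function, whose convolution with
  \<open>l\<close> is finite at almost every time.\<close>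

lemma (in conj_kernels) half_norm_sq_ineq:
  fixes h :: "real \<Rightarrow> 'h::{real_inner,banach}"
  assumes h: "strongly_measurable lebesgue h" and h0: "\<And>s. s \<notin> {0<..<T} \<Longrightarrow> h s = 0"
    and hs: "locint (norm_sq h)"
  shows "AE t in lebesgue. (norm (conv l h t))\<^sup>2 / 2 \<le> rconv l (\<lambda>s. h s \<bullet> conv l h s) t \<and>
    rconv_integrable l (\<lambda>s. h s \<bullet> conv l h s) t"
proof -
  note L = mono_kernelD[OF l]
  have hz: "h s = 0" if "s \<le> 0" for s using h0 that by simp
  have hn: "locint (\<lambda>s. norm (h s))" by (rule locint_norm[OF h hs])
  have ch: "AE t in lebesgue. rconv_integrable l (\<lambda>s. norm (h s)) t \<and> (\<forall>e. conv l h t \<bullet> e = rconv l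
      (\<lambda>s. h s \<bullet> e) t)"
    by (rule conv_strongly_measurable(2)[OF l h hz hn])
  let ?Q = "rconv l (\<lambda>s. norm (h s))"
  have "locint (\<lambda>s. norm (h s) * ?Q s)"
  proof (rule locint_bound_AE)
    show "locint (\<lambda>s. cumul l T / 2 * (norm (h s))\<^sup>2 + 1 / 2 * rconv l (norm_sq h) s)"
      by (intro locint_add locint_cmult hs rconv_kernel_integrable_AE(2) l)
    show "(\<lambda>s. norm (h s) * ?Q s) \<in> borel_measurable lebesgue"
      by (intro borel_measurable_times rconv_measurable L strongly_measurable_norm h)
    show "norm (h s) * ?Q s = 0" if "s \<le> 0" for s using hz[OF that] by simp
    show "AE s in lebesgue. \<bar>norm (h s) * ?Q s\<bar> \<le> cumul l T / 2 * (norm (h s))\<^sup>2 + 1 / 2 * rconv l (norm_sq h) s"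
      using ch rconv_kernel_integrable_AE(1)[OF l hs]
    proof eventually_elim
      case (elim s)
      have Q0: "0 \<le> ?Q s" and R0: "0 \<le> rconv l (norm_sq h) s" by (intro rconv_nonneg l; simp)+
      show ?case
      proof (cases "s \<in> {0<..<T}")
        case False then show ?thesis using h0[OF False] R0 by simp
      next
        case True
        have ih: "rconv_integrable l (\<lambda>r. (norm (h s))\<^sup>2 / 2 * heaviside r) s"
          by (intro integrable_kernel_cmult integrable_kernel_heaviside l)
        have i2: "rconv_integrable l (\<lambda>r. 1 / 2 * (norm (h r))\<^sup>2) s" by (rule integrable_kernel_cmult[OF elim(2)])
        have "norm (h s) * ?Q s = rconv l (\<lambda>r. norm (h s) * norm (h r)) s" by (simp add: rconv_cmult)
        also have "\<dots> \<le> rconv l (\<lambda>r. (norm (h s))\<^sup>2 / 2 * heaviside r + 1 / 2 * (norm (h r))\<^sup>2) s"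
        proof (rule rconv_mono[OF l])
          show "rconv_integrable l (\<lambda>r. norm (h s) * norm (h r)) s"
            using elim(1) by (intro integrable_kernel_cmult) simp
          show "rconv_integrable l (\<lambda>r. (norm (h s))\<^sup>2 / 2 * heaviside r + 1 / 2 * (norm (h r))\<^sup>2) s"
            by (rule integrable_kernel_add[OF ih i2])
          fix r
          show "norm (h s) * norm (h r) \<le> (norm (h s))\<^sup>2 / 2 * heaviside r + 1 / 2 * (norm (h r))\<^sup>2"
          proof (cases "r \<le> 0")
            case True then show ?thesis using hz[OF True] by simp
          next
            case False
            have "0 \<le> (norm (h s) - norm (h r))\<^sup>2" by simp
            then show ?thesis using False by (simp add: power2_diff)
          qed
        qed
        also have "\<dots> = (norm (h s))\<^sup>2 / 2 * cumul l s + 1 / 2 * rconv l (norm_sq h) s"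
          by (simp only: rconv_add[OF ih i2] rconv_cmult rconv_heaviside)
        also have "(norm (h s))\<^sup>2 / 2 * cumul l s \<le> (norm (h s))\<^sup>2 / 2 * cumul l T"
          using True L by (intro mult_left_mono cumul_mono) auto
        finally show ?thesis using Q0 by (simp add: mult.commute)
      qed
    qed
  qed
  from rconv_kernel_integrable_AE(1)[OF l this] ch show ?thesis
  proof eventually_elim
    case (elim t)
    have it: "rconv_integrable l (\<lambda>s. norm (h s)) t" and ct: "\<And>e. conv l h t \<bullet> e = rconv l (\<lambda>s. h s \<bullet> e) t"
      using elim(2) by auto
    have z: "(norm (0::'h))\<^sup>2 / 2 = 0" by simp
    show ?case
      using convex_ineq[OF smooth_convex_half_norm_sq z h _ it ct ch elim(1)] hz by blast
  qed
qed

text \<open>Both solutions are in Volterra form with derivatives \<open>h1\<close> and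
  \<open>h2\<close>. Monotonicity of the subdifferential leaves only the Lipschitz term in the
  pairing of \<open>h1 - h2\<close> with the difference of the solutions, and the convexity
  inequality becomes a homogeneous Volterra inequality.\<close>

lemma strong_solution_unique:
  fixes v1 v2 :: "real \<Rightarrow> 'h::{real_inner,banach}"
  assumes \<phi>: "convex_lsc \<phi>" and cK: "condition_K k l" and B: "LB-lipschitz_on UNIV B" and T: "0 < T"
    and v1: "strong_solution \<phi> k B f u0 T v1" and v2: "strong_solution \<phi> k B f u0 T v2"
  shows "AE t in lebesgue. 0 < t \<and> t < T \<longrightarrow> v1 t = v2 t"
proof -
  define L where "L = zext l"
  interpret conj_kernels "zext k" L unfolding L_def by (rule conj_kernels_zext[OF cK])
  interpret convex_lsc \<phi> by (rule \<phi>)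
  note Lk = mono_kernelD[OF l]
  have LB: "0 \<le> LB" and BL: "\<And>x y. norm (B x - B y) \<le> LB * norm (x - y)"
    using B by (auto simp: lipschitz_on_def dist_norm)
  obtain h1 where h1: "strongly_measurable lebesgue h1" "\<forall>s. s \<notin> {0<..<T} \<longrightarrow> h1 s = 0" "locint (norm_sq h1)"
    "AE s in lebesgue. 0 < s \<and> s < T \<longrightarrow> v1 s - u0 = conv L h1 s \<and> f s - h1 s - B (v1 s) \<in> subdiff \<phi> (v1 s)"
    using strong_solution_volterra[OF cK v1 T, folded L_def] by (elim exE conjE) (rule that; assumption)
  obtain h2 where h2: "strongly_measurable lebesgue h2" "\<forall>s. s \<notin> {0<..<T} \<longrightarrow> h2 s = 0" "locint (norm_sq h2)"
    "AE s in lebesgue. 0 < s \<and> s < T \<longrightarrow> v2 s - u0 = conv L h2 s \<and> f s - h2 s - B (v2 s) \<in> subdiff \<phi> (v2 s)"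
    using strong_solution_volterra[OF cK v2 T, folded L_def] by (elim exE conjE) (rule that; assumption)
  define h where "h s = h1 s - h2 s" for s
  define d where "d = conv L h"
  \<comment> \<open>Defined from the solutions rather than from \<open>d\<close>, so that local
    integrability comes directly from their square integrability.\<close>
  define y where "y s = (norm (cut T v1 s - cut T v2 s))\<^sup>2" for s
  have hm: "strongly_measurable lebesgue h" unfolding h_def by (intro strongly_measurable_diff h1 h2)
  have hs: "locint (norm_sq h)" unfolding h_def by (intro locint_sq_diff h1 h2)
  have h0: "h s = 0" if "s \<notin> {0<..<T}" for s using h1(2) h2(2) that by (simp add: h_def)
  have z: "h1 s = 0" "h2 s = 0" "h s = 0" if "s \<le> 0" for s using h1(2) h2(2) h0 that by auto
  have c1: "AE t in lebesgue. rconv_integrable L (\<lambda>s. norm (h1 s)) t \<and> (\<forall>e. conv L h1 t \<bullet> e = rconv L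
      (\<lambda>s. h1 s \<bullet> e) t)"
    by (rule conv_strongly_measurable(2)[OF l h1(1) z(1) locint_norm[OF h1(1,3)]])
  have c2: "AE t in lebesgue. rconv_integrable L (\<lambda>s. norm (h2 s)) t \<and> (\<forall>e. conv L h2 t \<bullet> e = rconv L
      (\<lambda>s. h2 s \<bullet> e) t)"
    by (rule conv_strongly_measurable(2)[OF l h2(1) z(2) locint_norm[OF h2(1,3)]])
  have c: "AE t in lebesgue. rconv_integrable L (\<lambda>s. norm (h s)) t \<and> (\<forall>e. conv L h t \<bullet> e = rconv L
      (\<lambda>s. h s \<bullet> e) t)"
    by (rule conv_strongly_measurable(2)[OF l hm z(3) locint_norm[OF hm hs]])
  have y: "locint y" unfolding y_def
    using v1 v2 by (intro locint_sq_diff locint_cut) (auto simp: strong_solution_def L2_on_cut)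
  have y0: "0 \<le> y s" for s by (simp add: y_def)
  have dv: "AE s in lebesgue. s \<in> {0<..<T} \<longrightarrow> (norm (d s))\<^sup>2 = y s \<and> h s \<bullet> d s \<le> LB * y s"
    using c1 c2 c h1(4) h2(4)
  proof eventually_elim
    case (elim s)
    show ?case
    proof
      assume s: "s \<in> {0<..<T}"
      have "d s \<bullet> e = (conv L h1 s - conv L h2 s) \<bullet> e" for e
      proof -
        have "rconv L (\<lambda>r. h1 r \<bullet> e - h2 r \<bullet> e) s = rconv L (\<lambda>r. h1 r \<bullet> e) s - rconv L (\<lambda>r.
            h2 r \<bullet> e) s"
          using elim(1,2) by (intro rconv_diff rconv_inner_integrable l h1 h2) auto
        then show ?thesis using elim(1-3) by (simp add: d_def h_def inner_diff_left)
      qed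
      then have "d s = conv L h1 s - conv L h2 s" using vector_eq_rdot by blast
      moreover have 1: "v1 s - u0 = conv L h1 s" "f s - h1 s - B (v1 s) \<in> subdiff \<phi> (v1 s)"
        and 2: "v2 s - u0 = conv L h2 s" "f s - h2 s - B (v2 s) \<in> subdiff \<phi> (v2 s)" using elim(4,5) s by auto
      ultimately have d: "d s = v1 s - v2 s" by (metis diff_add_cancel add_diff_cancel_right)
      have ys: "(norm (d s))\<^sup>2 = y s" using s by (simp add: y_def d)
      have "R (v1 s) + (f s - h1 s - B (v1 s)) \<bullet> (v2 s - v1 s) \<le> R (v2 s)"
        "R (v2 s) + (f s - h2 s - B (v2 s)) \<bullet> (v1 s - v2 s) \<le> R (v1 s)"
        using 1(2) 2(2) by (auto simp: subdiff_iff)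
      then have "h s \<bullet> d s \<le> - ((B (v1 s) - B (v2 s)) \<bullet> d s)"
        by (simp add: d h_def inner_diff_left inner_diff_right)
      also have "\<dots> \<le> norm (B (v1 s) - B (v2 s)) * norm (d s)" using Cauchy_Schwarz_ineq2[of "B (v1 s) - B (v2 s)" "d s"] by linarith
      also have "\<dots> \<le> LB * norm (d s) * norm (d s)" unfolding d by (intro mult_right_mono BL) simp
      finally show "(norm (d s))\<^sup>2 = y s \<and> h s \<bullet> d s \<le> LB * y s" using ys by (simp add: power2_eq_square mult.assoc)
    qed
  qed
  have hd: "AE s in lebesgue. h s \<bullet> d s \<le> LB * y s"
    using dv by eventually_elim (use h0 LB y0 in \<open>force\<close>)
  have hd2: "AE t in lebesgue. (norm (conv L h t))\<^sup>2 / 2 \<le> rconv L (\<lambda>s. h s \<bullet> conv L h s) t \<and>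
      rconv_integrable L (\<lambda>s. h s \<bullet> conv L h s) t"
    by (rule half_norm_sq_ineq[OF hm h0 hs])
  have yle: "AE t in lebesgue. y t \<le> (2 * LB) * rconv L y t"
    using dv hd2 rconv_kernel_integrable_AE(1)[OF l y]
  proof eventually_elim
    case (elim t)
    show ?case
    proof (cases "t \<in> {0<..<T}")
      case False
      then have "y t = 0" by (auto simp: y_def cut_def)
      then show ?thesis using LB l y0 rconv_nonneg[of L y t] by simp
    next
      case True
      have "(norm (d t))\<^sup>2 / 2 \<le> rconv L (\<lambda>s. h s \<bullet> d s) t" using elim(2) by (simp add: d_def)
      also have "\<dots> \<le> rconv L (\<lambda>s. LB * y s) t"
        unfolding rconv_def
      proof (rule integral_mono_AE)
        show "rconv_integrable L (\<lambda>s. h s \<bullet> d s) t" using elim(2) by (simp add: d_def)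
        show "rconv_integrable L (\<lambda>s. LB * y s) t" by (rule integrable_kernel_cmult[OF elim(3)])
        show "AE s in lebesgue. L (t - s) * (h s \<bullet> d s) \<le> L (t - s) * (LB * y s)"
          using hd by eventually_elim (rule mult_left_mono[OF _ Lk(3)])
      qed
      finally show ?thesis using elim(1) True by (simp add: rconv_cmult)
    qed
  qed
  \<comment> \<open>The inequality for \<open>y\<close> holds only almost everywhere and
    \<open>y\<close> may be unbounded. Its primitive satisfies the same inequality at every time and
    is locally bounded, as Gronwall's inequality demands.\<close>
  have Y: "cumul y t \<le> 0 + (2 * LB) * rconv L (cumul y) t" for t
  proof -
    have ly: "locint (\<lambda>s. (2 * LB) * rconv L y s)" by (intro locint_cmult rconv_kernel_integrable_AE(2)[OF l y])
    have "cumul y t \<le> cumul (\<lambda>s. (2 * LB) * rconv L y s) t"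
      unfolding cumul_def
    proof (rule integral_mono_AE[OF locint_integrable[OF y] locint_integrable[OF ly]])
      show "AE s in lebesgue. indicator {..<t} s * y s \<le> indicator {..<t} s * (2 * LB * rconv L y s)"
        using yle by eventually_elim (auto simp: indicator_def)
    qed
    also have "\<dots> = (2 * LB) * rconv L (cumul y) t"
      unfolding cumul_rconv(1)[OF l y, symmetric] cumul_eq_rconv rconv_cmult ..
    finally show ?thesis by simp
  qed
  have LB2: "0 \<le> 2 * LB" using LB by simp
  \<comment> \<open>The horizon T + 1 makes the strict bound on time cover t = T.\<close>
  obtain E where E: "\<And>z b t. volterra_subsolution L (2 * LB) (T + 1) b z \<Longrightarrow> t < T + 1 \<Longrightarrow> z t \<le> E * b"
    using volterra_gronwall[OF l LB2, of "T + 1"] by blast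
  have "\<exists>Z. \<forall>s<T + 1. cumul y s \<le> Z" using cumul_mono[OF y y0] by (intro exI[of _ "cumul y (T + 1)"]) simp
  then have sub: "volterra_subsolution L (2 * LB) (T + 1) 0 (cumul y)"
    using Y y0 cumul_nonneg[of y] cumul_nonpos[OF y] cumul_measurable[OF y] by (simp add: volterra_subsolution_def)
  have Y0: "cumul y t = 0" if "t \<le> T" for t
  proof -
    have "cumul y t \<le> E * 0" by (rule E[OF sub]) (use that in simp)
    then show ?thesis using y0 cumul_nonneg[of y t] by simp
  qed
  have "AE s in lebesgue. s < T \<longrightarrow> y s = 0" by (rule cumul_zero_imp_AE[OF y Y0])
  then show ?thesis by eventually_elim (auto simp: y_def)
qed

section \<open>Existence\<close>

text \<open>The bound on \<open>l * |f|\<^sup>2\<close> holds only almost everywhere. As \<open>l\<close> is nonincreasing, Fatou's lemma along times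
  increasing to \<open>t0\<close> extends it to every time.\<close>

lemma rconv_at_endpoint:
  assumes l: "mono_kernel l" and y: "locint y" and y0: "\<And>s. 0 \<le> y s" and C: "0 \<le> C"
    and bound: "AE t in lebesgue. 0 < t \<and> t < T \<longrightarrow> rconv l y t \<le> C" and t0: "0 < t0" "t0 \<le> T"
  shows "rconv_integrable l y t0" "rconv l y t0 \<le> C"
proof -
  note L = mono_kernelD[OF l]
  note L(2)[measurable] locint_measurable[OF y, measurable]
  have ml [measurable]: "(\<lambda>s. l (r - s)) \<in> borel_measurable lebesgue" for r by (rule borel_imp_lebesgue) measurable
  have good: "AE t in lebesgue. 0 < t \<and> t < T \<longrightarrow> rconv_integrable l y t \<and> rconv l y t \<le> C"
    using bound rconv_kernel_integrable_AE(1)[OF l y] by eventually_elim auto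
  then obtain N where N: "N \<in> null_sets lebesgue"
    and Ng: "\<And>t. t \<notin> N \<Longrightarrow> 0 < t \<and> t < T \<Longrightarrow> rconv_integrable l y t \<and> rconv l y t \<le> C"
    by (auto elim!: AE_E3)
  \<comment> \<open>Otherwise an interval of positive length would be contained in the null
    set.\<close>
  have "\<exists>t. max 0 (t0 - 1 / real (Suc n)) < t \<and> t < t0 \<and> t \<notin> N" for n
  proof (rule ccontr)
    let ?a = "max 0 (t0 - 1 / real (Suc n))"
    assume "\<nexists>t. ?a < t \<and> t < t0 \<and> t \<notin> N"
    then have "{?a<..<t0} \<subseteq> N" by auto
    then have "{?a<..<t0} \<in> null_sets lebesgue" using null_sets_subset[OF N] by simp
    moreover have "?a < t0" using t0 by simp
    ultimately show False by (auto simp: null_sets_def)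
  qed
  then obtain \<tau> where \<tau>: "\<And>n. max 0 (t0 - 1 / real (Suc n)) < \<tau> n" "\<And>n. \<tau> n < t0" "\<And>n. \<tau> n \<notin>
      N" by metis
  have \<tau>lim: "\<tau> \<longlonglongrightarrow> t0"
  proof (rule real_tendsto_sandwich[of "\<lambda>n. t0 - 1 / real (Suc n)" _ _ "\<lambda>n. t0"])
    show "(\<lambda>n. t0 - 1 / real (Suc n)) \<longlonglongrightarrow> t0"
      using tendsto_diff[OF tendsto_const LIMSEQ_Suc[OF lim_1_over_n], of t0] by simp
    show "\<forall>\<^sub>F n in sequentially. t0 - 1 / real (Suc n) \<le> \<tau> n" "\<forall>\<^sub>F n in sequentially. \<tau> n \<le> t0"
      using \<tau> by (auto intro!: always_eventually less_imp_le simp: less_max_iff_disj max_less_iff_conj)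
  qed simp
  define F where "F n s = ennreal (indicator {..<\<tau> n} s * (l (t0 - s) * y s))" for n s
  have F: "(\<integral>\<^sup>+s. F n s \<partial>lebesgue) \<le> ennreal C" for n
  proof -
    have i: "rconv_integrable l y (\<tau> n)" and b: "rconv l y (\<tau> n) \<le> C"
      using Ng[OF \<tau>(3)[of n]] \<tau>(1,2)[of n] t0 by auto
    have "F n s \<le> ennreal (l (\<tau> n - s) * y s)" for s
      unfolding F_def using L(4)[of "\<tau> n - s" "t0 - s"] \<tau>(2)[of n] y0[of s] L(3)
      by (intro ennreal_leI) (auto simp: indicator_def intro!: mult_right_mono)
    then have "(\<integral>\<^sup>+s. F n s \<partial>lebesgue) \<le> (\<integral>\<^sup>+s. ennreal (l (\<tau> n - s) * y s)
        \<partial>lebesgue)" by (intro nn_integral_mono)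
    also have "\<dots> = ennreal (rconv l y (\<tau> n))"
      unfolding rconv_def by (rule nn_integral_eq_integral[OF i]) (use L(3) y0 in auto)
    finally show ?thesis using b by (meson ennreal_leI order_trans)
  qed
  have "(\<lambda>n. F n s) \<longlonglongrightarrow> ennreal (l (t0 - s) * y s)" for s
  proof (cases "s < t0")
    case True
    then have "\<forall>\<^sub>F n in sequentially. s < \<tau> n" by (rule order_tendstoD(1)[OF \<tau>lim])
    then have "\<forall>\<^sub>F n in sequentially. F n s = ennreal (l (t0 - s) * y s)" by eventually_elim (simp add: F_def)
    then show ?thesis by (rule tendsto_eventually)
  next
    case False
    then have "F n s = ennreal (l (t0 - s) * y s)" for n using L(5)[of "t0 - s"] by (simp add: F_def)
    then show ?thesis by simp
  qed
  then have lim: "liminf (\<lambda>n. F n s) = ennreal (l (t0 - s) * y s)" for s by (intro lim_imp_Liminf) auto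
  have "(\<integral>\<^sup>+s. ennreal (l (t0 - s) * y s) \<partial>lebesgue) = (\<integral>\<^sup>+s. liminf (\<lambda>n. F n s)
      \<partial>lebesgue)" by (simp add: lim)
  also have "\<dots> \<le> liminf (\<lambda>n. \<integral>\<^sup>+s. F n s \<partial>lebesgue)"
    unfolding F_def by (rule nn_integral_liminf) measurable
  also have "\<dots> \<le> ennreal C" using F by (intro Liminf_le) auto
  finally have le: "(\<integral>\<^sup>+s. ennreal (l (t0 - s) * y s) \<partial>lebesgue) \<le> ennreal C" .
  show i: "rconv_integrable l y t0"
  proof (rule integrableI_nonneg)
    show "AE s in lebesgue. 0 \<le> l (t0 - s) * y s" using L(3) y0 by simp
    show "(\<integral>\<^sup>+s. ennreal (l (t0 - s) * y s) \<partial>lebesgue) < \<infinity>" using le by (auto simp: order.strict_trans1)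
  qed measurable
  have "ennreal (rconv l y t0) \<le> ennreal C"
    using le unfolding rconv_def by (subst nn_integral_eq_integral[OF i, symmetric]) (use L(3) y0 in auto)
  then show "rconv l y t0 \<le> C" using C by (simp add: ennreal_le_iff)
qed

text \<open>Beyond \<open>T\<close> the cut function vanishes, and shifting the nonincreasing kernel
  further only lowers its values, so the bound at \<open>T\<close> persists for all later times. The
  problem on [0,T] thereby becomes one on the half-line.\<close>

lemma conv_sq_bounded_cut:
  fixes f :: "real \<Rightarrow> 'h::real_normed_vector"
  assumes l: "mono_kernel (zext l)" and f: "L2_on T f" and T: "0 < T"
    and b: "Linf_on T (\<lambda>t. ereal (conv l (norm_sq f) t))"
  shows "conv_sq_bounded (zext l) (cut T f)"
proof -
  note L = mono_kernelD[OF l]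
  define y where "y s = (norm (cut T f s))\<^sup>2" for s
  have y: "locint y" unfolding y_def by (rule locint_cut[OF f])
  have y0: "0 \<le> y s" for s by (simp add: y_def)
  have yT: "y s = 0" if "T \<le> s" for s using that by (simp add: y_def)
  obtain C where C: "AE t in lebesgue_on {0<..<T}. \<bar>ereal (conv l (norm_sq f) t)\<bar> \<le> ereal C"
    using b by (auto simp: Linf_on_def)
  have eq: "conv l (norm_sq f) t = rconv (zext l) y t" if "t < T" for t
    unfolding conv_real rconv_def using that
    by (intro Bochner_Integration.integral_cong) (auto simp: zext_def y_def cut_def)
  have "AE t in lebesgue. 0 < t \<and> t < T \<longrightarrow> rconv (zext l) y t \<le> max C 0"
    using C[unfolded AE_lebesgue_on[of "{0<..<T}", simplified]] by eventually_elim (auto simp: eq le_max_iff_disj)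
  note E = rconv_at_endpoint[OF l y y0 _ this]
  have "rconv_integrable (zext l) y t \<and> rconv (zext l) y t \<le> max C 0" for t
  proof -
    consider "t \<le> 0" | "0 < t" "t \<le> T" | "T < t" by linarith
    then show ?thesis
    proof cases
      case 1
      then have "(\<lambda>s. zext l (t - s) * y s) = (\<lambda>s. 0)" using locint_nonpos[OF y] by (auto simp: zext_def fun_eq_iff)
      then show ?thesis by (simp add: rconv_def)
    next
      case 2 then show ?thesis using E[of t] by simp
    next
      case 3
      have le: "zext l (t - s) * y s \<le> zext l (T - s) * y s" for s
        using L(4)[of "T - s" "t - s"] yT[of s] y0[of s] 3 by (cases "s < T") (auto intro: mult_right_mono)
      have iT: "rconv_integrable (zext l) y T" and bT: "rconv (zext l) y T \<le> max C 0" using E[of T] T by auto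
      have i: "rconv_integrable (zext l) y t"
      proof (rule Bochner_Integration.integrable_bound[OF iT])
        note L(2)[measurable] locint_measurable[OF y, measurable]
        have [measurable]: "(\<lambda>s. zext l (t - s)) \<in> borel_measurable lebesgue" by (rule borel_imp_lebesgue) measurable
        show "(\<lambda>s. zext l (t - s) * y s) \<in> borel_measurable lebesgue" by measurable
        show "AE s in lebesgue. norm (zext l (t - s) * y s) \<le> norm (zext l (T - s) * y s)"
          using le L(3) y0 by (intro AE_I2) (simp add: abs_mult)
      qed
      have "rconv (zext l) y t \<le> rconv (zext l) y T" unfolding rconv_def by (rule integral_mono[OF i iT le])
      then show ?thesis using i bT by simp
    qed
  qed
  then show ?thesis using f by (auto simp: conv_sq_bounded_def y_def[abs_def] L2_on_cut)
qed

text \<open>For times below \<open>T\<close> a convolution sees only values before \<open>T\<close>,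
  where \<open>zext f\<close> agrees with a cut function; the horizon \<open>max T 1\<close> is used
  because it must be positive.\<close>

lemma conv_sq_bounded_zext:
  fixes f :: "real \<Rightarrow> 'h::real_normed_vector"
  assumes l: "mono_kernel (zext l)" and f: "L2_loc f" and b: "Linf_loc (\<lambda>t. ereal (conv l (norm_sq f) t))"
  shows "conv_sq_bounded (zext l) (zext f)" and "locint (norm_sq (zext f))"
proof -
  have fT: "L2_on T f" if "0 < T" for T using f that by (simp add: L2_loc_def)
  have m: "strongly_measurable lebesgue (zext f)"
  proof (rule strongly_measurable_AE_lim)
    show "strongly_measurable lebesgue (cut (real (Suc n)) f)" for n using fT[of "real (Suc n)"] by (simp add: L2_on_cut)
    have "(\<lambda>n. cut (real (Suc n)) f t) \<longlonglongrightarrow> zext f t" for t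
    proof -
      obtain N where N: "t < real N" using reals_Archimedean2 by blast
      have "cut (real (Suc n)) f t = zext f t" if "n \<ge> N" for n using that N by (auto simp: cut_def zext_def)
      then show ?thesis by (intro tendsto_eventually) (auto simp: eventually_sequentially)
    qed
    then show "AE t in lebesgue. (\<lambda>n. cut (real (Suc n)) f t) \<longlonglongrightarrow> zext f t" by simp
  qed
  have ez: "zext f s = cut T f s" if "s < T" for s T using that by (auto simp: zext_def cut_def)
  show "conv_sq_bounded (zext l) (zext f)"
    unfolding conv_sq_bounded_def
  proof (intro conjI allI impI m)
    fix T :: real
    define T' where "T' = max T 1"
    have T': "0 < T'" "T \<le> T'" by (auto simp: T'_def)
    have c: "conv_sq_bounded (zext l) (cut T' f)"
      using b T' by (intro conv_sq_bounded_cut l fT) (auto simp: Linf_loc_def)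
    have e: "(\<lambda>s. zext l (t - s) * (norm (zext f s))\<^sup>2) = (\<lambda>s. zext l (t - s) * (norm (cut T' f s))\<^sup>2)" if "t < T" for t
      using that T' ez by (auto simp: fun_eq_iff zext_def cut_def)
    obtain C where "0 \<le> C" "\<forall>t<T. rconv (zext l) (norm_sq (cut T' f)) t \<le> C" using conv_sq_boundedD(4)[OF c] by blast
    then show "\<exists>C. \<forall>t<T. rconv_integrable (zext l) (norm_sq (zext f)) t \<and> rconv (zext l) (norm_sq (zext f)) t \<le> C"
      using conv_sq_boundedD(3)[OF c] by (intro exI[of _ C]) (simp add: rconv_def e)
  qed simp
  show "locint (norm_sq (zext f))"
    unfolding locint_def
  proof (intro conjI allI impI)
    show "(norm_sq (zext f)) \<in> borel_measurable lebesgue" using strongly_measurable_norm[OF m] by measurable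
    fix T :: real
    define T' where "T' = max T 1"
    have "(\<lambda>s. indicator {..<T} s * (norm (zext f s))\<^sup>2) = (\<lambda>s. indicator {..<T} s * (norm (cut T' f s))\<^sup>2)"
      using ez[of _ T'] by (auto simp: indicator_def T'_def fun_eq_iff)
    moreover have "0 < T'" by (simp add: T'_def)
    ultimately show "integrable lebesgue (\<lambda>s. indicator {..<T} s * (norm (zext f s))\<^sup>2)"
      using locint_integrable[OF locint_cut[OF fT[of T']], of T] by (simp only:)
  qed simp
qed

section \<open>From the limit to a strong solution\<close>

context evolution
begin

text \<open>Superlevel sets of a lower semicontinuous \<phi> are open, which gives measurability
  along a continuous \<open>u\<close>. The lower bound comes from the cone minorant, as
  \<open>u\<close> is bounded on bounded time intervals.\<close>

lemma Linf_on_functional: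
  assumes u: "continuous_on UNIV u" and u0t: "\<forall>t\<le>0. u t = u0" and ub: "\<exists>C. \<forall>t<T. 0 < t \<longrightarrow> \<phi>
      (u t) \<le> ereal C"
  shows "Linf_on T (\<lambda>t. \<phi> (u t))"
  unfolding Linf_on_def
proof
  have "(\<lambda>t. \<phi> (u t)) \<in> borel_measurable borel"
  proof (rule borel_measurableI_greater)
    fix c
    have "open {w. c < \<phi> w}"
    proof (subst open_subopen, intro ballI)
      fix w assume "w \<in> {w. c < \<phi> w}"
      then have "\<forall>\<^sub>F y in nhds w. c < \<phi> y" using lsc by (simp add: lsc_functional_def)
      then show "\<exists>T. open T \<and> w \<in> T \<and> T \<subseteq> {w. c < \<phi> w}"
        unfolding eventually_nhds by (elim exE conjE, intro exI conjI) auto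
    qed
    then have "open (u -` {w. c < \<phi> w})" by (rule open_vimage) (rule u)
    moreover have "u -` {w. c < \<phi> w} = {x \<in> space borel. c < \<phi> (u x)}" by auto
    ultimately show "{x \<in> space borel. c < \<phi> (u x)} \<in> sets borel" by simp
  qed
  then show "(\<lambda>t. \<phi> (u t)) \<in> borel_measurable (lebesgue_on {0<..<T})"
    by (intro measurable_restrict_space1 borel_imp_lebesgue)
  obtain C where C: "\<forall>t<T. 0 < t \<longrightarrow> \<phi> (u t) \<le> ereal C" using ub by blast
  obtain r where r: "0 < r" "\<forall>v\<in>D. R u0 - 1 - norm (v - u0) / r \<le> R v" using affine_minorant[OF u0] by blast
  have "continuous_on UNIV (\<lambda>t. u t - u0)" by (intro continuous_intros u)
  then obtain N where N: "0 \<le> N" "\<forall>s\<le>T. norm (u s - u0) \<le> N"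
    using continuous_locally_bounded[of "\<lambda>t. u t - u0" 0 T] u0t by auto
  define C' where "C' = max C (- (R u0 - 1 - N / r))"
  have "\<bar>\<phi> (u t)\<bar> \<le> ereal C'" if t: "0 < t" "t < T" for t
  proof -
    have d: "u t \<in> D" using C t by (intro D_I) auto
    have "norm (u t - u0) / r \<le> N / r" using N t r(1) by (intro divide_right_mono) auto
    moreover have "R u0 - 1 - norm (u t - u0) / r \<le> R (u t)" using r(2) d by blast
    ultimately have "- C' \<le> R (u t)" unfolding C'_def by linarith
    moreover have "R (u t) \<le> C'" using C t \<phi>_eq[OF d] by (auto simp: C'_def le_max_iff_disj)
    ultimately show ?thesis by (simp add: \<phi>_eq[OF d] abs_le_iff)
  qed
  then show "\<exists>C. AE t in lebesgue_on {0<..<T}. \<bar>\<phi> (u t)\<bar> \<le> ereal C" by (intro exI[of _ C'] AE_I2) auto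
qed

text \<open>As \<open>u\<close> is continuous, the convolution of \<open>k\<close> with
  \<open>u - u0\<close> is itself the continuous representative demanded in the definition. The
  integrated equation shows it to be a primitive of \<open>h\<close>, and integration by parts
  identifies \<open>h\<close> as its weak derivative.\<close>

lemma evolution_strong_solution:
  assumes f2: "locint (norm_sq f)"
  shows "\<exists>u g h \<eta>. continuous_on UNIV u \<and> (\<forall>t\<le>0. u t = u0) \<and> continuous_on UNIV g \<and> g 0 = 0 \<and>
     (\<forall>t. g t = conv k (\<lambda>s. u s - u0) t) \<and>
     (\<forall>T>0. W12_on T g h \<and> L2_on T u \<and> L2_on T \<eta> \<and> Linf_on T (\<lambda>t. \<phi> (u t))) \<and>
     (AE s in lebesgue. 0 < s \<longrightarrow> \<eta> s \<in> subdiff \<phi> (u s) \<and> h s + \<eta> s + B (u s) = f s)"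
proof -
  obtain u \<eta> where u: "continuous_on UNIV u" "\<forall>t\<le>0. u t = u0" and \<eta>: "strongly_measurable lebesgue \<eta>"
     "locint (norm_sq \<eta>)" "AE s in lebesgue. 0 < s \<longrightarrow> \<eta> s \<in> subdiff \<phi> (u s)"
     and ub: "\<forall>T. \<exists>C. \<forall>t<T. 0 < t \<longrightarrow> \<phi> (u t) \<le> ereal C"
     and eq: "\<forall>t e. rconv k (\<lambda>s. (u s - u0) \<bullet> e) t = cumul (\<lambda>s. (f s - \<eta> s - zext (\<lambda>s. B (u
         s)) s) \<bullet> e) t"
    using evolution_solution[OF f2] by (elim exE conjE) (rule that; assumption)
  define h where "h s = f s - \<eta> s - zext (\<lambda>s. B (u s)) s" for s
  define g where "g = conv k (\<lambda>s. u s - u0)"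
  have cB: "continuous_on UNIV (\<lambda>s. B (u s))" by (rule continuous_on_compose2[OF continuous_B u(1)]) simp
  have zm: "strongly_measurable lebesgue (zext (\<lambda>s. B (u s)))" by (intro strongly_measurable_zext strongly_measurable_continuous cB)
  have zs: "locint (\<lambda>s. (norm (zext (\<lambda>s. B (u s)) s))\<^sup>2)"
  proof (rule locint_sq_local[OF zm])
    have "B (u t) = B u0" if "t \<le> 0" for t using u(2) that by simp
    then show "\<exists>C. \<forall>s<T. norm (zext (\<lambda>s. B (u s)) s) \<le> C" for T by (rule zext_continuous_bounded[OF cB])
  qed simp
  have fm: "strongly_measurable lebesgue f" by (rule conv_sq_boundedD(1)[OF f])
  have hm: "strongly_measurable lebesgue h" unfolding h_def by (intro strongly_measurable_diff fm \<eta>(1) zm)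
  have hs: "locint (norm_sq h)"
    unfolding h_def by (intro locint_sq_diff strongly_measurable_diff fm \<eta>(1,2) zm zs f2)
  have he: "locint (\<lambda>s. h s \<bullet> e)" for e by (rule locint_inner[OF hm hs])
  have cw: "continuous_on UNIV (\<lambda>s. u s - u0)" by (intro continuous_intros u)
  have w0: "u s - u0 = 0" if "s \<le> 0" for s using u(2) that by simp
  have wb: "\<exists>C. \<forall>s<T. norm (u s - u0) \<le> C" for T
  proof -
    obtain C where "0 \<le> C" "\<forall>s\<le>T. norm (u s - u0) \<le> C" using continuous_locally_bounded[of "\<lambda>s. u s - u0" 0 T]
        cw w0 by blast
    then show ?thesis by (intro exI[of _ C]) auto
  qed
  have gc: "continuous_on UNIV g" unfolding g_def
    by (rule conv_locally_bounded(3)[OF k strongly_measurable_continuous[OF cw] w0 wb])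
  have ge: "g t \<bullet> e = cumul (\<lambda>s. h s \<bullet> e) t" for t e
  proof -
    have "g t \<bullet> e = rconv k (\<lambda>s. (u s - u0) \<bullet> e) t"
      unfolding g_def by (rule conv_locally_bounded(2)[OF k strongly_measurable_continuous[OF cw] w0 wb])
    then show ?thesis using eq by (simp add: h_def)
  qed
  have g0: "g 0 = 0" unfolding g_def by (rule conv_nonpos[OF k strongly_measurable_continuous[OF cw] w0]) simp_all
  have gL: "L2_on T g" and hL: "L2_on T h" for T by (rule L2_on_continuous[OF gc]) (rule L2_on_locint[OF hm hs])
  have W: "W12_on T g h" if T: "0 < T" for T
    unfolding W12_on_def
  proof (intro conjI allI impI gL hL)
    fix \<psi> assume \<psi>: "test_function T \<psi>"
    note P = test_functionD[OF \<psi>]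
    have "bochner_int (lebesgue_on {0<..<T}) (\<lambda>t. deriv \<psi> t *\<^sub>R g t) \<bullet> e =
        (- bochner_int (lebesgue_on {0<..<T}) (\<lambda>t. \<psi> t *\<^sub>R h t)) \<bullet> e" for e
      using cumul_by_parts[OF he \<psi> T] by (simp add: bochner_pairing(1)[OF gL P(2)] bochner_pairing(1)[OF hL P(3)] ge)
    then show "bochner_int (lebesgue_on {0<..<T}) (\<lambda>t. deriv \<psi> t *\<^sub>R g t) =
        - bochner_int (lebesgue_on {0<..<T}) (\<lambda>t. \<psi> t *\<^sub>R h t)" using vector_eq_rdot by blast
  qed
  have AE: "AE s in lebesgue. 0 < s \<longrightarrow> \<eta> s \<in> subdiff \<phi> (u s) \<and> h s + \<eta> s + B (u s) = f s"
    using \<eta>(3) by eventually_elim (simp add: h_def)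
  show ?thesis
    by (rule exI[of _ u], rule exI[of _ g], rule exI[of _ h], rule exI[of _ \<eta>])
      (intro conjI allI impI u gc g0 W L2_on_continuous[OF u(1)] L2_on_locint[OF \<eta>(1,2)]
        Linf_on_functional[OF u ub[rule_format]] AE, simp add: g_def)
qed

end

lemma strong_solution_global_imp:
  assumes v: "strong_solution_global \<phi> k B f u0 v" and T: "0 < T"
  shows "strong_solution \<phi> k B f u0 T v"
proof -
  from v obtain g g' \<xi> where 1: "L2_loc v" "AE t in lebesgue_on {0<..}. g t = conv k (\<lambda>s. v s - u0) t"
    "continuous_on {0..} g" "W12_loc g g'" "g 0 = 0" "AE t in lebesgue_on {0<..}. v t \<in> dom_subdiff \<phi>" "L2_loc \<xi>"
    "AE t in lebesgue_on {0<..}. \<xi> t \<in> subdiff \<phi> (v t) \<and> g' t + \<xi> t + B (v t) = f t"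
    unfolding strong_solution_global_def by (elim exE conjE) (rule that; assumption)
  have r: "AE t in lebesgue_on {0<..<T}. P t" if "AE t in lebesgue_on {0<..}. P t" for P
    using that by (auto simp: AE_lebesgue_on elim!: eventually_mono)
  show ?thesis
    unfolding strong_solution_def
    by (intro conjI exI[of _ g] exI[of _ g'] exI[of _ \<xi>] r 1 continuous_on_subset[OF 1(3)])
      (use 1 T in \<open>auto simp: L2_loc_def W12_loc_def\<close>)
qed

theorem theorem4p4:
  fixes \<phi> :: "'h::{real_inner, banach} \<Rightarrow> ereal"
    and k l :: "real \<Rightarrow> real"
    and B :: "'h \<Rightarrow> 'h"
    and LB :: real
  assumes "proper_functional \<phi>" and "lsc_functional \<phi>" and "convex_functional \<phi>"
    and "condition_K k l"
    and "LB-lipschitz_on UNIV B"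
  shows
    "(\<forall>T>0. \<forall>u0\<in>eff_dom \<phi>. \<forall>f.
        L2_on T f \<and> Linf_on T (\<lambda>t. ereal (conv l (\<lambda>s. (norm (f s))\<^sup>2) t)) \<longrightarrow>
        (\<exists>u. strong_solution \<phi> k B f u0 T u \<and>
             continuous_on {0..T} u \<and> u 0 = u0 \<and> Linf_on T (\<lambda>t. \<phi> (u t)) \<and>
             (\<forall>v. strong_solution \<phi> k B f u0 T v \<longrightarrow>
                (AE t in lebesgue_on {0<..<T}. v t = u t)))) \<and>
     (\<forall>u0\<in>eff_dom \<phi>. \<forall>f.
        L2_loc f \<and> Linf_loc (\<lambda>t. ereal (conv l (\<lambda>s. (norm (f s))\<^sup>2) t)) \<longrightarrow>
        (\<exists>u. strong_solution_global \<phi> k B f u0 u \<and>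
             (\<forall>T'>0. continuous_on {0..T'} u \<and> u 0 = u0 \<and> Linf_on T' (\<lambda>t. \<phi> (u t))) \<and>
             (\<forall>v. strong_solution_global \<phi> k B f u0 v \<longrightarrow>
                (AE t in lebesgue_on {0<..}. v t = u t))))"
proof -
  have cl: "convex_lsc \<phi>" using assms by (simp add: convex_lsc_def)
  have ck: "conj_kernels (zext k) (zext l)" by (rule conj_kernels_zext[OF assms(4)])
  have lk: "mono_kernel (zext l)" using ck by (simp add: conj_kernels_def)
  \<comment> \<open>\<open>u\<close> equals \<open>u0\<close> at nonpositive times, so the extension
    by zero does not change \<open>u - u0\<close>.\<close>
  have conv_eq: "conv (zext k) (\<lambda>s. u s - u0) t = conv k (\<lambda>s. u s - u0) t" if "\<forall>t\<le>0. u t = u0" for u :: "real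
      \<Rightarrow> 'h" and u0 t
  proof -
    have "zext (\<lambda>s. u s - u0) = (\<lambda>s. u s - u0)" using that by (auto simp: zext_def fun_eq_iff)
    then show ?thesis by (simp add: conv_zext[of k])
  qed
  \<comment> \<open>One existence statement on the half-line serves both cases: the data are
    \<open>cut T f\<close> for a finite horizon and \<open>zext f\<close> for the infinite
    one.\<close>
  have sol: "\<exists>u g h \<eta>. continuous_on UNIV u \<and> u 0 = u0 \<and> continuous_on UNIV g \<and> g 0 = 0 \<and>
     (\<forall>t. g t = conv k (\<lambda>s. u s - u0) t) \<and>
     (\<forall>T>0. W12_on T g h \<and> L2_on T u \<and> L2_on T \<eta> \<and> Linf_on T (\<lambda>t. \<phi> (u t))) \<and>
     (AE s in lebesgue. 0 < s \<longrightarrow> \<eta> s \<in> subdiff \<phi> (u s) \<and> h s + \<eta> s + B (u s) = F s)"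
    if u0: "u0 \<in> eff_dom \<phi>" and F: "conv_sq_bounded (zext l) F" "locint (norm_sq F)" for u0 and F :: "real \<Rightarrow> 'h"
  proof -
    interpret evolution "zext k" "zext l" \<phi> B LB F u0
      using cl ck u0 F(1) assms(5) by (simp add: evolution_def evolution_axioms_def)
    obtain u g h \<eta> where 1: "continuous_on UNIV u" "\<forall>t\<le>0. u t = u0" "continuous_on UNIV g" "g 0 = 0"
      "\<forall>t. g t = conv (zext k) (\<lambda>s. u s - u0) t"
      "\<forall>T>0. W12_on T g h \<and> L2_on T u \<and> L2_on T \<eta> \<and> Linf_on T (\<lambda>t. \<phi> (u t))"
      "AE s in lebesgue. 0 < s \<longrightarrow> \<eta> s \<in> subdiff \<phi> (u s) \<and> h s + \<eta> s + B (u s) = F s"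
      using evolution_strong_solution[OF F(2)] by (elim exE conjE) (rule that; assumption)
    have "u 0 = u0" "\<forall>t. g t = conv k (\<lambda>s. u s - u0) t" using 1(2,5) conv_eq[OF 1(2)] by auto
    with 1 show ?thesis by (intro exI[of _ u] exI[of _ g] exI[of _ h] exI[of _ \<eta>] conjI)
  qed
  have dom: "\<xi> \<in> subdiff \<phi> w \<Longrightarrow> w \<in> dom_subdiff \<phi>" for \<xi> w by (auto simp: dom_subdiff_def subdiff_def)
  note uniq = strong_solution_unique[OF cl assms(4,5)]
  show ?thesis
  proof (intro conjI allI ballI impI; elim conjE)
    fix T :: real and u0 and f :: "real \<Rightarrow> 'h"
    assume T: "0 < T" and u0: "u0 \<in> eff_dom \<phi>" and f: "L2_on T f"
      and b: "Linf_on T (\<lambda>t. ereal (conv l (norm_sq f) t))"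
    obtain u g h \<eta> where 1: "continuous_on UNIV u" "u 0 = u0" "continuous_on UNIV g" "g 0 = 0"
      "\<forall>t. g t = conv k (\<lambda>s. u s - u0) t"
      "\<forall>T>0. W12_on T g h \<and> L2_on T u \<and> L2_on T \<eta> \<and> Linf_on T (\<lambda>t. \<phi> (u t))"
      "AE s in lebesgue. 0 < s \<longrightarrow> \<eta> s \<in> subdiff \<phi> (u s) \<and> h s + \<eta> s + B (u s) = cut T f s"
      using sol[OF u0 conv_sq_bounded_cut[OF lk f T b] locint_cut[OF f]] by (elim exE conjE) (rule that; assumption)
    have AE: "AE t in lebesgue_on {0<..<T}. \<eta> t \<in> subdiff \<phi> (u t) \<and> h t + \<eta> t + B (u t) = f t"
      using 1(7) by (auto simp: AE_lebesgue_on elim!: eventually_mono)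
    have u: "strong_solution \<phi> k B f u0 T u"
      unfolding strong_solution_def
      by (intro conjI exI[of _ g] exI[of _ h] exI[of _ \<eta>] AE continuous_on_subset[OF 1(3)])
        (use 1 T AE dom in \<open>auto elim!: eventually_mono\<close>)
    have "AE t in lebesgue_on {0<..<T}. v t = u t" if v: "strong_solution \<phi> k B f u0 T v" for v
      using uniq[OF T v u] by (simp add: AE_lebesgue_on)
    then show "\<exists>u. strong_solution \<phi> k B f u0 T u \<and>
             continuous_on {0..T} u \<and> u 0 = u0 \<and> Linf_on T (\<lambda>t. \<phi> (u t)) \<and>
             (\<forall>v. strong_solution \<phi> k B f u0 T v \<longrightarrow>
                (AE t in lebesgue_on {0<..<T}. v t = u t))"
      using u 1 T continuous_on_subset[OF 1(1)] by (intro exI[of _ u]) blast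
  next
    fix u0 and f :: "real \<Rightarrow> 'h"
    assume u0: "u0 \<in> eff_dom \<phi>" and f: "L2_loc f"
      and b: "Linf_loc (\<lambda>t. ereal (conv l (norm_sq f) t))"
    obtain u g h \<eta> where 1: "continuous_on UNIV u" "u 0 = u0" "continuous_on UNIV g" "g 0 = 0"
      "\<forall>t. g t = conv k (\<lambda>s. u s - u0) t"
      "\<forall>T>0. W12_on T g h \<and> L2_on T u \<and> L2_on T \<eta> \<and> Linf_on T (\<lambda>t. \<phi> (u t))"
      "AE s in lebesgue. 0 < s \<longrightarrow> \<eta> s \<in> subdiff \<phi> (u s) \<and> h s + \<eta> s + B (u s) = zext f s"
      using sol[OF u0 conv_sq_bounded_zext[OF lk f b]] by (elim exE conjE) (rule that; assumption)
    have AE: "AE t in lebesgue_on {0<..}. \<eta> t \<in> subdiff \<phi> (u t) \<and> h t + \<eta> t + B (u t) = f t"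
      using 1(7) by (auto simp: AE_lebesgue_on elim!: eventually_mono)
    have u: "strong_solution_global \<phi> k B f u0 u"
      unfolding strong_solution_global_def L2_loc_def W12_loc_def
      by (intro conjI exI[of _ g] exI[of _ h] exI[of _ \<eta>] AE continuous_on_subset[OF 1(3)])
        (use 1 AE dom in \<open>auto elim!: eventually_mono\<close>)
    have "AE t in lebesgue_on {0<..}. v t = u t" if v: "strong_solution_global \<phi> k B f u0 v" for v
    proof -
      \<comment> \<open>Global uniqueness is uniqueness on each of countably many horizons; the
        successor makes every horizon positive.\<close>
      have "AE t in lebesgue. \<forall>n. 0 < t \<and> t < real (Suc n) \<longrightarrow> v t = u t"
        unfolding AE_all_countable
      proof
        fix n
        have n: "0 < real (Suc n)" by simp
        show "AE t in lebesgue. 0 < t \<and> t < real (Suc n) \<longrightarrow> v t = u t"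
          by (rule uniq[OF n strong_solution_global_imp[OF v n] strong_solution_global_imp[OF u n]])
      qed
      then have "AE t in lebesgue. 0 < t \<longrightarrow> v t = u t"
      proof eventually_elim
        case (elim t)
        obtain n where "t < real n" using reals_Archimedean2 by blast
        then have "t < real (Suc n)" by simp
        then show ?case using elim by blast
      qed
      then show ?thesis by (simp add: AE_lebesgue_on)
    qed
    then show "\<exists>u. strong_solution_global \<phi> k B f u0 u \<and>
             (\<forall>T'>0. continuous_on {0..T'} u \<and> u 0 = u0 \<and> Linf_on T' (\<lambda>t. \<phi> (u t))) \<and>
             (\<forall>v. strong_solution_global \<phi> k B f u0 v \<longrightarrow>
                (AE t in lebesgue_on {0<..}. v t = u t))"
      using u 1 continuous_on_subset[OF 1(1)] by (intro exI[of _ u]) blast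
  qed
qed

end
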